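(* Let $q_n$ denote the $n$-th positive integer that is a product of exactly two distinct primes. Suppose that Hypotheses $BV(\theta)$ and $BV_2(\theta)$ (defined in the context) are both true for some $\theta$ with \[ \frac{75-\sqrt{473}}{56}=0.950918\ldots<\theta\le 1 . \] Then $\liminf_{n\to\infty}(q_{n+1}-q_n)\le 6$.
   Context: Let $\varpi(n)=\log n$ if $n$ is prime and $\varpi(n)=0$ otherwise, and let $\varpi*\varpi(n)=\sum_{d\mid n}\varpi(d)\varpi(n/d)$. For $(a,q)=1$, define $E(x;q,a)$ by $\sum_{x<n\le 2x,\ n\equiv a \,(\mathrm{mod}\, q)}\varpi(n)=\frac{x}{\phi(q)}+E(x;q,a)$. Set $E(x,q)=\max_{(a,q)=1}|E(x;q,a)|$ and $E^*(N,q)=\max_{x\le N}E(x,q)$. Let $C_0=2\log 2-2\gamma-1-2\sum_p\frac{\log p}{p(p-1)}$, where $\gamma$ is Euler's constant. For $(a,r)=1$, define $E_2(x;r,a)$ by \[ \sum_{x<n\le 2x,\ n\equiv a\,(\mathrm{mod}\, r)}\varpi*\varpi(n)=\frac{x}{\phi(r)}\Big(\log x+C_0-2\sum_{p\mid r}\frac{\log p}{p}\Big)+E_2(x;r,a). \] Set $E_2(x,r)=\max_{(a,r)=1}|E_2(x;r,a)|$ and $E_2^*(N,r)=\max_{x\le N}E_2(x,r)$. For $1/2<\theta\le 1$: - Hypothesis $BV(\theta)$ asserts that for every $A>0$ and $\epsilon>0$, $\sum_{q\le N^{\theta-\epsilon}}E^*(N,q)\ll_{A,\epsilon}N(\log N)^{-A}$.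 - Hypothesis $BV_2(\theta)$ asserts the same bound with $E_2^*(N,q)$ in place of $E^*(N,q)$. *)

theory Defs
  imports "HOL-Analysis.Analysis" "HOL-Library.Landau_Symbols" "HOL-Number_Theory.Number_Theory"
begin

definition vpi :: "nat \<Rightarrow> real" where
  "vpi n = (if prime n then ln (real n) else 0)"

definition vpi2 :: "nat \<Rightarrow> real" where
  "vpi2 n = (\<Sum>d | d dvd n. vpi d * vpi (n div d))"

definition Err :: "real \<Rightarrow> nat \<Rightarrow> nat \<Rightarrow> real" where
  "Err x q a = (\<Sum>n | x < real n \<and> real n \<le> 2 * x \<and> [n = a] (mod q). vpi n)
               - x / real (totient q)"

definition ErrMax :: "real \<Rightarrow> nat \<Rightarrow> real" where
  "ErrMax x q = Max {\<bar>Err x q a\<bar> | a. a < q \<and> coprime a q}"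

definition ErrStar :: "real \<Rightarrow> nat \<Rightarrow> real" where
  "ErrStar N q = (SUP x\<in>{0<..N}. ErrMax x q)"

definition C0 :: real where
  "C0 = 2 * ln 2 - 2 * euler_mascheroni - 1
        - 2 * (\<Sum>\<^sub>\<infinity>p\<in>{p::nat. prime p}. ln (real p) / (real p * (real p - 1)))"

definition Err2 :: "real \<Rightarrow> nat \<Rightarrow> nat \<Rightarrow> real" where
  "Err2 x r a = (\<Sum>n | x < real n \<and> real n \<le> 2 * x \<and> [n = a] (mod r). vpi2 n)
     - x / real (totient r) * (ln x + C0 - 2 * (\<Sum>p\<in>prime_factors r. ln (real p) / real p))"

definition Err2Max :: "real \<Rightarrow> nat \<Rightarrow> real" where
  "Err2Max x r = Max {\<bar>Err2 x r a\<bar> | a. a < r \<and> coprime a r}"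

definition Err2Star :: "real \<Rightarrow> nat \<Rightarrow> real" where
  "Err2Star N r = (SUP x\<in>{0<..N}. Err2Max x r)"

definition BV :: "real \<Rightarrow> bool" where
  "BV \<theta> \<longleftrightarrow> (\<forall>A>0. \<forall>\<epsilon>>0.
     (\<lambda>N::real. \<Sum>q\<in>{1..nat \<lfloor>N powr (\<theta> - \<epsilon>)\<rfloor>}. ErrStar N q)
       \<in> O[at_top](\<lambda>N. N * ln N powr (-A)))"

definition BV2 :: "real \<Rightarrow> bool" where
  "BV2 \<theta> \<longleftrightarrow> (\<forall>A>0. \<forall>\<epsilon>>0.
     (\<lambda>N::real. \<Sum>q\<in>{1..nat \<lfloor>N powr (\<theta> - \<epsilon>)\<rfloor>}. Err2Star N q)
       \<in> O[at_top](\<lambda>N. N * ln N powr (-A)))"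

text \<open>Products of exactly two distinct primes, and their increasing enumeration
  (q_seq 0 is the first one, i.e. 6).\<close>
definition two_prime_prod :: "nat \<Rightarrow> bool" where
  "two_prime_prod n \<longleftrightarrow> (\<exists>p q. prime p \<and> prime q \<and> p \<noteq> q \<and> n = p * q)"

definition q_seq :: "nat \<Rightarrow> nat" where
  "q_seq = enumerate {n. two_prime_prod n}"

end

theory Submission
  imports Defs "HOL-Real_Asymp.Real_Asymp"
begin

text \<open>
  Choose the residue class of \<open>n\<close> so that \<open>n = 3 L\<^sub>1\<close>, \<open>n + 1 = 2 L\<^sub>2\<close>, \<open>n + 2 = 5 L\<^sub>3\<close>, \<open>n + 4 = 7 L\<^sub>4\<close>,
  \<open>n + 5 = 2 L\<^sub>5\<close>, \<open>n + 6 = 3 L\<^sub>6\<close> with all \<open>L\<^sub>i\<close> free of small prime factors. If two of the \<open>L\<^sub>i\<close> are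
  large primes, the corresponding numbers are products of two distinct primes at distance at
  most 6. So it suffices to find two primes among six admissible linear forms, and this is done by
  Maynard's multidimensional sieve with the weight function \<open>F = P\<^sub>2 + s + 4 s\<^sup>2\<close> on the simplex,
  where \<open>s = 1 - (t\<^sub>1 + \<dots> + t\<^sub>6)\<close> and \<open>P\<^sub>2 = t\<^sub>1\<^sup>2 + \<dots> + t\<^sub>6\<^sup>2\<close>. Its integrals are \<open>I = 29 / 60480\<close> and
  \<open>J = 1 / 5940\<close>, and the sieve succeeds as soon as \<open>3 \<theta> J > I\<close>, that is \<open>\<theta> > 0.9495\<close>.

  Only primes above a large constant \<open>D\<close> are sieved. The quadratic forms of the sieve are then
  Kronecker products over these primes of local matrices that can be diagonalised up to relative
  errors of size \<open>1 / p\<^sup>2\<close>, so all secondary terms are bounded by Euler products and cost a factor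
  \<open>O(1 / D)\<close>. The main terms are multiple logarithmic sums of monomials, which are
  evaluated one variable at a time by the Beta integral.
\<close>


section \<open>Quadratic forms over residue configurations\<close>

text \<open>With R = N^(theta/2) each of the six forms brings in J ln R = (theta/2) J ln N, while
  the total is at most I ln N if no two forms are ever prime together; this is the origin of 3 theta
  J > I. The margin at theta = 0.95 is only about 6 parts in 10^4, but it is positive and one-sided
  inequalities suffice. Hence relative errors O(1/D) need not tend to zero: D can be a fixed huge
  number. For this to work each of these secondary terms must carry the same power of phi(Q)/Q and
  of ln R as the main term, with a constant not depending on D; a Mertens bound of the right order,
  without an asymptotic constant, is enough. The usual asymptotics for sums of multiplicative
  functions are avoided in the same way: an integer coprime to Q has only prime factors above D, so
  replacing squarefree, pairwise coprime divisors weighted by 1/phi by arbitrary integers coprime to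
  Q weighted by 1/u again costs O(1/D). The sums that remain need only the density of the integers
  coprime to Q.\<close>

lemma kronecker_form:
  fixes z :: "(nat \<Rightarrow> nat) \<Rightarrow> real" and M G D :: "nat \<Rightarrow> nat \<Rightarrow> nat \<Rightarrow> real"
  assumes fin: "finite P" "finite S" "finite T"
    and D: "\<And>p a b. p \<in> P \<Longrightarrow> a \<in> S \<Longrightarrow> b \<in> S \<Longrightarrow>
              D p a b = (\<Sum>e\<in>T. \<Sum>f\<in>T. M p a e * M p b f * G p e f)"
  shows "(\<Sum>c\<in>PiE P (\<lambda>_. S). \<Sum>c'\<in>PiE P (\<lambda>_. S). z c * z c' * (\<Prod>p\<in>P. D p (c p) (c' p)))
       = (\<Sum>s\<in>PiE P (\<lambda>_. T). \<Sum>t\<in>PiE P (\<lambda>_. T).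
            (\<Sum>c\<in>PiE P (\<lambda>_. S). z c * (\<Prod>p\<in>P. M p (c p) (s p)))
          * (\<Sum>c\<in>PiE P (\<lambda>_. S). z c * (\<Prod>p\<in>P. M p (c p) (t p)))
          * (\<Prod>p\<in>P. G p (s p) (t p)))"
proof -
  let ?C = "PiE P (\<lambda>_. S)" and ?E = "PiE P (\<lambda>_. T)"
  \<comment> \<open>The Kronecker product of the local factorisations D = M G M^T factorises the
    global matrix. This serves twice: to pass from \<open>lam\<close> to its \<open>y\<close>
    variables, and to split off the colour \<open>m\<close> in the second form.\<close>
  have "(\<Prod>p\<in>P. D p (c p) (c' p)) = (\<Sum>s\<in>?E. \<Sum>t\<in>?E. (\<Prod>p\<in>P. M p (c p) (s p))
         * (\<Prod>p\<in>P. M p (c' p) (t p)) * (\<Prod>p\<in>P. G p (s p) (t p)))"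
    if "c \<in> ?C" "c' \<in> ?C" for c c'
  proof -
    have "(\<Prod>p\<in>P. D p (c p) (c' p))
        = (\<Prod>p\<in>P. \<Sum>e\<in>T. \<Sum>f\<in>T. M p (c p) e * M p (c' p) f * G p e f)"
      using that by (intro prod.cong refl D) (auto simp: PiE_iff)
    also have "\<dots> = (\<Sum>s\<in>?E. \<Prod>p\<in>P. \<Sum>f\<in>T. M p (c p) (s p) * M p (c' p) f * G p (s p) f)"
      by (rule prod_sum_PiE) (use fin in auto)
    also have "\<dots> = (\<Sum>s\<in>?E. \<Sum>t\<in>?E. \<Prod>p\<in>P. M p (c p) (s p) * M p (c' p) (t p) * G p (s p) (t p))"
      by (intro sum.cong refl prod_sum_PiE) (use fin in auto)
    finally show ?thesis by (simp add: prod.distrib)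
  qed
  hence "(\<Sum>c\<in>?C. \<Sum>c'\<in>?C. z c * z c' * (\<Prod>p\<in>P. D p (c p) (c' p)))
    = (\<Sum>c\<in>?C. \<Sum>c'\<in>?C. \<Sum>s\<in>?E. \<Sum>t\<in>?E. z c * z c' * ((\<Prod>p\<in>P. M p (c p) (s p))
         * (\<Prod>p\<in>P. M p (c' p) (t p)) * (\<Prod>p\<in>P. G p (s p) (t p))))"
    by (simp add: sum_distrib_left)
  also have "\<dots> = (\<Sum>c\<in>?C. \<Sum>s\<in>?E. \<Sum>c'\<in>?C. \<Sum>t\<in>?E. z c * z c' * ((\<Prod>p\<in>P. M p (c p) (s p))
         * (\<Prod>p\<in>P. M p (c' p) (t p)) * (\<Prod>p\<in>P. G p (s p) (t p))))"
    by (intro sum.cong refl sum.swap)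
  also have "\<dots> = (\<Sum>s\<in>?E. \<Sum>c\<in>?C. \<Sum>t\<in>?E. \<Sum>c'\<in>?C. z c * z c' * ((\<Prod>p\<in>P. M p (c p) (s p))
         * (\<Prod>p\<in>P. M p (c' p) (t p)) * (\<Prod>p\<in>P. G p (s p) (t p))))"
    by (subst sum.swap) (intro sum.cong refl sum.swap)
  also have "\<dots> = (\<Sum>s\<in>?E. \<Sum>t\<in>?E. \<Sum>c\<in>?C. \<Sum>c'\<in>?C. z c * z c' * ((\<Prod>p\<in>P. M p (c p) (s p))
         * (\<Prod>p\<in>P. M p (c' p) (t p)) * (\<Prod>p\<in>P. G p (s p) (t p))))"
    by (intro sum.cong refl sum.swap)
  also have "\<dots> = (\<Sum>s\<in>?E. \<Sum>t\<in>?E.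
            (\<Sum>c\<in>?C. z c * (\<Prod>p\<in>P. M p (c p) (s p)))
          * (\<Sum>c\<in>?C. z c * (\<Prod>p\<in>P. M p (c p) (t p))) * (\<Prod>p\<in>P. G p (s p) (t p)))"
    unfolding sum_product sum_distrib_right
    by (intro sum.cong refl) (simp add: mult_ac sum_distrib_left)
  finally show ?thesis .
qed

text \<open>Each cross term is split by AM-GM.\<close>
lemma kronecker_form_diagonal:
  fixes z :: "(nat \<Rightarrow> nat) \<Rightarrow> real" and D :: "nat \<Rightarrow> nat \<Rightarrow> nat \<Rightarrow> real"
  assumes fin: "finite P" "finite S"
    and sym: "\<And>p a b. p \<in> P \<Longrightarrow> a \<in> S \<Longrightarrow> b \<in> S \<Longrightarrow> D p a b = D p b a"
  shows "\<bar>(\<Sum>c\<in>PiE P (\<lambda>_. S). \<Sum>c'\<in>PiE P (\<lambda>_. S). z c * z c' * (\<Prod>p\<in>P. D p (c p) (c' p)))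
         - (\<Sum>c\<in>PiE P (\<lambda>_. S). (z c)\<^sup>2 * (\<Prod>p\<in>P. D p (c p) (c p)))\<bar>
       \<le> (\<Sum>c\<in>PiE P (\<lambda>_. S). (z c)\<^sup>2 * ((\<Prod>p\<in>P. \<Sum>b\<in>S. \<bar>D p (c p) b\<bar>) - (\<Prod>p\<in>P. \<bar>D p (c p) (c p)\<bar>)))"
proof -
  let ?C = "PiE P (\<lambda>_. S)"
  define g where "g c c' = (\<Prod>p\<in>P. D p (c p) (c' p))" for c c'
  have finC: "finite ?C" using fin by (intro finite_PiE) auto
  have gsym: "g c c' = g c' c" if "c \<in> ?C" "c' \<in> ?C" for c c'
    unfolding g_def using that by (intro prod.cong refl sym) (auto simp: PiE_iff)
  \<comment> \<open>Absolute row sums of a Kronecker product factorise over the primes; this is why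
    the off-diagonal loss ends up as a difference of two Euler products.\<close>
  have row: "(\<Prod>p\<in>P. \<Sum>b\<in>S. \<bar>D p (c p) b\<bar>) = (\<Sum>c'\<in>?C. \<bar>g c c'\<bar>)" for c
    unfolding g_def abs_prod by (rule prod_sum_PiE) (use fin in auto)
  have split: "(\<Sum>c'\<in>?C. h c') = h c + (\<Sum>c'\<in>?C-{c}. h c')" if "c \<in> ?C" for c and h :: "(nat \<Rightarrow> nat) \<Rightarrow> real"
    using finC that by (rule sum.remove)
  have "(\<Sum>c\<in>?C. \<Sum>c'\<in>?C. z c * z c' * g c c') - (\<Sum>c\<in>?C. (z c)\<^sup>2 * g c c)
      = (\<Sum>c\<in>?C. \<Sum>c'\<in>?C-{c}. z c * z c' * g c c')"
    unfolding sum_subtractf[symmetric]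
    by (intro sum.cong refl) (subst split, auto simp: power2_eq_square)
  also have "\<bar>\<dots>\<bar> \<le> (\<Sum>c\<in>?C. \<Sum>c'\<in>?C-{c}. \<bar>z c * z c' * g c c'\<bar>)"
    by (rule order_trans[OF sum_abs]) (intro sum_mono sum_abs)
  also have "\<dots> \<le> (\<Sum>c\<in>?C. \<Sum>c'\<in>?C-{c}. ((z c)\<^sup>2 / 2 * \<bar>g c c'\<bar> + (z c')\<^sup>2 / 2 * \<bar>g c c'\<bar>))"
  proof (intro sum_mono)
    fix c c'
    have "0 \<le> (\<bar>z c\<bar> - \<bar>z c'\<bar>)\<^sup>2" by simp
    hence "\<bar>z c * z c'\<bar> \<le> (z c)\<^sup>2 / 2 + (z c')\<^sup>2 / 2"
      by (simp add: power2_diff abs_mult)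
    from mult_right_mono[OF this abs_ge_zero[of "g c c'"]]
    show "\<bar>z c * z c' * g c c'\<bar> \<le> (z c)\<^sup>2 / 2 * \<bar>g c c'\<bar> + (z c')\<^sup>2 / 2 * \<bar>g c c'\<bar>"
      by (simp add: abs_mult algebra_simps)
  qed
  also have "\<dots> = (\<Sum>c\<in>?C. \<Sum>c'\<in>?C-{c}. (z c)\<^sup>2 / 2 * \<bar>g c c'\<bar>) + (\<Sum>c\<in>?C. \<Sum>c'\<in>?C-{c}. (z c')\<^sup>2 / 2 * \<bar>g c c'\<bar>)"
    by (simp add: sum.distrib)
  \<comment> \<open>Padding the excluded diagonal by zeros allows the two sums to be swapped; the
    symmetry of \<open>g\<close> afterwards identifies this half with the first.\<close>
  also have "(\<Sum>c\<in>?C. \<Sum>c'\<in>?C-{c}. (z c')\<^sup>2 / 2 * \<bar>g c c'\<bar>) = (\<Sum>c'\<in>?C. \<Sum>c\<in>?C-{c'}. (z c')\<^sup>2 / 2 * \<bar>g c c'\<bar>)"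
  proof -
    have "(\<Sum>c\<in>?C. \<Sum>c'\<in>?C-{c}. h c c') = (\<Sum>c\<in>?C. \<Sum>c'\<in>?C. if c' = c then 0 else h c c')" for h :: "_ \<Rightarrow> _ \<Rightarrow> real"
      by (intro sum.cong refl sum.mono_neutral_cong_left) (use finC in auto)
    hence 1: "(\<Sum>c\<in>?C. \<Sum>c'\<in>?C-{c}. (z c')\<^sup>2 / 2 * \<bar>g c c'\<bar>) = (\<Sum>c\<in>?C. \<Sum>c'\<in>?C. if c' = c then 0 else (z c')\<^sup>2 / 2 * \<bar>g c c'\<bar>)" .
    have 2: "(\<Sum>c'\<in>?C. \<Sum>c\<in>?C-{c'}. (z c')\<^sup>2 / 2 * \<bar>g c c'\<bar>) = (\<Sum>c'\<in>?C. \<Sum>c\<in>?C. if c = c' then 0 else (z c')\<^sup>2 / 2 * \<bar>g c c'\<bar>)"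
      by (intro sum.cong refl sum.mono_neutral_cong_left) (use finC in auto)
    show ?thesis unfolding 1 2 by (subst sum.swap) (intro sum.cong refl, auto)
  qed
  also have "\<dots> = (\<Sum>c\<in>?C. \<Sum>c'\<in>?C-{c}. (z c)\<^sup>2 / 2 * \<bar>g c c'\<bar>)"
    by (intro sum.cong refl) (auto simp: gsym)
  also have "(\<Sum>c\<in>?C. \<Sum>c'\<in>?C-{c}. (z c)\<^sup>2 / 2 * \<bar>g c c'\<bar>) + (\<Sum>c\<in>?C. \<Sum>c'\<in>?C-{c}. (z c)\<^sup>2 / 2 * \<bar>g c c'\<bar>)
    = (\<Sum>c\<in>?C. (z c)\<^sup>2 * (\<Sum>c'\<in>?C-{c}. \<bar>g c c'\<bar>))"
    unfolding sum.distrib[symmetric] sum_distrib_left by (intro sum.cong refl) simp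
  also have "\<dots> = (\<Sum>c\<in>?C. (z c)\<^sup>2 * ((\<Prod>p\<in>P. \<Sum>b\<in>S. \<bar>D p (c p) b\<bar>) - (\<Prod>p\<in>P. \<bar>D p (c p) (c p)\<bar>)))"
    unfolding row by (intro sum.cong refl, subst split) (auto simp: g_def abs_prod)
  finally show ?thesis by (simp add: g_def)
qed

text \<open>
  A configuration maps each sieving prime \<open>p\<close> to a colour: \<open>i \<noteq> 0\<close> means that \<open>p\<close> divides the \<open>i\<close>-th
  form, \<open>0\<close> is no condition. This encodes Maynard's tuples of pairwise coprime squarefree
  divisors. \<open>dens1 p a b\<close> is the density of the integers satisfying both conditions \<open>a\<close> and \<open>b\<close> at \<open>p\<close>;
  \<open>dens2 m\<close> is the density among the integers at which form \<open>m\<close> is a large prime. \<open>lam\<close> is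
  Maynard's \<open>\<lambda>\<close> in terms of his \<open>y\<close>, and \<open>zcoef\<close> is \<open>\<mu>(r) r y\<^sub>r / \<phi>(r)\<close>.
\<close>
definition Tinv :: "nat \<Rightarrow> nat \<Rightarrow> nat \<Rightarrow> real" where
  "Tinv p c s = (if s = c then 1 else if s = 0 then - 1 / real p else 0)"

definition dens1 :: "nat \<Rightarrow> nat \<Rightarrow> nat \<Rightarrow> real" where
  "dens1 p a b = (if a = 0 \<and> b = 0 then 1 else if a = 0 \<or> b = 0 \<or> a = b then 1 / real p else 0)"

definition dens2 :: "nat \<Rightarrow> nat \<Rightarrow> nat \<Rightarrow> nat \<Rightarrow> real" where
  "dens2 m p a b = (if a = m \<or> b = m then 0 else if a = 0 \<and> b = 0 then 1
     else if a = 0 \<or> b = 0 \<or> a = b then 1 / (real p - 1) else 0)"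

definition zcoef :: "nat set \<Rightarrow> ((nat \<Rightarrow> nat) \<Rightarrow> real) \<Rightarrow> (nat \<Rightarrow> nat) \<Rightarrow> real" where
  "zcoef P y c = y c * (\<Prod>p\<in>P. if c p = 0 then 1 else - (real p / (real p - 1)))"

definition lam :: "nat set \<Rightarrow> nat set \<Rightarrow> ((nat \<Rightarrow> nat) \<Rightarrow> real) \<Rightarrow> (nat \<Rightarrow> nat) \<Rightarrow> real" where
  "lam P K y s = (\<Sum>c\<in>PiE P (\<lambda>_. insert 0 K). zcoef P y c * (\<Prod>p\<in>P. Tinv p (c p) (s p)))"

lemma sum_Tinv:
  assumes "finite K" "0 \<notin> K" "a \<in> insert 0 K"
  shows "(\<Sum>e\<in>insert 0 K. Tinv p a e * g e) = (if a = 0 then g 0 else g a - g 0 / real p)"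
proof (cases "a = 0")
  case True
  have "(\<Sum>e\<in>K. Tinv p 0 e * g e) = 0" using assms by (intro sum.neutral) (auto simp: Tinv_def)
  thus ?thesis using assms True by (simp add: Tinv_def)
next
  case False
  hence "a \<in> K" using assms by auto
  have "(\<Sum>e\<in>K. Tinv p a e * g e) = g a + (\<Sum>e\<in>K-{a}. Tinv p a e * g e)"
    using assms \<open>a \<in> K\<close> by (subst sum.remove) (auto simp: Tinv_def)
  also have "(\<Sum>e\<in>K-{a}. Tinv p a e * g e) = 0" using assms by (intro sum.neutral) (auto simp: Tinv_def)
  finally show ?thesis using assms False by (simp add: Tinv_def)
qed

text \<open>The row \<open>Tinv p a\<close> turns the indicator of condition \<open>a\<close> into
  the indicator minus its mean 1/p. The result is therefore a covariance matrix: variance 1/p -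
  1/p^2 on the diagonal, -1/p^2 for the disjoint events of two colours, and 0 against the
  constant.\<close>

lemma Tinv_dens1:
  assumes K: "finite K" "0 \<notin> K" "a \<in> insert 0 K" "b \<in> insert 0 K" and "p > 1"
  shows "(\<Sum>e\<in>insert 0 K. \<Sum>f\<in>insert 0 K. Tinv p a e * Tinv p b f * dens1 p e f)
     = (if a = 0 \<and> b = 0 then 1 else if a = 0 \<or> b = 0 then 0 else if a = b then (real p - 1) / (real p)\<^sup>2 else - 1 / (real p)\<^sup>2)"
proof -
  have "(\<Sum>e\<in>insert 0 K. \<Sum>f\<in>insert 0 K. Tinv p a e * Tinv p b f * dens1 p e f)
     = (\<Sum>e\<in>insert 0 K. Tinv p a e * (\<Sum>f\<in>insert 0 K. Tinv p b f * dens1 p e f))"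
    by (simp add: sum_distrib_left mult.assoc)
  also have "\<dots> = (if a = 0 \<and> b = 0 then 1 else if a = 0 \<or> b = 0 then 0 else if a = b then (real p - 1) / (real p)\<^sup>2 else - 1 / (real p)\<^sup>2)"
    unfolding sum_Tinv[OF K(1,2,4)] sum_Tinv[OF K(1,2,3)]
    using assms by (auto simp: dens1_def field_simps power2_eq_square)
  finally show ?thesis .
qed

text \<open>In an upper bound the diagonal cancels and only absolute row sums remain. With k =
  \<open>card K\<close> a row gives ((p - 1) + (k - 1)) / p^2, one variance and k - 1 covariances,
  and the square of \<open>zcoef\<close> supplies the factor p^2 / (p - 1)^2.\<close>

theorem form1_le:
  fixes y :: "(nat \<Rightarrow> nat) \<Rightarrow> real"
  assumes K: "finite K" "0 \<notin> K" and P: "finite P" "\<And>p. p \<in> P \<Longrightarrow> p > 1"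
  shows "(\<Sum>s\<in>PiE P (\<lambda>_. insert 0 K). \<Sum>t\<in>PiE P (\<lambda>_. insert 0 K). lam P K y s * lam P K y t * (\<Prod>p\<in>P. dens1 p (s p) (t p)))
     \<le> (\<Sum>c\<in>PiE P (\<lambda>_. insert 0 K). (y c)\<^sup>2 * (\<Prod>p\<in>P. if c p = 0 then 1 else (real p + real (card K) - 2) / (real p - 1)\<^sup>2))"
proof -
  let ?S = "insert 0 K" and ?C = "PiE P (\<lambda>_. insert 0 K)"
  define D where "D p a b = (if a = 0 \<and> b = 0 then 1 else if a = 0 \<or> b = 0 then 0
       else if a = b then (real p - 1) / (real p)\<^sup>2 else - 1 / (real p)\<^sup>2)" for p a b :: nat
  have "(\<Sum>s\<in>?C. \<Sum>t\<in>?C. lam P K y s * lam P K y t * (\<Prod>p\<in>P. dens1 p (s p) (t p)))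
    = (\<Sum>c\<in>?C. \<Sum>c'\<in>?C. zcoef P y c * zcoef P y c' * (\<Prod>p\<in>P. D p (c p) (c' p)))"
    unfolding lam_def
  proof (rule kronecker_form[symmetric])
    fix p a b assume "p \<in> P" "a \<in> ?S" "b \<in> ?S"
    thus "D p a b = (\<Sum>e\<in>?S. \<Sum>f\<in>?S. Tinv p a e * Tinv p b f * dens1 p e f)"
      unfolding D_def using K P(2) by (intro Tinv_dens1[symmetric])
  qed (use K P in auto)
  also have "\<dots> \<le> (\<Sum>c\<in>?C. (zcoef P y c)\<^sup>2 * (\<Prod>p\<in>P. D p (c p) (c p)))
     + (\<Sum>c\<in>?C. (zcoef P y c)\<^sup>2 * ((\<Prod>p\<in>P. \<Sum>b\<in>?S. \<bar>D p (c p) b\<bar>) - (\<Prod>p\<in>P. \<bar>D p (c p) (c p)\<bar>)))"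
  proof -
    have "D p a b = D p b a" for p a b by (simp add: D_def)
    from kronecker_form_diagonal[of P ?S D "zcoef P y", OF P(1) _ this] finite_insert[of 0 "K - {m}"] finite_insert[of 0 K] K show ?thesis by force
  qed
  also have "\<dots> = (\<Sum>c\<in>?C. (zcoef P y c)\<^sup>2 * (\<Prod>p\<in>P. \<Sum>b\<in>?S. \<bar>D p (c p) b\<bar>))"
  proof -
    have "(\<Prod>p\<in>P. \<bar>D p (c p) (c p)\<bar>) = (\<Prod>p\<in>P. D p (c p) (c p))" for c
      using P(2) by (intro prod.cong refl) (fastforce simp: D_def)
    thus ?thesis unfolding sum.distrib[symmetric] by (intro sum.cong refl) (simp add: algebra_simps)
  qed
  also have "\<dots> = (\<Sum>c\<in>?C. (y c)\<^sup>2 * (\<Prod>p\<in>P. if c p = 0 then 1 else (real p + real (card K) - 2) / (real p - 1)\<^sup>2))"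
  proof (intro sum.cong refl)
    fix c assume c: "c \<in> ?C"
    have "(\<Prod>p\<in>P. \<Sum>b\<in>?S. \<bar>D p (c p) b\<bar>)
        = (\<Prod>p\<in>P. if c p = 0 then 1 else (real p + real (card K) - 2) / (real p)\<^sup>2)"
    proof (intro prod.cong refl)
      fix p assume p: "p \<in> P"
      show "(\<Sum>b\<in>?S. \<bar>D p (c p) b\<bar>) = (if c p = 0 then 1 else (real p + real (card K) - 2) / (real p)\<^sup>2)"
      proof (cases "c p = 0")
        case True
        have "b \<noteq> 0" if "b \<in> K" for b using that K(2) by metis
        hence "(\<Sum>b\<in>K. \<bar>D p (c p) b\<bar>) = 0" using True by (intro sum.neutral) (auto simp: D_def)
        thus ?thesis using K True by (simp add: D_def)
      next
        case False
        hence cK: "c p \<in> K" using c p by (auto simp: PiE_iff)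
        have "(\<Sum>b\<in>?S. \<bar>D p (c p) b\<bar>) = (\<Sum>b\<in>K. \<bar>D p (c p) b\<bar>)"
          using K False by (simp add: D_def)
        also have "\<dots> = \<bar>D p (c p) (c p)\<bar> + (\<Sum>b\<in>K-{c p}. \<bar>D p (c p) b\<bar>)"
          using K cK by (subst sum.remove) auto
        also have "(\<Sum>b\<in>K-{c p}. \<bar>D p (c p) b\<bar>) = (\<Sum>b\<in>K-{c p}. 1 / (real p)\<^sup>2)"
          using K False by (intro sum.cong) (auto simp: D_def)
        also have "\<dots> = (real (card K) - 1) / (real p)\<^sup>2"
          using K cK card_gt_0_iff[of K] by (auto simp: of_nat_diff)
        also have "\<bar>D p (c p) (c p)\<bar> = (real p - 1) / (real p)\<^sup>2"
          using False P(2)[OF p] by (simp add: D_def)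
        finally show ?thesis using False by (simp add: add_divide_distrib[symmetric] algebra_simps)
      qed
    qed
    moreover have "(zcoef P y c)\<^sup>2 = (y c)\<^sup>2 * (\<Prod>p\<in>P. if c p = 0 then 1 else (real p)\<^sup>2 / (real p - 1)\<^sup>2)"
      unfolding zcoef_def power_mult_distrib prod_power_distrib
      by (intro arg_cong2[where f="(*)"] refl prod.cong) (auto simp: power_divide)
    ultimately show "(zcoef P y c)\<^sup>2 * (\<Prod>p\<in>P. \<Sum>b\<in>?S. \<bar>D p (c p) b\<bar>)
       = (y c)\<^sup>2 * (\<Prod>p\<in>P. if c p = 0 then 1 else (real p + real (card K) - 2) / (real p - 1)\<^sup>2)"
      using P(2) by (auto simp: mult.assoc prod.distrib[symmetric] intro!: prod.cong) (force)
  qed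
  finally show ?thesis .
qed


text \<open>
  The local matrices satisfy \<open>Tinv dens2 Tinv\<^sup>T = Umat Dmat Umat\<^sup>T\<close>, where \<open>Umat\<close> removes the colour
  \<open>m\<close> and \<open>Dmat\<close> is diagonal up to entries of size \<open>1 / p\<^sup>2\<close>.
\<close>
definition Umat :: "nat \<Rightarrow> nat \<Rightarrow> nat \<Rightarrow> nat \<Rightarrow> real" where
  "Umat m p a e = (if a = 0 then (if e = 0 then 1 else 0)
     else if e = a \<and> a \<noteq> m then 1 else if e = 0 then (if a = m then - 1 / real p else 1 / (real p * (real p - 1))) else 0)"

definition Dmat :: "nat \<Rightarrow> nat \<Rightarrow> nat \<Rightarrow> real" where
  "Dmat p a b = (if a = 0 \<and> b = 0 then 1 else if a = 0 \<or> b = 0 then 0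
       else if a = b then (real p - 2) / (real p - 1)\<^sup>2 else - 1 / (real p - 1)\<^sup>2)"

lemma sum_Umat:
  assumes "finite K" "0 \<notin> K" "a \<in> insert 0 K"
  shows "(\<Sum>e\<in>insert 0 (K - {m}). Umat m p a e * g e)
     = (if a = 0 then g 0 else if a = m then - g 0 / real p else g a + g 0 / (real p * (real p - 1)))"
proof (cases "a = 0 \<or> a = m")
  case True
  have "(\<Sum>e\<in>K - {m}. Umat m p a e * g e) = 0"
    using assms True by (intro sum.neutral) (auto simp: Umat_def)
  thus ?thesis using assms True by (auto simp: Umat_def)
next
  case False
  hence "a \<in> K - {m}" using assms by auto
  have "(\<Sum>e\<in>K-{m}. Umat m p a e * g e) = g a + (\<Sum>e\<in>K-{m}-{a}. Umat m p a e * g e)"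
    using assms False \<open>a \<in> K - {m}\<close> by (subst sum.remove) (auto simp: Umat_def)
  also have "(\<Sum>e\<in>K-{m}-{a}. Umat m p a e * g e) = 0" using assms by (intro sum.neutral) (auto simp: Umat_def)
  finally show ?thesis using assms False by (simp add: Umat_def)
qed

text \<open>Once form \<open>m\<close> is known to be a large prime, condition \<open>m\<close> at p
  is impossible and every other condition has mean 1/(p - 1). So the indicator minus 1/p becomes the
  constant -1/p for colour \<open>m\<close>, and otherwise the newly centred indicator plus 1/(p -
  1) - 1/p = 1/(p (p - 1)). These are the rows of \<open>Umat\<close>, and \<open>Dmat\<close> is
  the covariance matrix of the newly centred indicators.\<close>

lemma Tinv_dens2:
  assumes K: "finite K" "0 \<notin> K" "a \<in> insert 0 K" "b \<in> insert 0 K" and m: "m \<in> K" and p: "p > 1"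
  shows "(\<Sum>e\<in>insert 0 K. \<Sum>f\<in>insert 0 K. Tinv p a e * Tinv p b f * dens2 m p e f)
    = (\<Sum>e\<in>insert 0 (K-{m}). \<Sum>f\<in>insert 0 (K-{m}). Umat m p a e * Umat m p b f * Dmat p e f)"
proof -
  have m0: "m \<noteq> 0" using K(2) m by metis
  obtain x where x: "real p = x + 1" "x \<noteq> 0" "x + 1 \<noteq> 0" using p that[of "real p - 1"] by auto
  have "(\<Sum>e\<in>insert 0 K. \<Sum>f\<in>insert 0 K. Tinv p a e * Tinv p b f * dens2 m p e f)
     = (\<Sum>e\<in>insert 0 K. Tinv p a e * (\<Sum>f\<in>insert 0 K. Tinv p b f * dens2 m p e f))"
    by (simp only: sum_distrib_left mult.assoc)
  also have "\<dots> = (\<Sum>e\<in>insert 0 (K-{m}). Umat m p a e * (\<Sum>f\<in>insert 0 (K-{m}). Umat m p b f * Dmat p e f))"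
    unfolding sum_Tinv[OF K(1,2,4)] sum_Tinv[OF K(1,2,3)] sum_Umat[OF K(1,2,4)] sum_Umat[OF K(1,2,3)]
    using x m0
    by (cases "a = 0"; cases "b = 0"; cases "a = m"; cases "b = m"; cases "a = b")
       (simp_all add: dens2_def Dmat_def divide_simps power2_eq_square, simp_all add: algebra_simps)
  finally show ?thesis by (simp only: sum_distrib_left mult.assoc)
qed

text \<open>\<open>Umat\<close> after the factors of \<open>zcoef\<close> have been moved across.
  The two minus signs of colour \<open>m\<close> cancel, which leaves the positive weight 1/(p - 1);
  the other colours enter only with weight of order 1/p^2.\<close>

definition Xmat :: "nat \<Rightarrow> nat \<Rightarrow> nat \<Rightarrow> nat \<Rightarrow> real" where
  "Xmat m p b e = (if b = e then 1 else if e = 0 then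
      (if b = m then 1 / (real p - 1) else - 1 / (real p - 1)\<^sup>2) else 0)"

text \<open>Plays the role of Maynard's y^(m): essentially the sum of \<open>y\<close> over its m-th
  coordinate with weight 1/phi.\<close>

definition Vsum :: "nat set \<Rightarrow> nat set \<Rightarrow> nat \<Rightarrow> ((nat \<Rightarrow> nat) \<Rightarrow> real) \<Rightarrow> (nat \<Rightarrow> nat) \<Rightarrow> real" where
  "Vsum P K m y e = (\<Sum>b\<in>PiE P (\<lambda>_. insert 0 K). y b * (\<Prod>p\<in>P. Xmat m p (b p) (e p)))"

lemma zcoef_Umat_sum:
  assumes K: "finite K" "0 \<notin> K" and m: "m \<in> K" and P: "\<And>p. p \<in> P \<Longrightarrow> p > 1"
    and e: "e \<in> PiE P (\<lambda>_. insert 0 (K - {m}))"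
  shows "(\<Sum>c\<in>PiE P (\<lambda>_. insert 0 K). zcoef P y c * (\<Prod>p\<in>P. Umat m p (c p) (e p)))
     = (\<Prod>p\<in>P. if e p = 0 then 1 else - (real p / (real p - 1))) * Vsum P K m y e"
  unfolding Vsum_def sum_distrib_left
proof (intro sum.cong refl)
  fix b assume b: "b \<in> PiE P (\<lambda>_. insert 0 K)"
  have "(\<Prod>p\<in>P. if b p = 0 then 1 else - (real p / (real p - 1))) * (\<Prod>p\<in>P. Umat m p (b p) (e p))
    = (\<Prod>p\<in>P. if e p = 0 then 1 else - (real p / (real p - 1))) * (\<Prod>p\<in>P. Xmat m p (b p) (e p))"
    unfolding prod.distrib[symmetric]
  proof (intro prod.cong refl)
    fix p assume p: "p \<in> P"
    have "e p \<noteq> m" using e p m K by (auto simp: PiE_iff)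
    moreover have "m \<noteq> 0" using K(2) m by metis
    ultimately show "(if b p = 0 then 1 else - (real p / (real p - 1))) * Umat m p (b p) (e p)
       = (if e p = 0 then 1 else - (real p / (real p - 1))) * Xmat m p (b p) (e p)"
      using P[OF p] by (auto simp: Umat_def Xmat_def power2_eq_square)
  qed
  thus "zcoef P y b * (\<Prod>p\<in>P. Umat m p (b p) (e p))
     = (\<Prod>p\<in>P. if e p = 0 then 1 else - (real p / (real p - 1))) * (y b * (\<Prod>p\<in>P. Xmat m p (b p) (e p)))"
    by (simp add: zcoef_def mult_ac)
qed

text \<open>In a lower bound the off-diagonal loss is subtracted, which leaves twice the diagonal
  minus the absolute row sum. Colour \<open>m\<close> has disappeared, so with k =
  \<open>card K\<close> a row has k - 2 off-diagonal colours and its absolute sum is ((p - 2) + (k -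
  2)) / (p - 1)^2.\<close>

theorem form2_ge:
  fixes y :: "(nat \<Rightarrow> nat) \<Rightarrow> real"
  assumes K: "finite K" "0 \<notin> K" and m: "m \<in> K" and P: "finite P" "\<And>p. p \<in> P \<Longrightarrow> p > 2"
  shows "(\<Sum>s\<in>PiE P (\<lambda>_. insert 0 K). \<Sum>t\<in>PiE P (\<lambda>_. insert 0 K). lam P K y s * lam P K y t * (\<Prod>p\<in>P. dens2 m p (s p) (t p)))
     \<ge> (\<Sum>e\<in>PiE P (\<lambda>_. insert 0 (K - {m})). (Vsum P K m y e)\<^sup>2 *
         (2 * (\<Prod>p\<in>P. if e p = 0 then 1 else (real p)\<^sup>2 * (real p - 2) / (real p - 1) ^ 4)
          - (\<Prod>p\<in>P. if e p = 0 then 1 else (real p)\<^sup>2 * (real p + real (card K) - 4) / (real p - 1) ^ 4)))"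
proof -
  let ?S = "insert 0 K" and ?C = "PiE P (\<lambda>_. insert 0 K)" and ?T = "insert 0 (K - {m})"
    and ?E = "PiE P (\<lambda>_. insert 0 (K - {m}))"
  define zz where "zz e = (\<Prod>p\<in>P. if e p = 0 then 1 else - (real p / (real p - 1))) * Vsum P K m y e" for e
  define D where "D p a b = (\<Sum>e\<in>?T. \<Sum>f\<in>?T. Umat m p a e * Umat m p b f * Dmat p e f)" for p a b
  have P1: "p > 1" if "p \<in> P" for p using P(2)[OF that] by simp
  have zz: "(\<Sum>c\<in>?C. zcoef P y c * (\<Prod>p\<in>P. Umat m p (c p) (e p))) = zz e" if "e \<in> ?E" for e
    unfolding zz_def by (rule zcoef_Umat_sum) (use K m P1 that in auto)
  have "(\<Sum>s\<in>?C. \<Sum>t\<in>?C. lam P K y s * lam P K y t * (\<Prod>p\<in>P. dens2 m p (s p) (t p)))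
    = (\<Sum>c\<in>?C. \<Sum>c'\<in>?C. zcoef P y c * zcoef P y c' * (\<Prod>p\<in>P. D p (c p) (c' p)))"
    unfolding lam_def
  proof (rule kronecker_form[symmetric])
    fix p a b assume "p \<in> P" "a \<in> ?S" "b \<in> ?S"
    thus "D p a b = (\<Sum>e\<in>?S. \<Sum>f\<in>?S. Tinv p a e * Tinv p b f * dens2 m p e f)"
      unfolding D_def using K m P1 by (intro Tinv_dens2[symmetric])
  qed (use K P in auto)
  also have "\<dots> = (\<Sum>e\<in>?E. \<Sum>f\<in>?E.
            (\<Sum>c\<in>?C. zcoef P y c * (\<Prod>p\<in>P. Umat m p (c p) (e p)))
          * (\<Sum>c\<in>?C. zcoef P y c * (\<Prod>p\<in>P. Umat m p (c p) (f p)))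
          * (\<Prod>p\<in>P. Dmat p (e p) (f p)))"
    by (rule kronecker_form) (use K P in \<open>auto simp: D_def\<close>)
  also have "\<dots> = (\<Sum>e\<in>?E. \<Sum>f\<in>?E. zz e * zz f * (\<Prod>p\<in>P. Dmat p (e p) (f p)))"
    by (intro sum.cong refl) (simp add: zz)
  also have "\<dots> \<ge> (\<Sum>c\<in>?E. (zz c)\<^sup>2 * (\<Prod>p\<in>P. Dmat p (c p) (c p)))
     - (\<Sum>c\<in>?E. (zz c)\<^sup>2 * ((\<Prod>p\<in>P. \<Sum>b\<in>?T. \<bar>Dmat p (c p) b\<bar>) - (\<Prod>p\<in>P. \<bar>Dmat p (c p) (c p)\<bar>)))"
  proof -
    have "Dmat p a b = Dmat p b a" for p a b by (simp add: Dmat_def)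
    from kronecker_form_diagonal[of P ?T Dmat zz, OF P(1) _ this] finite_insert[of 0 "K - {m}"] finite_insert[of 0 K] K show ?thesis by force
  qed
  also have "(\<Sum>c\<in>?E. (zz c)\<^sup>2 * (\<Prod>p\<in>P. Dmat p (c p) (c p)))
     - (\<Sum>c\<in>?E. (zz c)\<^sup>2 * ((\<Prod>p\<in>P. \<Sum>b\<in>?T. \<bar>Dmat p (c p) b\<bar>) - (\<Prod>p\<in>P. \<bar>Dmat p (c p) (c p)\<bar>)))
    = (\<Sum>c\<in>?E. (zz c)\<^sup>2 * (2 * (\<Prod>p\<in>P. Dmat p (c p) (c p)) - (\<Prod>p\<in>P. \<Sum>b\<in>?T. \<bar>Dmat p (c p) b\<bar>)))"
  proof -
    have "(\<Prod>p\<in>P. \<bar>Dmat p (c p) (c p)\<bar>) = (\<Prod>p\<in>P. Dmat p (c p) (c p))" for c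
      using P(2) by (intro prod.cong refl) (fastforce simp: Dmat_def)
    thus ?thesis unfolding sum_subtractf[symmetric] by (intro sum.cong refl) (simp add: algebra_simps)
  qed
  also have "\<dots> = (\<Sum>e\<in>?E. (Vsum P K m y e)\<^sup>2 *
         (2 * (\<Prod>p\<in>P. if e p = 0 then 1 else (real p)\<^sup>2 * (real p - 2) / (real p - 1) ^ 4)
          - (\<Prod>p\<in>P. if e p = 0 then 1 else (real p)\<^sup>2 * (real p + real (card K) - 4) / (real p - 1) ^ 4)))"
  proof (intro sum.cong refl)
    fix c assume c: "c \<in> ?E"
    define g where "g = (\<Prod>p\<in>P. if c p = 0 then 1 else (real p)\<^sup>2 / (real p - 1)\<^sup>2)"
    have zz2: "(zz c)\<^sup>2 = (Vsum P K m y c)\<^sup>2 * g"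
      unfolding zz_def power_mult_distrib prod_power_distrib g_def mult.commute[of "(Vsum _ _ _ _ _)\<^sup>2"]
      by (intro arg_cong2[where f="(*)"] refl prod.cong) (auto simp: power_divide)
    have 1: "g * (\<Prod>p\<in>P. Dmat p (c p) (c p)) = (\<Prod>p\<in>P. if c p = 0 then 1 else (real p)\<^sup>2 * (real p - 2) / (real p - 1) ^ 4)"
      unfolding g_def prod.distrib[symmetric]
      by (intro prod.cong refl) (auto simp: Dmat_def power2_eq_square power4_eq_xxxx)
    have 2: "g * (\<Prod>p\<in>P. \<Sum>b\<in>?T. \<bar>Dmat p (c p) b\<bar>)
      = (\<Prod>p\<in>P. if c p = 0 then 1 else (real p)\<^sup>2 * (real p + real (card K) - 4) / (real p - 1) ^ 4)"
      unfolding g_def prod.distrib[symmetric]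
    proof (intro prod.cong refl)
      fix p assume p: "p \<in> P"
      have "(\<Sum>b\<in>?T. \<bar>Dmat p (c p) b\<bar>) = (if c p = 0 then 1 else (real p + real (card K) - 4) / (real p - 1)\<^sup>2)"
      proof (cases "c p = 0")
        case True
        have "b \<noteq> 0" if "b \<in> K" for b using that K(2) by metis
        hence "(\<Sum>b\<in>K-{m}. \<bar>Dmat p (c p) b\<bar>) = 0" using True by (intro sum.neutral) (auto simp: Dmat_def)
        thus ?thesis using K True by (simp add: Dmat_def)
      next
        case False
        hence cK: "c p \<in> K - {m}" using c p by (auto simp: PiE_iff)
        have card: "card K \<ge> 2"
          using K cK m card_mono[of K "{c p, m}"] by auto
        have "(\<Sum>b\<in>?T. \<bar>Dmat p (c p) b\<bar>) = (\<Sum>b\<in>K-{m}. \<bar>Dmat p (c p) b\<bar>)"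
          using K False by (simp add: Dmat_def)
        also have "\<dots> = \<bar>Dmat p (c p) (c p)\<bar> + (\<Sum>b\<in>K-{m}-{c p}. \<bar>Dmat p (c p) b\<bar>)"
          using K cK by (subst sum.remove) auto
        also have "(\<Sum>b\<in>K-{m}-{c p}. \<bar>Dmat p (c p) b\<bar>) = (\<Sum>b\<in>K-{m}-{c p}. 1 / (real p - 1)\<^sup>2)"
          using K False by (intro sum.cong) (auto simp: Dmat_def)
        also have "\<dots> = (real (card K) - 2) / (real p - 1)\<^sup>2"
          using K cK m card by (auto simp: of_nat_diff)
        also have "\<bar>Dmat p (c p) (c p)\<bar> = (real p - 2) / (real p - 1)\<^sup>2"
          using False P(2)[OF p] by (simp add: Dmat_def)
        finally show ?thesis using False by (simp add: add_divide_distrib[symmetric] algebra_simps)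
      qed
      thus "(if c p = 0 then 1 else (real p)\<^sup>2 / (real p - 1)\<^sup>2) * (\<Sum>b\<in>?T. \<bar>Dmat p (c p) b\<bar>) =
         (if c p = 0 then 1 else (real p)\<^sup>2 * (real p + real (card K) - 4) / (real p - 1) ^ 4)"
        by (simp add: power2_eq_square power4_eq_xxxx)
    qed
    have "(zz c)\<^sup>2 * (2 * (\<Prod>p\<in>P. Dmat p (c p) (c p)) - (\<Prod>p\<in>P. \<Sum>b\<in>?T. \<bar>Dmat p (c p) b\<bar>))
       = (Vsum P K m y c)\<^sup>2 * (2 * (g * (\<Prod>p\<in>P. Dmat p (c p) (c p))) - g * (\<Prod>p\<in>P. \<Sum>b\<in>?T. \<bar>Dmat p (c p) b\<bar>))"
      unfolding zz2 by (simp add: algebra_simps)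
    thus "(zz c)\<^sup>2 * (2 * (\<Prod>p\<in>P. Dmat p (c p) (c p)) - (\<Prod>p\<in>P. \<Sum>b\<in>?T. \<bar>Dmat p (c p) b\<bar>)) =
      (Vsum P K m y c)\<^sup>2 *
         (2 * (\<Prod>p\<in>P. if c p = 0 then 1 else (real p)\<^sup>2 * (real p - 2) / (real p - 1) ^ 4)
          - (\<Prod>p\<in>P. if c p = 0 then 1 else (real p)\<^sup>2 * (real p + real (card K) - 4) / (real p - 1) ^ 4))"
      unfolding 1 2 .
  qed
  finally show ?thesis .
qed

section \<open>An upper bound of Mertens type\<close>

lemma prod_one_plus_eq_sum_subsets:
  fixes f :: "'a \<Rightarrow> real"
  assumes "finite P"
  shows "(\<Prod>p\<in>P. 1 + f p) = (\<Sum>A\<in>Pow P. \<Prod>p\<in>A. f p)"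
  using prod_add[OF assms, of f "\<lambda>_. 1"] by (simp add: add.commute)

text \<open>The set is recovered as the set of primes dividing its product. This lets a sum over
  sets of primes be bounded by a sum over integers.\<close>

lemma inj_on_prod_primes: "inj_on (\<lambda>A. \<Prod>A) (Pow {p::nat. prime p \<and> real p \<le> x})"
proof (rule inj_onI)
  fix A B assume AB: "A \<in> Pow {p::nat. prime p \<and> real p \<le> x}" "B \<in> Pow {p::nat. prime p \<and> real p \<le> x}" "\<Prod>A = \<Prod>B"
  have fin: "finite {p::nat. prime p \<and> real p \<le> x}"
    by (rule finite_subset[of _ "{..nat \<lfloor>x\<rfloor>}"]) (auto simp: le_nat_floor)
  have "q \<in> C \<longleftrightarrow> prime q \<and> q dvd \<Prod>C" if "C \<subseteq> {p::nat. prime p \<and> real p \<le> x}" for q :: nat and C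
  proof -
    have "finite C" using fin that finite_subset by blast
    have "x = q" if "x \<in> C" "prime q" "q dvd x" for x
      using that \<open>C \<subseteq> _\<close> primes_dvd_imp_eq[of q x] by auto
    moreover have "prime q" if "q \<in> C" using that \<open>C \<subseteq> _\<close> by auto
    moreover have "q dvd \<Prod>C \<longleftrightarrow> (\<exists>x\<in>C. q dvd x)" if "prime q"
      using prime_dvd_prod_iff[of C q "\<lambda>x. x"] \<open>finite C\<close> that by simp
    ultimately show ?thesis by (metis dvd_refl)
  qed
  note char = this
  show "A = B"
  proof (intro equalityI subsetI)
    fix q
    show "q \<in> B" if "q \<in> A" using that char[of A q] char[of B q] AB by simp
    show "q \<in> A" if "q \<in> B" using that char[of A q] char[of B q] AB by simp
  qed
qed

lemma finite_primes_le: "finite {p::nat. prime p \<and> real p \<le> x}"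
  by (rule finite_subset[of _ "{..nat \<lfloor>x\<rfloor>}"]) (auto simp: le_nat_floor)

text \<open>The term at M + 1 is at most the integral of x^(-1-e) over [M, M + 1], obtained here
  from the mean value theorem. The induction carries the negative tail -M^(-e)/e along so that the
  integrals telescope.\<close>

lemma sum_powr_le:
  fixes e :: real assumes "e > 0"
  shows "(\<Sum>n=1..M. real n powr (-1-e)) \<le> 1 + 1 / e"
proof (cases "M \<ge> 1")
  case True
  have "(\<Sum>n=1..M. real n powr (-1-e)) \<le> 1 + 1/e - real M powr (-e) / e"
    using True
  proof (induction M rule: dec_induct)
    case base
    thus ?case by simp
  next
    case (step M)
    have M: "real M > 0" using step by simp
    have "\<exists>z. z > real M \<and> z < real M + 1 \<and> (real M + 1) powr (-e) / (-e) - real M powr (-e) / (-e)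
          = (real M + 1 - real M) * (z powr (-e-1))"
      using assms M
      by (intro MVT2[of "real M" "real M + 1" "\<lambda>x. x powr (-e) / (-e)" "\<lambda>x. x powr (-e-1)"])
         (auto intro!: derivative_eq_intros simp: field_simps)
    moreover have ee: "- e - 1 = -1 - e" by simp
    ultimately obtain z where z: "z > real M" "z < real M + 1"
      "real M powr (-e) / e - (real M + 1) powr (-e) / e = z powr (-1-e)"
      unfolding ee by auto
    have "(real M + 1) powr (-1-e) \<le> z powr (-1-e)"
      using z M assms by (intro powr_mono2') auto
    hence "real (Suc M) powr (-1-e) \<le> real M powr (-e) / e - real (Suc M) powr (-e) / e"
      using z by (simp add: add.commute)
    thus ?case using step by (simp)
  qed
  also have "\<dots> \<le> 1 + 1/e" using assms by simp
  finally show ?thesis .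
next
  case False thus ?thesis using assms by simp
qed

text \<open>Pairs (m, p) with p dividing m <= n are counted with weight ln p. Each m receives at
  most ln m, because its radical divides it, and each p has at least n/(2p) multiples, because
  rounding down a quotient that is at least 1 loses at most a factor 2.\<close>

lemma sum_ln_div_prime_le:
  assumes "n \<ge> 1"
  shows "(\<Sum>p | prime p \<and> p \<le> n. ln (real p) / real p) \<le> 2 * ln (real n)"
proof -
  let ?P = "{p::nat. prime p \<and> p \<le> n}"
  have fin: "finite ?P" by simp
  have ln_ge: "(\<Sum>p | prime p \<and> p dvd m. ln (real p)) \<le> ln (real m)" if "m \<ge> 1" for m :: nat
  proof -
    have "(\<Prod>p\<in>prime_factors m. p) dvd m"
    proof -
      have "(\<Prod>p\<in>prime_factors m. p) dvd (\<Prod>p\<in>prime_factors m. p ^ multiplicity p m)"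
        by (intro prod_dvd_prod dvd_power) (auto simp: prime_factors_multiplicity)
      also have "\<dots> = m" using that by (subst prime_factorization_nat[symmetric]) auto
      finally show ?thesis .
    qed
    hence "(\<Prod>p\<in>prime_factors m. p) \<le> m" using that by (intro dvd_imp_le) auto
    hence "ln (real (\<Prod>p\<in>prime_factors m. p)) \<le> ln (real m)"
      using that by (intro ln_mono) (auto simp: prime_gt_0_nat in_prime_factors_iff intro!: prod_pos simp flip: of_nat_prod)
    moreover have "ln (real (\<Prod>p\<in>prime_factors m. p)) = (\<Sum>p\<in>prime_factors m. ln (real p))"
      unfolding of_nat_prod by (subst ln_prod) (auto simp: in_prime_factors_iff prime_gt_0_nat)
    moreover have "prime_factors m = {p. prime p \<and> p dvd m}" using that by (auto simp: in_prime_factors_iff)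
    ultimately show ?thesis by simp
  qed
  have "real n / 2 * (\<Sum>p\<in>?P. ln (real p) / real p) = (\<Sum>p\<in>?P. ln (real p) * (real n / (2 * real p)))"
    by (simp add: sum_distrib_left field_simps)
  also have "\<dots> \<le> (\<Sum>p\<in>?P. ln (real p) * real (card {m\<in>{1..n}. p dvd m}))"
  proof (intro sum_mono mult_left_mono)
    fix p assume p: "p \<in> ?P"
    have "n div p \<ge> 1" using p prime_gt_0_nat[of p] by (simp add: Suc_le_eq div_greater_zero_iff)
    have "real n = real p * real (n div p) + real (n mod p)"
      by (metis mult_div_mod_eq of_nat_add of_nat_mult)
    also have "\<dots> \<le> real p * real (n div p) + real p * 1"
      using p prime_gt_0_nat[of p] by (auto intro: less_imp_le)
    also have "\<dots> \<le> real p * real (n div p) + real p * real (n div p)"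
      using \<open>n div p \<ge> 1\<close> by (intro add_left_mono mult_left_mono) auto
    finally have "real n / (2 * real p) \<le> real (n div p)"
      using p prime_gt_0_nat[of p] by (auto simp: field_simps)
    also have "\<dots> = real (card ((\<lambda>j. p * j) ` {1..n div p}))"
      using p prime_gt_0_nat[of p] by (subst card_image) (auto simp: inj_on_def)
    also have "\<dots> \<le> real (card {m\<in>{1..n}. p dvd m})"
    proof -
      have "p * j \<le> n" if "j \<le> n div p" for j
        using that by (metis div_times_less_eq_dividend dual_order.trans mult.commute mult_le_mono2)
      thus ?thesis
        using p prime_gt_0_nat[of p] by (intro of_nat_mono card_mono) (auto simp: Suc_le_eq)
    qed
    finally show "real n / (2 * real p) \<le> real (card {m\<in>{1..n}. p dvd m})" .
  next
    fix p assume "p \<in> ?P"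
    thus "0 \<le> ln (real p)" using prime_ge_1_nat[of p] by simp
  qed
  also have "\<dots> = (\<Sum>p\<in>?P. \<Sum>m | m \<in> {1..n} \<and> p dvd m. ln (real p))"
    by (simp add: mult.commute)
  also have "\<dots> = (\<Sum>m\<in>{1..n}. \<Sum>p | p \<in> ?P \<and> p dvd m. ln (real p))"
    by (intro sum.swap_restrict) auto
  also have "\<dots> = (\<Sum>m\<in>{1..n}. \<Sum>p | prime p \<and> p dvd m. ln (real p))"
  proof (intro sum.cong refl)
    fix m assume m: "m \<in> {1..n}"
    have "p \<le> n" if "p dvd m" for p using dvd_imp_le[OF that] m by simp
    thus "{p. p \<in> ?P \<and> p dvd m} = {p. prime p \<and> p dvd m}" by blast
  qed
  also have "\<dots> \<le> (\<Sum>m\<in>{1..n}. ln (real n))"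
    using ln_ge by (intro sum_mono order_trans[OF ln_ge]) auto
  also have "\<dots> = real n * ln (real n)" by simp
  finally have "real n * (\<Sum>p\<in>?P. ln (real p) / real p) \<le> real n * (2 * ln (real n))" by simp
  thus ?thesis using assms by simp
qed

text \<open>Rankin's trick: compare with the exponent \<open>1 + 1 / ln x\<close>.\<close>
lemma prod_one_plus_inverse_prime_le:
  assumes "x \<ge> 3"
  shows "(\<Prod>p | prime p \<and> real p \<le> x. 1 + 1 / real p) \<le> 100 * ln x"
proof -
  let ?P = "{p::nat. prime p \<and> real p \<le> x}"
  define e where "e = 1 / ln x"
  have "exp 1 < (3::real)" using e_less_272 by simp
  hence lnx: "ln x > 1" using assms 
  proof -
    have "ln (exp 1) < ln x" using \<open>exp 1 < 3\<close> assms by (subst ln_less_cancel_iff) auto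
    thus ?thesis by simp
  qed
  hence e: "e > 0" "e < 1" by (auto simp: e_def)
  have fin: "finite ?P" by (rule finite_primes_le)
  have p1: "real p \<ge> 2" if "p \<in> ?P" for p using that prime_ge_2_nat[of p] by auto
  have P': "?P = {p. prime p \<and> p \<le> nat \<lfloor>x\<rfloor>}" using assms by (auto simp: le_nat_floor le_nat_iff le_floor_iff)
  have "(\<Prod>p\<in>?P. 1 + 1 / real p) \<le> (\<Prod>p\<in>?P. (1 + real p powr (-1-e)) * exp (e * (ln (real p) / real p)))"
  proof (intro prod_mono conjI)
    fix p assume p: "p \<in> ?P"
    have pp: "real p > 0" using p1[OF p] by simp
    \<comment> \<open>1 - t <= exp(-t) trades 1/p for p^(-1-e) at the price e ln p / p, which is
      small enough to be collected in an exponential.\<close>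
    have "1 - e * ln (real p) \<le> exp (- e * ln (real p))"
      using exp_ge_add_one_self[of "- e * ln (real p)"] by simp
    also have "\<dots> = real p powr (-e)" using pp by (simp add: powr_def)
    finally have "1 / real p \<le> real p powr (-e) / real p + e * (ln (real p) / real p)"
      using pp by (simp add: field_simps)
    also have "real p powr (-e) / real p = real p powr (-1-e)"
      using pp powr_add[of "real p" "-1" "-e"] by (simp add: powr_minus field_simps)
    finally have "1 + 1 / real p \<le> (1 + real p powr (-1-e)) + e * (ln (real p) / real p)" by simp
    also have "\<dots> \<le> (1 + real p powr (-1-e)) * (1 + e * (ln (real p) / real p))"
      using e p1[OF p] by (simp add: algebra_simps)
    also have "\<dots> \<le> (1 + real p powr (-1-e)) * exp (e * (ln (real p) / real p))"
      by (intro mult_left_mono exp_ge_add_one_self) auto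
    finally show "1 + 1 / real p \<le> (1 + real p powr (-1-e)) * exp (e * (ln (real p) / real p))" .
  qed auto
  also have "\<dots> = (\<Prod>p\<in>?P. 1 + real p powr (-1-e)) * exp (e * (\<Sum>p\<in>?P. ln (real p) / real p))"
    using fin by (simp add: prod.distrib exp_sum sum_distrib_left)
  \<comment> \<open>The first product is part of the sum of n^(-1-e) over all n, hence at most 1 +
    1/e = 1 + ln x. In the exponential e cancels the ln x that comes from the sum over
    primes.\<close>
  also have "\<dots> \<le> (1 + ln x) * exp 2"
  proof (intro mult_mono)
    have "(\<Prod>p\<in>?P. 1 + real p powr (-1-e)) = (\<Sum>A\<in>Pow ?P. \<Prod>p\<in>A. real p powr (-1-e))"
      by (rule prod_one_plus_eq_sum_subsets[OF fin])
    also have "\<dots> = (\<Sum>A\<in>Pow ?P. real (\<Prod>A) powr (-1-e))"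
    proof (intro sum.cong refl)
      fix A assume "A \<in> Pow ?P"
      hence "finite A" using fin finite_subset by blast
      thus "(\<Prod>p\<in>A. real p powr (-1-e)) = real (\<Prod>A) powr (-1-e)"
        by (induction A) (auto simp: powr_mult)
    qed
    also have "\<dots> = (\<Sum>n\<in>(\<lambda>A. \<Prod>A) ` Pow ?P. real n powr (-1-e))"
      by (subst sum.reindex[OF inj_on_prod_primes]) simp
    also have "\<dots> \<le> (\<Sum>n=1..Max ((\<lambda>A. \<Prod>A) ` Pow ?P). real n powr (-1-e))"
    proof (intro sum_mono2)
      show "(\<lambda>A. \<Prod>A) ` Pow ?P \<subseteq> {1..Max ((\<lambda>A. \<Prod>A) ` Pow ?P)}"
      proof
        fix n assume n: "n \<in> (\<lambda>A. \<Prod>A) ` Pow ?P"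
        obtain A where A: "A \<subseteq> ?P" "n = \<Prod>A" using n by auto
        have "n > 0" unfolding A(2) using A(1) prime_gt_0_nat by (intro prod_pos) blast
        thus "n \<in> {1..Max ((\<lambda>A. \<Prod>A) ` Pow ?P)}" using n fin by auto
      qed
    qed auto
    also have "\<dots> \<le> 1 + 1 / e" by (rule sum_powr_le) (use e in auto)
    finally show "(\<Prod>p\<in>?P. 1 + real p powr (-1-e)) \<le> 1 + ln x" by (simp add: e_def)
    have "(\<Sum>p\<in>?P. ln (real p) / real p) \<le> 2 * ln (real (nat \<lfloor>x\<rfloor>))"
      unfolding P' using assms by (intro sum_ln_div_prime_le) (auto simp: le_nat_iff le_floor_iff)
    also have "\<dots> \<le> 2 * ln x" using assms by (intro mult_left_mono ln_mono) (auto simp: le_nat_iff le_floor_iff)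
    finally have "e * (\<Sum>p\<in>?P. ln (real p) / real p) \<le> e * (2 * ln x)" using e by (intro mult_left_mono) auto
    thus "exp (e * (\<Sum>p\<in>?P. ln (real p) / real p)) \<le> exp 2" using lnx by (simp add: e_def)
  qed (use lnx in auto)
  also have "\<dots> \<le> (2 * ln x) * 9"
  proof (intro mult_mono)
    have "exp 2 = (exp 1 :: real)\<^sup>2" by (simp add: power2_eq_square flip: exp_add)
    also have "\<dots> \<le> 3\<^sup>2" using \<open>exp 1 < (3::real)\<close> by (intro power_mono) auto
    finally show "exp 2 \<le> (9::real)" by simp
  qed (use lnx in auto)
  also have "\<dots> \<le> 100 * ln x" using lnx by simp
  finally show ?thesis .
qed

text \<open>Over all integers from 2 to M the product telescopes to (1 + 1/M)/2, and leaving out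
  factors below 1 only increases it.\<close>

lemma prod_one_minus_inverse_sq_ge:
  assumes "finite P" "\<And>p. p \<in> P \<Longrightarrow> prime p"
  shows "(\<Prod>p\<in>P. 1 - 1 / (real p)\<^sup>2) \<ge> 1 / 2"
proof -
  have fact: "(\<Prod>n=2..Suc M. 1 - 1 / (real n)\<^sup>2) \<ge> 1/2 * (1 + 1 / real (Suc M))" for M
  proof (induction M)
    case (Suc M)
    have "(\<Prod>n=2..Suc (Suc M). 1 - 1 / (real n)\<^sup>2) = (\<Prod>n=2..Suc M. 1 - 1 / (real n)\<^sup>2) * (1 - 1 / (real (Suc (Suc M)))\<^sup>2)"
      by simp
    also have "\<dots> \<ge> 1/2 * (1 + 1 / real (Suc M)) * (1 - 1 / (real (Suc (Suc M)))\<^sup>2)"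
      using Suc one_le_power[of "real (Suc (Suc M))" 2] by (intro mult_right_mono) (simp_all add: divide_le_eq_1)
    also have "1/2 * (1 + 1 / real (Suc M)) * (1 - 1 / (real (Suc (Suc M)))\<^sup>2) = 1/2 * (1 + 1 / real (Suc (Suc M)))"
    proof -
      define y where "y = real M"
      have "y \<ge> 0" by (simp add: y_def)
      hence "y + 1 \<noteq> 0" "y + 2 \<noteq> 0" by auto
      moreover have "real (Suc M) = y + 1" "real (Suc (Suc M)) = y + 2" by (simp_all add: y_def)
      ultimately show ?thesis by (simp add: divide_simps power2_eq_square) (simp add: algebra_simps)
    qed
    finally show ?case .
  qed auto
  define M where "M = Max (insert 2 P)"
  have sub: "P \<subseteq> {2..Suc M}"
  proof
    fix p assume p: "p \<in> P"
    hence "p \<le> M" unfolding M_def using assms(1) by (intro Max_ge) auto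
    thus "p \<in> {2..Suc M}" using prime_ge_2_nat[OF assms(2)[OF p]] by simp
  qed
  have f: "0 \<le> 1 - 1 / (real n)\<^sup>2" "1 - 1 / (real n)\<^sup>2 \<le> 1" if "n \<in> {2..Suc M}" for n
    using that one_le_power[of "real n" 2] by (simp_all add: divide_le_eq_1)
  have "1/2 \<le> (\<Prod>n=2..Suc M. 1 - 1 / (real n)\<^sup>2)" 
  proof -
    have "1/2 \<le> 1/2 * (1 + 1 / real (Suc M))" by simp
    thus ?thesis using fact[of M] by linarith
  qed
  also have "\<dots> = (\<Prod>n\<in>P. 1 - 1 / (real n)\<^sup>2) * (\<Prod>n\<in>{2..Suc M} - P. 1 - 1 / (real n)\<^sup>2)"
    using sub by (subst prod.subset_diff[of P]) (auto simp: mult.commute)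
  also have "\<dots> \<le> (\<Prod>n\<in>P. 1 - 1 / (real n)\<^sup>2) * 1"
    using f sub by (intro mult_left_mono prod_le_1 prod_nonneg) auto
  finally show ?thesis by simp
qed

text \<open>The product of 1 + 1/p over p <= D is at least half the inverse of the product of 1 -
  1/p. Dividing the bound for all p <= x by it produces the factor phi(Q)/Q that the main terms
  carry as well. Since 200 does not depend on D, errors of relative size 1/D can be made small by
  the choice of D.\<close>

theorem prod_primes_between_le:
  assumes "x \<ge> 3" "x \<ge> real D"
  shows "(\<Prod>p | prime p \<and> p > D \<and> real p \<le> x. 1 + 1 / real p)
     \<le> 200 * (\<Prod>p | prime p \<and> p \<le> D. 1 - 1 / real p) * ln x"
proof -
  let ?A = "{p. prime p \<and> p \<le> D}" and ?B = "{p. prime p \<and> p > D \<and> real p \<le> x}"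
  have fin: "finite ?A" "finite ?B" by (auto intro: finite_subset[OF _ finite_primes_le[of x]])
  have "{p. prime p \<and> real p \<le> x} = ?A \<union> ?B" using assms by auto
  hence "(\<Prod>p\<in>?A. 1 + 1 / real p) * (\<Prod>p\<in>?B. 1 + 1 / real p) = (\<Prod>p | prime p \<and> real p \<le> x. 1 + 1 / real p)"
    using fin by (subst prod.union_disjoint[symmetric]) auto
  also have "\<dots> \<le> 100 * ln x" by (rule prod_one_plus_inverse_prime_le[OF assms(1)])
  finally have 1: "(\<Prod>p\<in>?A. 1 + 1 / real p) * (\<Prod>p\<in>?B. 1 + 1 / real p) \<le> 100 * ln x" .
  have A0: "(\<Prod>p\<in>?A. 1 - 1 / real p) \<ge> 0" by (intro prod_nonneg) (auto simp: prime_ge_1_nat divide_le_eq_1)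
  have B0: "(\<Prod>p\<in>?B. 1 + 1 / real p) \<ge> 0" by (intro prod_nonneg) auto
  have "(1/2) * (\<Prod>p\<in>?B. 1 + 1 / real p) \<le> (\<Prod>p\<in>?A. 1 - 1 / (real p)\<^sup>2) * (\<Prod>p\<in>?B. 1 + 1 / real p)"
    using fin B0 by (intro mult_right_mono prod_one_minus_inverse_sq_ge) auto
  also have "(\<Prod>p\<in>?A. 1 - 1 / (real p)\<^sup>2) = (\<Prod>p\<in>?A. 1 - 1 / real p) * (\<Prod>p\<in>?A. 1 + 1 / real p)"
    unfolding prod.distrib[symmetric] by (intro prod.cong refl) (simp add: algebra_simps power2_eq_square)
  also have "\<dots> * (\<Prod>p\<in>?B. 1 + 1 / real p) \<le> (\<Prod>p\<in>?A. 1 - 1 / real p) * (100 * ln x)"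
    using mult_left_mono[OF 1 A0] by (simp add: mult_ac)
  finally show ?thesis by simp
qed

section \<open>Logarithmic sums over tuples of integers\<close>

definition Cop :: "nat \<Rightarrow> nat set" where "Cop Q = {a. a \<ge> 1 \<and> coprime a Q}"

definition Cop_le :: "nat \<Rightarrow> real \<Rightarrow> nat set" where "Cop_le Q x = {a \<in> Cop Q. real a \<le> x}"

definition tuples :: "nat \<Rightarrow> nat set \<Rightarrow> real \<Rightarrow> (nat \<Rightarrow> nat) set" where
  "tuples Q I x = {u \<in> PiE I (\<lambda>_. Cop Q). real (\<Prod>i\<in>I. u i) \<le> x}"

lemma finite_Cop_le [simp]: "finite (Cop_le Q x)"
  by (rule finite_subset[of _ "{..nat \<lfloor>x\<rfloor>}"]) (auto simp: Cop_le_def le_nat_floor)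

lemma Cop_le_nat: "Cop_le Q x = Cop_le Q (real (nat \<lfloor>x\<rfloor>))"
  by (auto simp: Cop_le_def Cop_def le_nat_floor) (metis le_nat_floor of_nat_le_iff not_less_eq_eq One_nat_def le_floor_iff nat_floor_neg of_nat_le_0_iff linorder_not_le nle_le of_nat_0_le_iff of_nat_floor order_trans)

text \<open>For \<open>m = 0\<close> the bound forces \<open>f\<close> to be exactly \<open>K\<close>.\<close>
definition ln_asym :: "(real \<Rightarrow> real) \<Rightarrow> real \<Rightarrow> nat \<Rightarrow> bool" where
  "ln_asym f K m \<longleftrightarrow> (\<exists>C\<ge>0. \<forall>y\<ge>1. \<bar>f y - K * ln y ^ m\<bar> \<le> C * real m * (1 + ln y) ^ (m - 1))"

text \<open>Over a period of length Q the count grows by exactly \<open>totient Q\<close>, so the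
  deviation is periodic in n and only n < Q has to be estimated.\<close>

lemma card_Cop_le_error:
  assumes "Q \<ge> 1"
  shows "\<bar>real (card {a\<in>{1..n}. coprime a Q}) - real (totient Q) / real Q * real n\<bar> \<le> real Q"
proof -
  define c where "c n = card {a\<in>{1..n}. coprime a Q}" for n
  have cS: "c (Suc n) = c n + (if coprime (Suc n) Q then 1 else 0)" for n
  proof -
    have "{a\<in>{1..Suc n}. coprime a Q} = (if coprime (Suc n) Q then insert (Suc n) {a\<in>{1..n}. coprime a Q} else {a\<in>{1..n}. coprime a Q})"
      by (auto simp: le_Suc_eq)
    thus ?thesis by (auto simp: c_def)
  qed
  have cQ: "c Q = totient Q"
    unfolding c_def totient_def totatives_def
    by (intro arg_cong[of _ _ card]) auto
  have shift: "c (n + Q) = c n + totient Q" for n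
  proof (induction n)
    case 0 thus ?case by (simp add: cQ) (simp add: c_def)
  next
    case (Suc n)
    have "coprime (Suc n + Q) Q \<longleftrightarrow> coprime (Suc n) Q"
      by (metis coprime_iff_gcd_eq_1 gcd_add1)
    thus ?case using Suc cS[of "n + Q"] cS[of n] by auto
  qed
  have cle: "c n \<le> n" for n
  proof -
    have "c n \<le> card {1..n}" unfolding c_def by (intro card_mono) auto
    thus ?thesis by simp
  qed
  have tle: "real (totient Q) / real Q \<le> 1" using assms totient_le[of Q] by (simp add: field_simps)
  have "\<bar>real (c n) - real (totient Q) / real Q * real n\<bar> \<le> real Q" for n
  proof (induction n rule: less_induct)
    case (less n)
    show ?case
    proof (cases "n < Q")
      case True
      have "real (c n) \<le> real Q" "real (totient Q) / real Q * real n \<le> 1 * real Q"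
        using cle[of n] True mult_mono[OF tle, of "real n" "real Q"] by simp_all
      moreover have "real (totient Q) / real Q * real n \<ge> 0" by simp
      ultimately show ?thesis by linarith
    next
      case False
      hence n: "n = (n - Q) + Q" by simp
      have "real (c n) - real (totient Q) / real Q * real n
        = real (c (n-Q)) - real (totient Q) / real Q * real (n-Q)"
        using False assms shift[of "n - Q"] by (simp add: of_nat_diff field_simps)
      thus ?thesis using less[of "n - Q"] False assms by simp
    qed
  qed
  thus ?thesis by (simp add: c_def)
qed

section \<open>Partial summation over integers coprime to Q\<close>

lemma abel_sum:
  fixes w g :: "nat \<Rightarrow> real"
  assumes "M \<ge> 1"
  shows "(\<Sum>a=1..M. w a * g a) = (\<Sum>a=1..M. w a) * g M - (\<Sum>a=1..<M. (\<Sum>j=1..a. w j) * (g (Suc a) - g a))"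
  using assms
proof (induction M rule: dec_induct)
  case (step M)
  have "{1..<Suc M} = insert M {1..<M}" using step by auto
  thus ?case using step by (simp add: algebra_simps)
qed auto

text \<open>After partial summation the density contributes k times the harmonic number. The
  deviations \<open>r\<close> are bounded by Q and are summed against 1/a - 1/(a + 1), which
  telescopes, so they stay bounded.\<close>

lemma sum_Cop_inverse:
  assumes "Q \<ge> 1"
  shows "\<exists>C\<ge>0. \<forall>n\<ge>1. \<bar>(\<Sum>a\<in>Cop_le Q (real n). 1 / real a) - real (totient Q) / real Q * ln (real n)\<bar> \<le> C"
proof -
  define k where "k = real (totient Q) / real Q"
  define w where "w a = (if coprime a Q then 1 else (0::real))" for a :: nat
  define r where "r n = (\<Sum>a=1..n. w a) - k * real n" for n
  have k: "0 \<le> k" "k \<le> 1" using assms totient_le[of Q] by (auto simp: k_def field_simps)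
  have sw: "(\<Sum>a=1..n. w a) = real (card {a\<in>{1..n}. coprime a Q})" for n
    unfolding w_def by (subst sum.inter_filter[symmetric]) auto
  have r: "\<bar>r n\<bar> \<le> real Q" for n unfolding r_def sw k_def by (rule card_Cop_le_error[OF assms])
  have tel: "(\<Sum>a=1..<n. 1 / real a - 1 / real (Suc a)) = 1 - 1 / real n" if "n \<ge> 1" for n
    using that by (induction n rule: dec_induct) auto
  have main: "\<bar>(\<Sum>a\<in>Cop_le Q (real n). 1 / real a) - k * ln (real n)\<bar> \<le> 2 * real Q + 2" if n: "n \<ge> 1" for n
  proof -
    have "(\<Sum>a\<in>Cop_le Q (real n). 1 / real a) = (\<Sum>a=1..n. w a * (1 / real a))"
    proof -
      have "Cop_le Q (real n) = {a\<in>{1..n}. coprime a Q}" by (auto simp: Cop_le_def Cop_def)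
      moreover have "(\<Sum>a\<in>{a\<in>{1..n}. coprime a Q}. 1 / real a) = (\<Sum>a\<in>{1..n}. if coprime a Q then 1 / real a else 0)"
        by (rule sum.inter_filter) auto
      ultimately show ?thesis by (auto simp: w_def intro!: sum.cong)
    qed
    also have "\<dots> = (\<Sum>a=1..n. w a) * (1 / real n) + (\<Sum>a=1..<n. (\<Sum>j=1..a. w j) * (1 / real a - 1 / real (Suc a)))"
      unfolding abel_sum[OF n] by (simp add: sum_subtractf algebra_simps)
    also have "\<dots> = (k * real n + r n) * (1 / real n) + (\<Sum>a=1..<n. (k * real a + r a) * (1 / real a - 1 / real (Suc a)))"
      by (simp add: r_def)
    also have "\<dots> = k * (1 + (\<Sum>a=1..<n. 1 / real (Suc a))) + (r n * (1 / real n) + (\<Sum>a=1..<n. r a * (1 / real a - 1 / real (Suc a))))"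
    proof -
      have "(\<Sum>a=1..<n. (k * real a + r a) * (1 / real a - 1 / real (Suc a)))
         = (\<Sum>a=1..<n. k * (1 / real (Suc a)) + r a * (1 / real a - 1 / real (Suc a)))"
      proof (intro sum.cong refl)
        fix a assume "a \<in> {1..<n}"
        hence a: "real a \<noteq> 0" "1 + real a \<noteq> 0" by auto
        hence "real a * (1 / real a - 1 / real (Suc a)) = 1 / real (Suc a)"
          by (simp add: right_diff_distrib) (simp add: divide_simps)
        moreover have "(k * real a + r a) * d = k * (real a * d) + r a * d" for d by (simp add: algebra_simps)
        ultimately show "(k * real a + r a) * (1 / real a - 1 / real (Suc a)) = k * (1 / real (Suc a)) + r a * (1 / real a - 1 / real (Suc a))"
          by metis
      qed
      hence e1: "(\<Sum>a=1..<n. (k * real a + r a) * (1 / real a - 1 / real (Suc a)))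
         = k * (\<Sum>a=1..<n. 1 / real (Suc a)) + (\<Sum>a=1..<n. r a * (1 / real a - 1 / real (Suc a)))"
        by (simp only: sum.distrib sum_distrib_left)
      have e2: "(k * real n + r n) * (1 / real n) = k + r n * (1 / real n)" using n by (simp add: field_simps)
      show ?thesis unfolding e1 e2 by (simp only: distrib_left mult_1_right add_ac)
    qed
    also have "1 + (\<Sum>a=1..<n. 1 / real (Suc a)) = harm n"
      using n by (induction n rule: dec_induct) (auto simp: harm_Suc harm_expand inverse_eq_divide add_ac)
    finally have eq: "(\<Sum>a\<in>Cop_le Q (real n). 1 / real a)
        = k * harm n + (r n * (1 / real n) + (\<Sum>a=1..<n. r a * (1 / real a - 1 / real (Suc a))))" .
    have "\<bar>r n * (1 / real n)\<bar> \<le> real Q * 1"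
      unfolding abs_mult using r n by (intro mult_mono) auto
    moreover have "\<bar>\<Sum>a=1..<n. r a * (1 / real a - 1 / real (Suc a))\<bar> \<le> (\<Sum>a=1..<n. real Q * (1 / real a - 1 / real (Suc a)))"
    proof (rule order_trans[OF sum_abs sum_mono])
      fix a assume "a \<in> {1..<n}"
      hence "1 / real a - 1 / real (Suc a) \<ge> 0" by (simp add: field_simps)
      thus "\<bar>r a * (1 / real a - 1 / real (Suc a))\<bar> \<le> real Q * (1 / real a - 1 / real (Suc a))"
        unfolding abs_mult using r by (intro mult_mono) auto
    qed
    moreover have "(\<Sum>a=1..<n. real Q * (1 / real a - 1 / real (Suc a))) \<le> real Q * 1"
      unfolding sum_distrib_left[symmetric] tel[OF n] by (intro mult_left_mono) auto
    moreover have "\<bar>k * harm n - k * ln (real n)\<bar> \<le> 1"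
    proof -
      have "harm n - ln (real n) \<le> 1"
        using n
      proof (induction n rule: dec_induct)
        case (step m)
        have "ln (real m / real (Suc m)) \<le> real m / real (Suc m) - 1" using step by (intro ln_le_minus_one) auto
        hence "1 / real (Suc m) \<le> ln (real (Suc m)) - ln (real m)" using step by (simp add: ln_div field_simps)
        thus ?case using step by (simp add: harm_Suc inverse_eq_divide)
      qed (auto simp: harm_expand)
      moreover have "harm n \<ge> ln (real n)"
        using ln_le_harm[of n] n by (smt (verit) ln_mono of_nat_0_less_iff of_nat_Suc less_le_trans zero_less_one)
      ultimately have "\<bar>harm n - ln (real n)\<bar> \<le> 1" by simp
      hence "\<bar>k\<bar> * \<bar>harm n - ln (real n)\<bar> \<le> 1 * 1" using k by (intro mult_mono) auto
      thus ?thesis by (simp add: abs_mult[symmetric] algebra_simps)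
    qed
    ultimately show ?thesis unfolding eq by linarith
  qed
  show ?thesis by (rule exI[of _ "2 * real Q + 2"]) (use main in \<open>auto simp: k_def\<close>)
qed

lemma power_diff_bounds:
  fixes x y :: real
  assumes "0 \<le> x" "x \<le> y"
  shows "y ^ Suc b - x ^ Suc b \<le> real (Suc b) * (y ^ b * (y - x))"
    and "real (Suc b) * (x ^ b * (y - x)) \<le> y ^ Suc b - x ^ Suc b"
proof -
  have eq: "y ^ Suc b - x ^ Suc b = (y - x) * (\<Sum>p<Suc b. y ^ p * x ^ (b - p))"
    by (rule diff_power_eq_sum)
  have "(\<Sum>p<Suc b. y ^ p * x ^ (b - p)) \<le> (\<Sum>p<Suc b. y ^ b)"
  proof (intro sum_mono)
    fix p assume "p \<in> {..<Suc b}"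
    hence "y ^ p * x ^ (b - p) \<le> y ^ p * y ^ (b - p)" using assms by (intro mult_left_mono power_mono) auto
    thus "y ^ p * x ^ (b - p) \<le> y ^ b" using \<open>p \<in> _\<close> by (simp add: power_add[symmetric])
  qed
  hence "(y - x) * (\<Sum>p<Suc b. y ^ p * x ^ (b - p)) \<le> (y - x) * (\<Sum>p<Suc b. y ^ b)"
    using assms by (intro mult_left_mono) auto
  thus "y ^ Suc b - x ^ Suc b \<le> real (Suc b) * (y ^ b * (y - x))" unfolding eq by (simp add: mult_ac)
  have "(\<Sum>p<Suc b. y ^ p * x ^ (b - p)) \<ge> (\<Sum>p<Suc b. x ^ b)"
  proof (intro sum_mono)
    fix p assume "p \<in> {..<Suc b}"
    hence "y ^ p * x ^ (b - p) \<ge> x ^ p * x ^ (b - p)" using assms by (intro mult_right_mono power_mono) auto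
    thus "y ^ p * x ^ (b - p) \<ge> x ^ b" using \<open>p \<in> _\<close> by (simp add: power_add[symmetric])
  qed
  hence "(y - x) * (\<Sum>p<Suc b. y ^ p * x ^ (b - p)) \<ge> (y - x) * (\<Sum>p<Suc b. x ^ b)"
    using assms by (intro mult_left_mono) auto
  thus "real (Suc b) * (x ^ b * (y - x)) \<le> y ^ Suc b - x ^ Suc b" unfolding eq by (simp add: mult_ac)
qed

text \<open>Partial summation of the case b = 0 against (ln a)^b. The main part becomes an upper
  Riemann sum for the integral of t^b over [0, ln n] with nodes ln a. Its mesh is at most 1, so it
  exceeds the integral by at most (ln n)^b.\<close>

lemma sum_Cop_ln_power_nat:
  assumes "Q \<ge> 1"
  shows "\<exists>C\<ge>0. \<forall>n\<ge>1. \<bar>(\<Sum>a\<in>Cop_le Q (real n). 1 / real a * ln (real a) ^ b) - real (totient Q) / real Q / real (Suc b) * ln (real n) ^ Suc b\<bar>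
     \<le> C * ln (real n) ^ b"
proof -
  define k where "k = real (totient Q) / real Q"
  have k: "0 \<le> k" "k \<le> 1" using assms totient_le[of Q] by (auto simp: k_def field_simps)
  define w where "w a = (if coprime a Q then 1 / real a else (0::real))" for a :: nat
  have sw: "(\<Sum>a\<in>Cop_le Q (real n). 1 / real a * h a) = (\<Sum>a=1..n. w a * h a)" for n and h :: "nat \<Rightarrow> real"
  proof -
    have "Cop_le Q (real n) = {a\<in>{1..n}. coprime a Q}" by (auto simp: Cop_le_def Cop_def)
    moreover have "(\<Sum>a\<in>{a\<in>{1..n}. coprime a Q}. 1 / real a * h a) = (\<Sum>a\<in>{1..n}. if coprime a Q then 1 / real a * h a else 0)"
      by (rule sum.inter_filter) auto
    ultimately show ?thesis by (auto simp: w_def intro!: sum.cong)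
  qed
  obtain C where C: "C \<ge> 0" "\<And>n. n \<ge> 1 \<Longrightarrow> \<bar>(\<Sum>a=1..n. w a) - k * ln (real n)\<bar> \<le> C"
    using sum_Cop_inverse[OF assms] sw[where h="\<lambda>_. 1"] by (auto simp: k_def)
  define r where "r n = (\<Sum>a=1..n. w a) - k * ln (real n)" for n
  define g where "g a = ln (real a) ^ b" for a :: nat
  have gmono: "g a \<le> g (Suc a)" if "a \<ge> 1" for a
    unfolding g_def using that by (intro power_mono ln_mono) auto
  have tel: "(\<Sum>a=1..<n. h (Suc a) - h a) = h n - h 1" if "n \<ge> 1" for n and h :: "nat \<Rightarrow> real"
    using that by (induction n rule: dec_induct) auto
  have main: "\<bar>(\<Sum>a=1..n. w a * g a) - k / real (Suc b) * ln (real n) ^ Suc b\<bar> \<le> (2 * C + 1) * g n" if n: "n \<ge> 1" for n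
  proof -
    have g0: "g n \<ge> 0" "g 1 \<ge> 0" using n by (auto simp: g_def)
    have "(\<Sum>a=1..n. w a * g a) = (k * ln (real n) + r n) * g n - (\<Sum>a=1..<n. (k * ln (real a) + r a) * (g (Suc a) - g a))"
      unfolding abel_sum[OF n] by (simp add: r_def)
    also have "\<dots> = k * (ln (real n) * g n - (\<Sum>a=1..<n. ln (real a) * (g (Suc a) - g a)))
       + (r n * g n - (\<Sum>a=1..<n. r a * (g (Suc a) - g a)))"
      by (simp add: algebra_simps sum.distrib sum_distrib_left sum_subtractf)
    also have "ln (real n) * g n - (\<Sum>a=1..<n. ln (real a) * (g (Suc a) - g a))
        = (\<Sum>a=1..<n. g (Suc a) * (ln (real (Suc a)) - ln (real a)))"
      using n by (induction n rule: dec_induct) (auto simp: algebra_simps)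
    finally have eq: "(\<Sum>a=1..n. w a * g a) = k * (\<Sum>a=1..<n. g (Suc a) * (ln (real (Suc a)) - ln (real a)))
       + (r n * g n - (\<Sum>a=1..<n. r a * (g (Suc a) - g a)))" .
    have "\<bar>r n * g n\<bar> \<le> C * g n" unfolding abs_mult using C n g0 by (intro mult_mono) (auto simp: r_def)
    moreover have "\<bar>\<Sum>a=1..<n. r a * (g (Suc a) - g a)\<bar> \<le> (\<Sum>a=1..<n. C * (g (Suc a) - g a))"
    proof (rule order_trans[OF sum_abs sum_mono])
      fix a assume "a \<in> {1..<n}"
      thus "\<bar>r a * (g (Suc a) - g a)\<bar> \<le> C * (g (Suc a) - g a)"
        unfolding abs_mult using C gmono[of a] by (intro mult_mono) (auto simp: r_def)
    qed
    moreover have "(\<Sum>a=1..<n. C * (g (Suc a) - g a)) \<le> C * g n"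
      unfolding sum_distrib_left[symmetric] tel[OF n] using C g0 by (intro mult_left_mono) auto
    moreover have "\<bar>(\<Sum>a=1..<n. g (Suc a) * (ln (real (Suc a)) - ln (real a))) - ln (real n) ^ Suc b / real (Suc b)\<bar> \<le> g n"
    proof -
      have "(\<Sum>a=1..<n. g (Suc a) * (ln (real (Suc a)) - ln (real a))) - ln (real n) ^ Suc b / real (Suc b)
        = (\<Sum>a=1..<n. g (Suc a) * (ln (real (Suc a)) - ln (real a)) - (ln (real (Suc a)) ^ Suc b / real (Suc b) - ln (real a) ^ Suc b / real (Suc b)))"
        by (subst sum_subtractf, subst tel[OF n, of "\<lambda>a. ln (real a) ^ Suc b / real (Suc b)"]) simp
      also have "\<bar>\<dots>\<bar> \<le> (\<Sum>a=1..<n. g (Suc a) - g a)"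
      proof (rule order_trans[OF sum_abs sum_mono])
        fix a assume a: "a \<in> {1..<n}"
        define x where "x = ln (real a)"
        define y where "y = ln (real (Suc a))"
        have xy: "0 \<le> x" "x \<le> y" using a by (auto simp: x_def y_def)
        have "ln (real (Suc a) / real a) \<le> real (Suc a) / real a - 1" using a by (intro ln_le_minus_one) auto
        also have "\<dots> \<le> 1" using a by (simp add: field_simps)
        finally have d1: "y - x \<le> 1" using a by (simp add: ln_div x_def y_def)
        have gg: "g (Suc a) = y ^ b" "g a = x ^ b" by (simp_all add: g_def x_def y_def)
        have "(y ^ Suc b - x ^ Suc b) / real (Suc b) \<le> y ^ b * (y - x)"
          using power_diff_bounds(1)[OF xy, of b] by (simp add: divide_le_eq mult.commute)
        moreover have "x ^ b * (y - x) \<le> (y ^ Suc b - x ^ Suc b) / real (Suc b)"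
          using power_diff_bounds(2)[OF xy, of b] by (simp add: le_divide_eq mult.commute)
        moreover have "(y ^ b - x ^ b) * (y - x) \<le> (y ^ b - x ^ b) * 1"
          using xy d1 by (intro mult_left_mono) (auto simp: power_mono)
        ultimately have "\<bar>y ^ b * (y - x) - (y ^ Suc b / real (Suc b) - x ^ Suc b / real (Suc b))\<bar> \<le> y ^ b - x ^ b"
          by (simp add: diff_divide_distrib algebra_simps del: power_Suc)
        thus "\<bar>g (Suc a) * (ln (real (Suc a)) - ln (real a)) - (ln (real (Suc a)) ^ Suc b / real (Suc b) - ln (real a) ^ Suc b / real (Suc b))\<bar>
          \<le> g (Suc a) - g a" unfolding gg x_def[symmetric] y_def[symmetric] .
      qed
      also have "\<dots> \<le> g n" unfolding tel[OF n] using g0 by simp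
      finally show ?thesis .
    qed
    hence "\<bar>k\<bar> * \<bar>(\<Sum>a=1..<n. g (Suc a) * (ln (real (Suc a)) - ln (real a))) - ln (real n) ^ Suc b / real (Suc b)\<bar> \<le> 1 * g n"
      using k by (intro mult_mono) auto
    hence "\<bar>k * (\<Sum>a=1..<n. g (Suc a) * (ln (real (Suc a)) - ln (real a))) - k / real (Suc b) * ln (real n) ^ Suc b\<bar> \<le> g n"
      unfolding abs_mult[symmetric] by (simp add: algebra_simps)
    ultimately show ?thesis unfolding eq by (simp add: algebra_simps)
  qed
  show ?thesis
    by (rule exI[of _ "2 * C + 1"]) (use main C sw in \<open>auto simp: k_def g_def\<close>)
qed


lemma sum_Cop_ln_power:
  assumes "Q \<ge> 1"
  shows "ln_asym (\<lambda>x. \<Sum>a\<in>Cop_le Q x. 1 / real a * ln (real a) ^ b) (real (totient Q) / real Q / real (Suc b)) (Suc b)"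
proof -
  define k where "k = real (totient Q) / real Q / real (Suc b)"
  have k: "k \<ge> 0" by (simp add: k_def)
  obtain C where C: "C \<ge> 0" "\<And>n. n \<ge> 1 \<Longrightarrow> \<bar>(\<Sum>a\<in>Cop_le Q (real n). 1 / real a * ln (real a) ^ b) - k * ln (real n) ^ Suc b\<bar>
     \<le> C * ln (real n) ^ b" using sum_Cop_ln_power_nat[OF assms, of b] by (auto simp: k_def)
  have main: "\<bar>(\<Sum>a\<in>Cop_le Q x. 1 / real a * ln (real a) ^ b) - k * ln x ^ Suc b\<bar> \<le> (C + k * real (Suc b)) * real (Suc b) * (1 + ln x) ^ (Suc b - 1)"
    if x: "x \<ge> 1" for x
  proof -
    define n where "n = nat \<lfloor>x\<rfloor>"
    have n: "n \<ge> 1" "real n \<le> x" "x < real n + 1" using x by (auto simp: n_def le_nat_iff le_floor_iff)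
    have l: "0 \<le> ln (real n)" "ln (real n) \<le> ln x" using n by auto
    have "ln (x / real n) \<le> x / real n - 1" using n by (intro ln_le_minus_one) auto
    also have "\<dots> \<le> 1" using n by (simp add: field_simps)
    finally have d: "ln x - ln (real n) \<le> 1" using n x by (simp add: ln_div)
    have "ln x ^ Suc b - ln (real n) ^ Suc b \<le> real (Suc b) * (ln x ^ b * (ln x - ln (real n)))"
      by (rule power_diff_bounds(1)[OF l])
    also have "\<dots> \<le> real (Suc b) * (ln x ^ b * 1)" using d l by (intro mult_left_mono) auto
    finally have "k * (ln x ^ Suc b - ln (real n) ^ Suc b) \<le> k * (real (Suc b) * ln x ^ b)" using k by (intro mult_left_mono) auto
    moreover have "k * (ln x ^ Suc b - ln (real n) ^ Suc b) \<ge> 0" using k l by (intro mult_nonneg_nonneg) (auto intro: power_mono simp del: power_Suc)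
    moreover have "C * ln (real n) ^ b \<le> C * ln x ^ b" using C l by (intro mult_left_mono power_mono) auto
    moreover have "\<bar>(\<Sum>a\<in>Cop_le Q x. 1 / real a * ln (real a) ^ b) - k * ln (real n) ^ Suc b\<bar> \<le> C * ln (real n) ^ b"
      using C(2)[OF n(1)] unfolding Cop_le_nat[of Q x] n_def .
    ultimately have "\<bar>(\<Sum>a\<in>Cop_le Q x. 1 / real a * ln (real a) ^ b) - k * ln x ^ Suc b\<bar> \<le> (C + k * real (Suc b)) * ln x ^ b"
      by (simp add: algebra_simps abs_le_iff)
    also have "\<dots> \<le> (C + k * real (Suc b)) * real (Suc b) * (1 + ln x) ^ (Suc b - 1)"
    proof -
      have "(C + k * real (Suc b)) * 1 * ln x ^ b \<le> (C + k * real (Suc b)) * real (Suc b) * (1 + ln x) ^ (Suc b - 1)"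
        using C k l by (intro mult_mono mult_left_mono) (auto intro!: power_mono mult_nonneg_nonneg add_nonneg_nonneg)
      thus ?thesis by simp
    qed
    finally show ?thesis .
  qed
  show ?thesis unfolding ln_asym_def k_def[symmetric]
    by (rule exI[of _ "C + k * real (Suc b)"]) (use main C k in auto)
qed

lemma ln_asym_times_ln:
  assumes "ln_asym f K m"
  shows "ln_asym (\<lambda>x. ln x * f x) K (Suc m)"
proof -
  obtain C where C: "C \<ge> 0" "\<And>y. y \<ge> 1 \<Longrightarrow> \<bar>f y - K * ln y ^ m\<bar> \<le> C * real m * (1 + ln y) ^ (m - 1)"
    using assms by (auto simp: ln_asym_def)
  have "\<bar>ln y * f y - K * ln y ^ Suc m\<bar> \<le> C * real (Suc m) * (1 + ln y) ^ (Suc m - 1)" if y: "y \<ge> 1" for y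
  proof -
    have ly: "ln y \<ge> 0" using y by simp
    have "ln y * f y - K * ln y ^ Suc m = ln y * (f y - K * ln y ^ m)" by (simp add: algebra_simps)
    also have "\<bar>\<dots>\<bar> \<le> (1 + ln y) * (C * real m * (1 + ln y) ^ (m - 1))"
      unfolding abs_mult using C(2)[OF y] ly by (intro mult_mono) auto
    \<comment> \<open>For m = 0 both sides vanish through the factor \<open>real m\<close>, so the
      truncated exponent m - 1 is harmless.\<close>
    also have "\<dots> = C * (real m * (1 + ln y) ^ m)" by (cases m) auto
    also have "\<dots> \<le> C * (real (Suc m) * (1 + ln y) ^ m)"
      using C ly by (intro mult_left_mono mult_right_mono) auto
    finally show ?thesis by simp
  qed
  thus ?thesis unfolding ln_asym_def using C by blast
qed

lemma ln_asym_diff: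
  assumes "ln_asym f K m" "ln_asym g K' m"
  shows "ln_asym (\<lambda>x. f x - g x) (K - K') m"
proof -
  obtain C where C: "C \<ge> 0" "\<And>y. y \<ge> 1 \<Longrightarrow> \<bar>f y - K * ln y ^ m\<bar> \<le> C * real m * (1 + ln y) ^ (m - 1)"
    using assms by (auto simp: ln_asym_def)
  obtain C' where C': "C' \<ge> 0" "\<And>y. y \<ge> 1 \<Longrightarrow> \<bar>g y - K' * ln y ^ m\<bar> \<le> C' * real m * (1 + ln y) ^ (m - 1)"
    using assms by (auto simp: ln_asym_def)
  have "\<bar>(f y - g y) - (K - K') * ln y ^ m\<bar> \<le> (C + C') * real m * (1 + ln y) ^ (m - 1)" if y: "y \<ge> 1" for y
    using C(2)[OF y] C'(2)[OF y] by (simp add: algebra_simps)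
  thus ?thesis unfolding ln_asym_def using C C' by (intro exI[of _ "C + C'"]) auto
qed

lemma ln_asym_cong:
  assumes "\<And>x. x \<ge> 1 \<Longrightarrow> f x = g x" "K = K'"
  shows "ln_asym f K m = ln_asym g K' m"
  using assms by (auto simp: ln_asym_def)

text \<open>Induction on m through ln(x/a) = ln x - ln a. On the constants this is the recursion
  B(b, m+1) = B(b, m) - B(b+1, m) for the integral of t^b (1 - t)^m over [0, 1].\<close>

lemma sum_Cop_beta:
  assumes "Q \<ge> 1"
  shows "ln_asym (\<lambda>x. \<Sum>a\<in>Cop_le Q x. 1 / real a * ln (real a) ^ b * ln (x / real a) ^ m)
     (real (totient Q) / real Q * fact b * fact m / fact (Suc (b + m))) (Suc (b + m))"
proof (induction m arbitrary: b)
  case 0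
  have "x * fact b * fact 0 / fact (Suc (b + 0)) = x / real (Suc b)" for x :: real
    unfolding fact_Suc by simp
  thus ?case using sum_Cop_ln_power[OF assms, of b] by simp
next
  case (Suc m)
  have "ln_asym (\<lambda>x. ln x * (\<Sum>a\<in>Cop_le Q x. 1 / real a * ln (real a) ^ b * ln (x / real a) ^ m)
        - (\<Sum>a\<in>Cop_le Q x. 1 / real a * ln (real a) ^ Suc b * ln (x / real a) ^ m))
     (real (totient Q) / real Q * fact b * fact m / fact (Suc (b + m)) - real (totient Q) / real Q * fact (Suc b) * fact m / fact (Suc (Suc b + m))) (Suc (Suc (b + m)))"
    using Suc[of b] Suc[of "Suc b"] by (intro ln_asym_diff ln_asym_times_ln) simp_all
  also have "?this \<longleftrightarrow> ?case"
    unfolding add_Suc_right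
  proof (rule ln_asym_cong)
    fix x :: real assume x: "x \<ge> 1"
    show "ln x * (\<Sum>a\<in>Cop_le Q x. 1 / real a * ln (real a) ^ b * ln (x / real a) ^ m)
        - (\<Sum>a\<in>Cop_le Q x. 1 / real a * ln (real a) ^ Suc b * ln (x / real a) ^ m)
      = (\<Sum>a\<in>Cop_le Q x. 1 / real a * ln (real a) ^ b * ln (x / real a) ^ Suc m)"
      unfolding sum_distrib_left sum_subtractf[symmetric]
    proof (intro sum.cong refl)
      fix a assume "a \<in> Cop_le Q x"
      hence eq: "ln (x / real a) = ln x - ln (real a)" using x by (auto simp: Cop_le_def Cop_def ln_div)
      show "ln x * (1 / real a * ln (real a) ^ b * ln (x / real a) ^ m) - 1 / real a * ln (real a) ^ Suc b * ln (x / real a) ^ m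
         = 1 / real a * ln (real a) ^ b * ln (x / real a) ^ Suc m" unfolding eq by (simp add: algebra_simps)
    qed
  next
    define k where "k = real (totient Q) / real Q"
    have f: "fact (Suc (Suc (b+m))) = (real b + real m + 2) * fact (Suc (b + m))" "fact (Suc b) = (real b + 1) * fact b" "fact (Suc m) = (real m + 1) * fact m"
      by (simp_all add: algebra_simps)
    have nz: "real b + real m + 2 \<noteq> 0" "fact (Suc (b + m)) \<noteq> (0::real)" by auto
    show "real (totient Q) / real Q * fact b * fact m / fact (Suc (b + m)) - real (totient Q) / real Q * fact (Suc b) * fact m / fact (Suc (Suc b + m))
       = real (totient Q) / real Q * fact b * fact (Suc m) / fact (Suc (Suc (b + m)))"
      unfolding k_def[symmetric] add_Suc f using nz by (simp add: divide_simps del: fact_Suc) (simp add: algebra_simps)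
  qed
  finally show ?case .
qed

text \<open>Replacing \<open>f\<close> by its leading term costs one power of the logarithm, and the
  sum of 1/a gives back one, so the error keeps one power less than the main term. For m = 0 this
  argument would fail with a bounded error, which the summation would raise to the order of the main
  term; hence the exactness demanded by \<open>ln_asym\<close> in that case.\<close>

lemma sum_Cop_convolution:
  assumes Q: "Q \<ge> 1" and f: "ln_asym f K m"
  shows "ln_asym (\<lambda>x. \<Sum>a\<in>Cop_le Q x. 1 / real a * ln (real a) ^ b * f (x / real a))
     (K * (real (totient Q) / real Q * fact b * fact m / fact (Suc (b + m)))) (Suc (b + m))"
proof -
  define B where "B = real (totient Q) / real Q * fact b * fact m / fact (Suc (b + m))"
  obtain C where C: "C \<ge> 0" "\<And>y. y \<ge> 1 \<Longrightarrow> \<bar>f y - K * ln y ^ m\<bar> \<le> C * real m * (1 + ln y) ^ (m - 1)"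
    using f by (auto simp: ln_asym_def)
  obtain C1 where C1: "C1 \<ge> 0" "\<And>y. y \<ge> 1 \<Longrightarrow> \<bar>(\<Sum>a\<in>Cop_le Q y. 1 / real a * ln (real a) ^ b * ln (y / real a) ^ m) - B * ln y ^ Suc (b + m)\<bar>
        \<le> C1 * real (Suc (b + m)) * (1 + ln y) ^ (Suc (b + m) - 1)"
    using sum_Cop_beta[OF Q, of b m] unfolding B_def ln_asym_def by blast
  obtain C2 where C2: "C2 \<ge> 0" "\<And>y. y \<ge> 1 \<Longrightarrow> (\<Sum>a\<in>Cop_le Q y. 1 / real a) \<le> C2 * (1 + ln y)"
  proof -
    define k where "k = real (totient Q) / real Q"
    have k: "k \<ge> 0" by (simp add: k_def)
    obtain c where c: "c \<ge> 0" "\<And>y. y \<ge> 1 \<Longrightarrow> \<bar>(\<Sum>a\<in>Cop_le Q y. 1 / real a) - k * ln y\<bar> \<le> c"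
      using sum_Cop_ln_power[OF Q, of 0] by (auto simp: ln_asym_def k_def)
    have "(\<Sum>a\<in>Cop_le Q y. 1 / real a) \<le> (c + k) * (1 + ln y)" if "y \<ge> 1" for y
    proof -
      have "0 \<le> c * ln y" using c that by auto
      thus ?thesis using c(2)[OF that] k by (simp add: algebra_simps abs_le_iff)
    qed
    thus ?thesis using c k that[of "c + k"] by auto
  qed
  have main: "\<bar>(\<Sum>a\<in>Cop_le Q x. 1 / real a * ln (real a) ^ b * f (x / real a)) - K * B * ln x ^ Suc (b + m)\<bar>
     \<le> (\<bar>K\<bar> * C1 + C * C2) * real (Suc (b + m)) * (1 + ln x) ^ (Suc (b + m) - 1)" if x: "x \<ge> 1" for x
  proof -
    have lx: "ln x \<ge> 0" using x by simp
    have "(\<Sum>a\<in>Cop_le Q x. 1 / real a * ln (real a) ^ b * f (x / real a)) - K * B * ln x ^ Suc (b + m)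
       = K * ((\<Sum>a\<in>Cop_le Q x. 1 / real a * ln (real a) ^ b * ln (x / real a) ^ m) - B * ln x ^ Suc (b + m))
       + (\<Sum>a\<in>Cop_le Q x. 1 / real a * ln (real a) ^ b * (f (x / real a) - K * ln (x / real a) ^ m))"
      by (simp add: algebra_simps sum_distrib_left sum_subtractf)
    also have "\<bar>\<dots>\<bar> \<le> \<bar>K\<bar> * (C1 * real (Suc (b + m)) * (1 + ln x) ^ (Suc (b + m) - 1)) + C * real m * C2 * (1 + ln x) ^ (b + m)"
    proof (rule order_trans[OF abs_triangle_ineq add_mono])
      show "\<bar>K * ((\<Sum>a\<in>Cop_le Q x. 1 / real a * ln (real a) ^ b * ln (x / real a) ^ m) - B * ln x ^ Suc (b + m))\<bar>
        \<le> \<bar>K\<bar> * (C1 * real (Suc (b + m)) * (1 + ln x) ^ (Suc (b + m) - 1))"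
        unfolding abs_mult using C1(2)[OF x] by (intro mult_left_mono) auto
      have "\<bar>\<Sum>a\<in>Cop_le Q x. 1 / real a * ln (real a) ^ b * (f (x / real a) - K * ln (x / real a) ^ m)\<bar>
         \<le> (\<Sum>a\<in>Cop_le Q x. 1 / real a * ((1 + ln x) ^ b * (C * real m * (1 + ln x) ^ (m - 1))))"
      proof (rule order_trans[OF sum_abs sum_mono])
        fix a assume a: "a \<in> Cop_le Q x"
        hence a': "a \<ge> 1" "real a \<le> x" by (auto simp: Cop_le_def Cop_def)
        hence xa: "x / real a \<ge> 1" "x / real a \<le> x" using x by (auto simp: field_simps)
        have "ln (x / real a) \<le> ln x" using xa by (intro ln_mono) auto
        hence "C * real m * (1 + ln (x / real a)) ^ (m - 1) \<le> C * real m * (1 + ln x) ^ (m - 1)"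
          using C xa by (intro mult_left_mono power_mono) auto
        hence "\<bar>f (x / real a) - K * ln (x / real a) ^ m\<bar> \<le> C * real m * (1 + ln x) ^ (m - 1)"
          using C(2)[OF xa(1)] by linarith
        moreover have "ln (real a) ^ b \<le> (1 + ln x) ^ b"
        proof (rule power_mono)
          have "ln (real a) \<le> ln x" using a' by auto
          thus "ln (real a) \<le> 1 + ln x" by simp
        qed (use a' in auto)
        ultimately show "\<bar>1 / real a * ln (real a) ^ b * (f (x / real a) - K * ln (x / real a) ^ m)\<bar>
          \<le> 1 / real a * ((1 + ln x) ^ b * (C * real m * (1 + ln x) ^ (m - 1)))"
          unfolding abs_mult mult.assoc using a' lx C by (intro mult_mono) auto
      qed
      also have "\<dots> = (\<Sum>a\<in>Cop_le Q x. 1 / real a) * ((1 + ln x) ^ b * (C * real m * (1 + ln x) ^ (m - 1)))"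
        by (simp only: sum_distrib_right)
      also have "\<dots> \<le> C2 * (1 + ln x) * ((1 + ln x) ^ b * (C * real m * (1 + ln x) ^ (m - 1)))"
        using C2(2)[OF x] C lx by (intro mult_right_mono) auto
      also have "\<dots> = C * real m * C2 * (1 + ln x) ^ (b + m)"
        by (cases m) (auto simp: power_add algebra_simps)
      finally show "\<bar>\<Sum>a\<in>Cop_le Q x. 1 / real a * ln (real a) ^ b * (f (x / real a) - K * ln (x / real a) ^ m)\<bar>
        \<le> C * real m * C2 * (1 + ln x) ^ (b + m)" .
    qed
    also have "C * real m * C2 * (1 + ln x) ^ (b + m) \<le> C * real (Suc (b + m)) * C2 * (1 + ln x) ^ (b + m)"
      using C C2 lx by (intro mult_right_mono mult_left_mono) auto
    finally show ?thesis by (simp add: algebra_simps)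
  qed
  show ?thesis unfolding ln_asym_def B_def[symmetric]
    by (rule exI[of _ "\<bar>K\<bar> * C1 + C * C2"]) (use main C C1 C2 in auto)
qed

section \<open>Logarithmic sums in several variables\<close>

lemma finite_tuples:
  assumes "finite I"
  shows "finite (tuples Q I x)"
proof (rule finite_subset)
  show "tuples Q I x \<subseteq> PiE I (\<lambda>_. Cop_le Q x)"
  proof
    fix u assume u: "u \<in> tuples Q I x"
    have "u i \<le> (\<Prod>i\<in>I. u i)" if "i \<in> I" for i
    proof (rule dvd_imp_le)
      show "u i dvd (\<Prod>i\<in>I. u i)" using assms that by (rule dvd_prodI)
      show "(\<Prod>i\<in>I. u i) > 0" using u by (auto simp: tuples_def Cop_def PiE_iff Suc_le_eq intro!: prod_pos)
    qed
    thus "u \<in> PiE I (\<lambda>_. Cop_le Q x)"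
      using u of_nat_mono[where 'a = real] unfolding tuples_def Cop_le_def PiE_iff mem_Collect_eq
      by (metis order_trans)
  qed
qed (use assms in \<open>auto intro!: finite_PiE\<close>)

lemma tuples_empty: "x \<ge> 1 \<Longrightarrow> tuples Q {} x = {\<lambda>_. undefined}"
  by (auto simp: tuples_def)

lemma sum_tuples_insert:
  assumes I: "finite I" "i \<notin> I"
  shows "(\<Sum>u\<in>tuples Q (insert i I) x. h u) = (\<Sum>a\<in>Cop_le Q x. \<Sum>u\<in>tuples Q I (x / real a). h (u(i := a)))"
proof -
  have "(\<Sum>a\<in>Cop_le Q x. \<Sum>u\<in>tuples Q I (x / real a). h (u(i := a)))
      = (\<Sum>(a,u)\<in>Sigma (Cop_le Q x) (\<lambda>a. tuples Q I (x / real a)). h (u(i := a)))"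
    by (rule sum.Sigma) (use I in \<open>auto simp: finite_tuples\<close>)
  also have "\<dots> = (\<Sum>u\<in>tuples Q (insert i I) x. h u)"
  proof (rule sum.reindex_bij_witness[of _ "\<lambda>u. (u i, restrict u I)" "\<lambda>(a,u). u(i := a)"])
    fix v assume v: "v \<in> Sigma (Cop_le Q x) (\<lambda>a. tuples Q I (x / real a))"
    obtain a u where au: "v = (a, u)" by force
    have a: "a \<in> Cop Q" "a \<ge> 1" "real a \<le> x" and u: "u \<in> PiE I (\<lambda>_. Cop Q)" "real (\<Prod>j\<in>I. u j) \<le> x / real a"
      using v au by (auto simp: Cop_le_def Cop_def tuples_def)
    have pr: "(\<Prod>j\<in>insert i I. (u(i := a)) j) = a * (\<Prod>j\<in>I. u j)"
    proof -
      have "(\<Prod>j\<in>I. (u(i := a)) j) = (\<Prod>j\<in>I. u j)" using I by (intro prod.cong) auto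
      thus ?thesis using I by simp
    qed
    show "(case v of (a, u) \<Rightarrow> u(i := a)) \<in> tuples Q (insert i I) x"
      unfolding tuples_def au mem_Collect_eq prod.case pr using a u
      by (auto simp: field_simps PiE_iff extensional_def)
    show "(\<lambda>u. (u i, restrict u I)) (case v of (a, u) \<Rightarrow> u(i := a)) = v"
      unfolding au using u I by (auto simp: PiE_iff extensional_def restrict_def fun_eq_iff)
    show "h (case v of (a, u) \<Rightarrow> u(i := a)) = (case v of (a, u) \<Rightarrow> h (u(i := a)))"
      by (simp add: au)
  next
    fix u assume u: "u \<in> tuples Q (insert i I) x"
    have ui: "u i \<in> Cop Q" "u i \<ge> 1" and uj: "\<And>j. j \<in> I \<Longrightarrow> u j \<in> Cop Q" "\<And>j. j \<in> I \<Longrightarrow> u j \<ge> 1"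
      using u by (auto simp: tuples_def PiE_iff Cop_def)
    have pr: "real (u i) * real (\<Prod>j\<in>I. u j) \<le> x" using u I by (auto simp: tuples_def)
    have "(\<Prod>j\<in>I. u j) > 0" using uj(2) by (intro prod_pos) (auto simp: Suc_le_eq)
    hence "real (\<Prod>j\<in>I. u j) \<ge> 1" by linarith
    hence "real (u i) * 1 \<le> real (u i) * real (\<Prod>j\<in>I. u j)" by (intro mult_left_mono) auto
    hence "real (u i) \<le> x" using pr by linarith
    moreover have "real (\<Prod>j\<in>I. u j) \<le> x / real (u i)" using pr ui by (simp add: field_simps)
    ultimately show "(u i, restrict u I) \<in> Sigma (Cop_le Q x) (\<lambda>a. tuples Q I (x / real a))"
      using ui uj by (auto simp: Cop_le_def tuples_def)
    show "(case (u i, restrict u I) of (a, u) \<Rightarrow> u(i := a)) = u"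
      using u by (auto simp: tuples_def PiE_iff extensional_def fun_eq_iff)
  qed
  finally show ?thesis by simp
qed

text \<open>Removing one variable contributes one Beta factor. The factorial of the previous total
  degree cancels each time, so the constant becomes Dirichlet's integral over the simplex, with
  \<open>e\<close> the power of the remaining room.\<close>

theorem dirichlet_sum_asym:
  assumes "finite I" "Q \<ge> 1"
  shows "ln_asym (\<lambda>x. \<Sum>u\<in>tuples Q I x. (\<Prod>i\<in>I. 1 / real (u i) * ln (real (u i)) ^ b i) * ln (x / real (\<Prod>i\<in>I. u i)) ^ e)
     ((real (totient Q) / real Q) ^ card I * (\<Prod>i\<in>I. fact (b i)) * fact e / fact (card I + (\<Sum>i\<in>I. b i) + e))
     (card I + (\<Sum>i\<in>I. b i) + e)"
  using assms(1)
proof (induction I)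
  case empty
  have "ln_asym (\<lambda>x. ln x ^ e) 1 e" by (auto simp: ln_asym_def)
  thus ?case by (subst ln_asym_cong[where g = "\<lambda>x. ln x ^ e" and K' = 1]) (auto simp: tuples_empty)
next
  case (insert i I)
  have s: "Suc (b i + (card I + (\<Sum>i\<in>I. b i) + e)) = card (insert i I) + (\<Sum>i\<in>insert i I. b i) + e"
    using insert by simp
  show ?case
    unfolding s[symmetric]
  proof (subst ln_asym_cong)
    show "ln_asym (\<lambda>x. \<Sum>a\<in>Cop_le Q x. 1 / real a * ln (real a) ^ b i *
         (\<Sum>u\<in>tuples Q I (x / real a). (\<Prod>i\<in>I. 1 / real (u i) * ln (real (u i)) ^ b i) * ln (x / real a / real (\<Prod>i\<in>I. u i)) ^ e))
         ((real (totient Q) / real Q) ^ card I * (\<Prod>i\<in>I. fact (b i)) * fact e / fact (card I + (\<Sum>i\<in>I. b i) + e)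
          * (real (totient Q) / real Q * fact (b i) * fact (card I + (\<Sum>i\<in>I. b i) + e) / fact (Suc (b i + (card I + (\<Sum>i\<in>I. b i) + e)))))
          (Suc (b i + (card I + (\<Sum>i\<in>I. b i) + e)))"
      by (rule sum_Cop_convolution[OF assms(2) insert.IH])
    fix x :: real assume "x \<ge> 1"
    show "(\<Sum>u\<in>tuples Q (insert i I) x. (\<Prod>i\<in>insert i I. 1 / real (u i) * ln (real (u i)) ^ b i) * ln (x / real (\<Prod>i\<in>insert i I. u i)) ^ e)
     = (\<Sum>a\<in>Cop_le Q x. 1 / real a * ln (real a) ^ b i *
         (\<Sum>u\<in>tuples Q I (x / real a). (\<Prod>i\<in>I. 1 / real (u i) * ln (real (u i)) ^ b i) * ln (x / real a / real (\<Prod>i\<in>I. u i)) ^ e))"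
      unfolding sum_tuples_insert[OF insert.hyps] sum_distrib_left
    proof (intro sum.cong refl)
      fix a u
      have 1: "(\<Prod>j\<in>I. 1 / real ((u(i := a)) j) * ln (real ((u(i := a)) j)) ^ b j) = (\<Prod>j\<in>I. 1 / real (u j) * ln (real (u j)) ^ b j)"
        using insert.hyps by (intro prod.cong) auto
      have 2: "(\<Prod>j\<in>I. (u(i := a)) j) = (\<Prod>j\<in>I. u j)" using insert.hyps by (intro prod.cong) auto
      show "(\<Prod>j\<in>insert i I. 1 / real ((u(i := a)) j) * ln (real ((u(i := a)) j)) ^ b j) * ln (x / real (\<Prod>j\<in>insert i I. (u(i := a)) j)) ^ e
        = 1 / real a * ln (real a) ^ b i * ((\<Prod>i\<in>I. 1 / real (u i) * ln (real (u i)) ^ b i) * ln (x / real a / real (\<Prod>i\<in>I. u i)) ^ e)"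
        unfolding prod.insert[OF insert.hyps] 1 2 by (simp add: divide_divide_eq_left)
    qed
  qed (use insert in auto)
qed

section \<open>The quadratic forms as sums over tuples\<close>

lemma sum_configs:
  fixes f :: "nat \<Rightarrow> real"
  assumes "finite P" "finite K" "0 \<notin> K"
  shows "(\<Sum>c\<in>PiE P (\<lambda>_. insert 0 K). \<Prod>p\<in>P. if c p = 0 then 1 else f p) = (\<Prod>p\<in>P. 1 + real (card K) * f p)"
proof -
  have "(\<Sum>c\<in>PiE P (\<lambda>_. insert 0 K). \<Prod>p\<in>P. if c p = 0 then 1 else f p)
      = (\<Prod>p\<in>P. \<Sum>b\<in>insert 0 K. if b = 0 then 1 else f p)"
    by (rule prod_sum_PiE[symmetric]) (use assms in auto)
  also have "\<dots> = (\<Prod>p\<in>P. 1 + real (card K) * f p)"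
  proof (intro prod.cong refl)
    fix p
    have "b \<noteq> 0" if "b \<in> K" for b using that assms(3) by metis
    hence "(\<Sum>b\<in>K. if b = 0 then 1 else f p) = (\<Sum>b\<in>K. f p)"
      by (intro sum.cong) simp_all
    thus "(\<Sum>b\<in>insert 0 K. if b = 0 then 1 else f p) = 1 + real (card K) * f p"
      using assms by simp
  qed
  finally show ?thesis .
qed

text \<open>Recovers Maynard's tuple of divisors from its colouring, so that sums over
  configurations can be compared with sums over \<open>tuples\<close>.\<close>

definition ucol :: "nat set \<Rightarrow> nat set \<Rightarrow> (nat \<Rightarrow> nat) \<Rightarrow> nat \<Rightarrow> nat" where
  "ucol P K c = (\<lambda>i\<in>K. \<Prod>p\<in>{p\<in>P. c p = i}. p)"

lemma prod_colours:
  fixes g :: "nat \<Rightarrow> 'a::comm_monoid_mult"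
  assumes "finite P" "finite K" "0 \<notin> K" "c \<in> PiE P (\<lambda>_. insert 0 K)"
  shows "(\<Prod>i\<in>K. \<Prod>p\<in>{p\<in>P. c p = i}. g p) = (\<Prod>p\<in>P. if c p = 0 then 1 else g p)"
proof -
  have "(\<Prod>i\<in>K. \<Prod>p\<in>{p\<in>{p\<in>P. c p \<noteq> 0}. c p = i}. g p) = (\<Prod>p\<in>{p\<in>P. c p \<noteq> 0}. g p)"
    by (rule prod.group) (use assms in \<open>auto simp: PiE_iff\<close>)
  moreover have "(\<Prod>i\<in>K. \<Prod>p\<in>{p\<in>{p\<in>P. c p \<noteq> 0}. c p = i}. g p) = (\<Prod>i\<in>K. \<Prod>p\<in>{p\<in>P. c p = i}. g p)"
  proof (intro prod.cong refl)
    fix i assume "i \<in> K"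
    hence "i \<noteq> 0" using assms(3) by metis
    thus "{p\<in>{p\<in>P. c p \<noteq> 0}. c p = i} = {p\<in>P. c p = i}" by auto
  qed
  moreover have "(\<Prod>p\<in>{p\<in>P. c p \<noteq> 0}. g p) = (\<Prod>p\<in>P. if c p = 0 then 1 else g p)"
    by (subst prod.inter_filter) (use assms in \<open>auto intro!: prod.cong\<close>)
  ultimately show ?thesis by simp
qed

lemma weight_eq_ucol:
  assumes "finite P" "finite K" "0 \<notin> K" "c \<in> PiE P (\<lambda>_. insert 0 K)"
  shows "(\<Prod>p\<in>P. if c p = 0 then 1 else 1 / real p) = (\<Prod>i\<in>K. 1 / real (ucol P K c i))"
  unfolding prod_colours[OF assms, symmetric]
  by (intro prod.cong refl) (simp add: ucol_def prod_dividef)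

lemma dvd_ucol_iff:
  assumes P: "finite P" "\<And>p. p \<in> P \<Longrightarrow> prime p" and "i \<in> K" "prime q"
  shows "q dvd ucol P K c i \<longleftrightarrow> q \<in> P \<and> c q = i"
proof -
  have "q dvd ucol P K c i \<longleftrightarrow> (\<exists>p\<in>{p\<in>P. c p = i}. q dvd p)"
    unfolding ucol_def using assms by (simp add: prime_dvd_prod_iff)
  also have "\<dots> \<longleftrightarrow> q \<in> P \<and> c q = i"
  proof -
    have "p = q" if "p \<in> P" "q dvd p" for p
      using primes_dvd_imp_eq[OF assms(4) P(2)[OF that(1)] that(2)] by simp
    thus ?thesis by auto
  qed
  finally show ?thesis .
qed

lemma inj_on_ucol:
  assumes P: "finite P" "\<And>p. p \<in> P \<Longrightarrow> prime p" and K: "0 \<notin> K"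
  shows "inj_on (ucol P K) (PiE P (\<lambda>_. insert 0 K))"
proof (rule inj_onI)
  fix c d assume cd: "c \<in> PiE P (\<lambda>_. insert 0 K)" "d \<in> PiE P (\<lambda>_. insert 0 K)" "ucol P K c = ucol P K d"
  show "c = d"
  proof (rule PiE_ext[OF cd(1,2)])
    fix p assume p: "p \<in> P"
    have "c p = i \<longleftrightarrow> d p = i" if "i \<in> K" for i
      using dvd_ucol_iff[OF P that P(2)[OF p], of c] dvd_ucol_iff[OF P that P(2)[OF p], of d] cd(3) p by auto
    moreover have "c p \<in> insert 0 K" "d p \<in> insert 0 K" using cd p by (auto simp: PiE_iff)
    ultimately show "c p = d p" by (metis insertE)
  qed
qed

lemma squarefree_eq_prod:
  fixes a :: nat
  assumes P: "finite P" "\<And>p. p \<in> P \<Longrightarrow> prime p" and a: "a \<ge> 1"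
    and sub: "\<And>p. prime p \<Longrightarrow> p dvd a \<Longrightarrow> p \<in> P" and sqf: "\<And>p. p \<in> P \<Longrightarrow> \<not> p\<^sup>2 dvd a"
  shows "(\<Prod>p\<in>{p\<in>P. p dvd a}. p) = a"
proof -
  have "{p\<in>P. p dvd a} = prime_factors a" using P a sub by (auto simp: in_prime_factors_iff)
  moreover have "(\<Prod>p\<in>prime_factors a. p) = (\<Prod>p\<in>prime_factors a. p ^ multiplicity p a)"
  proof (intro prod.cong refl)
    fix p assume p: "p \<in> prime_factors a"
    hence "prime p" "p dvd a" by (auto simp: in_prime_factors_iff)
    moreover have "multiplicity p a < 2"
      using sqf[OF sub[OF \<open>prime p\<close> \<open>p dvd a\<close>]] a by (metis multiplicity_dvd' not_le)
    moreover have "multiplicity p a > 0" using p by (simp add: prime_factors_multiplicity)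
    ultimately have "multiplicity p a = 1" by simp
    thus "p = p ^ multiplicity p a" by simp
  qed
  moreover have "\<dots> = a" using a by (subst prime_factorization_nat[symmetric]) auto
  ultimately show ?thesis by simp
qed

lemma one_plus_sum_le_prod:
  fixes t :: "'a \<Rightarrow> real"
  assumes "finite P" "\<And>p. p \<in> P \<Longrightarrow> t p \<ge> 0"
  shows "1 + (\<Sum>p\<in>P. t p) \<le> (\<Prod>p\<in>P. 1 + t p)"
  using assms
proof (induction P)
  case (insert p P)
  have "1 + (\<Sum>p\<in>insert p P. t p) \<le> (1 + t p) * (1 + (\<Sum>p\<in>P. t p))"
    using insert by (simp add: algebra_simps sum_nonneg)
  also have "\<dots> \<le> (1 + t p) * (\<Prod>p\<in>P. 1 + t p)" using insert by (intro mult_left_mono) auto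
  finally show ?case using insert by simp
qed auto

lemma sum_UNION_le:
  fixes w :: "'a \<Rightarrow> real"
  assumes "finite A" "\<And>a. finite (B a)" "\<And>x. w x \<ge> 0"
  shows "(\<Sum>x\<in>(\<Union>a\<in>A. B a). w x) \<le> (\<Sum>a\<in>A. \<Sum>x\<in>B a. w x)"
  using assms(1)
proof (induction A)
  case (insert a A)
  have "(\<Sum>x\<in>B a \<union> (\<Union>a\<in>A. B a). w x) + (\<Sum>x\<in>B a \<inter> (\<Union>a\<in>A. B a). w x)
     = (\<Sum>x\<in>B a. w x) + (\<Sum>x\<in>(\<Union>a\<in>A. B a). w x)"
    using insert assms by (intro sum.union_inter) auto
  moreover have "(\<Sum>x\<in>B a \<inter> (\<Union>a\<in>A. B a). w x) \<ge> 0" using assms by (intro sum_nonneg)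
  moreover have U: "(\<Union>a\<in>insert a A. B a) = B a \<union> (\<Union>a\<in>A. B a)" by auto
  moreover have "(\<Sum>a\<in>insert a A. \<Sum>x\<in>B a. w x) = (\<Sum>x\<in>B a. w x) + (\<Sum>a\<in>A. \<Sum>x\<in>B a. w x)"
    using insert by simp
  ultimately show ?case using insert.IH unfolding U by linarith
qed auto

lemma sum_inverse_squares_le:
  assumes "finite P" "\<And>p. p \<in> P \<Longrightarrow> p > D" "D \<ge> 1"
  shows "(\<Sum>p\<in>P. 1 / (real p)\<^sup>2) \<le> 1 / real D"
proof -
  have tel: "(\<Sum>p=Suc D..M. 1 / (real p)\<^sup>2) \<le> 1 / real D - 1 / real M" if "M \<ge> D" for M
    using that
  proof (induction M rule: dec_induct)
    case (step M)
    have "1 / (real (Suc M))\<^sup>2 \<le> 1 / (real M * real (Suc M))"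
      using step assms(3) by (intro divide_left_mono) (auto simp: power2_eq_square)
    also have "\<dots> = 1 / real M - 1 / real (Suc M)" using step assms(3) by (simp add: field_simps)
    finally show ?case using step by simp
  qed auto
  define M where "M = Max (insert D P)"
  have "P \<subseteq> {Suc D..M}" using assms by (auto simp: M_def Suc_le_eq)
  hence "(\<Sum>p\<in>P. 1 / (real p)\<^sup>2) \<le> (\<Sum>p=Suc D..M. 1 / (real p)\<^sup>2)" by (intro sum_mono2) auto
  also have "\<dots> \<le> 1 / real D - 1 / real M" by (intro tel) (use assms in \<open>auto simp: M_def\<close>)
  also have "\<dots> \<le> 1 / real D" by simp
  finally show ?thesis .
qed

text \<open>1 + t <= exp t gives exp(B/D), and exp x <= 1 + x + x^2 <= 1 + 2x on [0, 1]; the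
  assumption B <= D keeps x = B/D in this range.\<close>

lemma prod_inverse_squares_le:
  assumes "finite P" "\<And>p. p \<in> P \<Longrightarrow> p > D" "D \<ge> 1" "B \<ge> 0" "B \<le> real D"
  shows "(\<Prod>p\<in>P. 1 + B / (real p)\<^sup>2) \<le> 1 + 2 * B / real D"
proof -
  have "(\<Prod>p\<in>P. 1 + B / (real p)\<^sup>2) \<le> (\<Prod>p\<in>P. exp (B / (real p)\<^sup>2))"
    using assms(4) by (intro prod_mono) (auto intro: add_nonneg_nonneg exp_ge_add_one_self)
  also have "\<dots> = exp (B * (\<Sum>p\<in>P. 1 / (real p)\<^sup>2))" by (simp add: exp_sum[OF assms(1)] sum_distrib_left)
  also have "\<dots> \<le> exp (B * (1 / real D))"
    using mult_left_mono[OF sum_inverse_squares_le[OF assms(1-3)] assms(4)] by simp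
  also have "\<dots> \<le> 1 + 2 * (B / real D)"
  proof -
    define x where "x = B / real D"
    have x: "0 \<le> x" "x \<le> 1" using assms by (auto simp: x_def)
    have "exp x \<le> 1 + x + x\<^sup>2" by (rule exp_bound) (use x in auto)
    also have "x\<^sup>2 \<le> x" using x by (simp add: power2_eq_square mult_left_le)
    finally show ?thesis by (simp add: x_def)
  qed
  finally show ?thesis by simp
qed

text \<open>Until the main terms are evaluated the weight \<open>F\<close> enters only through its
  sign, its maximum and its support. The bound D >= 1000 serves the crude local inequalities and
  allows B = 1000 in \<open>prod_inverse_squares_le\<close>.\<close>

locale sieve =
  fixes Q D :: nat and R :: real and K :: "nat set" and F :: "(nat \<Rightarrow> nat) \<Rightarrow> real" and Fm :: real
  assumes Q1: "Q \<ge> 1" and dvd_Q: "\<And>p. prime p \<Longrightarrow> p dvd Q \<longleftrightarrow> p \<le> D" and D: "D \<ge> 1000"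
    and K: "finite K" "0 \<notin> K" "card K = 6"
    and F0: "\<And>u. u \<in> PiE K (\<lambda>_. Cop Q) \<Longrightarrow> 0 \<le> F u" and Fm: "\<And>u. u \<in> PiE K (\<lambda>_. Cop Q) \<Longrightarrow> F u \<le> Fm"
    and Fsupp: "\<And>u. u \<in> PiE K (\<lambda>_. Cop Q) \<Longrightarrow> real (\<Prod>i\<in>K. u i) > R \<Longrightarrow> F u = 0"
begin

definition P :: "nat set" where "P = {p. prime p \<and> p > D \<and> real p \<le> R}"
definition Pi1 :: real where "Pi1 = (\<Prod>p\<in>P. 1 + 1 / real p)"
definition A0 :: real where "A0 = (\<Sum>a\<in>Cop_le Q R. 1 / real a)"
text \<open>2 * 1000 / D: the relative change of an Euler product whose factors move by at most
  1000/p^2.\<close>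

definition eps :: real where "eps = 2000 / real D"
definition yF :: "(nat \<Rightarrow> nat) \<Rightarrow> real" where "yF c = F (ucol P K c)"

lemma finite_P: "finite P"
  by (rule finite_subset[OF _ finite_primes_le[of R]]) (auto simp: P_def)

lemma P_ge: "p \<in> P \<Longrightarrow> real p \<ge> 1000" "p \<in> P \<Longrightarrow> prime p" "p \<in> P \<Longrightarrow> p > D"
  using D by (auto simp: P_def)

lemma eps_pos: "eps > 0" using D by (simp add: eps_def)

lemma Fm0: "Fm \<ge> 0"
  using F0[of "\<lambda>i\<in>K. 1"] Fm[of "\<lambda>i\<in>K. 1"] by (auto simp: Cop_def)

lemma Pi1_ge1: "Pi1 \<ge> 1" unfolding Pi1_def by (intro prod_ge_1) auto

lemma A0_ge: "A0 \<ge> 0" unfolding A0_def by (intro sum_nonneg) auto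

lemma prod_eps: "P' \<subseteq> P \<Longrightarrow> (\<And>p. p \<in> P' \<Longrightarrow> 0 \<le> t p \<and> t p \<le> 1000 / (real p)\<^sup>2) \<Longrightarrow> (\<Prod>p\<in>P'. 1 + t p) \<le> 1 + eps"
proof -
  assume P': "P' \<subseteq> P" and t: "\<And>p. p \<in> P' \<Longrightarrow> 0 \<le> t p \<and> t p \<le> 1000 / (real p)\<^sup>2"
  have "(\<Prod>p\<in>P'. 1 + t p) \<le> (\<Prod>p\<in>P'. 1 + 1000 / (real p)\<^sup>2)"
    using t by (intro prod_mono) (auto intro: add_nonneg_nonneg)
  also have "\<dots> \<le> 1 + 2 * 1000 / real D"
    using P' P_ge D finite_P by (intro prod_inverse_squares_le) (auto dest: finite_subset)
  finally show ?thesis by (simp add: eps_def)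
qed

lemma prod_perturb:
  assumes "P' \<subseteq> P" "\<And>p. p \<in> P' \<Longrightarrow> 0 \<le> g p" "\<And>p. p \<in> P' \<Longrightarrow> h p \<le> g p * (1 + 1000 / (real p)\<^sup>2)" "\<And>p. p \<in> P' \<Longrightarrow> 0 \<le> h p"
  shows "(\<Prod>p\<in>P'. h p) - (\<Prod>p\<in>P'. g p) \<le> (\<Prod>p\<in>P'. g p) * eps"
proof -
  have "(\<Prod>p\<in>P'. h p) \<le> (\<Prod>p\<in>P'. g p * (1 + 1000 / (real p)\<^sup>2))"
    using assms by (intro prod_mono) auto
  also have "\<dots> = (\<Prod>p\<in>P'. g p) * (\<Prod>p\<in>P'. 1 + 1000 / (real p)\<^sup>2)" by (simp add: prod.distrib)
  also have "\<dots> \<le> (\<Prod>p\<in>P'. g p) * (1 + eps)"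
    using assms by (intro mult_left_mono prod_eps prod_nonneg) auto
  finally show ?thesis by (simp add: algebra_simps)
qed

lemma prod_one_plus_le_Pi1: "(\<Prod>p\<in>P. 1 + real n / real p) \<le> Pi1 ^ n"
  unfolding Pi1_def prod_power_distrib
proof (intro prod_mono conjI)
  fix p assume "p \<in> P"
  show "1 + real n / real p \<le> (1 + 1 / real p) ^ n"
  proof -
    have "-1 \<le> 1 / real p" by (rule order_trans[of _ 0]) auto
    from Bernoulli_inequality[OF this, of n] show ?thesis by simp
  qed
qed auto

text \<open>Sums of product weights over configurations are Euler products, so the excess is a
  difference of two of them. A relative change 100/p of the weight 1/p moves an Euler factor by at
  most 600/p^2, within the 1000/p^2 allowed by \<open>prod_perturb\<close>.\<close>

lemma sum_excess_weights:
  assumes I: "finite I" "0 \<notin> I" "card I \<le> 6" and f: "\<And>p. p \<in> P \<Longrightarrow> f p \<ge> 0" "\<And>p. p \<in> P \<Longrightarrow> f p \<le> 1 / real p * (1 + 100 / real p)"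
  shows "(\<Sum>c\<in>PiE P (\<lambda>_. insert 0 I). (\<Prod>p\<in>P. if c p = 0 then 1 else f p) - (\<Prod>p\<in>P. if c p = 0 then 1 else 1 / real p))
     \<le> Pi1 ^ card I * eps"
proof -
  have "(\<Sum>c\<in>PiE P (\<lambda>_. insert 0 I). (\<Prod>p\<in>P. if c p = 0 then 1 else f p) - (\<Prod>p\<in>P. if c p = 0 then 1 else 1 / real p))
     = (\<Prod>p\<in>P. 1 + real (card I) * f p) - (\<Prod>p\<in>P. 1 + real (card I) * (1 / real p))"
    by (simp only: sum_subtractf sum_configs[OF finite_P I(1,2)])
  also have "\<dots> \<le> (\<Prod>p\<in>P. 1 + real (card I) * (1 / real p)) * eps"
  proof (intro prod_perturb)
    fix p assume p: "p \<in> P"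
    have pp: "real p > 0" using P_ge(1)[OF p] by linarith
    have "1 + real (card I) * f p \<le> 1 + real (card I) * (1 / real p * (1 + 100 / real p))"
      using f[OF p] by (intro add_left_mono mult_left_mono) auto
    also have "\<dots> = 1 + real (card I) * (1 / real p) + real (card I) * 100 / (real p)\<^sup>2"
      using pp by (simp add: field_simps power2_eq_square)
    also have "\<dots> \<le> 1 + real (card I) * (1 / real p) + 1000 / (real p)\<^sup>2"
      using I(3) by (intro add_left_mono divide_right_mono) auto
    also have "\<dots> \<le> (1 + real (card I) * (1 / real p)) * (1 + 1000 / (real p)\<^sup>2)"
    proof -
      have "1 + a + t \<le> (1 + a) * (1 + t)" if "0 \<le> a * t" for a t :: real
        using that by (simp add: algebra_simps)
      thus ?thesis by simp
    qed
    finally show "1 + real (card I) * f p \<le> (1 + real (card I) * (1 / real p)) * (1 + 1000 / (real p)\<^sup>2)" .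
  qed (use f in auto)
  also have "\<dots> \<le> Pi1 ^ card I * eps"
    using prod_one_plus_le_Pi1[of "card I"] eps_pos by (intro mult_right_mono) auto
  finally show ?thesis .
qed

text \<open>The link between \<open>Q\<close>, \<open>D\<close> and \<open>P\<close>: up to R, an
  integer coprime to Q is built from sieving primes only.\<close>

lemma prime_dvd_Cop:
  assumes "a \<in> Cop Q" "real a \<le> R" "prime p" "p dvd a"
  shows "p \<in> P"
proof -
  have "coprime a Q" using assms(1) by (simp add: Cop_def)
  hence "\<not> p dvd Q" using coprime_common_divisor[of a Q p] assms(3,4) not_prime_unit[of p] by blast
  moreover have "p \<le> a" using assms(1,4) by (intro dvd_imp_le) (auto simp: Cop_def)
  ultimately show ?thesis using assms dvd_Q[of p] by (auto simp: P_def)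
qed

lemma ucol_PiE: "I \<subseteq> K \<Longrightarrow> ucol P I c \<in> PiE I (\<lambda>_. Cop Q)"
proof -
  have "(\<Prod>p\<in>{p\<in>P. c p = i}. p) \<in> Cop Q" for i
  proof -
    have "coprime p Q" if "p \<in> P" for p
      using that dvd_Q[of p] by (intro prime_imp_coprime) (auto simp: P_def)
    hence "coprime (\<Prod>p\<in>{p\<in>P. c p = i}. p) Q" by (intro prod_coprime_left) auto
    moreover have "(\<Prod>p\<in>{p\<in>P. c p = i}. p) > 0" by (intro prod_pos) (auto simp: P_def prime_gt_0_nat)
    ultimately show ?thesis by (auto simp: Cop_def)
  qed
  thus ?thesis by (auto simp: ucol_def)
qed

text \<open>Configurations inject into tuples, and the passage to all tuples only adds nonnegative
  terms. The opposite inequality is not free; it is \<open>sum_tuples_le\<close>.\<close>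

lemma sum_ucol_le:
  assumes I: "I \<subseteq> K" and h: "\<And>u. u \<in> PiE I (\<lambda>_. Cop Q) \<Longrightarrow> h u \<ge> 0"
    and supp: "\<And>u. u \<in> PiE I (\<lambda>_. Cop Q) \<Longrightarrow> real (\<Prod>i\<in>I. u i) > R \<Longrightarrow> h u = (0::real)"
  shows "(\<Sum>c\<in>PiE P (\<lambda>_. insert 0 I). h (ucol P I c)) \<le> (\<Sum>u\<in>tuples Q I R. h u)"
proof -
  have finI: "finite I" "0 \<notin> I" using I K finite_subset by auto
  have finC: "finite (PiE P (\<lambda>_. insert 0 I))" using finite_P finI by (intro finite_PiE) auto
  have "(\<Sum>c\<in>PiE P (\<lambda>_. insert 0 I). h (ucol P I c)) = (\<Sum>u\<in>ucol P I ` PiE P (\<lambda>_. insert 0 I). h u)"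
    using inj_on_ucol[OF finite_P P_ge(2) finI(2)] by (subst sum.reindex) auto
  also have "\<dots> = (\<Sum>u\<in>ucol P I ` PiE P (\<lambda>_. insert 0 I) \<inter> tuples Q I R. h u)"
  proof (rule sum.mono_neutral_right)
    show "\<forall>u\<in>ucol P I ` PiE P (\<lambda>_. insert 0 I) - ucol P I ` PiE P (\<lambda>_. insert 0 I) \<inter> tuples Q I R. h u = 0"
    proof
      fix u assume u: "u \<in> ucol P I ` PiE P (\<lambda>_. insert 0 I) - ucol P I ` PiE P (\<lambda>_. insert 0 I) \<inter> tuples Q I R"
      hence "u \<in> PiE I (\<lambda>_. Cop Q)" using ucol_PiE[OF I] by auto
      thus "h u = 0" using u supp by (auto simp: tuples_def not_le)
    qed
  qed (use finC in auto)
  also have "\<dots> \<le> (\<Sum>u\<in>tuples Q I R. h u)"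
    using h by (intro sum_mono2 finite_tuples finI) (auto simp: tuples_def)
  finally show ?thesis .
qed

text \<open>With \<open>card K\<close> = 6 the local weight is (p + 4)/(p - 1)^2. Replacing it by
  1/p is charged to the crude bound \<open>Fm\<close>, which is affordable because the excess summed
  over all configurations is at most the fraction eps of Pi1^6.\<close>

theorem form1_upper:
  "(\<Sum>s\<in>PiE P (\<lambda>_. insert 0 K). \<Sum>t\<in>PiE P (\<lambda>_. insert 0 K). lam P K yF s * lam P K yF t * (\<Prod>p\<in>P. dens1 p (s p) (t p)))
   \<le> (\<Sum>u\<in>tuples Q K R. (\<Prod>i\<in>K. 1 / real (u i)) * (F u)\<^sup>2) + Fm\<^sup>2 * (Pi1 ^ 6 * eps)"
proof -
  let ?C = "PiE P (\<lambda>_. insert 0 K)"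
  define w where "w c = (\<Prod>p\<in>P. if c p = 0 then 1 else 1 / real p)" for c :: "nat \<Rightarrow> nat"
  define w' where "w' c = (\<Prod>p\<in>P. if c p = 0 then 1 else (real p + 4) / (real p - 1)\<^sup>2)" for c :: "nat \<Rightarrow> nat"
  have y: "0 \<le> yF c" "yF c \<le> Fm" for c
    unfolding yF_def using F0 Fm ucol_PiE[of K] by auto
  have loc: "1 / real p \<le> (real p + 4) / (real p - 1)\<^sup>2 \<and> (real p + 4) / (real p - 1)\<^sup>2 \<le> 1 / real p * (1 + 100 / real p)" if p: "p \<in> P" for p
  proof -
    define x where "x = real p - 1000"
    have x: "x \<ge> 0" "real p = x + 1000" using P_ge(1)[OF p] by (auto simp: x_def)
    have "(real p - 1)\<^sup>2 \<le> real p * (real p + 4)" "real p * real p * (real p + 4) \<le> (real p + 100) * (real p - 1)\<^sup>2"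
      unfolding x(2) using x(1) by (simp_all add: power2_eq_square algebra_simps)
    moreover have "real p > 0" "real p - 1 > 0" using x by auto
    ultimately show ?thesis by (simp add: divide_simps power2_eq_square) (simp add: algebra_simps)
  qed
  have le: "w c \<le> w' c" for c unfolding w_def w'_def using loc by (intro prod_mono) auto
  have "(\<Sum>s\<in>?C. \<Sum>t\<in>?C. lam P K yF s * lam P K yF t * (\<Prod>p\<in>P. dens1 p (s p) (t p)))
     \<le> (\<Sum>c\<in>?C. (yF c)\<^sup>2 * w' c)"
  proof -
    have e: "real p + real (card K) - 2 = real p + 4" for p :: nat by (simp add: K(3))
    have "p > 1" if "p \<in> P" for p using prime_gt_1_nat[OF P_ge(2)[OF that]] .
    from form1_le[OF K(1,2) finite_P this, of yF] show ?thesis unfolding e w'_def .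
  qed
  also have "\<dots> \<le> (\<Sum>c\<in>?C. (yF c)\<^sup>2 * w c + Fm\<^sup>2 * (w' c - w c))"
  proof (intro sum_mono)
    fix c
    have "(yF c)\<^sup>2 * (w' c - w c) \<le> Fm\<^sup>2 * (w' c - w c)"
      using y le by (intro mult_right_mono power_mono) auto
    thus "(yF c)\<^sup>2 * w' c \<le> (yF c)\<^sup>2 * w c + Fm\<^sup>2 * (w' c - w c)" by (simp add: algebra_simps)
  qed
  also have "\<dots> = (\<Sum>c\<in>?C. (yF c)\<^sup>2 * w c) + Fm\<^sup>2 * (\<Sum>c\<in>?C. w' c - w c)"
    by (simp add: sum.distrib sum_distrib_left)
  also have "\<dots> \<le> (\<Sum>u\<in>tuples Q K R. (\<Prod>i\<in>K. 1 / real (u i)) * (F u)\<^sup>2) + Fm\<^sup>2 * (Pi1 ^ 6 * eps)"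
  proof (intro add_mono mult_left_mono)
    have "(\<Sum>c\<in>?C. (yF c)\<^sup>2 * w c) = (\<Sum>c\<in>?C. (\<Prod>i\<in>K. 1 / real (ucol P K c i)) * (F (ucol P K c))\<^sup>2)"
      using weight_eq_ucol[OF finite_P K(1,2)] by (intro sum.cong refl) (simp add: w_def yF_def)
    also have "\<dots> \<le> (\<Sum>u\<in>tuples Q K R. (\<Prod>i\<in>K. 1 / real (u i)) * (F u)\<^sup>2)"
      using Fsupp by (intro sum_ucol_le) (auto intro!: mult_nonneg_nonneg prod_nonneg)
    finally show "(\<Sum>c\<in>?C. (yF c)\<^sup>2 * w c) \<le> (\<Sum>u\<in>tuples Q K R. (\<Prod>i\<in>K. 1 / real (u i)) * (F u)\<^sup>2)" .
    show "(\<Sum>c\<in>?C. w' c - w c) \<le> Pi1 ^ 6 * eps"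
      unfolding w_def w'_def using sum_excess_weights[OF K(1,2), of "\<lambda>p. (real p + 4) / (real p - 1)\<^sup>2"] loc
      by (simp add: K(3))
  qed auto
  finally show ?thesis .
qed


definition Yo :: "nat \<Rightarrow> (nat \<Rightarrow> nat) \<Rightarrow> real" where
  "Yo m u = (\<Sum>a\<in>Cop_le Q R. 1 / real a * F (u(m := a)))"

lemma upd_PiE: "m \<in> K \<Longrightarrow> u \<in> PiE (K - {m}) (\<lambda>_. Cop Q) \<Longrightarrow> a \<in> Cop Q \<Longrightarrow> u(m := a) \<in> PiE K (\<lambda>_. Cop Q)"
  by (auto simp: PiE_iff extensional_def)

lemma Yo_bounds:
  assumes "m \<in> K" "u \<in> PiE (K - {m}) (\<lambda>_. Cop Q)"
  shows "0 \<le> Yo m u" "Yo m u \<le> Fm * A0"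
proof -
  have F: "0 \<le> F (u(m := a)) \<and> F (u(m := a)) \<le> Fm" if "a \<in> Cop_le Q R" for a
    using that upd_PiE[OF assms, of a] F0 Fm by (auto simp: Cop_le_def)
  show "0 \<le> Yo m u" unfolding Yo_def using F by (intro sum_nonneg mult_nonneg_nonneg) auto
  have "Yo m u \<le> (\<Sum>a\<in>Cop_le Q R. 1 / real a * Fm)"
    unfolding Yo_def using F by (intro sum_mono mult_left_mono) auto
  thus "Yo m u \<le> Fm * A0" by (simp add: A0_def sum_distrib_left mult.commute)
qed

lemma sum_multiples_le:
  assumes "d \<ge> 1"
  shows "(\<Sum>a | a \<in> Cop_le Q R \<and> d dvd a. 1 / real a) \<le> A0 / real d"
proof -
  have "(\<Sum>a | a \<in> Cop_le Q R \<and> d dvd a. 1 / real a) \<le> (\<Sum>a\<in>(\<lambda>b. d * b) ` Cop_le Q R. 1 / real a)"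
  proof (intro sum_mono2)
    show "{a \<in> Cop_le Q R. d dvd a} \<subseteq> (\<lambda>b. d * b) ` Cop_le Q R"
    proof
      fix a assume a: "a \<in> {a \<in> Cop_le Q R. d dvd a}"
      then obtain b where b: "a = d * b" by auto
      have "b \<ge> 1" "coprime b Q" "real a \<le> R" using a b by (auto simp: Cop_le_def Cop_def)
      moreover have "real b * 1 \<le> real b * real d" using assms by (intro mult_left_mono) auto
      hence "real b \<le> real a" using b by (simp add: mult.commute)
      ultimately have "b \<in> Cop_le Q R" by (auto simp: Cop_le_def Cop_def)
      thus "a \<in> (\<lambda>b. d * b) ` Cop_le Q R" using b by auto
    qed
  qed auto
  also have "\<dots> = (\<Sum>b\<in>Cop_le Q R. 1 / real (d * b))"
    using assms by (subst sum.reindex) (auto simp: inj_on_def)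
  also have "\<dots> = A0 / real d" by (simp add: A0_def sum_divide_distrib mult.commute)
  finally show ?thesis .
qed

lemma sum_inv_sq_P: "(\<Sum>p\<in>P. 1 / (real p)\<^sup>2) \<le> eps / 1000"
proof -
  have "(\<Sum>p\<in>P. 1 / (real p)\<^sup>2) \<le> 1 / real D"
    using finite_P P_ge(3) D by (intro sum_inverse_squares_le) auto
  also have "\<dots> \<le> 2 / real D" by (intro divide_right_mono) auto
  finally show ?thesis by (simp add: eps_def)
qed

text \<open>A squarefree \<open>a\<close> that avoids the primes already coloured by
  \<open>e\<close> can be entered as the m-th coordinate by giving its primes the colour
  \<open>m\<close>.\<close>

lemma ucol_upd:
  assumes m: "m \<in> K" and e: "e \<in> PiE P (\<lambda>_. insert 0 (K - {m}))"
    and a: "a \<in> Cop_le Q R" "\<And>p. p \<in> P \<Longrightarrow> \<not> p\<^sup>2 dvd a" "\<And>p. p \<in> P \<Longrightarrow> p dvd a \<Longrightarrow> e p = 0"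
  shows "ucol P K (\<lambda>p\<in>P. if p dvd a then m else e p) = (ucol P (K - {m}) e)(m := a)"
proof
  fix i
  show "ucol P K (\<lambda>p\<in>P. if p dvd a then m else e p) i = ((ucol P (K - {m}) e)(m := a)) i"
  proof (cases "i = m")
    case True
    have "{p\<in>P. (\<lambda>p\<in>P. if p dvd a then m else e p) p = m} = {p\<in>P. p dvd a}"
    proof -
      have "m \<noteq> 0" using m K(2) by metis
      hence "e p \<noteq> m" if "p \<in> P" for p using PiE_mem[OF e that] by auto
      thus ?thesis by auto
    qed
    hence "ucol P K (\<lambda>p\<in>P. if p dvd a then m else e p) m = (\<Prod>p\<in>{p\<in>P. p dvd a}. p)"
      using m by (simp add: ucol_def)
    also have "\<dots> = a"
    proof (rule squarefree_eq_prod[OF finite_P P_ge(2)])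
      show "a \<ge> 1" using a(1) by (auto simp: Cop_le_def Cop_def)
      show "p \<in> P" if "prime p" "p dvd a" for p
        using prime_dvd_Cop[of a p] a(1) that by (auto simp: Cop_le_def)
    qed (use a in auto)
    finally show ?thesis using True by simp
  next
    case False
    have "{p\<in>P. (\<lambda>p\<in>P. if p dvd a then m else e p) p = i} = {p\<in>P. e p = i}" if "i \<in> K"
    proof -
      have "i \<noteq> 0" using that K(2) by metis
      thus ?thesis using a(3) False by auto
    qed
    thus ?thesis using False by (auto simp: ucol_def)
  qed
qed

text \<open>Three losses separate \<open>Vsum\<close> from \<open>Yo\<close>: configurations using a
  colour other than \<open>m\<close> at an uncoloured prime, integers \<open>a\<close> divisible by
  some p^2, and integers \<open>a\<close> divisible by a prime already coloured by \<open>e\<close>.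
  The first two are of relative size eps. The third is not small for every \<open>e\<close>, only on
  average, so it is kept as a sum of 1/p over the coloured primes.\<close>

lemma Vsum_lower:
  assumes m: "m \<in> K" and e: "e \<in> PiE P (\<lambda>_. insert 0 (K - {m}))" and eps1: "eps \<le> 1"
  shows "Vsum P K m yF e \<ge> Yo m (ucol P (K - {m}) e)
           - Fm * (2 * Pi1 * eps + A0 * eps + A0 * (\<Sum>p\<in>P. if e p = 0 then 0 else 1 / real p))"
    and "\<bar>Vsum P K m yF e\<bar> \<le> 4 * Fm * Pi1"
proof -
  let ?C = "PiE P (\<lambda>_. insert 0 K)" and ?G = "PiE P (\<lambda>p. if e p = 0 then {0, m} else {e p})"
    and ?u = "ucol P (K - {m}) e"
  define X where "X b = (\<Prod>p\<in>P. Xmat m p (b p) (e p))" for b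
  have m0: "m \<noteq> 0" using m K(2) by metis
  have eK: "e p \<in> insert 0 K" "e p \<noteq> m" if "p \<in> P" for p using e that m0 by (auto simp: PiE_iff)
  have finC: "finite ?C" using finite_P K by (intro finite_PiE) auto
  have GC: "?G \<subseteq> ?C"
  proof (intro PiE_mono)
    fix p assume "p \<in> P"
    thus "(if e p = 0 then {0, m} else {e p}) \<subseteq> insert 0 K" using eK[of p] m by auto
  qed
  have finG: "finite ?G" using finC GC finite_subset by blast
  have yF: "0 \<le> yF b" "yF b \<le> Fm" for b
    unfolding yF_def using F0 Fm ucol_PiE[of K] by auto
  define P0 where "P0 = {p\<in>P. e p = 0}"
  \<comment> \<open>At an uncoloured prime, \<open>h\<close> and \<open>g\<close> are the sums of
    the absolute values of \<open>Xmat\<close> over all colours and over 0 and \<open>m\<close>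
    only; the 5 counts the colours different from \<open>m\<close>.\<close>
  define h where "h p = 1 + 1 / (real p - 1) + 5 / (real p - 1)\<^sup>2" for p :: nat
  define g where "g p = 1 + 1 / (real p - 1)" for p :: nat
  have P0: "P0 \<subseteq> P" by (auto simp: P0_def)
  have pos: "real p - 1 > 0" if "p \<in> P" for p using P_ge(1)[OF that] by simp
  have sumX: "(\<Sum>b\<in>?C. \<bar>X b\<bar>) = (\<Prod>p\<in>P0. h p)"
  proof -
    have "(\<Sum>b\<in>?C. \<bar>X b\<bar>) = (\<Prod>p\<in>P. \<Sum>b\<in>insert 0 K. \<bar>Xmat m p b (e p)\<bar>)"
      unfolding X_def abs_prod by (rule prod_sum_PiE[symmetric]) (use finite_P K in auto)
    also have "\<dots> = (\<Prod>p\<in>P. if e p = 0 then h p else 1)"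
    proof (intro prod.cong refl)
      fix p assume p: "p \<in> P"
      show "(\<Sum>b\<in>insert 0 K. \<bar>Xmat m p b (e p)\<bar>) = (if e p = 0 then h p else 1)"
      proof (cases "e p = 0")
        case True
        have nz: "b \<noteq> 0" if "b \<in> K" for b using that K(2) by metis
        have "(\<Sum>b\<in>insert 0 K. \<bar>Xmat m p b (e p)\<bar>) = 1 + (\<Sum>b\<in>K. \<bar>Xmat m p b 0\<bar>)"
          using K True by (simp add: Xmat_def)
        also have "(\<Sum>b\<in>K. \<bar>Xmat m p b 0\<bar>) = \<bar>Xmat m p m 0\<bar> + (\<Sum>b\<in>K-{m}. \<bar>Xmat m p b 0\<bar>)"
          using K m by (subst sum.remove) auto
        also have "(\<Sum>b\<in>K-{m}. \<bar>Xmat m p b 0\<bar>) = (\<Sum>b\<in>K-{m}. 1 / (real p - 1)\<^sup>2)"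
          using nz by (intro sum.cong) (auto simp: Xmat_def)
        also have "\<bar>Xmat m p m 0\<bar> = 1 / (real p - 1)" using m0 pos[OF p] by (simp add: Xmat_def)
        finally show ?thesis using True K m by (simp add: h_def)
      next
        case False
        hence ep: "e p \<in> K" using eK[OF p] by auto
        have "(\<Sum>b\<in>insert 0 K. \<bar>Xmat m p b (e p)\<bar>) = (\<Sum>b\<in>K. \<bar>Xmat m p b (e p)\<bar>)"
          using K False by (simp add: Xmat_def)
        also have "\<dots> = \<bar>Xmat m p (e p) (e p)\<bar> + (\<Sum>b\<in>K-{e p}. \<bar>Xmat m p b (e p)\<bar>)"
          using K ep by (subst sum.remove) auto
        also have "(\<Sum>b\<in>K-{e p}. \<bar>Xmat m p b (e p)\<bar>) = 0"
          using False by (intro sum.neutral) (auto simp: Xmat_def)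
        finally show ?thesis using False by (simp add: Xmat_def)
      qed
    qed
    also have "\<dots> = (\<Prod>p\<in>P0. h p)" unfolding P0_def by (rule prod.inter_filter[OF finite_P, symmetric])
    finally show ?thesis .
  qed
  have Xnn: "X b \<ge> 0" if "b \<in> ?G" for b
    unfolding X_def
  proof (intro prod_nonneg)
    fix p assume p: "p \<in> P"
    have "b p \<in> (if e p = 0 then {0, m} else {e p})" using that p by (auto simp: PiE_iff)
    thus "0 \<le> Xmat m p (b p) (e p)" using pos[OF p] by (auto simp: Xmat_def split: if_splits)
  qed
  have sumG: "(\<Sum>b\<in>?G. \<bar>X b\<bar>) = (\<Prod>p\<in>P0. g p)"
  proof -
    have "(\<Sum>b\<in>?G. \<bar>X b\<bar>) = (\<Prod>p\<in>P. \<Sum>b\<in>(if e p = 0 then {0, m} else {e p}). \<bar>Xmat m p b (e p)\<bar>)"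
      unfolding X_def abs_prod by (rule prod_sum_PiE[symmetric]) (use finite_P in auto)
    also have "\<dots> = (\<Prod>p\<in>P. if e p = 0 then g p else 1)"
    proof (intro prod.cong refl)
      fix p assume p: "p \<in> P"
      show "(\<Sum>b\<in>(if e p = 0 then {0, m} else {e p}). \<bar>Xmat m p b (e p)\<bar>) = (if e p = 0 then g p else 1)"
        using m0 pos[OF p] by (simp add: Xmat_def g_def)
    qed
    also have "\<dots> = (\<Prod>p\<in>P0. g p)" unfolding P0_def by (rule prod.inter_filter[OF finite_P, symmetric])
    finally show ?thesis .
  qed
  have loc: "h p \<le> g p * (1 + 1000 / (real p)\<^sup>2)" "g p \<le> (1 + 1 / real p) * (1 + 1000 / (real p)\<^sup>2)" "0 \<le> g p" "1 \<le> g p" "0 \<le> h p" if p: "p \<in> P" for p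
  proof -
    define x where "x = real p - 1000"
    have x: "x \<ge> 0" "real p = x + 1000" using P_ge(1)[OF p] by (auto simp: x_def)
    have "5 * (real p)\<^sup>2 \<le> 1000 * (real p - 1)\<^sup>2" "(real p)\<^sup>2 \<le> 1000 * (real p - 1)\<^sup>2"
      unfolding x(2) using x(1) by (simp_all add: power2_eq_square algebra_simps)
    hence q: "5 / (real p - 1)\<^sup>2 \<le> 1000 / (real p)\<^sup>2" "1 / (real p - 1)\<^sup>2 \<le> 1000 / (real p)\<^sup>2" using x by (simp_all add: divide_simps)
    have g1: "1 \<le> g p" using pos[OF p] by (simp add: g_def)
    have "h p = g p + 5 / (real p - 1)\<^sup>2" by (simp add: h_def g_def)
    also have "\<dots> \<le> g p + 1 * (1000 / (real p)\<^sup>2)" using q by simp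
    also have "\<dots> \<le> g p + g p * (1000 / (real p)\<^sup>2)" using g1 by (intro add_left_mono mult_right_mono) auto
    finally show "h p \<le> g p * (1 + 1000 / (real p)\<^sup>2)" by (simp add: distrib_left)
    have "g p = (1 + 1 / real p) + 1 / (real p * (real p - 1))" using pos[OF p] by (simp add: g_def field_simps)
    also have "\<dots> \<le> (1 + 1 / real p) + 1 / (real p - 1)\<^sup>2"
      using pos[OF p] by (intro add_left_mono divide_left_mono) (auto simp: power2_eq_square)
    also have "\<dots> \<le> (1 + 1 / real p) + 1 * (1000 / (real p)\<^sup>2)" using q by simp
    also have "\<dots> \<le> (1 + 1 / real p) + (1 + 1 / real p) * (1000 / (real p)\<^sup>2)" by (intro add_left_mono mult_right_mono) auto
    finally show "g p \<le> (1 + 1 / real p) * (1 + 1000 / (real p)\<^sup>2)" by (simp only: distrib_left mult_1_right)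
    show "0 \<le> g p" "1 \<le> g p" "0 \<le> h p" using g1 pos[OF p] by (auto simp: h_def g_def)
  qed
  have gP: "(\<Prod>p\<in>P0. g p) \<le> 2 * Pi1"
  proof -
    have "(\<Prod>p\<in>P0. g p) \<le> (\<Prod>p\<in>P. g p)"
      using P0 finite_P loc by (intro prod_mono2) auto
    also have "\<dots> \<le> Pi1 + Pi1 * eps"
      using prod_perturb[of P "\<lambda>p. 1 + 1 / real p" g] loc by (auto simp: Pi1_def)
    also have "\<dots> \<le> 2 * Pi1" using eps1 eps_pos Pi1_ge1 mult_left_mono[OF eps1, of Pi1] by simp
    finally show ?thesis .
  qed
  have hg: "(\<Prod>p\<in>P0. h p) - (\<Prod>p\<in>P0. g p) \<le> 2 * Pi1 * eps"
  proof -
    have "(\<Prod>p\<in>P0. h p) - (\<Prod>p\<in>P0. g p) \<le> (\<Prod>p\<in>P0. g p) * eps"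
      using P0 loc by (intro prod_perturb) auto
    also have "\<dots> \<le> 2 * Pi1 * eps" using gP eps_pos by (intro mult_right_mono) auto
    finally show ?thesis .
  qed
  have "\<bar>Vsum P K m yF e\<bar> \<le> (\<Sum>b\<in>?C. \<bar>yF b * X b\<bar>)" unfolding Vsum_def X_def by (rule sum_abs)
  also have "\<dots> \<le> (\<Sum>b\<in>?C. Fm * \<bar>X b\<bar>)"
    unfolding abs_mult using yF by (intro sum_mono mult_right_mono) auto
  also have "\<dots> = Fm * (\<Prod>p\<in>P0. h p)" by (simp add: sumX flip: sum_distrib_left)
  also have "\<dots> \<le> Fm * (4 * Pi1)"
  proof (rule mult_left_mono[OF _ Fm0])
    have "2 * Pi1 * eps \<le> 2 * Pi1 * 1" using eps1 Pi1_ge1 by (intro mult_left_mono) auto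
    thus "(\<Prod>p\<in>P0. h p) \<le> 4 * Pi1" using hg gP by simp
  qed
  finally show "\<bar>Vsum P K m yF e\<bar> \<le> 4 * Fm * Pi1" by simp

  \<comment> \<open>Exactly the integers that can be entered as the m-th coordinate beside
    \<open>e\<close>.\<close>
  define good where "good = {a\<in>Cop_le Q R. (\<forall>p\<in>P. \<not> p\<^sup>2 dvd a) \<and> (\<forall>p\<in>P. p dvd a \<longrightarrow> e p = 0)}"
  define ba where "ba a = (\<lambda>p\<in>P. if p dvd a then m else e p)" for a :: nat
  have finCop: "finite (Cop_le Q R)" by simp
  have fing: "finite good" unfolding good_def by simp
  have baG: "ba a \<in> ?G" if "a \<in> good" for a
    using that by (auto simp: ba_def good_def)
  have uba: "ucol P K (ba a) = ?u(m := a)" if "a \<in> good" for a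
    unfolding ba_def by (rule ucol_upd[OF m e]) (use that in \<open>auto simp: good_def\<close>)
  have inj: "inj_on ba good"
  proof (rule inj_onI)
    fix a b assume "a \<in> good" "b \<in> good" "ba a = ba b"
    hence "?u(m := a) = ?u(m := b)" using uba by metis
    thus "a = b" by (metis fun_upd_same)
  qed
  \<comment> \<open>\<open>X (ba a)\<close> is the product of 1/(p - 1) over the primes of
    \<open>a\<close>. It is at least 1/a because \<open>a\<close> is squarefree, so the inequality
    goes in the direction that is needed.\<close>
  have Xba: "X (ba a) \<ge> 1 / real a" if a: "a \<in> good" for a
  proof -
    have a': "a \<in> Cop_le Q R" using a by (simp add: good_def)
    have "1 / real a = (\<Prod>p\<in>{p\<in>P. p dvd a}. 1 / real p)"
    proof -
      have "(\<Prod>p\<in>{p\<in>P. p dvd a}. p) = a"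
      proof (rule squarefree_eq_prod[OF finite_P P_ge(2)])
        show "a \<ge> 1" using a' by (auto simp: Cop_le_def Cop_def)
        show "p \<in> P" if "prime p" "p dvd a" for p
          using prime_dvd_Cop[of a p] a' that by (auto simp: Cop_le_def)
      qed (use a in \<open>auto simp: good_def\<close>)
      hence "1 / real a = 1 / real (\<Prod>p\<in>{p\<in>P. p dvd a}. p)" by (rule arg_cong[OF sym])
      also have "\<dots> = (\<Prod>p\<in>{p\<in>P. p dvd a}. 1 / real p)" by (simp add: prod_dividef)
      finally show ?thesis .
    qed
    also have "\<dots> = (\<Prod>p\<in>P. if p dvd a then 1 / real p else 1)" by (rule prod.inter_filter[OF finite_P])
    also have "\<dots> \<le> X (ba a)"
      unfolding X_def
    proof (intro prod_mono conjI)
      fix p assume p: "p \<in> P"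
      have "1 / real p \<le> 1 / (real p - 1)" using pos[OF p] by (intro divide_left_mono) auto
      thus "(if p dvd a then 1 / real p else 1) \<le> Xmat m p (ba a p) (e p)"
        using p a m0 by (auto simp: ba_def Xmat_def good_def)
    qed auto
    finally show ?thesis .
  qed
  have "(\<Sum>a\<in>good. 1 / real a * F (?u(m := a))) \<le> (\<Sum>a\<in>good. X (ba a) * yF (ba a))"
  proof (intro sum_mono mult_mono)
    fix a assume a: "a \<in> good"
    show "F (?u(m := a)) \<le> yF (ba a)" unfolding yF_def uba[OF a] by simp
    show "0 \<le> X (ba a)" using Xnn[OF baG[OF a]] .
    show "0 \<le> F (?u(m := a))" unfolding uba[OF a, symmetric] using F0 ucol_PiE[of K] by simp
  qed (use Xba in auto)
  also have "\<dots> = (\<Sum>b\<in>ba ` good. X b * yF b)" using inj by (simp add: sum.reindex)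
  also have "\<dots> \<le> (\<Sum>b\<in>?G. X b * yF b)"
    using baG finG Xnn yF by (intro sum_mono2) auto
  finally have 1: "(\<Sum>a\<in>good. 1 / real a * F (?u(m := a))) \<le> (\<Sum>b\<in>?G. X b * yF b)" .
  have "Vsum P K m yF e = (\<Sum>b\<in>?G. yF b * X b) + (\<Sum>b\<in>?C-?G. yF b * X b)"
    unfolding Vsum_def X_def[symmetric] using sum.subset_diff[OF GC finC] by (simp add: add.commute)
  moreover have "\<bar>\<Sum>b\<in>?C-?G. yF b * X b\<bar> \<le> Fm * (2 * Pi1 * eps)"
  proof -
    have "\<bar>\<Sum>b\<in>?C-?G. yF b * X b\<bar> \<le> (\<Sum>b\<in>?C-?G. \<bar>yF b * X b\<bar>)" by (rule sum_abs)
    also have "\<dots> \<le> (\<Sum>b\<in>?C-?G. Fm * \<bar>X b\<bar>)"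
      unfolding abs_mult using yF by (intro sum_mono mult_right_mono) auto
    also have "\<dots> = Fm * ((\<Sum>b\<in>?C. \<bar>X b\<bar>) - (\<Sum>b\<in>?G. \<bar>X b\<bar>))"
      using sum.subset_diff[OF GC finC, of "\<lambda>b. \<bar>X b\<bar>"] by (simp flip: sum_distrib_left)
    also have "\<dots> \<le> Fm * (2 * Pi1 * eps)" unfolding sumX sumG using hg Fm0 by (intro mult_left_mono)
    finally show ?thesis .
  qed
  moreover have "Yo m ?u - (\<Sum>a\<in>good. 1 / real a * F (?u(m := a))) \<le> Fm * (A0 * eps + A0 * (\<Sum>p\<in>P. if e p = 0 then 0 else 1 / real p))"
  proof -
    have uP: "?u \<in> PiE (K - {m}) (\<lambda>_. Cop Q)" by (rule ucol_PiE) auto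
    have Fa: "0 \<le> F (?u(m := a)) \<and> F (?u(m := a)) \<le> Fm" if "a \<in> Cop_le Q R" for a
      using that upd_PiE[OF m uP, of a] F0 Fm by (auto simp: Cop_le_def)
    have "good \<subseteq> Cop_le Q R" by (auto simp: good_def)
    hence "Yo m ?u - (\<Sum>a\<in>good. 1 / real a * F (?u(m := a))) = (\<Sum>a\<in>Cop_le Q R - good. 1 / real a * F (?u(m := a)))"
      unfolding Yo_def using finCop by (subst sum_diff) auto
    also have "\<dots> \<le> (\<Sum>a\<in>Cop_le Q R - good. 1 / real a * Fm)"
      using Fa by (intro sum_mono mult_left_mono) auto
    also have "\<dots> = (\<Sum>a\<in>Cop_le Q R - good. 1 / real a) * Fm" by (simp add: sum_distrib_right)
    finally have Y: "Yo m ?u - (\<Sum>a\<in>good. 1 / real a * F (?u(m := a))) \<le> (\<Sum>a\<in>Cop_le Q R - good. 1 / real a) * Fm" .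
    \<comment> \<open>Each discarded \<open>a\<close> is charged to a prime witnessing the failure.
      After the sums are swapped, the multiples of p^2 and of p cost A0/p^2 and A0/p.\<close>
    have "(\<Sum>a\<in>Cop_le Q R - good. 1 / real a) \<le> (\<Sum>a\<in>Cop_le Q R. \<Sum>p\<in>P. (if p\<^sup>2 dvd a then 1 / real a else 0) + (if p dvd a \<and> e p \<noteq> 0 then 1 / real a else 0))"
    proof -
      have "(\<Sum>a\<in>Cop_le Q R - good. 1 / real a) \<le> (\<Sum>a\<in>Cop_le Q R - good. \<Sum>p\<in>P. (if p\<^sup>2 dvd a then 1 / real a else 0) + (if p dvd a \<and> e p \<noteq> 0 then 1 / real a else 0))"
      proof (intro sum_mono)
        fix a assume "a \<in> Cop_le Q R - good"
        then obtain p where p: "p \<in> P" "p\<^sup>2 dvd a \<or> (p dvd a \<and> e p \<noteq> 0)" by (auto simp: good_def)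
        have "1 / real a \<le> (if p\<^sup>2 dvd a then 1 / real a else 0) + (if p dvd a \<and> e p \<noteq> 0 then 1 / real a else 0)"
          using p by auto
        also have "\<dots> \<le> (\<Sum>p\<in>P. (if p\<^sup>2 dvd a then 1 / real a else 0) + (if p dvd a \<and> e p \<noteq> 0 then 1 / real a else 0))"
          using p(1) finite_P by (intro member_le_sum) auto
        finally show "1 / real a \<le> (\<Sum>p\<in>P. (if p\<^sup>2 dvd a then 1 / real a else 0) + (if p dvd a \<and> e p \<noteq> 0 then 1 / real a else 0))" .
      qed
      also have "\<dots> \<le> (\<Sum>a\<in>Cop_le Q R. \<Sum>p\<in>P. (if p\<^sup>2 dvd a then 1 / real a else 0) + (if p dvd a \<and> e p \<noteq> 0 then 1 / real a else 0))"
        by (intro sum_mono2 sum_nonneg) auto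
      finally show ?thesis .
    qed
    also have "\<dots> = (\<Sum>p\<in>P. (\<Sum>a | a \<in> Cop_le Q R \<and> p\<^sup>2 dvd a. 1 / real a) + (if e p = 0 then 0 else \<Sum>a | a \<in> Cop_le Q R \<and> p dvd a. 1 / real a))"
    proof (subst sum.swap, intro sum.cong refl)
      fix p
      show "(\<Sum>a\<in>Cop_le Q R. (if p\<^sup>2 dvd a then 1 / real a else 0) + (if p dvd a \<and> e p \<noteq> 0 then 1 / real a else 0))
        = (\<Sum>a | a \<in> Cop_le Q R \<and> p\<^sup>2 dvd a. 1 / real a) + (if e p = 0 then 0 else \<Sum>a | a \<in> Cop_le Q R \<and> p dvd a. 1 / real a)"
        by (cases "e p = 0") (simp_all add: sum.distrib sum.inter_filter)
    qed
    also have "\<dots> \<le> (\<Sum>p\<in>P. A0 / (real p)\<^sup>2 + (if e p = 0 then 0 else A0 / real p))"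
    proof (intro sum_mono add_mono)
      fix p assume p: "p \<in> P"
      show "(\<Sum>a | a \<in> Cop_le Q R \<and> p\<^sup>2 dvd a. 1 / real a) \<le> A0 / (real p)\<^sup>2"
        using sum_multiples_le[of "p\<^sup>2"] prime_gt_0_nat[OF P_ge(2)[OF p]] by simp
      show "(if e p = 0 then 0 else \<Sum>a | a \<in> Cop_le Q R \<and> p dvd a. 1 / real a) \<le> (if e p = 0 then 0 else A0 / real p)"
        using sum_multiples_le[of p] prime_gt_0_nat[OF P_ge(2)[OF p]] by simp
    qed
    also have "\<dots> = A0 * (\<Sum>p\<in>P. 1 / (real p)\<^sup>2) + A0 * (\<Sum>p\<in>P. if e p = 0 then 0 else 1 / real p)"
      unfolding sum_distrib_left sum.distrib[symmetric] by (intro sum.cong refl) auto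
    also have "\<dots> \<le> A0 * eps + A0 * (\<Sum>p\<in>P. if e p = 0 then 0 else 1 / real p)"
      using A0_ge sum_inv_sq_P eps_pos by (intro add_right_mono mult_left_mono) auto
    finally have "(\<Sum>a\<in>Cop_le Q R - good. 1 / real a) \<le> A0 * eps + A0 * (\<Sum>p\<in>P. if e p = 0 then 0 else 1 / real p)" .
    from order_trans[OF Y mult_right_mono[OF this Fm0]] show ?thesis by (simp only: mult.commute[of Fm])
  qed
  ultimately show "Vsum P K m yF e \<ge> Yo m ?u
           - Fm * (2 * Pi1 * eps + A0 * eps + A0 * (\<Sum>p\<in>P. if e p = 0 then 0 else 1 / real p))"
    using 1 by (simp add: distrib_left mult.commute[of "X _"] abs_le_iff)
qed


text \<open>The divisors \<open>d\<close> treat two defects at once: p^2 divides one entry (i = j),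
  or p divides two different entries. In both cases their product over I is p^2, which is what makes
  the sum over p converge.\<close>

lemma sum_bad_tuples:
  assumes I: "finite I" "i \<in> I" "j \<in> I" and p: "p \<ge> 1"
  defines "d \<equiv> \<lambda>l. (if l = i then p else 1) * (if l = j then p else 1)"
  shows "(\<Sum>u | u \<in> PiE I (\<lambda>_. Cop_le Q R) \<and> (\<forall>l\<in>I. d l dvd u l). \<Prod>l\<in>I. 1 / real (u l)) \<le> A0 ^ card I / (real p)\<^sup>2"
proof -
  have "(\<Sum>u | u \<in> PiE I (\<lambda>_. Cop_le Q R) \<and> (\<forall>l\<in>I. d l dvd u l). \<Prod>l\<in>I. 1 / real (u l))
     = (\<Sum>u\<in>PiE I (\<lambda>l. {a. a \<in> Cop_le Q R \<and> d l dvd a}). \<Prod>l\<in>I. 1 / real (u l))"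
    by (intro sum.cong) (auto simp: PiE_iff extensional_def)
  also have "\<dots> = (\<Prod>l\<in>I. \<Sum>a | a \<in> Cop_le Q R \<and> d l dvd a. 1 / real a)"
    by (rule prod_sum_PiE[symmetric]) (use I in auto)
  also have "\<dots> \<le> (\<Prod>l\<in>I. A0 / real (d l))"
  proof (intro prod_mono conjI)
    fix l
    have "d l \<ge> 1" using p by (simp add: d_def)
    thus "(\<Sum>a | a \<in> Cop_le Q R \<and> d l dvd a. 1 / real a) \<le> A0 / real (d l)" by (rule sum_multiples_le)
  qed (auto intro: sum_nonneg)
  also have "\<dots> = A0 ^ card I / real (\<Prod>l\<in>I. d l)" by (simp add: prod_dividef)
  also have "(\<Prod>l\<in>I. d l) = p * p"
    unfolding d_def prod.distrib using I by simp
  finally show ?thesis by (simp add: power2_eq_square)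
qed

text \<open>A tuple that is not of the form \<open>ucol\<close> has a sieving prime dividing two
  entries, or its square dividing one. There are at most 36 pairs of indices, and 36 times the sum
  of 1/p^2 is below eps.\<close>

lemma sum_tuples_le:
  assumes I: "I \<subseteq> K" and h: "\<And>u. u \<in> tuples Q I R \<Longrightarrow> 0 \<le> h u" "\<And>u. u \<in> tuples Q I R \<Longrightarrow> h u \<le> (H::real)" and H: "H \<ge> 0"
    and h0: "\<And>u. u \<in> PiE I (\<lambda>_. Cop Q) \<Longrightarrow> 0 \<le> h u"
  shows "(\<Sum>u\<in>tuples Q I R. (\<Prod>i\<in>I. 1 / real (u i)) * h u)
     \<le> (\<Sum>c\<in>PiE P (\<lambda>_. insert 0 I). (\<Prod>p\<in>P. if c p = 0 then 1 else 1 / real p) * h (ucol P I c)) + H * A0 ^ card I * eps"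
proof -
  let ?E = "PiE P (\<lambda>_. insert 0 I)"
  define w where "w u = (\<Prod>i\<in>I. 1 / real (u i))" for u :: "nat \<Rightarrow> nat"
  define d where "d p i j l = (if l = i then p else 1) * (if l = j then p else (1::nat))" for p i j l :: nat
  define bad where "bad u \<longleftrightarrow> (\<exists>p\<in>P. \<exists>i\<in>I. \<exists>j\<in>I. \<forall>l\<in>I. d p i j l dvd u l)" for u
  have finI: "finite I" "0 \<notin> I" using I K finite_subset by auto
  have finE: "finite ?E" using finite_P finI by (intro finite_PiE) auto
  have finT: "finite (tuples Q I R)" using finI(1) by (rule finite_tuples)
  have cardI: "card I \<le> 6" using card_mono[OF K(1) I] K(3) by simp
  have w0: "w u \<ge> 0" for u unfolding w_def by (intro prod_nonneg) auto
  have sub: "u \<in> PiE I (\<lambda>_. Cop_le Q R)" if u: "u \<in> tuples Q I R" for u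
  proof -
    have "u i \<le> (\<Prod>i\<in>I. u i)" if "i \<in> I" for i
    proof (rule dvd_imp_le)
      show "u i dvd (\<Prod>i\<in>I. u i)" using finI(1) that by (rule dvd_prodI)
      show "(\<Prod>i\<in>I. u i) > 0" using u by (auto simp: tuples_def Cop_def PiE_iff Suc_le_eq intro!: prod_pos)
    qed
    thus ?thesis
      using u of_nat_mono[where 'a = real] unfolding tuples_def Cop_le_def PiE_iff mem_Collect_eq
      by (metis order_trans)
  qed
  have img: "u \<in> ucol P I ` ?E" if u: "u \<in> tuples Q I R" "\<not> bad u" for u
  proof -
    \<comment> \<open>The choice is harmless: when the tuple is not bad, each prime divides at most
      one entry.\<close>
    define e where "e = (\<lambda>p\<in>P. if \<exists>i\<in>I. p dvd u i then (SOME i. i \<in> I \<and> p dvd u i) else 0)"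
    have some: "(SOME i. i \<in> I \<and> p dvd u i) \<in> I \<and> p dvd u (SOME i. i \<in> I \<and> p dvd u i)" if "\<exists>i\<in>I. p dvd u i" for p
      using someI_ex[of "\<lambda>i. i \<in> I \<and> p dvd u i"] that by blast
    have eE: "e \<in> ?E" using some by (auto simp: e_def)
    have set: "{p\<in>P. e p = i} = {p\<in>P. p dvd u i}" if i: "i \<in> I" for i
    proof (intro equalityI subsetI)
      fix p assume p: "p \<in> {p\<in>P. e p = i}"
      have "i \<noteq> 0" using i finI(2) by metis
      hence "e p \<noteq> 0" using p by auto
      hence "\<exists>i\<in>I. p dvd u i" using p by (auto simp: e_def split: if_splits)
      thus "p \<in> {p\<in>P. p dvd u i}" using some[of p] p by (auto simp: e_def)
    next
      fix p assume p: "p \<in> {p\<in>P. p dvd u i}"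
      hence ex: "\<exists>i\<in>I. p dvd u i" using i by blast
      have ep: "e p \<in> I" "p dvd u (e p)" using some[OF ex] p ex by (auto simp: e_def)
      have "e p = i"
      proof (rule ccontr)
        assume ne: "e p \<noteq> i"
        have "\<forall>l\<in>I. d p i (e p) l dvd u l" using ne p ep by (auto simp: d_def)
        moreover have "p \<in> P" using p by simp
        ultimately show False using u(2) i ep(1) unfolding bad_def by blast
      qed
      thus "p \<in> {p\<in>P. e p = i}" using p by simp
    qed
    have "ucol P I e = u"
    proof
      fix i
      show "ucol P I e i = u i"
      proof (cases "i \<in> I")
        case False thus ?thesis using sub[OF u(1)] by (auto simp: ucol_def PiE_iff extensional_def)
      next
        case True
        have ui: "u i \<in> Cop_le Q R" using sub[OF u(1)] True by (auto simp: PiE_iff)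
        have "ucol P I e i = (\<Prod>p\<in>{p\<in>P. p dvd u i}. p)" using True set[OF True] by (simp add: ucol_def)
        also have "\<dots> = u i"
        proof (rule squarefree_eq_prod[OF finite_P P_ge(2)])
          show "u i \<ge> 1" using ui by (auto simp: Cop_le_def Cop_def)
          show "p \<in> P" if "prime p" "p dvd u i" for p
            using prime_dvd_Cop[of "u i" p] ui that by (auto simp: Cop_le_def)
          show "\<not> p\<^sup>2 dvd u i" if p: "p \<in> P" for p
          proof
            assume "p\<^sup>2 dvd u i"
            hence "\<forall>l\<in>I. d p i i l dvd u l" by (auto simp: d_def power2_eq_square)
            thus False using u(2) p True unfolding bad_def by blast
          qed
        qed
        finally show ?thesis .
      qed
    qed
    thus ?thesis using eE by auto
  qed
  have "(\<Sum>u\<in>tuples Q I R. w u * h u) = (\<Sum>u\<in>{u\<in>tuples Q I R. \<not> bad u}. w u * h u) + (\<Sum>u\<in>{u\<in>tuples Q I R. bad u}. w u * h u)"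
    by (subst sum.union_disjoint[symmetric]) (use finT in \<open>auto intro!: sum.cong\<close>)
  also have "(\<Sum>u\<in>{u\<in>tuples Q I R. \<not> bad u}. w u * h u) \<le> (\<Sum>u\<in>ucol P I ` ?E. w u * h u)"
  proof (intro sum_mono2)
    show "0 \<le> w u * h u" if u: "u \<in> ucol P I ` ?E - {u\<in>tuples Q I R. \<not> bad u}" for u
    proof -
      have "u \<in> PiE I (\<lambda>_. Cop Q)" using u ucol_PiE[OF I] by auto
      thus ?thesis using w0 h0 by (intro mult_nonneg_nonneg) auto
    qed
  qed (use img finE in auto)
  also have "\<dots> = (\<Sum>c\<in>?E. (\<Prod>p\<in>P. if c p = 0 then 1 else 1 / real p) * h (ucol P I c))"
    using inj_on_ucol[OF finite_P P_ge(2) finI(2)]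
    by (subst sum.reindex) (auto simp: w_def weight_eq_ucol[OF finite_P finI])
  also have "(\<Sum>u\<in>{u\<in>tuples Q I R. bad u}. w u * h u) \<le> H * A0 ^ card I * eps"
  proof -
    have "(\<Sum>u\<in>{u\<in>tuples Q I R. bad u}. w u * h u) \<le> (\<Sum>u\<in>{u\<in>tuples Q I R. bad u}. w u * H)"
      using h w0 by (intro sum_mono mult_left_mono) auto
    also have "\<dots> = H * (\<Sum>u\<in>{u\<in>tuples Q I R. bad u}. w u)" by (simp add: sum_distrib_left mult.commute)
    also have "\<dots> \<le> H * (A0 ^ card I * eps)"
    proof (rule mult_left_mono[OF _ H])
      let ?B = "\<lambda>p i j. {u. u \<in> PiE I (\<lambda>_. Cop_le Q R) \<and> (\<forall>l\<in>I. d p i j l dvd u l)}"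
      have finB: "finite (?B p i j)" for p i j
        by (rule finite_subset[of _ "PiE I (\<lambda>_. Cop_le Q R)"]) (use finI in \<open>auto intro!: finite_PiE\<close>)
      have "(\<Sum>u\<in>{u\<in>tuples Q I R. bad u}. w u) \<le> (\<Sum>u\<in>(\<Union>(p,i,j)\<in>P \<times> I \<times> I. ?B p i j). w u)"
      proof (intro sum_mono2)
        show "{u\<in>tuples Q I R. bad u} \<subseteq> (\<Union>(p,i,j)\<in>P \<times> I \<times> I. ?B p i j)"
        proof
          fix u assume u: "u \<in> {u\<in>tuples Q I R. bad u}"
          then obtain p i j where "p \<in> P" "i \<in> I" "j \<in> I" "\<forall>l\<in>I. d p i j l dvd u l" by (auto simp: bad_def)
          thus "u \<in> (\<Union>(p,i,j)\<in>P \<times> I \<times> I. ?B p i j)" using sub[of u] u by blast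
        qed
      qed (use finite_P finI finB w0 in auto)
      also have "\<dots> \<le> (\<Sum>(p,i,j)\<in>P \<times> I \<times> I. \<Sum>u\<in>?B p i j. w u)"
        unfolding case_prod_unfold using finite_P finI finB w0 by (intro sum_UNION_le) auto
      also have "\<dots> \<le> (\<Sum>(p,i,j)\<in>P \<times> I \<times> I. A0 ^ card I / (real p)\<^sup>2)"
      proof (intro sum_mono, clarify)
        fix p i j assume "p \<in> P" "i \<in> I" "j \<in> I"
        thus "(\<Sum>u\<in>?B p i j. w u) \<le> A0 ^ card I / (real p)\<^sup>2"
          unfolding w_def d_def using sum_bad_tuples[OF finI(1), of i j p] prime_ge_1_nat[OF P_ge(2)] by simp
      qed
      also have "\<dots> = (\<Sum>p\<in>P. \<Sum>x\<in>I \<times> I. A0 ^ card I / (real p)\<^sup>2)"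
        by (subst sum.cartesian_product) (auto intro!: sum.cong)
      also have "\<dots> = real (card I * card I) * A0 ^ card I * (\<Sum>p\<in>P. 1 / (real p)\<^sup>2)"
        by (simp add: sum_distrib_left card_cartesian_product)
      also have "\<dots> \<le> 36 * A0 ^ card I * (eps / 1000)"
      proof (intro mult_mono)
        have "card I * card I \<le> 6 * 6" using cardI by (intro mult_mono) auto
        thus "real (card I * card I) \<le> 36" by linarith
      qed (use sum_inv_sq_P A0_ge in \<open>auto intro: sum_nonneg\<close>)
      also have "\<dots> \<le> A0 ^ card I * eps"
        using A0_ge eps_pos by (simp add: mult_le_cancel_left)
      finally show "(\<Sum>u\<in>{u\<in>tuples Q I R. bad u}. w u) \<le> A0 ^ card I * eps" .
    qed
    finally show ?thesis by simp
  qed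
  finally show ?thesis unfolding w_def by simp
qed

text \<open>The 25 is 16 + 6 + 2 + 1. The bound 4 Fm X for \<open>Vsum\<close>, squared, multiplies
  the excess of the local weights and gives 16; the terms 3 eps and 1/p of
  \<open>Vsum_lower\<close>, doubled by squaring, give 6 and 2; the tuples missed by configurations
  give 1. The power X^7 consists of X^2 from the square of the inner sum and X^5 from the five
  remaining coordinates.\<close>

theorem form2_lower:
  assumes m: "m \<in> K" and eps1: "eps \<le> 1" and X: "Pi1 \<le> X" "A0 \<le> X"
  shows "(\<Sum>s\<in>PiE P (\<lambda>_. insert 0 K). \<Sum>t\<in>PiE P (\<lambda>_. insert 0 K). lam P K yF s * lam P K yF t * (\<Prod>p\<in>P. dens2 m p (s p) (t p)))
   \<ge> (\<Sum>u\<in>tuples Q (K - {m}) R. (\<Prod>i\<in>K - {m}. 1 / real (u i)) * (Yo m u)\<^sup>2) - 25 * Fm\<^sup>2 * X ^ 7 * eps"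
proof -
  let ?I = "K - {m}" and ?E = "PiE P (\<lambda>_. insert 0 (K - {m}))"
  have I: "finite ?I" "0 \<notin> ?I" "card ?I = 5" "?I \<subseteq> K" using K m by auto
  have X1: "X \<ge> 1" using X Pi1_ge1 by simp
  define W where "W f e = (\<Prod>p\<in>P. if e p = 0 then 1 else f p)" for f :: "nat \<Rightarrow> real" and e :: "nat \<Rightarrow> nat"
  define w where "w = W (\<lambda>p. 1 / real p)"
  define wr where "wr = W (\<lambda>p. 1 / real p * (1 + 100 / real p))"
  define wq where "wq = W (\<lambda>p. 1 / real p * (1 + 1 / real p))"
  define al where "al = W (\<lambda>p. (real p)\<^sup>2 * (real p - 2) / (real p - 1) ^ 4)"
  define rh where "rh = W (\<lambda>p. (real p)\<^sup>2 * (real p + 2) / (real p - 1) ^ 4)"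
  define V where "V = Vsum P K m yF"
  define Y where "Y e = Yo m (ucol P ?I e)" for e
  define sg where "sg e = (\<Sum>p\<in>P. if e p = 0 then 0 else 1 / real p)" for e :: "nat \<Rightarrow> nat"
  have W0: "(\<And>p. p \<in> P \<Longrightarrow> f p \<ge> 0) \<Longrightarrow> W f e \<ge> 0" for f e unfolding W_def by (intro prod_nonneg) auto
  have Wmono: "(\<And>p. p \<in> P \<Longrightarrow> 0 \<le> f p \<and> f p \<le> g p) \<Longrightarrow> W f e \<le> W g e" for f g e unfolding W_def by (intro prod_mono) auto
  have loc: "1 / real p \<le> (real p)\<^sup>2 * (real p - 2) / (real p - 1) ^ 4 \<and> (real p)\<^sup>2 * (real p + 2) / (real p - 1) ^ 4 \<le> 1 / real p * (1 + 100 / real p)" if p: "p \<in> P" for p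
  proof -
    define x where "x = real p - 1000"
    have x: "x \<ge> 0" "real p = x + 1000" using P_ge(1)[OF p] by (auto simp: x_def)
    have "(real p - 1) ^ 4 \<le> real p * ((real p)\<^sup>2 * (real p - 2))" "real p * real p * ((real p)\<^sup>2 * (real p + 2)) \<le> (real p + 100) * (real p - 1) ^ 4"
      unfolding x(2) using x(1) by (simp_all add: power2_eq_square power4_eq_xxxx algebra_simps)
    moreover have "real p > 0" "(real p - 1) ^ 4 > 0" using x by auto
    ultimately show ?thesis by (simp add: divide_simps) (simp add: algebra_simps)
  qed
  have pp: "real p > 0" if "p \<in> P" for p using P_ge(1)[OF that] by simp
  have al: "w e \<le> al e" for e unfolding w_def al_def using loc by (intro Wmono) auto
  have rh: "rh e \<le> wr e" for e unfolding rh_def wr_def using loc pp by (intro Wmono) auto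
  have ww: "0 \<le> w e" "w e \<le> wr e" "w e \<le> wq e" for e
  proof -
    have "1 / real p * 1 \<le> 1 / real p * (1 + c / real p)" if "c \<ge> 0" for p :: nat and c
      using that by (intro mult_left_mono) auto
    hence "1 / real p \<le> 1 / real p * (1 + c / real p)" if "c \<ge> 0" for p :: nat and c
      using that by simp
    from this[of 1] this[of 100] show "0 \<le> w e" "w e \<le> wr e" "w e \<le> wq e"
      unfolding w_def wr_def wq_def by (auto intro!: W0 Wmono simp del: times_divide_eq_left)
  qed
  \<comment> \<open>The loss over coloured primes is averaged here: 1 + sum t <= prod (1 + t) turns
    w * sg into the excess of a slightly larger product weight, to which
    \<open>sum_excess_weights\<close> applies.\<close>
  have sgw: "w e * sg e \<le> wq e - w e" for e
  proof -
    have "1 + sg e \<le> (\<Prod>p\<in>P. 1 + (if e p = 0 then 0 else 1 / real p))"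
      unfolding sg_def by (rule one_plus_sum_le_prod) (use finite_P in auto)
    hence "w e * (1 + sg e) \<le> w e * (\<Prod>p\<in>P. 1 + (if e p = 0 then 0 else 1 / real p))" using ww by (intro mult_left_mono)
    also have "\<dots> = wq e" unfolding w_def wq_def W_def prod.distrib[symmetric] by (intro prod.cong) auto
    finally show ?thesis by (simp add: algebra_simps)
  qed
  have Yb: "0 \<le> Y e" "Y e \<le> Fm * X" for e
  proof -
    have "ucol P ?I e \<in> PiE ?I (\<lambda>_. Cop Q)" by (rule ucol_PiE) auto
    from Yo_bounds[OF m this] show "0 \<le> Y e" "Y e \<le> Fm * X"
      unfolding Y_def using mult_left_mono[OF X(2) Fm0] by auto
  qed
  have sg0: "sg e \<ge> 0" for e unfolding sg_def by (intro sum_nonneg) auto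
  have each: "(V e)\<^sup>2 * (2 * al e - rh e) \<ge> w e * (Y e)\<^sup>2 - Fm\<^sup>2 * X\<^sup>2 * (16 * (wr e - w e) + 6 * eps * w e + 2 * (wq e - w e))"
    if e: "e \<in> ?E" for e
  proof -
    define err where "err = Fm * (3 * X * eps + X * sg e)"
    have err0: "err \<ge> 0" unfolding err_def using Fm0 X1 eps_pos sg0 by (intro mult_nonneg_nonneg add_nonneg_nonneg) auto
    have "Fm * (2 * Pi1 * eps + A0 * eps + A0 * sg e) \<le> Fm * (2 * X * eps + X * eps + X * sg e)"
      using Fm0 X eps_pos sg0 by (intro mult_left_mono add_mono mult_right_mono) auto
    also have "\<dots> = err" by (simp add: err_def algebra_simps)
    finally have Vl: "V e \<ge> Y e - err"
      using Vsum_lower(1)[OF m e eps1] unfolding V_def Y_def sg_def by linarith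
    \<comment> \<open>The lower bound Y - err may be negative and then cannot be squared; in that
      case the right-hand side is itself at most 0.\<close>
    have V2: "(V e)\<^sup>2 \<ge> (Y e)\<^sup>2 - 2 * Y e * err"
    proof (cases "Y e \<ge> err")
      case True
      have "(Y e - err)\<^sup>2 \<le> (V e)\<^sup>2" using Vl True by (intro power_mono) auto
      moreover have "(Y e - err)\<^sup>2 = (Y e)\<^sup>2 - 2 * Y e * err + err\<^sup>2" by (simp add: power2_diff)
      ultimately show ?thesis using zero_le_power2[of err] by linarith
    next
      case False
      have "Y e * Y e \<le> Y e * err" "0 \<le> Y e * err" using False Yb(1)[of e] err0 by (auto intro: mult_left_mono)
      hence "(Y e)\<^sup>2 \<le> Y e * err" by (simp add: power2_eq_square)
      thus ?thesis using zero_le_power2[of "V e"] \<open>0 \<le> Y e * err\<close> by linarith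
    qed
    have "Y e * err \<le> Fm * X * err" using Yb err0 by (intro mult_right_mono) auto
    also have "\<dots> = Fm\<^sup>2 * X\<^sup>2 * (3 * eps + sg e)" by (simp add: err_def power2_eq_square algebra_simps)
    finally have "(V e)\<^sup>2 \<ge> (Y e)\<^sup>2 - 2 * (Fm\<^sup>2 * X\<^sup>2 * (3 * eps + sg e))" using V2 by simp
    hence "w e * (V e)\<^sup>2 \<ge> w e * ((Y e)\<^sup>2 - 2 * (Fm\<^sup>2 * X\<^sup>2 * (3 * eps + sg e)))" using ww by (intro mult_left_mono)
    moreover have "w e * ((Y e)\<^sup>2 - 2 * (Fm\<^sup>2 * X\<^sup>2 * (3 * eps + sg e))) = w e * (Y e)\<^sup>2 - Fm\<^sup>2 * X\<^sup>2 * (6 * eps * w e + 2 * (w e * sg e))"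
      by (simp add: algebra_simps)
    moreover have "Fm\<^sup>2 * X\<^sup>2 * (6 * eps * w e + 2 * (w e * sg e)) \<le> Fm\<^sup>2 * X\<^sup>2 * (6 * eps * w e + 2 * (wq e - w e))"
      using sgw by (intro mult_left_mono add_left_mono) auto
    ultimately have A: "w e * (V e)\<^sup>2 \<ge> w e * (Y e)\<^sup>2 - Fm\<^sup>2 * X\<^sup>2 * (6 * eps * w e + 2 * (wq e - w e))" by linarith
    have "\<bar>V e\<bar> \<le> 4 * Fm * X"
    proof -
      have "4 * Fm * Pi1 \<le> 4 * Fm * X" using X Fm0 by (intro mult_left_mono) auto
      thus ?thesis using Vsum_lower(2)[OF m e eps1] unfolding V_def by linarith
    qed
    hence "\<bar>V e\<bar>\<^sup>2 \<le> (4 * Fm * X)\<^sup>2" by (intro power_mono) auto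
    hence "(V e)\<^sup>2 * (wr e - w e) \<le> (4 * Fm * X)\<^sup>2 * (wr e - w e)" using ww[of e] by (intro mult_right_mono) auto
    hence B: "(V e)\<^sup>2 * (wr e - w e) \<le> Fm\<^sup>2 * X\<^sup>2 * (16 * (wr e - w e))" by (simp add: power2_eq_square algebra_simps)
    have "(V e)\<^sup>2 * (2 * al e - rh e) \<ge> (V e)\<^sup>2 * (2 * w e - wr e)"
      using al[of e] rh[of e] by (intro mult_left_mono) auto
    moreover have "(V e)\<^sup>2 * (2 * w e - wr e) = w e * (V e)\<^sup>2 - (V e)\<^sup>2 * (wr e - w e)" by (simp add: algebra_simps)
    moreover have "Fm\<^sup>2 * X\<^sup>2 * (16 * (wr e - w e) + 6 * eps * w e + 2 * (wq e - w e))
       = Fm\<^sup>2 * X\<^sup>2 * (16 * (wr e - w e)) + Fm\<^sup>2 * X\<^sup>2 * (6 * eps * w e + 2 * (wq e - w e))" by (simp add: algebra_simps)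
    ultimately show ?thesis using A B by linarith
  qed
  have "(\<Sum>s\<in>PiE P (\<lambda>_. insert 0 K). \<Sum>t\<in>PiE P (\<lambda>_. insert 0 K). lam P K yF s * lam P K yF t * (\<Prod>p\<in>P. dens2 m p (s p) (t p)))
      \<ge> (\<Sum>e\<in>?E. (V e)\<^sup>2 * (2 * al e - rh e))"
  proof -
    have e: "real p + real (card K) - 4 = real p + 2" for p :: nat by (simp add: K(3))
    have "p > 2" if "p \<in> P" for p using P_ge(1)[OF that] by simp
    from form2_ge[OF K(1,2) m finite_P this, of yF] show ?thesis unfolding e V_def al_def rh_def W_def .
  qed
  moreover have "(\<Sum>e\<in>?E. (V e)\<^sup>2 * (2 * al e - rh e)) \<ge> (\<Sum>e\<in>?E. w e * (Y e)\<^sup>2) - 24 * Fm\<^sup>2 * X ^ 7 * eps"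
  proof -
    have "(\<Sum>e\<in>?E. (V e)\<^sup>2 * (2 * al e - rh e))
       \<ge> (\<Sum>e\<in>?E. w e * (Y e)\<^sup>2 - Fm\<^sup>2 * X\<^sup>2 * (16 * (wr e - w e) + 6 * eps * w e + 2 * (wq e - w e)))"
      using each by (intro sum_mono)
    also have "(\<Sum>e\<in>?E. w e * (Y e)\<^sup>2 - Fm\<^sup>2 * X\<^sup>2 * (16 * (wr e - w e) + 6 * eps * w e + 2 * (wq e - w e)))
      = (\<Sum>e\<in>?E. w e * (Y e)\<^sup>2) - Fm\<^sup>2 * X\<^sup>2 * (16 * (\<Sum>e\<in>?E. wr e - w e) + 6 * eps * (\<Sum>e\<in>?E. w e) + 2 * (\<Sum>e\<in>?E. wq e - w e))"
    proof -
      have "(\<Sum>e\<in>?E. Fm\<^sup>2 * X\<^sup>2 * (16 * (wr e - w e) + 6 * eps * w e + 2 * (wq e - w e)))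
         = Fm\<^sup>2 * X\<^sup>2 * (\<Sum>e\<in>?E. 16 * (wr e - w e) + 6 * eps * w e + 2 * (wq e - w e))"
        by (simp only: sum_distrib_left)
      also have "(\<Sum>e\<in>?E. 16 * (wr e - w e) + 6 * eps * w e + 2 * (wq e - w e))
         = 16 * (\<Sum>e\<in>?E. wr e - w e) + 6 * eps * (\<Sum>e\<in>?E. w e) + 2 * (\<Sum>e\<in>?E. wq e - w e)"
        by (simp only: sum.distrib sum_distrib_left)
      finally show ?thesis by (simp only: sum_subtractf)
    qed
    finally have 1: "(\<Sum>e\<in>?E. (V e)\<^sup>2 * (2 * al e - rh e)) \<ge> (\<Sum>e\<in>?E. w e * (Y e)\<^sup>2)
       - Fm\<^sup>2 * X\<^sup>2 * (16 * (\<Sum>e\<in>?E. wr e - w e) + 6 * eps * (\<Sum>e\<in>?E. w e) + 2 * (\<Sum>e\<in>?E. wq e - w e))" .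
    have P5: "Pi1 ^ 5 \<le> X ^ 5" using X Pi1_ge1 by (intro power_mono) auto
    hence P5e: "Pi1 ^ 5 * eps \<le> X ^ 5 * eps" using eps_pos by (intro mult_right_mono) auto
    have a: "(\<Sum>e\<in>?E. wr e - w e) \<le> X ^ 5 * eps"
      using sum_excess_weights[OF I(1,2), of "\<lambda>p. 1 / real p * (1 + 100 / real p)"] P5e
      unfolding wr_def w_def W_def I(3) by force
    have b: "(\<Sum>e\<in>?E. wq e - w e) \<le> X ^ 5 * eps"
    proof -
      have "1 / real p * (1 + 1 / real p) \<le> 1 / real p * (1 + 100 / real p)" for p :: nat
        by (intro mult_left_mono add_left_mono divide_right_mono) auto
      thus ?thesis using sum_excess_weights[OF I(1,2), of "\<lambda>p. 1 / real p * (1 + 1 / real p)"] P5e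
        unfolding wq_def w_def W_def I(3) by force
    qed
    have c: "(\<Sum>e\<in>?E. w e) \<le> X ^ 5"
    proof -
      have "(\<Sum>e\<in>?E. w e) = (\<Prod>p\<in>P. 1 + real (card ?I) * (1 / real p))"
        unfolding w_def W_def by (rule sum_configs[OF finite_P I(1,2)])
      also have "\<dots> = (\<Prod>p\<in>P. 1 + real 5 / real p)" unfolding I(3) by simp
      also have "\<dots> \<le> Pi1 ^ 5" by (rule prod_one_plus_le_Pi1)
      finally show ?thesis using P5 by linarith
    qed
    have "6 * eps * (\<Sum>e\<in>?E. w e) \<le> 6 * eps * X ^ 5" using c eps_pos by (intro mult_left_mono) auto
    hence "16 * (\<Sum>e\<in>?E. wr e - w e) + 6 * eps * (\<Sum>e\<in>?E. w e) + 2 * (\<Sum>e\<in>?E. wq e - w e) \<le> 24 * (X ^ 5 * eps)"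
      using a b by (simp add: mult.commute mult.left_commute)
    hence "Fm\<^sup>2 * X\<^sup>2 * (16 * (\<Sum>e\<in>?E. wr e - w e) + 6 * eps * (\<Sum>e\<in>?E. w e) + 2 * (\<Sum>e\<in>?E. wq e - w e)) \<le> Fm\<^sup>2 * X\<^sup>2 * (24 * (X ^ 5 * eps))"
      by (intro mult_left_mono) auto
    also have "\<dots> = 24 * Fm\<^sup>2 * X ^ 7 * eps"
    proof -
      have "Fm\<^sup>2 * X\<^sup>2 * (24 * (X ^ 5 * eps)) = 24 * Fm\<^sup>2 * (X\<^sup>2 * X ^ 5) * eps" by (simp only: mult_ac)
      also have "X\<^sup>2 * X ^ 5 = X ^ 7" by (simp flip: power_add)
      finally show ?thesis .
    qed
    finally show ?thesis using 1 by linarith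
  qed
  moreover have "(\<Sum>u\<in>tuples Q ?I R. (\<Prod>i\<in>?I. 1 / real (u i)) * (Yo m u)\<^sup>2) \<le> (\<Sum>e\<in>?E. w e * (Y e)\<^sup>2) + Fm\<^sup>2 * X ^ 7 * eps"
  proof -
    have "(\<Sum>u\<in>tuples Q ?I R. (\<Prod>i\<in>?I. 1 / real (u i)) * (Yo m u)\<^sup>2) \<le> (\<Sum>e\<in>?E. (\<Prod>p\<in>P. if e p = 0 then 1 else 1 / real p) * (Yo m (ucol P ?I e))\<^sup>2) + (Fm * X)\<^sup>2 * A0 ^ card ?I * eps"
    proof (rule sum_tuples_le[OF I(4)])
      fix u assume "u \<in> tuples Q ?I R"
      hence "u \<in> PiE ?I (\<lambda>_. Cop Q)" by (simp add: tuples_def)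
      note Yo_bounds[OF m this]
      moreover have "Fm * A0 \<le> Fm * X" using X Fm0 by (intro mult_left_mono)
      ultimately show "(Yo m u)\<^sup>2 \<le> (Fm * X)\<^sup>2" by (intro power_mono) auto
    qed auto
    also have "(Fm * X)\<^sup>2 * A0 ^ card ?I * eps \<le> (Fm * X)\<^sup>2 * X ^ 5 * eps"
      unfolding I(3) using X A0_ge eps_pos by (intro mult_left_mono mult_right_mono power_mono) auto
    also have "(Fm * X)\<^sup>2 * X ^ 5 * eps = Fm\<^sup>2 * X ^ 7 * eps"
    proof -
      have "(Fm * X)\<^sup>2 * X ^ 5 * eps = Fm\<^sup>2 * (X\<^sup>2 * X ^ 5) * eps" by (simp only: power_mult_distrib mult_ac)
      also have "X\<^sup>2 * X ^ 5 = X ^ 7" by (simp flip: power_add)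
      finally show ?thesis .
    qed
    finally show ?thesis by (simp add: w_def W_def Y_def)
  qed
  moreover have "25 * Fm\<^sup>2 * X ^ 7 * eps = 24 * Fm\<^sup>2 * X ^ 7 * eps + Fm\<^sup>2 * X ^ 7 * eps" by simp
  ultimately show ?thesis by linarith
qed

end

section \<open>Main terms\<close>

lemma ln_asym_scale:
  assumes "ln_asym f K m"
  shows "ln_asym (\<lambda>x. c * f x) (c * K) m"
proof -
  obtain C where C: "C \<ge> 0" "\<And>y. y \<ge> 1 \<Longrightarrow> \<bar>f y - K * ln y ^ m\<bar> \<le> C * real m * (1 + ln y) ^ (m - 1)"
    using assms by (auto simp: ln_asym_def)
  have "\<bar>c * f y - c * K * ln y ^ m\<bar> \<le> (\<bar>c\<bar> * C) * real m * (1 + ln y) ^ (m - 1)" if y: "y \<ge> 1" for y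
  proof -
    have "c * f y - c * K * ln y ^ m = c * (f y - K * ln y ^ m)" by (simp add: algebra_simps)
    thus ?thesis using mult_left_mono[OF C(2)[OF y] abs_ge_zero[of c]] by (simp add: abs_mult mult.assoc)
  qed
  thus ?thesis unfolding ln_asym_def using C by (intro exI[of _ "\<bar>c\<bar> * C"]) auto
qed

lemma ln_asym_add:
  assumes "ln_asym f K m" "ln_asym g K' m"
  shows "ln_asym (\<lambda>x. f x + g x) (K + K') m"
  using ln_asym_diff[OF assms(1) ln_asym_scale[OF assms(2), of "-1"]] by simp

lemma ln_asym_sum:
  assumes "\<And>i. i \<in> I \<Longrightarrow> ln_asym (f i) (K i) m"
  shows "ln_asym (\<lambda>x. \<Sum>i\<in>I. f i x) (\<Sum>i\<in>I. K i) m"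
  using assms
proof (induction I rule: infinite_finite_induct)
  case (insert i I)
  thus ?case using ln_asym_add[of "f i" "K i" m] by simp
qed (auto simp: ln_asym_def intro!: exI[of _ 0])

lemma ln_asym_tendsto:
  assumes "ln_asym f K m" "m > 0"
  shows "((\<lambda>x. f x / ln x ^ m) \<longlongrightarrow> K) at_top"
proof -
  obtain C where C: "C \<ge> 0" "\<And>y. y \<ge> 1 \<Longrightarrow> \<bar>f y - K * ln y ^ m\<bar> \<le> C * real m * (1 + ln y) ^ (m - 1)"
    using assms by (auto simp: ln_asym_def)
  have ev: "eventually (\<lambda>x::real. x \<ge> exp 1) at_top" by (rule eventually_ge_at_top)
  have "((\<lambda>x. f x / ln x ^ m - K) \<longlongrightarrow> 0) at_top"
  proof (rule tendsto_rabs_zero_cancel, rule tendsto_sandwich[OF _ _ tendsto_const])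
    show "\<forall>\<^sub>F x in at_top. \<bar>f x / ln x ^ m - K\<bar> \<le> (C * real m * 2 ^ (m - 1)) * (1 / ln x)"
      using ev
    proof eventually_elim
      case (elim x)
      have l: "ln x \<ge> 1" using elim by (metis exp_gt_zero ln_exp ln_le_cancel_iff less_le_trans)
      have x1: "x \<ge> 1" using elim order_trans[of 1 "exp 1" x] by simp
      have "f x / ln x ^ m - K = (f x - K * ln x ^ m) / ln x ^ m" using l by (simp add: diff_divide_distrib)
      hence "\<bar>f x / ln x ^ m - K\<bar> = \<bar>f x - K * ln x ^ m\<bar> / ln x ^ m" using l by simp
      also have "\<dots> \<le> C * real m * (1 + ln x) ^ (m - 1) / ln x ^ m"
        using C(2)[OF x1] l by (intro divide_right_mono) auto
      also have "\<dots> \<le> C * real m * (2 * ln x) ^ (m - 1) / ln x ^ m"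
        using C l by (intro divide_right_mono mult_left_mono power_mono) auto
      also have "\<dots> = (C * real m * 2 ^ (m - 1)) * (ln x ^ (m - 1) / ln x ^ m)" by (simp add: power_mult_distrib)
      also have "ln x ^ (m - 1) / ln x ^ m = 1 / ln x"
        using assms(2) l by (cases m) auto
      finally show ?case .
    qed
    show "((\<lambda>x::real. (C * real m * 2 ^ (m - 1)) * (1 / ln x)) \<longlongrightarrow> 0) at_top" by real_asymp
  qed auto
  thus ?thesis by (simp add: LIM_zero_iff)
qed

text \<open>The weight of the overview at t_i = ln u_i / ln R; the logarithm of R over the product,
  divided by ln R, is s = 1 - (t_1 + ... + t_6).\<close>

definition FR :: "nat set \<Rightarrow> real \<Rightarrow> (nat \<Rightarrow> nat) \<Rightarrow> real" where
  "FR K R u = (if real (\<Prod>i\<in>K. u i) \<le> R then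
      (\<Sum>i\<in>K. (ln (real (u i)) / ln R)\<^sup>2) + ln (R / real (\<Prod>i\<in>K. u i)) / ln R + 4 * (ln (R / real (\<Prod>i\<in>K. u i)) / ln R)\<^sup>2
    else 0)"

lemma ln_prod_tuple:
  assumes "finite K" "u \<in> PiE K (\<lambda>_. Cop Q)"
  shows "ln (real (\<Prod>i\<in>K. u i)) = (\<Sum>i\<in>K. ln (real (u i)))"
    and "\<And>i. i \<in> K \<Longrightarrow> 0 \<le> ln (real (u i))" and "real (\<Prod>i\<in>K. u i) \<ge> 1"
proof -
  have u: "u i \<ge> 1" if "i \<in> K" for i using assms that by (auto simp: Cop_def PiE_iff)
  show "ln (real (\<Prod>i\<in>K. u i)) = (\<Sum>i\<in>K. ln (real (u i)))"
    unfolding of_nat_prod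
    by (subst ln_prod) (use u assms(1) in \<open>auto simp: Suc_le_eq\<close>)
  show "0 \<le> ln (real (u i))" if "i \<in> K" for i using u[OF that] by simp
  have "(\<Prod>i\<in>K. u i) \<ge> 1" using u by (intro prod_ge_1) auto
  thus "real (\<Prod>i\<in>K. u i) \<ge> 1" by linarith
qed

lemma sum_sq_le_sq_sum:
  fixes f :: "'a \<Rightarrow> real"
  assumes "\<And>i. i \<in> K \<Longrightarrow> 0 \<le> f i"
  shows "(\<Sum>i\<in>K. (f i)\<^sup>2) \<le> (\<Sum>i\<in>K. f i)\<^sup>2"
  using assms
proof (induction K rule: infinite_finite_induct)
  case (insert a K)
  have "0 \<le> f a * (\<Sum>i\<in>K. f i)" using insert by (intro mult_nonneg_nonneg sum_nonneg) auto
  thus ?case using insert by (simp add: power2_sum)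
qed auto

text \<open>6 = 1 + 1 + 4: the sum of the squares is at most the square of the sum of the t_i, which
  is at most 1 on the support, and s lies in [0, 1].\<close>

lemma FR_bounds:
  assumes "finite K" "u \<in> PiE K (\<lambda>_. Cop Q)" "R > 1"
  shows "0 \<le> FR K R u" "FR K R u \<le> 6"
proof -
  define T where "T = real (\<Prod>i\<in>K. u i)"
  have T1: "T \<ge> 1" unfolding T_def by (rule ln_prod_tuple[OF assms(1,2)])
  have lR: "ln R > 0" using assms by simp
  have "0 \<le> FR K R u \<and> FR K R u \<le> 6"
  proof (cases "T \<le> R")
    case True
    define s where "s = ln (R / T) / ln R"
    define S2 where "S2 = (\<Sum>i\<in>K. (ln (real (u i)) / ln R)\<^sup>2)"
    have "ln (R / T) = ln R - ln T" using T1 assms by (simp add: ln_div)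
    moreover have "0 \<le> ln T" "ln T \<le> ln R" using T1 True assms by auto
    ultimately have s: "0 \<le> s" "s \<le> 1" using lR by (auto simp: s_def field_simps)
    have "S2 \<le> (\<Sum>i\<in>K. ln (real (u i)) / ln R)\<^sup>2"
      unfolding S2_def using lR ln_prod_tuple(2)[OF assms(1,2)] by (intro sum_sq_le_sq_sum) auto
    also have "(\<Sum>i\<in>K. ln (real (u i)) / ln R) = ln T / ln R"
      unfolding T_def ln_prod_tuple(1)[OF assms(1,2)] by (simp add: sum_divide_distrib)
    also have "(ln T / ln R)\<^sup>2 \<le> 1\<^sup>2" using \<open>0 \<le> ln T\<close> \<open>ln T \<le> ln R\<close> lR by (intro power_mono) auto
    finally have "S2 \<le> 1" by simp
    moreover have "0 \<le> S2" unfolding S2_def by (intro sum_nonneg) auto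
    moreover have "s\<^sup>2 \<le> 1" "s\<^sup>2 \<ge> 0" using s by (auto simp: power_le_one)
    ultimately show ?thesis using s True unfolding FR_def T_def[symmetric] s_def[symmetric] S2_def[symmetric] by auto
  next
    case False
    thus ?thesis by (simp add: FR_def T_def)
  qed
  thus "0 \<le> FR K R u" "FR K R u \<le> 6" by auto
qed

definition Dsum :: "nat \<Rightarrow> nat set \<Rightarrow> (nat \<Rightarrow> nat) \<Rightarrow> nat \<Rightarrow> real \<Rightarrow> real" where
  "Dsum Q I b e x = (\<Sum>u\<in>tuples Q I x. (\<Prod>i\<in>I. 1 / real (u i) * ln (real (u i)) ^ b i) * ln (x / real (\<Prod>i\<in>I. u i)) ^ e)"

lemma Dsum_asym:
  assumes "finite I" "Q \<ge> 1" "N = card I + (\<Sum>i\<in>I. b i) + e" "c = (\<Prod>i\<in>I. fact (b i)) * fact e / fact N"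
  shows "ln_asym (Dsum Q I b e) ((real (totient Q) / real Q) ^ card I * c) N"
  using dirichlet_sum_asym[OF assms(1,2), of b e] assms(3,4) unfolding Dsum_def by (simp only: mult.assoc times_divide_eq_right)

text \<open>With \<open>b22\<close>, the exponent vectors of the monomials t_i^2 and t_i^2 t_j^2 in
  the squared weight; for i = j the latter is t_i^4.\<close>

definition b2 :: "nat \<Rightarrow> nat \<Rightarrow> nat" where "b2 i j = (if j = i then 2 else 0)"
definition b22 :: "nat \<Rightarrow> nat \<Rightarrow> nat \<Rightarrow> nat" where "b22 i j l = b2 i l + b2 j l"

lemma prod_ln_power:
  assumes "finite I" "i \<in> I" "j \<in> I"
  shows "(\<Prod>l\<in>I. 1 / real (u l) * ln (real (u l)) ^ b2 i l) = (\<Prod>l\<in>I. 1 / real (u l)) * ln (real (u i)) ^ 2"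
    and "(\<Prod>l\<in>I. 1 / real (u l) * ln (real (u l)) ^ b22 i j l) = (\<Prod>l\<in>I. 1 / real (u l)) * (ln (real (u i)) ^ 2 * ln (real (u j)) ^ 2)"
proof -
  have 1: "(\<Prod>l\<in>I. ln (real (u l)) ^ b2 i l) = ln (real (u i)) ^ 2" if "i \<in> I" for i
  proof -
    have "(\<Prod>l\<in>I. ln (real (u l)) ^ b2 i l) = (\<Prod>l\<in>I. if l = i then ln (real (u l)) ^ 2 else 1)"
      by (intro prod.cong refl) (auto simp: b2_def)
    also have "\<dots> = ln (real (u i)) ^ 2" using that assms by simp
    finally show ?thesis .
  qed
  show "(\<Prod>l\<in>I. 1 / real (u l) * ln (real (u l)) ^ b2 i l) = (\<Prod>l\<in>I. 1 / real (u l)) * ln (real (u i)) ^ 2"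
    unfolding prod.distrib 1[OF assms(2)] ..
  show "(\<Prod>l\<in>I. 1 / real (u l) * ln (real (u l)) ^ b22 i j l) = (\<Prod>l\<in>I. 1 / real (u l)) * (ln (real (u i)) ^ 2 * ln (real (u j)) ^ 2)"
    unfolding b22_def power_add prod.distrib 1[OF assms(2)] 1[OF assms(3)] ..
qed

lemma b2_facts:
  assumes "finite I" "i \<in> I" "j \<in> I"
  shows "(\<Sum>l\<in>I. b2 i l) = 2" "(\<Prod>l\<in>I. fact (b2 i l)) = (2::real)" "(\<Sum>l\<in>I. b22 i j l) = 4"
    "(\<Prod>l\<in>I. fact (b22 i j l)) = (if i = j then 24 else 4::real)"
proof -
  show s: "(\<Sum>l\<in>I. b2 i l) = 2" using assms by (simp add: b2_def)
  have p: "(\<Prod>l\<in>I. fact (b2 i l)) = (2::real)" if "i \<in> I" for i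
  proof -
    have "(\<Prod>l\<in>I. fact (b2 i l)) = (\<Prod>l\<in>I. if l = i then (2::real) else 1)"
      by (intro prod.cong refl) (auto simp: b2_def)
    thus ?thesis using that assms by simp
  qed
  show "(\<Prod>l\<in>I. fact (b2 i l)) = (2::real)" by (rule p[OF assms(2)])
  show "(\<Sum>l\<in>I. b22 i j l) = 4" using assms by (simp add: b22_def b2_def sum.distrib)
  show "(\<Prod>l\<in>I. fact (b22 i j l)) = (if i = j then 24 else 4::real)"
  proof (cases "i = j")
    case True
    have "(\<Prod>l\<in>I. fact (b22 i j l)) = (\<Prod>l\<in>I. if l = i then (24::real) else 1)"
      using True by (intro prod.cong refl) (auto simp: b2_def b22_def fact_numeral)
    thus ?thesis using assms True by simp
  next
    case False
    have "(\<Prod>l\<in>I. fact (b22 i j l)) = (\<Prod>l\<in>I. fact (b2 i l) * (fact (b2 j l) :: real))"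
      using False by (intro prod.cong refl) (auto simp: b2_def b22_def)
    thus ?thesis using False p[OF assms(2)] p[OF assms(3)] by (simp add: prod.distrib)
  qed
qed

lemma sum_diag_const:
  assumes "finite I"
  shows "(\<Sum>i\<in>I. \<Sum>j\<in>I. c * (if i = j then a else b)) = c * (real (card I) * (a + (real (card I) - 1) * b))"
proof -
  have "(\<Sum>j\<in>I. c * (if i = j then a else b)) = c * (a + (real (card I) - 1) * b)" if i: "i \<in> I" for i
  proof -
    have "(\<Sum>j\<in>I. c * (if i = j then a else b)) = c * a + (\<Sum>j\<in>I-{i}. c * b)"
    proof -
      have "(\<Sum>j\<in>I-{i}. c * (if i = j then a else b)) = (\<Sum>j\<in>I-{i}. c * b)" by (intro sum.cong) auto
      thus ?thesis using assms i by (subst sum.remove[of _ i]) simp_all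
    qed
    also have "(\<Sum>j\<in>I-{i}. c * b) = (real (card I) - 1) * (c * b)"
      using assms i card_gt_0_iff[of I] by (auto simp: of_nat_diff)
    finally show ?thesis by (simp add: algebra_simps)
  qed
  thus ?thesis by simp
qed

text \<open>Multiplying the weight by (ln R)^2 makes it homogeneous of degree 2 in logarithms, with
  L standing for ln R. All terms of the square then have the same total degree once the powers of L
  are counted.\<close>

lemma sq_expand1:
  fixes A :: "'a \<Rightarrow> real"
  shows "((\<Sum>i\<in>I. (A i)\<^sup>2) + L * S + 4 * S\<^sup>2)\<^sup>2 =
    (\<Sum>i\<in>I. \<Sum>j\<in>I. (A i)\<^sup>2 * (A j)\<^sup>2) + 2 * (L * (\<Sum>i\<in>I. (A i)\<^sup>2 * S ^ 1)) + 8 * (\<Sum>i\<in>I. (A i)\<^sup>2 * S ^ 2)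
    + L * (L * S ^ 2) + 8 * (L * S ^ 3) + 16 * S ^ 4"
proof -
  define T where "T = (\<Sum>i\<in>I. (A i)\<^sup>2)"
  have 1: "(\<Sum>i\<in>I. \<Sum>j\<in>I. (A i)\<^sup>2 * (A j)\<^sup>2) = T * T" by (simp add: T_def sum_product)
  have 2: "(\<Sum>i\<in>I. (A i)\<^sup>2 * S ^ n) = T * S ^ n" for n by (simp add: T_def sum_distrib_right)
  show ?thesis unfolding 1 2 T_def[symmetric]
    by (simp add: power2_eq_square power3_eq_cube power4_eq_xxxx algebra_simps)
qed

text \<open>The bracket is the integral of the homogenised weight over one variable t in [0, S],
  where S is the room left by the others: the t^2 and 4 (S - t)^2 terms give 1/3 + 4/3 =
  5/3.\<close>

lemma sq_expand2:
  fixes A :: "'a \<Rightarrow> real"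
  shows "((\<Sum>i\<in>I. (A i)\<^sup>2) * S + L * S\<^sup>2 / 2 + 5 / 3 * S ^ 3)\<^sup>2 =
    (\<Sum>i\<in>I. \<Sum>j\<in>I. (A i)\<^sup>2 * (A j)\<^sup>2 * S ^ 2) + L * (\<Sum>i\<in>I. (A i)\<^sup>2 * S ^ 3) + 10 / 3 * (\<Sum>i\<in>I. (A i)\<^sup>2 * S ^ 4)
    + 1 / 4 * (L * (L * S ^ 4)) + 5 / 3 * (L * S ^ 5) + 25 / 9 * S ^ 6"
proof -
  define T where "T = (\<Sum>i\<in>I. (A i)\<^sup>2)"
  have 1: "(\<Sum>i\<in>I. \<Sum>j\<in>I. (A i)\<^sup>2 * (A j)\<^sup>2 * S ^ 2) = T * T * S ^ 2"
  proof -
    have "(\<Sum>i\<in>I. \<Sum>j\<in>I. (A i)\<^sup>2 * (A j)\<^sup>2 * S ^ 2) = (\<Sum>i\<in>I. \<Sum>j\<in>I. (A i)\<^sup>2 * (A j)\<^sup>2) * S ^ 2"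
      by (simp only: sum_distrib_right)
    also have "(\<Sum>i\<in>I. \<Sum>j\<in>I. (A i)\<^sup>2 * (A j)\<^sup>2) = T * T" by (simp only: T_def sum_product)
    finally show ?thesis .
  qed
  have 2: "(\<Sum>i\<in>I. (A i)\<^sup>2 * S ^ n) = T * S ^ n" for n by (simp add: T_def sum_distrib_right)
  have p: "S ^ 4 = S * S * S * S" "S ^ 5 = S * S * S * S * S" "S ^ 6 = S * S * S * S * S * S"
    by (simp_all add: numeral_eq_Suc)
  show ?thesis unfolding 1 2 T_def[symmetric]
    by (simp add: power2_eq_square power3_eq_cube p field_simps)
qed

definition w1 :: "nat set \<Rightarrow> (nat \<Rightarrow> nat) \<Rightarrow> real" where "w1 I u = (\<Prod>i\<in>I. 1 / real (u i))"

lemma sum_w1_Dsum: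
  assumes "finite I"
  shows "(\<Sum>u\<in>tuples Q I x. w1 I u * ln (x / real (\<Prod>i\<in>I. u i)) ^ e) = Dsum Q I (\<lambda>_. 0) e x"
    and "(\<Sum>u\<in>tuples Q I x. w1 I u * (\<Sum>i\<in>I. (ln (real (u i)))\<^sup>2 * ln (x / real (\<Prod>i\<in>I. u i)) ^ e)) = (\<Sum>i\<in>I. Dsum Q I (b2 i) e x)"
    and "(\<Sum>u\<in>tuples Q I x. w1 I u * (\<Sum>i\<in>I. \<Sum>j\<in>I. (ln (real (u i)))\<^sup>2 * (ln (real (u j)))\<^sup>2 * ln (x / real (\<Prod>i\<in>I. u i)) ^ e)) = (\<Sum>i\<in>I. \<Sum>j\<in>I. Dsum Q I (b22 i j) e x)"
proof -
  show "(\<Sum>u\<in>tuples Q I x. w1 I u * ln (x / real (\<Prod>i\<in>I. u i)) ^ e) = Dsum Q I (\<lambda>_. 0) e x"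
    unfolding Dsum_def w1_def by simp
  have "(\<Sum>u\<in>tuples Q I x. w1 I u * (\<Sum>i\<in>I. (ln (real (u i)))\<^sup>2 * ln (x / real (\<Prod>i\<in>I. u i)) ^ e))
      = (\<Sum>i\<in>I. \<Sum>u\<in>tuples Q I x. w1 I u * (ln (real (u i)))\<^sup>2 * ln (x / real (\<Prod>i\<in>I. u i)) ^ e)"
    unfolding sum_distrib_left by (subst sum.swap) (simp only: mult.assoc)
  also have "\<dots> = (\<Sum>i\<in>I. Dsum Q I (b2 i) e x)"
    unfolding Dsum_def w1_def using assms by (intro sum.cong refl) (simp only: prod_ln_power)
  finally show "(\<Sum>u\<in>tuples Q I x. w1 I u * (\<Sum>i\<in>I. (ln (real (u i)))\<^sup>2 * ln (x / real (\<Prod>i\<in>I. u i)) ^ e)) = (\<Sum>i\<in>I. Dsum Q I (b2 i) e x)" .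
  have "(\<Sum>u\<in>tuples Q I x. w1 I u * (\<Sum>i\<in>I. \<Sum>j\<in>I. (ln (real (u i)))\<^sup>2 * (ln (real (u j)))\<^sup>2 * ln (x / real (\<Prod>i\<in>I. u i)) ^ e))
     = (\<Sum>i\<in>I. \<Sum>j\<in>I. \<Sum>u\<in>tuples Q I x. w1 I u * ((ln (real (u i)))\<^sup>2 * (ln (real (u j)))\<^sup>2) * ln (x / real (\<Prod>i\<in>I. u i)) ^ e)"
    unfolding sum_distrib_left
    by (subst sum.swap, intro sum.cong refl, subst sum.swap) (simp only: mult.assoc)
  also have "\<dots> = (\<Sum>i\<in>I. \<Sum>j\<in>I. Dsum Q I (b22 i j) e x)"
    unfolding Dsum_def w1_def using assms by (intro sum.cong refl) (simp only: prod_ln_power)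
  finally show "(\<Sum>u\<in>tuples Q I x. w1 I u * (\<Sum>i\<in>I. \<Sum>j\<in>I. (ln (real (u i)))\<^sup>2 * (ln (real (u j)))\<^sup>2 * ln (x / real (\<Prod>i\<in>I. u i)) ^ e)) = (\<Sum>i\<in>I. \<Sum>j\<in>I. Dsum Q I (b22 i j) e x)" .
qed

lemma T1_asym:
  assumes K: "finite K" "card K = 6" and Q: "Q \<ge> 1"
  shows "((\<lambda>R. (\<Sum>u\<in>tuples Q K R. w1 K u * (FR K R u)\<^sup>2) / ln R ^ 6) \<longlongrightarrow> (real (totient Q) / real Q) ^ 6 * (29 / 60480)) at_top"
proof -
  define k where "k = (real (totient Q) / real Q) ^ 6"
  define f where "f x = (\<Sum>i\<in>K. \<Sum>j\<in>K. Dsum Q K (b22 i j) 0 x) + 2 * (ln x * (\<Sum>i\<in>K. Dsum Q K (b2 i) 1 x)) + 8 * (\<Sum>i\<in>K. Dsum Q K (b2 i) 2 x)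
    + ln x * (ln x * Dsum Q K (\<lambda>_. 0) 2 x) + 8 * (ln x * Dsum Q K (\<lambda>_. 0) 3 x) + 16 * Dsum Q K (\<lambda>_. 0) 4 x" for x
  have D1: "ln_asym (Dsum Q K (b22 i j) 0) (k * (1 / fact 10) * (if i = j then 24 else 4)) 10" if "i \<in> K" "j \<in> K" for i j
    using Dsum_asym[OF K(1) Q, of 10 "b22 i j" 0 "(if i = j then 24 else 4) / fact 10"] b2_facts[OF K(1) that] K
    by (simp add: k_def del: of_nat_prod fact_Suc)
  have D2: "ln_asym (Dsum Q K (b2 i) e) (k * (2 * fact e / fact (8 + e))) (8 + e)" if "i \<in> K" for i e
    using Dsum_asym[OF K(1) Q, of "8 + e" "b2 i" e "2 * fact e / fact (8 + e)"] b2_facts[OF K(1) that that] K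
    by (simp add: k_def)
  have D3: "ln_asym (Dsum Q K (\<lambda>_. 0) e) (k * (fact e / fact (6 + e))) (6 + e)" for e
    using Dsum_asym[OF K(1) Q, of "6 + e" "\<lambda>_. 0" e "fact e / fact (6 + e)"] K by (simp add: k_def)
  have f: "ln_asym f ((\<Sum>i\<in>K. \<Sum>j\<in>K. k * (1 / fact 10) * (if i = j then 24 else 4)) + 2 * (\<Sum>i\<in>K. k * (2 * fact 1 / fact 9)) + 8 * (\<Sum>i\<in>K. k * (2 * fact 2 / fact 10))
     + k * (fact 2 / fact 8) + 8 * (k * (fact 3 / fact 9)) + 16 * (k * (fact 4 / fact 10))) 10"
    unfolding f_def
  proof (intro ln_asym_add ln_asym_scale ln_asym_sum D1)
    have "ln_asym (\<lambda>x. ln x * (\<Sum>i\<in>K. Dsum Q K (b2 i) 1 x)) (\<Sum>i\<in>K. k * (2 * fact 1 / fact (8 + 1))) (Suc (8 + 1))"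
      by (intro ln_asym_times_ln ln_asym_sum D2)
    thus "ln_asym (\<lambda>x. ln x * (\<Sum>i\<in>K. Dsum Q K (b2 i) 1 x)) (\<Sum>i\<in>K. k * (2 * fact 1 / fact 9)) 10" by simp
    show "ln_asym (Dsum Q K (b2 i) 2) (k * (2 * fact 2 / fact 10)) 10" if "i \<in> K" for i
      using D2[OF that, of 2] by simp
    have "ln_asym (\<lambda>x. ln x * (ln x * Dsum Q K (\<lambda>_. 0) 2 x)) (k * (fact 2 / fact (6 + 2))) (Suc (Suc (6 + 2)))"
      by (intro ln_asym_times_ln D3)
    thus "ln_asym (\<lambda>x. ln x * (ln x * Dsum Q K (\<lambda>_. 0) 2 x)) (k * (fact 2 / fact 8)) 10" by simp
    have "ln_asym (\<lambda>x. ln x * Dsum Q K (\<lambda>_. 0) 3 x) (k * (fact 3 / fact (6 + 3))) (Suc (6 + 3))"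
      by (intro ln_asym_times_ln D3)
    thus "ln_asym (\<lambda>x. ln x * Dsum Q K (\<lambda>_. 0) 3 x) (k * (fact 3 / fact 9)) 10" by simp
    show "ln_asym (Dsum Q K (\<lambda>_. 0) 4) (k * (fact 4 / fact 10)) 10"
      using D3[of 4] by simp
  qed auto
  \<comment> \<open>Over the common denominator 10! the six terms are 264 = 6 * 24 + 30 * 4, 240,
    192, 180, 480 and 384, together 1740.\<close>
  also have "((\<Sum>i\<in>K. \<Sum>j\<in>K. k * (1 / fact 10) * (if i = j then 24 else 4)) + 2 * (\<Sum>i\<in>K. k * (2 * fact 1 / fact 9)) + 8 * (\<Sum>i\<in>K. k * (2 * fact 2 / fact 10))
     + k * (fact 2 / fact 8) + 8 * (k * (fact 3 / fact 9)) + 16 * (k * (fact 4 / fact 10))) = k * (29 / 60480)"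
    unfolding sum_diag_const[OF K(1)] using K by (simp add: fact_numeral)
  finally have lim: "((\<lambda>x. f x / ln x ^ 10) \<longlongrightarrow> k * (29 / 60480)) at_top" by (rule ln_asym_tendsto) simp
  have "\<forall>\<^sub>F R in at_top. f R / ln R ^ 10 = (\<Sum>u\<in>tuples Q K R. w1 K u * (FR K R u)\<^sup>2) / ln R ^ 6"
    using eventually_gt_at_top[of 1]
  proof eventually_elim
    case (elim R)
    have l: "ln R > 0" using elim by simp
    have "w1 K u * (FR K R u)\<^sup>2 = w1 K u * ((\<Sum>i\<in>K. (ln (real (u i)))\<^sup>2) + ln R * ln (R / real (\<Prod>i\<in>K. u i)) + 4 * (ln (R / real (\<Prod>i\<in>K. u i)))\<^sup>2)\<^sup>2 / ln R ^ 4"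
      if "u \<in> tuples Q K R" for u
    proof -
      define S where "S = ln (R / real (\<Prod>i\<in>K. u i))"
      define T where "T = (\<Sum>i\<in>K. (ln (real (u i)))\<^sup>2)"
      have "(\<Sum>i\<in>K. (ln (real (u i)) / ln R)\<^sup>2) = T / (ln R)\<^sup>2" by (simp add: T_def power_divide sum_divide_distrib)
      moreover have "real (\<Prod>i\<in>K. u i) \<le> R" using that unfolding tuples_def by blast
      ultimately have "FR K R u = T / (ln R)\<^sup>2 + S / ln R + 4 * (S / ln R)\<^sup>2" unfolding FR_def S_def by auto
      also have "\<dots> = (T + ln R * S + 4 * S\<^sup>2) / (ln R)\<^sup>2" using l by (simp add: field_simps power2_eq_square)
      finally have "(FR K R u)\<^sup>2 = (T + ln R * S + 4 * S\<^sup>2)\<^sup>2 / ((ln R)\<^sup>2)\<^sup>2" by (simp add: power_divide)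
      thus ?thesis by (simp add: S_def T_def flip: power_mult)
    qed
    hence "(\<Sum>u\<in>tuples Q K R. w1 K u * (FR K R u)\<^sup>2) = (\<Sum>u\<in>tuples Q K R. w1 K u * ((\<Sum>i\<in>K. (ln (real (u i)))\<^sup>2) + ln R * ln (R / real (\<Prod>i\<in>K. u i)) + 4 * (ln (R / real (\<Prod>i\<in>K. u i)))\<^sup>2)\<^sup>2) / ln R ^ 4"
      by (simp only: sum_divide_distrib cong: sum.cong)
    also have "(\<Sum>u\<in>tuples Q K R. w1 K u * ((\<Sum>i\<in>K. (ln (real (u i)))\<^sup>2) + ln R * ln (R / real (\<Prod>i\<in>K. u i)) + 4 * (ln (R / real (\<Prod>i\<in>K. u i)))\<^sup>2)\<^sup>2) = f R"
    proof -
      have z: "(\<Sum>i\<in>K. \<Sum>j\<in>K. (ln (real (u i)))\<^sup>2 * (ln (real (u j)))\<^sup>2) = (\<Sum>i\<in>K. \<Sum>j\<in>K. (ln (real (u i)))\<^sup>2 * (ln (real (u j)))\<^sup>2 * ln (R / real (\<Prod>i\<in>K. u i)) ^ 0)" for u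
        by simp
      have c: "(\<Sum>u\<in>T. w u * (a1 u + 2 * (l * a2 u) + 8 * a3 u + l * (l * a4 u) + 8 * (l * a5 u) + 16 * a6 u))
         = (\<Sum>u\<in>T. w u * a1 u) + 2 * (l * (\<Sum>u\<in>T. w u * a2 u)) + 8 * (\<Sum>u\<in>T. w u * a3 u)
           + l * (l * (\<Sum>u\<in>T. w u * a4 u)) + 8 * (l * (\<Sum>u\<in>T. w u * a5 u)) + 16 * (\<Sum>u\<in>T. w u * a6 u)"
        for T :: "(nat \<Rightarrow> nat) set" and w a1 a2 a3 a4 a5 a6 :: "(nat \<Rightarrow> nat) \<Rightarrow> real" and l :: real
        by (simp add: sum.distrib sum_distrib_left algebra_simps)
      show ?thesis
        unfolding sq_expand1 f_def c sum_w1_Dsum(1,2)[OF K(1)] sum_w1_Dsum(3)[OF K(1), where Q = Q and x = R and e = 0, symmetric] by simp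
    qed
    finally show ?case by (simp add: field_simps flip: power_add)
  qed
  from tendsto_cong[THEN iffD1, OF this lim] show ?thesis by (simp add: k_def)
qed


lemma ln_asym_bound:
  assumes "ln_asym f K m"
  obtains C where "C \<ge> 0" "\<And>y. y \<ge> 1 \<Longrightarrow> \<bar>f y - K * ln y ^ m\<bar> \<le> C * (1 + ln y) ^ (m - 1)"
proof -
  obtain C where C: "C \<ge> 0" "\<And>y. y \<ge> 1 \<Longrightarrow> \<bar>f y - K * ln y ^ m\<bar> \<le> C * real m * (1 + ln y) ^ (m - 1)"
    using assms by (auto simp: ln_asym_def)
  thus ?thesis by (intro that[of "C * real m"]) auto
qed

text \<open>The discrete version of integrating the weight over its m-th variable. The error is a
  constant uniform in \<open>u\<close>, which is negligible because the main term has order ln R for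
  typical tuples.\<close>

lemma inner_sum_lower:
  assumes K: "finite K" "m \<in> K" and Q: "Q \<ge> 1"
  obtains E where "E \<ge> 0" "\<And>R u. R \<ge> exp 1 \<Longrightarrow> u \<in> tuples Q (K - {m}) R \<Longrightarrow>
     (\<Sum>a\<in>Cop_le Q R. 1 / real a * FR K R (u(m := a))) \<ge>
     real (totient Q) / real Q / (ln R)\<^sup>2 * ((\<Sum>i\<in>K-{m}. (ln (real (u i)))\<^sup>2) * ln (R / real (\<Prod>i\<in>K-{m}. u i))
        + ln R * (ln (R / real (\<Prod>i\<in>K-{m}. u i)))\<^sup>2 / 2 + 5 / 3 * ln (R / real (\<Prod>i\<in>K-{m}. u i)) ^ 3) - E"
proof -
  define k where "k = real (totient Q) / real Q"
  define H where "H b e x = (\<Sum>a\<in>Cop_le Q x. 1 / real a * ln (real a) ^ b * ln (x / real a) ^ e)" for b e x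
  have Hasym: "ln_asym (H b e) (k * fact b * fact e / fact (Suc (b + e))) (Suc (b + e))" for b e
    unfolding H_def k_def by (rule sum_Cop_beta[OF Q])
  obtain C0 where C0: "C0 \<ge> 0" "\<And>y. y \<ge> 1 \<Longrightarrow> \<bar>H 0 0 y - k * ln y\<bar> \<le> C0"
    using ln_asym_bound[OF Hasym[of 0 0]] by auto
  obtain C1 where C1: "C1 \<ge> 0" "\<And>y. y \<ge> 1 \<Longrightarrow> \<bar>H 2 0 y - k / 3 * ln y ^ 3\<bar> \<le> C1 * (1 + ln y) ^ 2"
    using ln_asym_bound[OF Hasym[of 2 0]] by (auto simp: fact_numeral numeral_3_eq_3 numeral_2_eq_2)
  obtain C2 where C2: "C2 \<ge> 0" "\<And>y. y \<ge> 1 \<Longrightarrow> \<bar>H 0 1 y - k / 2 * ln y ^ 2\<bar> \<le> C2 * (1 + ln y)"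
    using ln_asym_bound[OF Hasym[of 0 1]] by (auto simp: fact_numeral numeral_2_eq_2)
  obtain C3 where C3: "C3 \<ge> 0" "\<And>y. y \<ge> 1 \<Longrightarrow> \<bar>H 0 2 y - k / 3 * ln y ^ 3\<bar> \<le> C3 * (1 + ln y) ^ 2"
    using ln_asym_bound[OF Hasym[of 0 2]] by (auto simp: fact_numeral numeral_3_eq_3 numeral_2_eq_2)
  \<comment> \<open>After division by L^2: the sum of squares is at most L^2, (1 + S)^2 <= 4 L^2
    enters twice, once with the coefficient 4 of s^2, and L (1 + S) <= 2 L^2.\<close>
  define E where "E = C0 + 4 * C1 + 2 * C2 + 16 * C3"
  show ?thesis
  proof (rule that[of E])
    show "E \<ge> 0" using C0 C1 C2 C3 by (simp add: E_def)
    fix R u assume R: "R \<ge> exp 1" and u: "u \<in> tuples Q (K - {m}) R"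
    define L where "L = ln R"
    define T where "T = real (\<Prod>i\<in>K-{m}. u i)"
    define S where "S = ln (R / T)"
    define A2 where "A2 = (\<Sum>i\<in>K-{m}. (ln (real (u i)))\<^sup>2)"
    have fin: "finite (K - {m})" using K by simp
    have uP: "u \<in> PiE (K - {m}) (\<lambda>_. Cop Q)" and TR: "T \<le> R" using u by (auto simp: tuples_def T_def)
    have T1: "T \<ge> 1" unfolding T_def by (rule ln_prod_tuple[OF fin uP])
    have R0: "R > 0" using T1 TR by simp
    have L1: "L \<ge> 1" unfolding L_def using R R0 by (metis exp_gt_zero ln_exp ln_le_cancel_iff)
    have S: "S = L - ln T" using T1 R0 by (simp add: S_def L_def ln_div)
    have lT: "0 \<le> ln T" "ln T \<le> L" using T1 TR by (auto simp: L_def)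
    have S0: "0 \<le> S" "S \<le> L" using S lT by auto
    have A2: "0 \<le> A2" "A2 \<le> L\<^sup>2"
    proof -
      show "0 \<le> A2" unfolding A2_def by (intro sum_nonneg) auto
      have "A2 \<le> (\<Sum>i\<in>K-{m}. ln (real (u i)))\<^sup>2"
        unfolding A2_def using ln_prod_tuple(2)[OF fin uP] by (intro sum_sq_le_sq_sum)
      also have "\<dots> = (ln T)\<^sup>2" unfolding T_def ln_prod_tuple(1)[OF fin uP] ..
      also have "\<dots> \<le> L\<^sup>2" using lT by (intro power_mono)
      finally show "A2 \<le> L\<^sup>2" .
    qed
    have y1: "R / T \<ge> 1" using T1 TR by simp
    have val: "FR K R (u(m := a)) = (A2 + (ln (real a))\<^sup>2 + L * ln (R / T / real a) + 4 * (ln (R / T / real a))\<^sup>2) / L\<^sup>2"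
      if a: "a \<in> Cop_le Q (R / T)" for a
    proof -
      have a1: "a \<ge> 1" "real a \<le> R / T" using a by (auto simp: Cop_le_def Cop_def)
      have pr: "(\<Prod>i\<in>K. (u(m := a)) i) = a * (\<Prod>i\<in>K-{m}. u i)"
        using K by (subst prod.remove[of K m]) (auto intro!: arg_cong2[of _ _ _ _ "(*)"] prod.cong)
      hence pr': "real (\<Prod>i\<in>K. (u(m := a)) i) = T * real a" by (simp add: T_def)
      have sm: "(\<Sum>i\<in>K. (ln (real ((u(m := a)) i)) / ln R)\<^sup>2) = ((ln (real a))\<^sup>2 + A2) / L\<^sup>2"
      proof -
        have "(\<Sum>i\<in>K. (ln (real ((u(m := a)) i)) / ln R)\<^sup>2) = (ln (real a) / L)\<^sup>2 + (\<Sum>i\<in>K-{m}. (ln (real ((u(m := a)) i)) / ln R)\<^sup>2)"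
          using K by (subst sum.remove[of K m]) (auto simp: L_def)
        also have "(\<Sum>i\<in>K-{m}. (ln (real ((u(m := a)) i)) / ln R)\<^sup>2) = (\<Sum>i\<in>K-{m}. (ln (real (u i)))\<^sup>2 / L\<^sup>2)"
          by (intro sum.cong) (auto simp: L_def power_divide)
        also have "\<dots> = A2 / L\<^sup>2" by (simp add: A2_def sum_divide_distrib)
        finally show ?thesis by (simp add: power_divide add_divide_distrib)
      qed
      have "T * real a \<le> R" using a1 T1 by (simp add: field_simps)
      hence "FR K R (u(m := a)) = ((ln (real a))\<^sup>2 + A2) / L\<^sup>2 + ln (R / (T * real a)) / L + 4 * (ln (R / (T * real a)) / L)\<^sup>2"
        unfolding FR_def pr' sm by (simp add: L_def)
      also have "R / (T * real a) = R / T / real a" by simp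
      also have "((ln (real a))\<^sup>2 + A2) / L\<^sup>2 + l / L + 4 * (l / L)\<^sup>2 = (A2 + (ln (real a))\<^sup>2 + L * l + 4 * l\<^sup>2) / L\<^sup>2" for l
      proof -
        have "l / L = L * l / L\<^sup>2" using L1 by (simp add: power2_eq_square)
        moreover have "4 * (l / L)\<^sup>2 = 4 * l\<^sup>2 / L\<^sup>2" by (simp add: power_divide)
        ultimately show ?thesis unfolding add_divide_distrib by linarith
      qed
      finally show ?thesis .
    qed
    have FR0: "FR K R (u(m := a)) = 0" if a: "a \<in> Cop_le Q R" "a \<notin> Cop_le Q (R / T)" for a
    proof -
      have "real a > R / T" using a by (auto simp: Cop_le_def)
      hence "\<not> T * real a \<le> R" using T1 by (simp add: field_simps)
      moreover have "(\<Prod>i\<in>K. (u(m := a)) i) = a * (\<Prod>i\<in>K-{m}. u i)"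
        using K by (subst prod.remove[of K m]) (auto intro!: arg_cong2[of _ _ _ _ "(*)"] prod.cong)
      hence "real (\<Prod>i\<in>K. (u(m := a)) i) = T * real a" by (simp add: T_def)
      ultimately show ?thesis unfolding FR_def by simp
    qed
    have sub: "Cop_le Q (R / T) \<subseteq> Cop_le Q R"
    proof -
      have "R / T \<le> R" using T1 R0 by (simp add: field_simps)
      thus ?thesis by (auto simp: Cop_le_def)
    qed
    have "(\<Sum>a\<in>Cop_le Q R. 1 / real a * FR K R (u(m := a))) = (\<Sum>a\<in>Cop_le Q (R / T). 1 / real a * FR K R (u(m := a)))"
      using sub FR0 by (intro sum.mono_neutral_right) auto
    also have "\<dots> = (\<Sum>a\<in>Cop_le Q (R / T). 1 / real a * ((A2 + (ln (real a))\<^sup>2 + L * ln (R / T / real a) + 4 * (ln (R / T / real a))\<^sup>2) / L\<^sup>2))"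
      by (intro sum.cong refl) (simp only: val)
    also have "\<dots> = (A2 * H 0 0 (R / T) + H 2 0 (R / T) + L * H 0 1 (R / T) + 4 * H 0 2 (R / T)) / L\<^sup>2"
      unfolding H_def sum_distrib_left sum.distrib[symmetric] sum_divide_distrib
      by (intro sum.cong refl) (simp add: add_divide_distrib mult_ac)
    finally have eq: "(\<Sum>a\<in>Cop_le Q R. 1 / real a * FR K R (u(m := a))) = (A2 * H 0 0 (R / T) + H 2 0 (R / T) + L * H 0 1 (R / T) + 4 * H 0 2 (R / T)) / L\<^sup>2" .
    have sq: "(1 + S)\<^sup>2 \<le> 4 * L\<^sup>2"
    proof -
      have "(1 + S)\<^sup>2 \<le> (2 * L)\<^sup>2" using S0 L1 by (intro power_mono) auto
      thus ?thesis by (simp add: power_mult_distrib)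
    qed
    have e0: "A2 * H 0 0 (R / T) \<ge> A2 * (k * S) - L\<^sup>2 * C0"
    proof -
      have "A2 * (k * S - C0) \<le> A2 * H 0 0 (R / T)" using C0(2)[OF y1] A2 by (intro mult_left_mono) (auto simp: S_def)
      moreover have "A2 * C0 \<le> L\<^sup>2 * C0" using A2 C0 by (intro mult_right_mono) auto
      ultimately show ?thesis by (simp add: algebra_simps)
    qed
    have e1: "H 2 0 (R / T) \<ge> k / 3 * S ^ 3 - C1 * (4 * L\<^sup>2)"
      using C1(2)[OF y1] mult_left_mono[OF sq C1(1)] unfolding S_def[symmetric] by linarith
    have e2: "L * H 0 1 (R / T) \<ge> L * (k / 2 * S ^ 2) - C2 * (2 * L\<^sup>2)"
    proof -
      have "C2 * (1 + S) \<le> C2 * (2 * L)" using S0 L1 C2 by (intro mult_left_mono) auto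
      hence "H 0 1 (R / T) \<ge> k / 2 * S ^ 2 - C2 * (2 * L)" using C2(2)[OF y1] unfolding S_def[symmetric] by linarith
      hence "L * (k / 2 * S ^ 2 - C2 * (2 * L)) \<le> L * H 0 1 (R / T)" using L1 by (intro mult_left_mono) auto
      thus ?thesis by (simp add: algebra_simps power2_eq_square)
    qed
    have e3: "H 0 2 (R / T) \<ge> k / 3 * S ^ 3 - C3 * (4 * L\<^sup>2)"
      using C3(2)[OF y1] mult_left_mono[OF sq C3(1)] unfolding S_def[symmetric] by linarith
    have "k * (A2 * S + L * S\<^sup>2 / 2 + 5 / 3 * S ^ 3) - E * L\<^sup>2 \<le> A2 * H 0 0 (R / T) + H 2 0 (R / T) + L * H 0 1 (R / T) + 4 * H 0 2 (R / T)"
      using e0 e1 e2 e3 unfolding E_def by (simp add: algebra_simps)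
    hence "(k * (A2 * S + L * S\<^sup>2 / 2 + 5 / 3 * S ^ 3) - E * L\<^sup>2) / L\<^sup>2 \<le> (A2 * H 0 0 (R / T) + H 2 0 (R / T) + L * H 0 1 (R / T) + 4 * H 0 2 (R / T)) / L\<^sup>2"
      by (intro divide_right_mono) auto
    also have "(k * (A2 * S + L * S\<^sup>2 / 2 + 5 / 3 * S ^ 3) - E * L\<^sup>2) / L\<^sup>2 = k / L\<^sup>2 * (A2 * S + L * S\<^sup>2 / 2 + 5 / 3 * S ^ 3) - E"
      using L1 by (simp add: diff_divide_distrib)
    finally have fin: "(\<Sum>a\<in>Cop_le Q R. 1 / real a * FR K R (u(m := a))) \<ge> k / L\<^sup>2 * (A2 * S + L * S\<^sup>2 / 2 + 5 / 3 * S ^ 3) - E"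
      unfolding eq .
    show "(\<Sum>a\<in>Cop_le Q R. 1 / real a * FR K R (u(m := a))) \<ge>
     real (totient Q) / real Q / (ln R)\<^sup>2 * ((\<Sum>i\<in>K-{m}. (ln (real (u i)))\<^sup>2) * ln (R / real (\<Prod>i\<in>K-{m}. u i))
        + ln R * (ln (R / real (\<Prod>i\<in>K-{m}. u i)))\<^sup>2 / 2 + 5 / 3 * ln (R / real (\<Prod>i\<in>K-{m}. u i)) ^ 3) - E"
      using fin unfolding k_def L_def A2_def S_def T_def .
  qed
qed

lemma G2_asym:
  assumes I: "finite I" "card I = 5" and Q: "Q \<ge> 1"
  shows "((\<lambda>R. (\<Sum>u\<in>tuples Q I R. w1 I u * ((\<Sum>i\<in>I. (ln (real (u i)))\<^sup>2) * ln (R / real (\<Prod>i\<in>I. u i))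
        + ln R * (ln (R / real (\<Prod>i\<in>I. u i)))\<^sup>2 / 2 + 5 / 3 * ln (R / real (\<Prod>i\<in>I. u i)) ^ 3)\<^sup>2) / ln R ^ 11)
      \<longlongrightarrow> (real (totient Q) / real Q) ^ 5 * (1 / 5940)) at_top"
proof -
  define k where "k = (real (totient Q) / real Q) ^ 5"
  define f where "f x = (\<Sum>i\<in>I. \<Sum>j\<in>I. Dsum Q I (b22 i j) 2 x) + ln x * (\<Sum>i\<in>I. Dsum Q I (b2 i) 3 x) + 10 / 3 * (\<Sum>i\<in>I. Dsum Q I (b2 i) 4 x)
    + 1 / 4 * (ln x * (ln x * Dsum Q I (\<lambda>_. 0) 4 x)) + 5 / 3 * (ln x * Dsum Q I (\<lambda>_. 0) 5 x) + 25 / 9 * Dsum Q I (\<lambda>_. 0) 6 x" for x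
  have D1: "ln_asym (Dsum Q I (b22 i j) 2) (k * (2 / fact 11) * (if i = j then 24 else 4)) 11" if "i \<in> I" "j \<in> I" for i j
    using Dsum_asym[OF I(1) Q, of 11 "b22 i j" 2 "(if i = j then 24 else 4) * 2 / fact 11"] b2_facts[OF I(1) that] I
    by (cases "i = j") (simp_all add: k_def mult_ac del: of_nat_prod fact_Suc)
  have D2: "ln_asym (Dsum Q I (b2 i) e) (k * (2 * fact e / fact (7 + e))) (7 + e)" if "i \<in> I" for i e
    using Dsum_asym[OF I(1) Q, of "7 + e" "b2 i" e "2 * fact e / fact (7 + e)"] b2_facts[OF I(1) that that] I
    by (simp add: k_def)
  have D3: "ln_asym (Dsum Q I (\<lambda>_. 0) e) (k * (fact e / fact (5 + e))) (5 + e)" for e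
    using Dsum_asym[OF I(1) Q, of "5 + e" "\<lambda>_. 0" e "fact e / fact (5 + e)"] I by (simp add: k_def)
  have f: "ln_asym f ((\<Sum>i\<in>I. \<Sum>j\<in>I. k * (2 / fact 11) * (if i = j then 24 else 4)) + (\<Sum>i\<in>I. k * (2 * fact 3 / fact 10)) + 10 / 3 * (\<Sum>i\<in>I. k * (2 * fact 4 / fact 11))
     + 1 / 4 * (k * (fact 4 / fact 9)) + 5 / 3 * (k * (fact 5 / fact 10)) + 25 / 9 * (k * (fact 6 / fact 11))) 11"
    unfolding f_def
  proof (intro ln_asym_add ln_asym_scale ln_asym_sum D1)
    have "ln_asym (\<lambda>x. ln x * (\<Sum>i\<in>I. Dsum Q I (b2 i) 3 x)) (\<Sum>i\<in>I. k * (2 * fact 3 / fact (7 + 3))) (Suc (7 + 3))"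
      by (intro ln_asym_times_ln ln_asym_sum D2)
    thus "ln_asym (\<lambda>x. ln x * (\<Sum>i\<in>I. Dsum Q I (b2 i) 3 x)) (\<Sum>i\<in>I. k * (2 * fact 3 / fact 10)) 11" by simp
    show "ln_asym (Dsum Q I (b2 i) 4) (k * (2 * fact 4 / fact 11)) 11" if "i \<in> I" for i
      using D2[OF that, of 4] by simp
    have "ln_asym (\<lambda>x. ln x * (ln x * Dsum Q I (\<lambda>_. 0) 4 x)) (k * (fact 4 / fact (5 + 4))) (Suc (Suc (5 + 4)))"
      by (intro ln_asym_times_ln D3)
    thus "ln_asym (\<lambda>x. ln x * (ln x * Dsum Q I (\<lambda>_. 0) 4 x)) (k * (fact 4 / fact 9)) 11" by simp
    have "ln_asym (\<lambda>x. ln x * Dsum Q I (\<lambda>_. 0) 5 x) (k * (fact 5 / fact (5 + 5))) (Suc (5 + 5))"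
      by (intro ln_asym_times_ln D3)
    thus "ln_asym (\<lambda>x. ln x * Dsum Q I (\<lambda>_. 0) 5 x) (k * (fact 5 / fact 10)) 11" by simp
    show "ln_asym (Dsum Q I (\<lambda>_. 0) 6) (k * (fact 6 / fact 11)) 11"
      using D3[of 6] by simp
  qed auto
  \<comment> \<open>Over 11! the six terms are 400 = 2 * (5 * 24 + 20 * 4), 660, 800, 660, 2200 and
    2000, together 6720, and 11! / 6720 = 5940.\<close>
  also have "((\<Sum>i\<in>I. \<Sum>j\<in>I. k * (2 / fact 11) * (if i = j then 24 else 4)) + (\<Sum>i\<in>I. k * (2 * fact 3 / fact 10)) + 10 / 3 * (\<Sum>i\<in>I. k * (2 * fact 4 / fact 11))
     + 1 / 4 * (k * (fact 4 / fact 9)) + 5 / 3 * (k * (fact 5 / fact 10)) + 25 / 9 * (k * (fact 6 / fact 11))) = k * (1 / 5940)"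
    unfolding sum_diag_const[OF I(1)] using I by (simp add: fact_numeral)
  finally have lim: "((\<lambda>x. f x / ln x ^ 11) \<longlongrightarrow> k * (1 / 5940)) at_top" by (rule ln_asym_tendsto) simp
  have c: "(\<Sum>u\<in>T. w u * (a1 u + l * a2 u + c1 * a3 u + c2 * (l * (l * a4 u)) + c3 * (l * a5 u) + c4 * a6 u))
     = (\<Sum>u\<in>T. w u * a1 u) + l * (\<Sum>u\<in>T. w u * a2 u) + c1 * (\<Sum>u\<in>T. w u * a3 u)
       + c2 * (l * (l * (\<Sum>u\<in>T. w u * a4 u))) + c3 * (l * (\<Sum>u\<in>T. w u * a5 u)) + c4 * (\<Sum>u\<in>T. w u * a6 u)"
    for T :: "(nat \<Rightarrow> nat) set" and w a1 a2 a3 a4 a5 a6 :: "(nat \<Rightarrow> nat) \<Rightarrow> real" and l c1 c2 c3 c4 :: real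
    by (simp add: sum.distrib sum_distrib_left algebra_simps)
  have "f = (\<lambda>R. (\<Sum>u\<in>tuples Q I R. w1 I u * ((\<Sum>i\<in>I. (ln (real (u i)))\<^sup>2) * ln (R / real (\<Prod>i\<in>I. u i))
        + ln R * (ln (R / real (\<Prod>i\<in>I. u i)))\<^sup>2 / 2 + 5 / 3 * ln (R / real (\<Prod>i\<in>I. u i)) ^ 3)\<^sup>2))"
    unfolding sq_expand2 f_def c sum_w1_Dsum[OF I(1)] ..
  thus ?thesis using lim by (simp only: k_def)
qed

text \<open>Squaring the inner lower bound leaves a cross term of order ln R for each tuple. Summed
  over five coordinates it has order (ln R)^6, one logarithm below the main term, and eta absorbs
  it.\<close>

lemma T2_lower:
  assumes K: "finite K" "card K = 6" "m \<in> K" and Q: "Q \<ge> 1" and eta: "\<eta> > 0"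
  shows "\<forall>\<^sub>F R in at_top. (\<Sum>u\<in>tuples Q (K - {m}) R. w1 (K - {m}) u * (\<Sum>a\<in>Cop_le Q R. 1 / real a * FR K R (u(m := a)))\<^sup>2)
     \<ge> (real (totient Q) / real Q) ^ 7 * ln R ^ 7 * (1 / 5940 - \<eta>)"
proof -
  let ?I = "K - {m}"
  define k where "k = real (totient Q) / real Q"
  have k: "k > 0" "k \<le> 1" using Q totient_le[of Q] by (auto simp: k_def field_simps)
  have I: "finite ?I" "card ?I = 5" using K by auto
  define G where "G R u = (\<Sum>i\<in>?I. (ln (real (u i)))\<^sup>2) * ln (R / real (\<Prod>i\<in>?I. u i))
        + ln R * (ln (R / real (\<Prod>i\<in>?I. u i)))\<^sup>2 / 2 + 5 / 3 * ln (R / real (\<Prod>i\<in>?I. u i)) ^ 3" for R u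
  define Y where "Y R u = (\<Sum>a\<in>Cop_le Q R. 1 / real a * FR K R (u(m := a)))" for R u
  obtain E where E: "E \<ge> 0" "\<And>R u. R \<ge> exp 1 \<Longrightarrow> u \<in> tuples Q ?I R \<Longrightarrow> Y R u \<ge> k / (ln R)\<^sup>2 * G R u - E"
  proof (rule inner_sum_lower[OF K(1,3) Q, folded k_def G_def Y_def])
    fix E assume "E \<ge> 0" "\<And>R u. R \<ge> exp 1 \<Longrightarrow> u \<in> tuples Q ?I R \<Longrightarrow> Y R u \<ge> k / (ln R)\<^sup>2 * G R u - E"
    thus thesis by (rule that)
  qed
  have lim1: "((\<lambda>R. (\<Sum>u\<in>tuples Q ?I R. w1 ?I u * (G R u)\<^sup>2) / ln R ^ 11) \<longlongrightarrow> k ^ 5 * (1 / 5940)) at_top"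
    using G2_asym[OF I Q] unfolding G_def k_def .
  have lim2: "((\<lambda>R. (\<Sum>u\<in>tuples Q ?I R. w1 ?I u) / ln R ^ 5) \<longlongrightarrow> k ^ 5 * (1 / fact 5)) at_top"
  proof -
    have "ln_asym (Dsum Q ?I (\<lambda>_. 0) 0) (k ^ 5 * (1 / fact 5)) 5"
      using Dsum_asym[OF I(1) Q, of 5 "\<lambda>_. 0" 0 "1 / fact 5"] I by (simp add: k_def)
    from ln_asym_tendsto[OF this] show ?thesis
      using sum_w1_Dsum(1)[OF I(1), where e = 0] by simp
  qed
  have "((\<lambda>R. k\<^sup>2 * ((\<Sum>u\<in>tuples Q ?I R. w1 ?I u * (G R u)\<^sup>2) / ln R ^ 11) - 8 * E * k * ((\<Sum>u\<in>tuples Q ?I R. w1 ?I u) / ln R ^ 5) * (1 / ln R))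
     \<longlongrightarrow> k\<^sup>2 * (k ^ 5 * (1 / 5940)) - 8 * E * k * (k ^ 5 * (1 / fact 5)) * 0) at_top"
    by (intro tendsto_diff tendsto_mult tendsto_const lim1 lim2) real_asymp
  hence "((\<lambda>R. k\<^sup>2 * ((\<Sum>u\<in>tuples Q ?I R. w1 ?I u * (G R u)\<^sup>2) / ln R ^ 11) - 8 * E * k * ((\<Sum>u\<in>tuples Q ?I R. w1 ?I u) / ln R ^ 5) * (1 / ln R))
     \<longlongrightarrow> k ^ 7 * (1 / 5940)) at_top" by (simp flip: power_add)
  moreover have "k ^ 7 * (1 / 5940 - \<eta>) < k ^ 7 * (1 / 5940)" using k eta by simp
  ultimately have ev: "\<forall>\<^sub>F R in at_top. k ^ 7 * (1 / 5940 - \<eta>) < k\<^sup>2 * ((\<Sum>u\<in>tuples Q ?I R. w1 ?I u * (G R u)\<^sup>2) / ln R ^ 11) - 8 * E * k * ((\<Sum>u\<in>tuples Q ?I R. w1 ?I u) / ln R ^ 5) * (1 / ln R)"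
    by (rule order_tendstoD(1))
  show ?thesis
    using ev eventually_ge_at_top[of "exp 1"]
  proof eventually_elim
    case (elim R)
    define L where "L = ln R"
    have R0: "R > 0" using elim(2) exp_gt_zero[of 1] by linarith
    have L1: "L \<ge> 1" unfolding L_def using elim(2) R0 by (metis exp_gt_zero ln_exp ln_le_cancel_iff)
    have w0: "w1 ?I u \<ge> 0" for u unfolding w1_def by (intro prod_nonneg) auto
    have each: "(Y R u)\<^sup>2 \<ge> k\<^sup>2 / L ^ 4 * (G R u)\<^sup>2 - 8 * E * k * L" if u: "u \<in> tuples Q ?I R" for u
    proof -
      define T where "T = real (\<Prod>i\<in>?I. u i)"
      define S where "S = ln (R / T)"
      define A2 where "A2 = (\<Sum>i\<in>?I. (ln (real (u i)))\<^sup>2)"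
      have uP: "u \<in> PiE ?I (\<lambda>_. Cop Q)" and TR: "T \<le> R" using u by (auto simp: tuples_def T_def)
      have T1: "T \<ge> 1" unfolding T_def by (rule ln_prod_tuple[OF I(1) uP])
      have lT: "0 \<le> ln T" "ln T \<le> L" using T1 TR by (auto simp: L_def)
      have "S = L - ln T" using T1 R0 by (simp add: S_def L_def ln_div)
      hence S0: "0 \<le> S" "S \<le> L" using lT by auto
      have "A2 \<le> (\<Sum>i\<in>?I. ln (real (u i)))\<^sup>2"
        unfolding A2_def using ln_prod_tuple(2)[OF I(1) uP] by (intro sum_sq_le_sq_sum)
      also have "\<dots> = (ln T)\<^sup>2" unfolding T_def ln_prod_tuple(1)[OF I(1) uP] ..
      also have "\<dots> \<le> L\<^sup>2" using lT by (intro power_mono)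
      finally have A2: "A2 \<le> L\<^sup>2" .
      have A20: "0 \<le> A2" unfolding A2_def by (intro sum_nonneg) auto
      have G: "G R u = A2 * S + L * S\<^sup>2 / 2 + 5 / 3 * S ^ 3" unfolding G_def A2_def S_def T_def L_def ..
      have "A2 * S \<le> L\<^sup>2 * L" using A2 S0 by (intro mult_mono) auto
      moreover have "L * S\<^sup>2 \<le> L * L\<^sup>2" using S0 L1 by (intro mult_left_mono power_mono) auto
      moreover have "S ^ 3 \<le> L ^ 3" using S0 by (intro power_mono) auto
      moreover have "L\<^sup>2 * L = L ^ 3" "L * L\<^sup>2 = L ^ 3" "0 \<le> L ^ 3" using L1 by (simp_all add: power2_eq_square power3_eq_cube)
      \<comment> \<open>1 + 1/2 + 5/3 is below 4. It follows that z <= 4 k L, so that the cross term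
        2 z E is at most 8 E k L.\<close>
      ultimately have Gle: "G R u \<le> 4 * L ^ 3" unfolding G by linarith
      have G0: "0 \<le> G R u" unfolding G using A20 S0 L1 by (intro add_nonneg_nonneg mult_nonneg_nonneg) auto
      define z where "z = k / L\<^sup>2 * G R u"
      have z0: "z \<ge> 0" unfolding z_def using k G0 by (intro mult_nonneg_nonneg) auto
      have "z \<le> k / L\<^sup>2 * (4 * L ^ 3)" unfolding z_def using Gle k by (intro mult_left_mono) auto
      also have "\<dots> = 4 * k * L" using L1 by (simp add: power2_eq_square power3_eq_cube)
      finally have zle: "z \<le> 4 * k * L" .
      have Yz: "Y R u \<ge> z - E" unfolding z_def L_def using E(2)[OF elim(2) u] .
      have "(Y R u)\<^sup>2 \<ge> z\<^sup>2 - 2 * z * E"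
      proof (cases "z \<ge> E")
        case True
        have "(z - E)\<^sup>2 \<le> (Y R u)\<^sup>2" using Yz True by (intro power_mono) auto
        moreover have "(z - E)\<^sup>2 = z\<^sup>2 - 2 * z * E + E\<^sup>2" by (simp add: power2_diff)
        ultimately show ?thesis using zero_le_power2[of E] by linarith
      next
        case False
        have "z * z \<le> z * E" "0 \<le> z * E" using False z0 E by (auto intro: mult_left_mono)
        hence "z\<^sup>2 \<le> z * E" by (simp add: power2_eq_square)
        thus ?thesis using zero_le_power2[of "Y R u"] \<open>0 \<le> z * E\<close> by linarith
      qed
      moreover have "z * E \<le> 4 * k * L * E" using zle E by (intro mult_right_mono) auto
      moreover have "z\<^sup>2 = k\<^sup>2 / L ^ 4 * (G R u)\<^sup>2" by (simp add: z_def power_mult_distrib power_divide flip: power_mult)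
      ultimately show ?thesis by (simp add: mult_ac)
    qed
    have "(\<Sum>u\<in>tuples Q ?I R. w1 ?I u * (Y R u)\<^sup>2) \<ge> (\<Sum>u\<in>tuples Q ?I R. w1 ?I u * (k\<^sup>2 / L ^ 4 * (G R u)\<^sup>2 - 8 * E * k * L))"
      using each w0 by (intro sum_mono mult_left_mono) auto
    also have "(\<Sum>u\<in>tuples Q ?I R. w1 ?I u * (k\<^sup>2 / L ^ 4 * (G R u)\<^sup>2 - 8 * E * k * L))
       = k\<^sup>2 / L ^ 4 * (\<Sum>u\<in>tuples Q ?I R. w1 ?I u * (G R u)\<^sup>2) - 8 * E * k * L * (\<Sum>u\<in>tuples Q ?I R. w1 ?I u)"
      by (simp add: right_diff_distrib sum_subtractf sum_distrib_left mult_ac)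
    also have "\<dots> = L ^ 7 * (k\<^sup>2 * ((\<Sum>u\<in>tuples Q ?I R. w1 ?I u * (G R u)\<^sup>2) / L ^ 11) - 8 * E * k * ((\<Sum>u\<in>tuples Q ?I R. w1 ?I u) / L ^ 5) * (1 / L))"
    proof -
      have Lp: "L ^ 11 = L ^ 4 * L ^ 7" "L ^ 7 = L * L * L ^ 5" "L \<noteq> 0" using L1 by (simp_all add: eval_nat_numeral)
      have "k\<^sup>2 / L ^ 4 * g = L ^ 7 * (k\<^sup>2 * (g / L ^ 11))" for g
        unfolding Lp(1) using Lp(3) by (simp add: field_simps)
      moreover have "8 * E * k * L * g = L ^ 7 * (8 * E * k * (g / L ^ 5) * (1 / L))" for g
        unfolding Lp(2) using Lp(3) by (simp add: field_simps)
      ultimately show ?thesis by (simp only: right_diff_distrib)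
    qed
    also have "\<dots> \<ge> L ^ 7 * (k ^ 7 * (1 / 5940 - \<eta>))"
      using elim(1) L1 unfolding L_def by (intro mult_left_mono) auto
    finally show ?case unfolding Y_def L_def k_def by (simp only: mult_ac)
  qed
qed

section \<open>Counting in residue classes\<close>

lemma crt_prime_set:
  fixes q v :: nat and r :: "nat \<Rightarrow> nat"
  assumes "finite B" "\<And>p. p \<in> B \<Longrightarrow> prime p" "\<And>p. p \<in> B \<Longrightarrow> \<not> p dvd q"
  shows "\<exists>a. \<forall>n. [n = a] (mod q * \<Prod>B) \<longleftrightarrow> [n = v] (mod q) \<and> (\<forall>p\<in>B. [n = r p] (mod p))"
  using assms
proof (induction B)
  case empty
  show ?case by (rule exI[of _ v]) simp
next
  case (insert p B)
  have ex: "\<exists>a. \<forall>n. [n = a] (mod q * \<Prod>B) \<longleftrightarrow> [n = v] (mod q) \<and> (\<forall>p\<in>B. [n = r p] (mod p))"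
    by (rule insert.IH) (use insert.prems in auto)
  then obtain a where a: "\<And>n. [n = a] (mod q * \<Prod>B) \<longleftrightarrow> [n = v] (mod q) \<and> (\<forall>p\<in>B. [n = r p] (mod p))" by blast
  have pp: "prime p" using insert.prems by simp
  have "\<not> p dvd \<Prod>B"
  proof
    assume "p dvd \<Prod>B"
    then obtain x where x: "x \<in> B" "p dvd x"
      using prime_dvd_prod_iff[of B p "\<lambda>x. x"] insert.hyps(1) pp by auto
    hence "p = x" using primes_dvd_imp_eq[of p x] pp insert.prems(1)[of x] by simp
    thus False using x insert.hyps(2) by simp
  qed
  hence "\<not> p dvd q * \<Prod>B" using insert.prems(2)[of p] pp by (simp add: prime_dvd_mult_iff)
  hence "coprime p (q * \<Prod>B)" by (rule prime_imp_coprime[OF pp])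
  hence cop: "coprime (q * \<Prod>B) p" by (rule coprime_commute[THEN iffD1])
  obtain x where x: "[x = a] (mod q * \<Prod>B)" "[x = r p] (mod p)"
    using binary_chinese_remainder_nat[OF cop, of a "r p"] by blast
  have "[n = x] (mod q * \<Prod>(insert p B)) \<longleftrightarrow> [n = v] (mod q) \<and> (\<forall>p\<in>insert p B. [n = r p] (mod p))" for n
  proof -
    have e: "q * \<Prod>(insert p B) = (q * \<Prod>B) * p" using insert.hyps by simp
    have "[n = x] (mod (q * \<Prod>B) * p) \<longleftrightarrow> [n = x] (mod q * \<Prod>B) \<and> [n = x] (mod p)"
    proof
      assume "[n = x] (mod q * \<Prod>B * p)"
      thus "[n = x] (mod q * \<Prod>B) \<and> [n = x] (mod p)"
        using cong_modulus_mult_nat[of n x "q * \<Prod>B" p] cong_modulus_mult_nat[of n x p "q * \<Prod>B"] by (simp add: mult.commute)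
    next
      assume "[n = x] (mod q * \<Prod>B) \<and> [n = x] (mod p)"
      thus "[n = x] (mod q * \<Prod>B * p)" using coprime_cong_mult_nat[OF _ _ cop] by simp
    qed
    also have "[n = x] (mod q * \<Prod>B) \<longleftrightarrow> [n = a] (mod q * \<Prod>B)" using x(1) by (simp add: cong_def)
    also have "[n = x] (mod p) \<longleftrightarrow> [n = r p] (mod p)" using x(2) by (simp add: cong_def)
    finally show ?thesis unfolding e a by auto
  qed
  thus ?case by blast
qed

lemma coprime_crt:
  fixes q a :: nat
  assumes "finite B" "\<And>p. p \<in> B \<Longrightarrow> prime p" "coprime v q" "\<And>p. p \<in> B \<Longrightarrow> coprime (r p) p"
    and "[a = v] (mod q)" "\<forall>p\<in>B. [a = r p] (mod p)"
  shows "coprime a (q * \<Prod>B)"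
proof -
  have 1: "coprime a q" using assms(3,5) cong_imp_coprime[OF cong_sym[OF assms(5)]] by simp
  have "coprime a p" if "p \<in> B" for p
    using assms(4)[OF that] cong_imp_coprime[OF cong_sym[of a "r p" p]] assms(6) that by simp
  hence "coprime a (\<Prod>B)" by (intro prod_coprime_right) auto
  thus ?thesis using 1 by simp
qed

lemma card_residue_le:
  fixes z :: real
  assumes q: "q \<ge> 1" and z: "z \<ge> 0"
  shows "real (card {n::nat. real n \<le> z \<and> [n = a] (mod q)}) > (z - real (a mod q)) / real q"
    and "real (card {n::nat. real n \<le> z \<and> [n = a] (mod q)}) \<le> (z - real (a mod q)) / real q + 1"
    and "finite {n::nat. real n \<le> z \<and> [n = a] (mod q)}"
proof -
  define b where "b = a mod q"
  have b: "b < q" using q by (simp add: b_def)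
  define S where "S = {n::nat. real n \<le> z \<and> [n = a] (mod q)}"
  define J where "J = {j::nat. real j \<le> (z - real b) / real q}"
  have q0: "real q > 0" using q by simp
  have S: "S = (\<lambda>j. b + j * q) ` J"
  proof (intro equalityI subsetI)
    fix n assume n: "n \<in> S"
    have nb: "n mod q = b" using n by (simp add: S_def b_def cong_def)
    have e: "n = b + (n div q) * q" using nb by (metis add.commute div_mult_mod_eq)
    hence "real n = real b + real (n div q) * real q" by (metis of_nat_add of_nat_mult)
    hence "real (n div q) \<le> (z - real b) / real q" using n q0 by (simp add: S_def field_simps)
    thus "n \<in> (\<lambda>j. b + j * q) ` J" using e by (auto simp: J_def)
  next
    fix n assume "n \<in> (\<lambda>j. b + j * q) ` J"
    then obtain j where j: "n = b + j * q" "real j \<le> (z - real b) / real q" by (auto simp: J_def)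
    have "real n \<le> z" using j q0 by (simp add: field_simps)
    moreover have "[n = a] (mod q)" using j b by (simp add: cong_def b_def)
    ultimately show "n \<in> S" by (simp add: S_def)
  qed
  have card: "card S = card J" unfolding S using q by (intro card_image) (auto simp: inj_on_def)
  have fin: "finite J \<and> real (card J) > (z - real b) / real q \<and> real (card J) \<le> (z - real b) / real q + 1"
  proof (cases "z \<ge> real b")
    case True
    define t where "t = (z - real b) / real q"
    have t: "t \<ge> 0" using True q0 by (simp add: t_def)
    have "J = {..nat \<lfloor>t\<rfloor>}" using t by (auto simp: J_def t_def[symmetric] le_nat_floor) linarith
    hence J: "real (card J) = real (nat \<lfloor>t\<rfloor>) + 1" "finite J" by auto
    have "real (nat \<lfloor>t\<rfloor>) \<le> t" "t < real (nat \<lfloor>t\<rfloor>) + 1" using t by linarith+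
    hence "real (card J) > t" "real (card J) \<le> t + 1" using J(1) by linarith+
    thus ?thesis using J(2) by (simp add: t_def)
  next
    case False
    have lt: "(z - real b) / real q < 0" using False q0 by (simp add: field_simps)
    hence "J = {}" by (auto simp: J_def)
    moreover have "(z - real b) / real q + 1 \<ge> 0" using z b q0 by (simp add: field_simps)
    ultimately show ?thesis using lt by simp
  qed
  show "real (card {n::nat. real n \<le> z \<and> [n = a] (mod q)}) > (z - real (a mod q)) / real q"
    and "real (card {n::nat. real n \<le> z \<and> [n = a] (mod q)}) \<le> (z - real (a mod q)) / real q + 1"
    using fin card unfolding S_def b_def by simp_all
  have "finite S" unfolding S using fin by simp
  thus "finite {n::nat. real n \<le> z \<and> [n = a] (mod q)}" by (simp add: S_def)
qed

text \<open>Counts up to z lie in a half-open interval (t, t + 1] with t linear in z, so the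
  difference of two of them deviates from its expected value by less than 1 rather than 2.\<close>

lemma card_residue_interval:
  fixes x y :: real
  assumes "q \<ge> 1" "0 \<le> x" "x \<le> y"
  shows "\<bar>real (card {n::nat. x < real n \<and> real n \<le> y \<and> [n = a] (mod q)}) - (y - x) / real q\<bar> \<le> 1"
    and "finite {n::nat. x < real n \<and> real n \<le> y \<and> [n = a] (mod q)}"
proof -
  define f where "f z = {n::nat. real n \<le> z \<and> [n = a] (mod q)}" for z
  have sub: "f x \<subseteq> f y" using assms by (auto simp: f_def)
  have e: "{n::nat. x < real n \<and> real n \<le> y \<and> [n = a] (mod q)} = f y - f x" by (auto simp: f_def)
  have fin: "finite (f x)" "finite (f y)" unfolding f_def using card_residue_le(3) assms by auto
  show "finite {n::nat. x < real n \<and> real n \<le> y \<and> [n = a] (mod q)}" unfolding e using fin by simp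
  have "card (f y - f x) = card (f y) - card (f x)" using fin sub by (simp add: card_Diff_subset)
  moreover have "card (f x) \<le> card (f y)" using fin sub by (simp add: card_mono)
  ultimately have c: "real (card (f y - f x)) = real (card (f y)) - real (card (f x))" by simp
  have d: "(y - x) / real q = (y - real (a mod q)) / real q - (x - real (a mod q)) / real q"
    by (simp add: diff_divide_distrib)
  have y0: "y \<ge> 0" using assms by simp
  note a1 = card_residue_le(1,2)[OF assms(1,2), of a, folded f_def]
  note a2 = card_residue_le(1,2)[OF assms(1) y0, of a, folded f_def]
  show "\<bar>real (card {n::nat. x < real n \<and> real n \<le> y \<and> [n = a] (mod q)}) - (y - x) / real q\<bar> \<le> 1"
    unfolding e c d using a1 a2 by linarith
qed

text \<open>Inverts \<open>c\<close> modulo p; the difference of the shifts is written h + (p - h')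
  to stay within the naturals. The class is reduced because the shifts are distinct and below p, and
  reduced classes are what Hypothesis BV speaks about.\<close>

lemma linear_residue:
  fixes p c h h' :: nat
  assumes p: "prime p" and c: "\<not> p dvd c" and h: "h \<noteq> h'" "h < p" "h' < p"
  shows "\<exists>r. coprime r p \<and> (\<forall>l. h \<le> c * l \<longrightarrow> (p dvd (c * l - h + h') \<longleftrightarrow> [l = r] (mod p)))"
proof -
  have cop: "coprime c p" using prime_imp_coprime[OF p c] by (simp add: coprime_commute)
  obtain d where d: "[c * d = 1] (mod p)" using cong_solve_coprime_nat[OF cop] by auto
  define r where "r = d * (h + (p - h'))"
  have iff: "p dvd (c * l - h + h') \<longleftrightarrow> [l = r] (mod p)" if l: "h \<le> c * l" for l
  proof -
    have "p dvd (c * l - h + h') \<longleftrightarrow> [c * l - h + h' = 0] (mod p)" by (simp add: cong_0_iff)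
    also have "\<dots> \<longleftrightarrow> [(c * l - h + h') + (h + (p - h')) = 0 + (h + (p - h'))] (mod p)"
      by (simp only: cong_add_rcancel_nat)
    also have "(c * l - h + h') + (h + (p - h')) = c * l + p" using l h by simp
    also have "[c * l + p = 0 + (h + (p - h'))] (mod p) \<longleftrightarrow> [c * l = h + (p - h')] (mod p)"
      by (simp add: cong_def)
    also have "\<dots> \<longleftrightarrow> [l = r] (mod p)"
    proof
      assume "[c * l = h + (p - h')] (mod p)"
      hence "[d * (c * l) = r] (mod p)" unfolding r_def by (rule cong_scalar_left)
      moreover have "[d * (c * l) = 1 * l] (mod p)"
        using cong_scalar_right[OF d, of l] by (simp add: mult_ac)
      ultimately show "[l = r] (mod p)" by (simp add: cong_def)
    next
      assume "[l = r] (mod p)"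
      hence "[c * l = c * r] (mod p)" by (rule cong_scalar_left)
      moreover have "[c * r = 1 * (h + (p - h'))] (mod p)"
        unfolding r_def using cong_scalar_right[OF d, of "h + (p - h')"] by (simp add: mult_ac)
      ultimately show "[c * l = h + (p - h')] (mod p)" by (simp add: cong_def)
    qed
    finally show ?thesis .
  qed
  have "\<not> p dvd r"
  proof
    assume "p dvd r"
    hence "p dvd d \<or> p dvd (h + (p - h'))" using p by (simp add: r_def prime_dvd_mult_iff)
    moreover have "\<not> p dvd d"
    proof
      assume "p dvd d"
      hence "p dvd c * d" by simp
      hence "[0 = 1] (mod p)" using d by (simp add: cong_def)
      thus False using prime_gt_1_nat[OF p] by (simp add: cong_def)
    qed
    moreover have "\<not> p dvd (h + (p - h'))"
    proof
      assume "p dvd (h + (p - h'))"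
      then obtain k where k: "h + (p - h') = p * k" by (auto elim: dvdE)
      have "h + (p - h') > 0" "h + (p - h') < 2 * p" using h by linarith+
      hence "k = 1" unfolding k using prime_gt_0_nat[OF p] by (cases k) auto
      thus False using k h by simp
    qed
    ultimately show False by blast
  qed
  hence "coprime p r" by (rule prime_imp_coprime[OF p])
  hence "coprime r p" by (rule coprime_commute[THEN iffD1])
  thus ?thesis using iff by blast
qed

lemma dvd_residue:
  fixes p h :: nat assumes "p \<ge> 1"
  shows "\<exists>r. \<forall>n. p dvd n + h \<longleftrightarrow> [n = r] (mod p)"
proof -
  define r where "r = p * h - h"
  have e: "r + h = p * h" using assms by (simp add: r_def)
  have "p dvd n + h \<longleftrightarrow> [n = r] (mod p)" for n
  proof -
    have "[n = r] (mod p) \<longleftrightarrow> [n + h = r + h] (mod p)" by (simp only: cong_add_rcancel_nat)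
    also have "\<dots> \<longleftrightarrow> p dvd n + h" unfolding e by (simp add: cong_def mod_eq_0_iff_dvd)
    finally show ?thesis by simp
  qed
  thus ?thesis by blast
qed

section \<open>Trivial bounds for the error terms of primes in progressions\<close>

lemma ErrMax_facts:
  assumes q: "q \<ge> 1"
  shows "finite {\<bar>Err x q a\<bar> | a. a < q \<and> coprime a q}" "{\<bar>Err x q a\<bar> | a. a < q \<and> coprime a q} \<noteq> {}"
proof -
  have "{\<bar>Err x q a\<bar> | a. a < q \<and> coprime a q} = (\<lambda>a. \<bar>Err x q a\<bar>) ` {a. a < q \<and> coprime a q}" by auto
  thus "finite {\<bar>Err x q a\<bar> | a. a < q \<and> coprime a q}" by simp
  have "\<exists>a. a < q \<and> coprime a q"
  proof (cases "q = 1")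
    case True thus ?thesis by auto
  next
    case False thus ?thesis using q by (intro exI[of _ 1]) auto
  qed
  thus "{\<bar>Err x q a\<bar> | a. a < q \<and> coprime a q} \<noteq> {}" by auto
qed

text \<open>The trivial estimate by counting integers; q <= N absorbs the rounding error 1 into N/q.
  It is stated with 1/phi(q), which splits over the sieving primes when the moduli are
  summed.\<close>

lemma Err_bound:
  assumes q: "q \<ge> 1" "real q \<le> N" and x: "0 < x" "x \<le> N" and N: "N \<ge> 2"
  shows "\<bar>Err x q a\<bar> \<le> 3 * N * ln (2 * N) / real (totient q)"
proof -
  let ?S = "{n::nat. x < real n \<and> real n \<le> 2 * x \<and> [n = a] (mod q)}"
  have t0: "real (totient q) > 0" using q by simp
  have tq: "real (totient q) \<le> real q" using totient_le[of q] by simp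
  have l1: "ln (2 * N) \<ge> 1"
  proof -
    have "exp 1 < (3::real)" using e_less_272 by simp
    hence "exp 1 \<le> 2 * N" using N by simp
    hence "ln (exp 1) \<le> ln (2 * N)" using N by (subst ln_le_cancel_iff) auto
    thus ?thesis by simp
  qed
  have v0: "vpi n \<ge> 0" for n unfolding vpi_def using prime_ge_1_nat[of n] by auto
  have vle: "vpi n \<le> ln (2 * N)" if "n \<in> ?S" for n
  proof (cases "prime n")
    case True
    have "real n > 0" using prime_gt_0_nat[OF True] by simp
    moreover have "real n \<le> 2 * N" using that x by auto
    ultimately show ?thesis using True by (simp add: vpi_def)
  next
    case False thus ?thesis using l1 by (simp add: vpi_def)
  qed
  have "(\<Sum>n\<in>?S. vpi n) \<le> real (card ?S) * ln (2 * N)"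
    using vle by (intro sum_bounded_above) auto
  also have "\<dots> \<le> (x / real q + 1) * ln (2 * N)"
  proof (intro mult_right_mono)
    have "\<bar>real (card ?S) - (2 * x - x) / real q\<bar> \<le> 1" using q x by (intro card_residue_interval) auto
    thus "real (card ?S) \<le> x / real q + 1" by simp
  qed (use l1 in auto)
  also have "\<dots> \<le> (2 * N / real (totient q)) * ln (2 * N)"
  proof (intro mult_right_mono)
    have "x / real q + 1 \<le> N / real q + N / real q" using q x by (intro add_mono divide_right_mono) (auto simp: field_simps)
    also have "\<dots> \<le> N / real (totient q) + N / real (totient q)"
      using tq t0 N by (intro add_mono divide_left_mono) auto
    finally show "x / real q + 1 \<le> 2 * N / real (totient q)" by simp
  qed (use l1 in auto)
  finally have 1: "(\<Sum>n\<in>?S. vpi n) \<le> 2 * N * ln (2 * N) / real (totient q)" by simp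
  have 2: "x / real (totient q) \<le> N * ln (2 * N) / real (totient q)"
  proof (intro divide_right_mono)
    have "x * 1 \<le> N * ln (2 * N)" using x N l1 by (intro mult_mono) auto
    thus "x \<le> N * ln (2 * N)" by simp
  qed (use t0 in auto)
  have "(\<Sum>n\<in>?S. vpi n) \<ge> 0" using v0 by (intro sum_nonneg) auto
  moreover have "x / real (totient q) \<ge> 0" using x by simp
  moreover have "3 * N * ln (2 * N) / real (totient q) = 2 * N * ln (2 * N) / real (totient q) + N * ln (2 * N) / real (totient q)"
    by (simp add: add_divide_distrib[symmetric])
  ultimately show ?thesis unfolding Err_def using 1 2 by linarith
qed

lemma ErrMax_bounds:
  assumes q: "q \<ge> 1" "real q \<le> N" and x: "0 < x" "x \<le> N" and N: "N \<ge> 2"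
  shows "0 \<le> ErrMax x q" "ErrMax x q \<le> 3 * N * ln (2 * N) / real (totient q)" "coprime a q \<Longrightarrow> \<bar>Err x q a\<bar> \<le> ErrMax x q"
proof -
  note f = ErrMax_facts[OF q(1), of x]
  obtain a0 where a0: "a0 < q" "coprime a0 q" using f(2) by auto
  have "\<bar>Err x q a0\<bar> \<le> ErrMax x q" unfolding ErrMax_def using f(1) a0 by (intro Max_ge) auto
  thus "0 \<le> ErrMax x q" by linarith
  have "y \<le> 3 * N * ln (2 * N) / real (totient q)" if "y \<in> {\<bar>Err x q a\<bar> | a. a < q \<and> coprime a q}" for y
    using that Err_bound[OF q x N] by auto
  thus "ErrMax x q \<le> 3 * N * ln (2 * N) / real (totient q)" unfolding ErrMax_def using f by (intro Max.boundedI) auto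
  assume a: "coprime a q"
  have "Err x q a = Err x q (a mod q)" unfolding Err_def by (simp add: cong_def)
  moreover have "a mod q < q" "coprime (a mod q) q" using q a by (auto simp: coprime_mod_left_iff)
  hence "\<bar>Err x q (a mod q)\<bar> \<le> ErrMax x q" unfolding ErrMax_def using f(1) by (intro Max_ge) auto
  ultimately show "\<bar>Err x q a\<bar> \<le> ErrMax x q" by simp
qed

text \<open>The supremum runs over a real interval, so boundedness has to be established before a
  single x can be compared with it; the trivial estimate provides it.\<close>

lemma ErrStar_bounds:
  assumes q: "q \<ge> 1" "real q \<le> N" and N: "N \<ge> 2"
  shows "0 \<le> ErrStar N q" "ErrStar N q \<le> 3 * N * ln (2 * N) / real (totient q)"
    "0 < x \<Longrightarrow> x \<le> N \<Longrightarrow> coprime a q \<Longrightarrow> \<bar>Err x q a\<bar> \<le> ErrStar N q"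
proof -
  have ne: "{0<..N} \<noteq> {}" using N by auto
  have bdd: "bdd_above ((\<lambda>x. ErrMax x q) ` {0<..N})"
    using ErrMax_bounds(2)[OF q _ _ N] by (intro bdd_aboveI2[of _ _ "3 * N * ln (2 * N) / real (totient q)"]) auto
  have up: "ErrMax x q \<le> ErrStar N q" if "0 < x" "x \<le> N" for x
    unfolding ErrStar_def using that by (intro cSUP_upper bdd) auto
  show "0 \<le> ErrStar N q" using up[of N] ErrMax_bounds(1)[OF q _ _ N, of N] N by simp
  show "ErrStar N q \<le> 3 * N * ln (2 * N) / real (totient q)"
    unfolding ErrStar_def using ErrMax_bounds(2)[OF q _ _ N] by (intro cSUP_least ne) auto
  show "\<bar>Err x q a\<bar> \<le> ErrStar N q" if "0 < x" "x \<le> N" "coprime a q"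
    using up[OF that(1,2)] ErrMax_bounds(3)[OF q that(1,2) N that(3)] by simp
qed


text \<open>The square in \<open>(c m)\<^sup>2 dvd Q\<close> keeps \<open>c m\<close> a divisor of Q
  / c m. Hence phi(Q) = c m * phi(Q / c m), which compensates exactly for the shortened range N / c
  m of the primes, and all forms get the same main term.\<close>

locale sieve_count =
  fixes P K :: "nat set" and Q v :: nat and h c :: "nat \<Rightarrow> nat" and l :: "(nat \<Rightarrow> nat) \<Rightarrow> real"
  assumes P: "finite P" "\<And>p. p \<in> P \<Longrightarrow> prime p" "\<And>p. p \<in> P \<Longrightarrow> p > 1000" "\<And>p. p \<in> P \<Longrightarrow> \<not> p dvd Q"
    and K: "finite K" "0 \<notin> K"
    and h: "\<And>m. m \<in> K \<Longrightarrow> h m \<le> 6" "inj_on h K"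
    and c: "\<And>m. m \<in> K \<Longrightarrow> prime (c m)" "\<And>m. m \<in> K \<Longrightarrow> c m \<le> 7" "\<And>m. m \<in> K \<Longrightarrow> (c m)\<^sup>2 dvd Q"
    and v: "\<And>m. m \<in> K \<Longrightarrow> c m dvd v + h m" "\<And>m. m \<in> K \<Longrightarrow> coprime ((v + h m) div c m) Q"
    and Q: "Q \<ge> 1"
begin

definition Om :: "(nat \<Rightarrow> nat) set" where "Om = PiE P (\<lambda>_. insert 0 K)"
definition hold :: "(nat \<Rightarrow> nat) \<Rightarrow> nat \<Rightarrow> bool" where "hold s n \<longleftrightarrow> (\<forall>p\<in>P. s p \<noteq> 0 \<longrightarrow> p dvd n + h (s p))"
definition wt :: "nat \<Rightarrow> real" where "wt n = (\<Sum>s\<in>Om. l s * of_bool (hold s n))\<^sup>2"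
definition Bset :: "(nat \<Rightarrow> nat) \<Rightarrow> (nat \<Rightarrow> nat) \<Rightarrow> nat set" where "Bset s t = {p\<in>P. s p \<noteq> 0 \<or> t p \<noteq> 0}"
definition compat :: "(nat \<Rightarrow> nat) \<Rightarrow> (nat \<Rightarrow> nat) \<Rightarrow> bool" where "compat s t \<longleftrightarrow> (\<forall>p\<in>P. s p \<noteq> 0 \<and> t p \<noteq> 0 \<longrightarrow> s p = t p)"
definition col :: "(nat \<Rightarrow> nat) \<Rightarrow> (nat \<Rightarrow> nat) \<Rightarrow> nat \<Rightarrow> nat" where "col s t p = (if s p \<noteq> 0 then s p else t p)"

lemma wt_expand: "wt n = (\<Sum>s\<in>Om. \<Sum>t\<in>Om. l s * l t * of_bool (hold s n \<and> hold t n))"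
proof -
  have "of_bool (hold s n \<and> hold t n) = of_bool (hold s n) * (of_bool (hold t n) :: real)" for s t by simp
  thus ?thesis unfolding wt_def power2_eq_square sum_product by (intro sum.cong refl) (simp only: mult_ac)
qed

lemma wt_nonneg: "wt n \<ge> 0" by (simp add: wt_def)

lemma Om_col: "s \<in> Om \<Longrightarrow> t \<in> Om \<Longrightarrow> p \<in> Bset s t \<Longrightarrow> col s t p \<in> K"
  by (auto simp: Om_def Bset_def col_def PiE_iff)

text \<open>A prime above 1000 cannot divide two numbers whose difference is nonzero and at most 6.
  So a prime with two different colours contributes nothing, in agreement with its zero
  densities.\<close>

lemma not_compat:
  assumes st: "s \<in> Om" "t \<in> Om" "\<not> compat s t"
  shows "\<not> (hold s n \<and> hold t n)" "(\<Prod>p\<in>P. dens1 p (s p) (t p)) = 0" "(\<Prod>p\<in>P. dens2 m p (s p) (t p)) = 0"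
proof -
  obtain p where p: "p \<in> P" "s p \<noteq> 0" "t p \<noteq> 0" "s p \<noteq> t p" using st by (auto simp: compat_def)
  have K': "s p \<in> K" "t p \<in> K" using st p by (auto simp: Om_def PiE_iff)
  have ne: "h (s p) \<noteq> h (t p)" using h(2) K' p by (auto simp: inj_on_def)
  show "\<not> (hold s n \<and> hold t n)"
  proof
    assume "hold s n \<and> hold t n"
    hence d: "p dvd n + h (s p)" "p dvd n + h (t p)" using p by (auto simp: hold_def)
    hence "int p dvd int (n + h (s p)) - int (n + h (t p))" by (intro dvd_diff) (simp_all only: int_dvd_int_iff)
    hence "int p dvd int (h (s p)) - int (h (t p))" by simp
    moreover have "int (h (s p)) - int (h (t p)) \<noteq> 0" using ne by simp
    ultimately have "int p \<le> \<bar>int (h (s p)) - int (h (t p))\<bar>" by (metis abs_of_nat dvd_imp_le_int)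
    thus False using h(1)[OF K'(1)] h(1)[OF K'(2)] P(3)[OF p(1)] by linarith
  qed
  show "(\<Prod>p\<in>P. dens1 p (s p) (t p)) = 0" using p P(1) by (intro prod_zero) (auto simp: dens1_def intro!: bexI[of _ p])
  show "(\<Prod>p\<in>P. dens2 m p (s p) (t p)) = 0" using p P(1) by (intro prod_zero) (auto simp: dens2_def intro!: bexI[of _ p])
qed

lemma compat_hold:
  assumes "compat s t"
  shows "hold s n \<and> hold t n \<longleftrightarrow> (\<forall>p\<in>Bset s t. p dvd n + h (col s t p))"
proof
  assume "hold s n \<and> hold t n"
  thus "\<forall>p\<in>Bset s t. p dvd n + h (col s t p)" by (auto simp: hold_def Bset_def col_def)
next
  assume r: "\<forall>p\<in>Bset s t. p dvd n + h (col s t p)"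
  have "p dvd n + h (s p)" if "p \<in> P" "s p \<noteq> 0" for p
    using r that by (auto simp: Bset_def col_def)
  moreover have "p dvd n + h (t p)" if p: "p \<in> P" "t p \<noteq> 0" for p
  proof -
    have "p dvd n + h (col s t p)" using r p by (auto simp: Bset_def)
    moreover have "col s t p = t p" using assms p by (auto simp: compat_def col_def)
    ultimately show ?thesis by simp
  qed
  ultimately show "hold s n \<and> hold t n" by (auto simp: hold_def)
qed

lemma finite_Bset: "finite (Bset s t)" using P(1) by (simp add: Bset_def)

lemma Bset_prod_pos: "\<Prod>(Bset s t) \<ge> 1"
proof -
  have "1 \<le> p" if "p \<in> Bset s t" for p using that P(3)[of p] by (auto simp: Bset_def)
  thus ?thesis by (intro prod_ge_1) auto
qed

lemma prod_dens1:
  assumes "compat s t"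
  shows "(\<Prod>p\<in>P. dens1 p (s p) (t p)) = 1 / real (\<Prod>(Bset s t))"
proof -
  have "(\<Prod>p\<in>P. dens1 p (s p) (t p)) = (\<Prod>p\<in>P. if s p \<noteq> 0 \<or> t p \<noteq> 0 then 1 / real p else 1)"
    using assms by (intro prod.cong refl) (auto simp: dens1_def compat_def)
  also have "\<dots> = (\<Prod>p\<in>Bset s t. 1 / real p)" unfolding Bset_def by (rule prod.inter_filter[OF P(1), symmetric])
  also have "\<dots> = 1 / real (\<Prod>(Bset s t))" by (simp add: prod_dividef)
  finally show ?thesis .
qed

text \<open>The range begins at N - 6 so that it contains n whenever some n + h m exceeds N. Each
  pair then has an error of at most 7: one for the count and 6/q <= 6 for the additional
  length.\<close>

lemma S1_le:
  assumes N: "N \<ge> 6"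
  shows "(\<Sum>n | N - 6 < real n \<and> real n \<le> 2 * N \<and> [n = v] (mod Q). wt n)
    \<le> N / real Q * (\<Sum>s\<in>Om. \<Sum>t\<in>Om. l s * l t * (\<Prod>p\<in>P. dens1 p (s p) (t p))) + 7 * (\<Sum>s\<in>Om. \<bar>l s\<bar>)\<^sup>2"
proof -
  let ?A = "{n. N - 6 < real n \<and> real n \<le> 2 * N \<and> [n = v] (mod Q)}"
  have finA: "finite ?A" using Q N by (intro card_residue_interval) auto
  define f where "f s t = (\<Sum>n\<in>?A. of_bool (hold s n \<and> hold t n) :: real)" for s t
  have each: "\<bar>f s t - N / real Q * (\<Prod>p\<in>P. dens1 p (s p) (t p))\<bar> \<le> 7" if st: "s \<in> Om" "t \<in> Om" for s t
  proof (cases "compat s t")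
    case False
    have "f s t = 0" unfolding f_def by (intro sum.neutral) (use not_compat(1)[OF st False] in simp)
    thus ?thesis using not_compat(2)[OF st False] by simp
  next
    case True
    have "\<forall>p\<in>Bset s t. \<exists>r. \<forall>n. p dvd n + h (col s t p) \<longleftrightarrow> [n = r] (mod p)"
    proof
      fix p assume "p \<in> Bset s t"
      hence "p \<ge> 1" using P(3)[of p] by (simp add: Bset_def)
      thus "\<exists>r. \<forall>n. p dvd n + h (col s t p) \<longleftrightarrow> [n = r] (mod p)" by (rule dvd_residue)
    qed
    then obtain r where r: "\<forall>p\<in>Bset s t. \<forall>n. p dvd n + h (col s t p) \<longleftrightarrow> [n = r p] (mod p)" by (rule bchoice[THEN exE])
    obtain a where a: "\<forall>n. [n = a] (mod Q * \<Prod>(Bset s t)) \<longleftrightarrow> [n = v] (mod Q) \<and> (\<forall>p\<in>Bset s t. [n = r p] (mod p))"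
      using crt_prime_set[OF finite_Bset, of s t Q v r] P by (auto simp: Bset_def)
    have iff: "[n = v] (mod Q) \<and> hold s n \<and> hold t n \<longleftrightarrow> [n = a] (mod Q * \<Prod>(Bset s t))" for n
      using a r compat_hold[OF True, of n] by simp
    define q where "q = Q * \<Prod>(Bset s t)"
    have q1: "q \<ge> 1" using Q Bset_prod_pos[of s t] by (simp add: q_def)
    have "f s t = real (card {n\<in>?A. hold s n \<and> hold t n})"
      unfolding f_def using finA by (simp add: of_bool_def sum.inter_filter[symmetric])
    also have "{n\<in>?A. hold s n \<and> hold t n} = {n. N - 6 < real n \<and> real n \<le> 2 * N \<and> [n = a] (mod q)}"
      using iff unfolding q_def by auto
    finally have fc: "f s t = real (card {n. N - 6 < real n \<and> real n \<le> 2 * N \<and> [n = a] (mod q)})" .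
    have "\<bar>f s t - (2 * N - (N - 6)) / real q\<bar> \<le> 1" unfolding fc using q1 N by (intro card_residue_interval) auto
    moreover have "(2 * N - (N - 6)) / real q = N / real q + 6 / real q" by (simp add: add_divide_distrib[symmetric])
    moreover have "6 / real q \<le> 6" "6 / real q \<ge> 0" using q1 by (auto simp: field_simps)
    moreover have "N / real Q * (\<Prod>p\<in>P. dens1 p (s p) (t p)) = N / real q" unfolding prod_dens1[OF True] q_def by simp
    ultimately show ?thesis by linarith
  qed
  have "(\<Sum>n\<in>?A. wt n) = (\<Sum>s\<in>Om. \<Sum>t\<in>Om. l s * l t * f s t)"
    unfolding wt_expand f_def sum_distrib_left
    by (subst sum.swap, intro sum.cong refl, subst sum.swap) simp
  also have "\<dots> \<le> (\<Sum>s\<in>Om. \<Sum>t\<in>Om. l s * l t * (N / real Q * (\<Prod>p\<in>P. dens1 p (s p) (t p))) + \<bar>l s\<bar> * \<bar>l t\<bar> * 7)"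
  proof (intro sum_mono)
    fix s t assume st: "s \<in> Om" "t \<in> Om"
    have "l s * l t * (f s t - N / real Q * (\<Prod>p\<in>P. dens1 p (s p) (t p))) \<le> \<bar>l s * l t * (f s t - N / real Q * (\<Prod>p\<in>P. dens1 p (s p) (t p)))\<bar>" by (rule abs_ge_self)
    also have "\<dots> \<le> \<bar>l s\<bar> * \<bar>l t\<bar> * 7" unfolding abs_mult using each[OF st] by (intro mult_left_mono) auto
    finally show "l s * l t * f s t \<le> l s * l t * (N / real Q * (\<Prod>p\<in>P. dens1 p (s p) (t p))) + \<bar>l s\<bar> * \<bar>l t\<bar> * 7" by (simp only: right_diff_distrib)
  qed
  also have "\<dots> = N / real Q * (\<Sum>s\<in>Om. \<Sum>t\<in>Om. l s * l t * (\<Prod>p\<in>P. dens1 p (s p) (t p))) + 7 * (\<Sum>s\<in>Om. \<bar>l s\<bar>)\<^sup>2"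
    unfolding power2_eq_square sum_product by (simp add: sum.distrib sum_distrib_left mult_ac)
  finally show ?thesis .
qed

lemma totient_cQ:
  assumes "m \<in> K"
  shows "totient Q = c m * totient (Q div c m)"
proof -
  define Q' where "Q' = Q div c m"
  have c0: "c m > 0" using c(1)[OF assms] by (rule prime_gt_0_nat)
  have "c m * c m dvd Q" using c(3)[OF assms] by (simp add: power2_eq_square)
  then obtain k where k: "Q = c m * c m * k" by (auto elim: dvdE)
  have Q': "Q' = c m * k" "Q = c m * Q'" using k c0 by (simp_all add: Q'_def mult.assoc)
  have g: "gcd (c m) Q' = c m" unfolding Q'(1) by simp
  have t: "totient (c m) > 0" using c0 by simp
  have "totient Q = totient (c m) * totient Q' * c m div totient (c m)" unfolding Q'(2) totient_mult[of "c m" Q'] g ..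
  also have "\<dots> = totient (c m) * (totient Q' * c m) div totient (c m)" by (simp only: mult.assoc)
  also have "\<dots> = totient Q' * c m" using t by simp
  finally show ?thesis by (simp add: Q'_def)
qed

lemma totient_prod_primes:
  assumes "finite B" "\<And>p. p \<in> B \<Longrightarrow> prime p" "\<And>p. p \<in> B \<Longrightarrow> \<not> p dvd q"
  shows "real (totient (q * \<Prod>B)) = real (totient q) * (\<Prod>p\<in>B. real p - 1)"
  using assms
proof (induction B)
  case (insert p B)
  have pp: "prime p" using insert.prems by simp
  have "\<not> p dvd \<Prod>B"
  proof
    assume "p dvd \<Prod>B"
    then obtain x where x: "x \<in> B" "p dvd x"
      using prime_dvd_prod_iff[of B p "\<lambda>x. x"] insert.hyps(1) pp by auto
    hence "p = x" using primes_dvd_imp_eq[of p x] pp insert.prems(1)[of x] by simp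
    thus False using x insert.hyps(2) by simp
  qed
  hence "\<not> p dvd q * \<Prod>B" using insert.prems(2)[of p] pp by (simp add: prime_dvd_mult_iff)
  hence "coprime p (q * \<Prod>B)" by (rule prime_imp_coprime[OF pp])
  hence "totient (p * (q * \<Prod>B)) = totient p * totient (q * \<Prod>B)" by (rule totient_mult_coprime)
  moreover have "p * (q * \<Prod>B) = q * \<Prod>(insert p B)" using insert.hyps by simp
  moreover have "real (totient p) = real p - 1" using totient_prime[OF pp] prime_ge_1_nat[OF pp] by (simp add: of_nat_diff)
  moreover have "real (totient (q * \<Prod>B)) = real (totient q) * (\<Prod>p\<in>B. real p - 1)"
    using insert.IH insert.prems by simp
  ultimately show ?case using insert.hyps by (metis (no_types, lifting) mult.left_commute of_nat_mult prod.insert)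
qed simp

lemma prod_dens2:
  assumes "compat s t" "\<And>p. p \<in> P \<Longrightarrow> s p \<noteq> m \<and> t p \<noteq> m"
  shows "(\<Prod>p\<in>P. dens2 m p (s p) (t p)) = 1 / (\<Prod>p\<in>Bset s t. real p - 1)"
proof -
  have "(\<Prod>p\<in>P. dens2 m p (s p) (t p)) = (\<Prod>p\<in>P. if s p \<noteq> 0 \<or> t p \<noteq> 0 then 1 / (real p - 1) else 1)"
    using assms by (intro prod.cong refl) (auto simp: dens2_def compat_def)
  also have "\<dots> = (\<Prod>p\<in>Bset s t. 1 / (real p - 1))" unfolding Bset_def by (rule prod.inter_filter[OF P(1), symmetric])
  also have "\<dots> = 1 / (\<Prod>p\<in>Bset s t. real p - 1)" by (simp add: prod_dividef)
  finally show ?thesis .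
qed

text \<open>Primes are counted in the variable x with n + h m = c m * x. Cancelling
  \<open>c m\<close> leaves the modulus Q / c m, and each coloured prime imposes a reduced class;
  colour \<open>m\<close> is excluded because it would demand that p divides x.\<close>

lemma class_prime:
  assumes m: "m \<in> K" and st: "s \<in> Om" "t \<in> Om" "compat s t" "\<And>p. p \<in> P \<Longrightarrow> s p \<noteq> m \<and> t p \<noteq> m"
  shows "\<exists>a. coprime a (Q div c m * \<Prod>(Bset s t)) \<and> (\<forall>x. h m \<le> c m * x \<longrightarrow>
     ([c m * x - h m = v] (mod Q) \<and> hold s (c m * x - h m) \<and> hold t (c m * x - h m) \<longleftrightarrow> [x = a] (mod Q div c m * \<Prod>(Bset s t))))"
proof -
  define Q' where "Q' = Q div c m"
  define w where "w = (v + h m) div c m"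
  have c0: "c m > 0" using c(1)[OF m] by (rule prime_gt_0_nat)
  have "c m dvd Q" using c(3)[OF m] by (metis dvd_trans dvd_triv_left power2_eq_square)
  hence Q': "Q = c m * Q'" by (simp add: Q'_def)
  have w: "v + h m = c m * w" using v(1)[OF m] by (simp add: w_def)
  have copw: "coprime w Q'" using v(2)[OF m] unfolding w_def[symmetric] Q' by simp
  have B: "finite (Bset s t)" "\<And>p. p \<in> Bset s t \<Longrightarrow> prime p" "\<And>p. p \<in> Bset s t \<Longrightarrow> \<not> p dvd Q'"
  proof -
    show "\<not> p dvd Q'" if "p \<in> Bset s t" for p
    proof
      assume "p dvd Q'"
      hence "p dvd Q" unfolding Q' by simp
      thus False using P(4)[of p] that by (simp add: Bset_def)
    qed
  qed (use finite_Bset P(2) in \<open>auto simp: Bset_def\<close>)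
  have "\<forall>p\<in>Bset s t. \<exists>r. coprime r p \<and> (\<forall>x. h m \<le> c m * x \<longrightarrow> (p dvd (c m * x - h m + h (col s t p)) \<longleftrightarrow> [x = r] (mod p)))"
  proof
    fix p assume p: "p \<in> Bset s t"
    hence pP: "p \<in> P" by (simp add: Bset_def)
    have ck: "col s t p \<in> K" using Om_col[OF st(1,2) p] .
    have "col s t p \<noteq> m" using st(4)[OF pP] by (auto simp: col_def)
    hence ne: "h m \<noteq> h (col s t p)" using h(2) m ck by (auto simp: inj_on_def)
    have nd: "\<not> p dvd c m"
    proof
      assume "p dvd c m"
      hence "p \<le> c m" using c0 by (rule dvd_imp_le)
      thus False using c(2)[OF m] P(3)[OF pP] by linarith
    qed
    show "\<exists>r. coprime r p \<and> (\<forall>x. h m \<le> c m * x \<longrightarrow> (p dvd (c m * x - h m + h (col s t p)) \<longleftrightarrow> [x = r] (mod p)))"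
      using linear_residue[OF P(2)[OF pP] nd ne] h(1)[OF m] h(1)[OF ck] P(3)[OF pP] by auto
  qed
  then obtain r where r: "\<forall>p\<in>Bset s t. coprime (r p) p \<and> (\<forall>x. h m \<le> c m * x \<longrightarrow> (p dvd (c m * x - h m + h (col s t p)) \<longleftrightarrow> [x = r p] (mod p)))"
    by (rule bchoice[THEN exE])
  obtain a where a: "\<forall>n. [n = a] (mod Q' * \<Prod>(Bset s t)) \<longleftrightarrow> [n = w] (mod Q') \<and> (\<forall>p\<in>Bset s t. [n = r p] (mod p))"
    using crt_prime_set[OF B, of w r] by blast
  have aa: "[a = w] (mod Q')" "\<forall>p\<in>Bset s t. [a = r p] (mod p)" using a[rule_format, of a] by simp_all
  have cop: "coprime a (Q' * \<Prod>(Bset s t))"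
    by (rule coprime_crt[OF B(1,2) copw _ aa]) (use r in auto)
  have "[c m * x - h m = v] (mod Q) \<and> hold s (c m * x - h m) \<and> hold t (c m * x - h m) \<longleftrightarrow> [x = a] (mod Q' * \<Prod>(Bset s t))"
    if x: "h m \<le> c m * x" for x
  proof -
    have "[c m * x - h m = v] (mod Q) \<longleftrightarrow> [(c m * x - h m) + h m = v + h m] (mod Q)" by (simp only: cong_add_rcancel_nat)
    also have "\<dots> \<longleftrightarrow> [c m * x = c m * w] (mod c m * Q')" unfolding w using x Q' by simp
    also have "\<dots> \<longleftrightarrow> [x = w] (mod Q')" using c0 by (simp add: cong_def)
    finally have 1: "[c m * x - h m = v] (mod Q) \<longleftrightarrow> [x = w] (mod Q')" .
    have "(\<forall>p\<in>Bset s t. p dvd (c m * x - h m + h (col s t p))) \<longleftrightarrow> (\<forall>p\<in>Bset s t. [x = r p] (mod p))"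
      using r x by (intro ball_cong refl) simp
    thus ?thesis using 1 a compat_hold[OF st(3), of "c m * x - h m"] by simp
  qed
  thus ?thesis using cop unfolding Q'_def by blast
qed

text \<open>The distribution of primes is used at height N / c m <= N, which
  \<open>ErrStar N\<close> covers. The bound on the moduli is asked only for pairs with nonzero
  coefficients, because it follows from the support of the weights.\<close>

lemma S2_ge:
  assumes m: "m \<in> K" and N: "N \<ge> 7" and R: "\<And>p. p \<in> P \<Longrightarrow> real p \<le> N / 7"
    and supp: "\<And>s t. s \<in> Om \<Longrightarrow> t \<in> Om \<Longrightarrow> l s \<noteq> 0 \<Longrightarrow> l t \<noteq> 0 \<Longrightarrow> real (Q * \<Prod>(Bset s t)) \<le> N"
  shows "(\<Sum>x | N / real (c m) < real x \<and> real x \<le> 2 * (N / real (c m)) \<and> [c m * x - h m = v] (mod Q). vpi x * wt (c m * x - h m))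
    \<ge> N / real (totient Q) * (\<Sum>s\<in>Om. \<Sum>t\<in>Om. l s * l t * (\<Prod>p\<in>P. dens2 m p (s p) (t p)))
      - (\<Sum>s\<in>Om. \<Sum>t\<in>Om. \<bar>l s\<bar> * \<bar>l t\<bar> * ErrStar N (Q div c m * \<Prod>(Bset s t)))"
proof -
  define z where "z = N / real (c m)"
  let ?A = "{x. z < real x \<and> real x \<le> 2 * z \<and> [c m * x - h m = v] (mod Q)}"
  have c0: "c m > 0" using c(1)[OF m] by (rule prime_gt_0_nat)
  have c7: "c m \<le> 7" by (rule c(2)[OF m])
  have zN: "0 < z" "z \<le> N" "N / 7 \<le> z" using N c0 c7 by (auto simp: z_def field_simps)
  have finA: "finite ?A"
    by (rule finite_subset[of _ "{..nat \<lfloor>2 * z\<rfloor>}"]) (auto simp: le_nat_floor)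
  have big: "h m \<le> c m * x" if "z < real x" for x
  proof -
    have "N < real (c m) * real x" using that c0 by (simp add: z_def field_simps)
    hence "N < real (c m * x)" by simp
    thus ?thesis using h(1)[OF m] N by linarith
  qed
  have zx: "real x > z" if "x \<in> ?A" for x using that by simp
  define f where "f s t = (\<Sum>x\<in>?A. vpi x * of_bool (hold s (c m * x - h m) \<and> hold t (c m * x - h m)))" for s t
  define E where "E s t = ErrStar N (Q div c m * \<Prod>(Bset s t))" for s t
  have cQ: "c m dvd Q" using c(3)[OF m] by (metis dvd_trans dvd_triv_left power2_eq_square)
  have each: "\<bar>f s t - N / real (totient Q) * (\<Prod>p\<in>P. dens2 m p (s p) (t p))\<bar> \<le> E s t"
    if st: "s \<in> Om" "t \<in> Om" and qN: "real (Q * \<Prod>(Bset s t)) \<le> N" for s t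
  proof -
    define q where "q = Q div c m * \<Prod>(Bset s t)"
    have Q'1: "Q div c m \<ge> 1" using cQ Q c0 by (simp add: div_greater_zero_iff dvd_imp_le Suc_le_eq)
    have q1: "q \<ge> 1" unfolding q_def using Q'1 Bset_prod_pos[of s t] by simp
    have "Q div c m \<le> Q" by simp
    hence "q \<le> Q * \<Prod>(Bset s t)" unfolding q_def by (rule mult_right_mono) simp
    hence qle: "real q \<le> N" using qN by linarith
    have N2: "N \<ge> 2" using N by simp
    have E0: "E s t \<ge> 0" unfolding E_def q_def[symmetric] by (rule ErrStar_bounds(1)[OF q1 qle N2])
    consider "\<not> compat s t" | p where "compat s t" "p \<in> P" "s p = m \<or> t p = m" | "compat s t" "\<And>p. p \<in> P \<Longrightarrow> s p \<noteq> m \<and> t p \<noteq> m" by blast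
    thus ?thesis
    proof cases
      case 1
      have "f s t = 0" unfolding f_def by (intro sum.neutral) (use not_compat(1)[OF st 1] in simp)
      thus ?thesis using not_compat(3)[OF st 1] E0 by simp
    next
      \<comment> \<open>Colour \<open>m\<close> makes p divide the prime x, hence x = p; but x > N/7
        >= p. This is the reason for the zeros of \<open>dens2\<close>.\<close>
      case (2 p)
      have m0: "m \<noteq> 0" using m K(2) by metis
      have "f s t = 0"
        unfolding f_def
      proof (intro sum.neutral ballI)
        fix x assume x: "x \<in> ?A"
        show "vpi x * of_bool (hold s (c m * x - h m) \<and> hold t (c m * x - h m)) = 0"
        proof (rule ccontr)
          assume "\<not> ?thesis"
          hence a: "vpi x \<noteq> 0" "hold s (c m * x - h m)" "hold t (c m * x - h m)" by (auto split: if_splits)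
          have px: "prime x" using a(1) by (auto simp: vpi_def split: if_splits)
          have "p dvd (c m * x - h m) + h m" using 2 a(2,3) m0 by (auto simp: hold_def)
          hence "p dvd c m * x" using big[OF zx[OF x]] by simp
          moreover have "\<not> p dvd c m"
          proof
            assume "p dvd c m"
            hence "p \<le> c m" using c0 by (rule dvd_imp_le)
            thus False using c7 P(3)[OF 2(2)] by linarith
          qed
          ultimately have "p dvd x" using P(2)[OF 2(2)] by (simp add: prime_dvd_mult_iff)
          hence "p = x" using primes_dvd_imp_eq[OF P(2)[OF 2(2)] px] by simp
          thus False using R[OF 2(2)] zN(3) zx[OF x] by linarith
        qed
      qed
      moreover have "(\<Prod>p\<in>P. dens2 m p (s p) (t p)) = 0"
        using 2 P(1) by (intro prod_zero) (auto simp: dens2_def intro!: bexI[of _ p])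
      ultimately show ?thesis using E0 by simp
    next
      case 3
      obtain a where a: "coprime a q" "\<And>x. h m \<le> c m * x \<Longrightarrow>
         ([c m * x - h m = v] (mod Q) \<and> hold s (c m * x - h m) \<and> hold t (c m * x - h m) \<longleftrightarrow> [x = a] (mod q))"
        using class_prime[OF m st 3] unfolding q_def by blast
      have "f s t = (\<Sum>x\<in>{x\<in>?A. hold s (c m * x - h m) \<and> hold t (c m * x - h m)}. vpi x)"
        unfolding f_def by (subst sum.inter_filter[OF finA]) (intro sum.cong refl, simp)
      also have "{x\<in>?A. hold s (c m * x - h m) \<and> hold t (c m * x - h m)} = {x. z < real x \<and> real x \<le> 2 * z \<and> [x = a] (mod q)}"
      proof (intro equalityI subsetI)
        fix x assume "x \<in> {x\<in>?A. hold s (c m * x - h m) \<and> hold t (c m * x - h m)}"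
        thus "x \<in> {x. z < real x \<and> real x \<le> 2 * z \<and> [x = a] (mod q)}" using a(2)[of x] big[of x] by simp
      next
        fix x assume "x \<in> {x. z < real x \<and> real x \<le> 2 * z \<and> [x = a] (mod q)}"
        thus "x \<in> {x\<in>?A. hold s (c m * x - h m) \<and> hold t (c m * x - h m)}" using a(2)[of x] big[of x] by simp
      qed
      finally have "f s t = Err z q a + z / real (totient q)" unfolding Err_def by simp
      moreover have "\<bar>Err z q a\<bar> \<le> E s t" unfolding E_def q_def[symmetric] by (rule ErrStar_bounds(3)[OF q1 qle N2 zN(1,2) a(1)])
      moreover have "z / real (totient q) = N / real (totient Q) * (\<Prod>p\<in>P. dens2 m p (s p) (t p))"
      proof -
        have "\<not> p dvd Q div c m" if "p \<in> Bset s t" for p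
        proof
          assume "p dvd Q div c m"
          hence "p dvd Q" using cQ by (metis dvd_mult dvd_mult_div_cancel)
          thus False using P(4) that by (auto simp: Bset_def)
        qed
        hence "real (totient q) = real (totient (Q div c m)) * (\<Prod>p\<in>Bset s t. real p - 1)"
          unfolding q_def by (intro totient_prod_primes) (use finite_Bset P in \<open>auto simp: Bset_def\<close>)
        moreover have "real (totient Q) = real (c m) * real (totient (Q div c m))" using totient_cQ[OF m] by simp
        moreover have "(\<Prod>p\<in>P. dens2 m p (s p) (t p)) = 1 / (\<Prod>p\<in>Bset s t. real p - 1)"
          by (rule prod_dens2) (use 3 in auto)
        ultimately show ?thesis unfolding z_def by (simp only:) simp
      qed
      ultimately show ?thesis by simp
    qed
  qed
  have "(\<Sum>x\<in>?A. vpi x * wt (c m * x - h m)) = (\<Sum>s\<in>Om. \<Sum>t\<in>Om. l s * l t * f s t)"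
  proof -
    have "(\<Sum>x\<in>?A. vpi x * wt (c m * x - h m)) = (\<Sum>x\<in>?A. \<Sum>s\<in>Om. \<Sum>t\<in>Om. l s * l t * (vpi x * of_bool (hold s (c m * x - h m) \<and> hold t (c m * x - h m))))"
      unfolding wt_expand sum_distrib_left by (intro sum.cong refl) (simp only: mult_ac)
    also have "\<dots> = (\<Sum>s\<in>Om. \<Sum>x\<in>?A. \<Sum>t\<in>Om. l s * l t * (vpi x * of_bool (hold s (c m * x - h m) \<and> hold t (c m * x - h m))))"
      by (rule sum.swap)
    also have "\<dots> = (\<Sum>s\<in>Om. \<Sum>t\<in>Om. \<Sum>x\<in>?A. l s * l t * (vpi x * of_bool (hold s (c m * x - h m) \<and> hold t (c m * x - h m))))"
      by (intro sum.cong refl sum.swap)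
    also have "\<dots> = (\<Sum>s\<in>Om. \<Sum>t\<in>Om. l s * l t * f s t)" unfolding f_def sum_distrib_left ..
    finally show ?thesis .
  qed
  also have "\<dots> \<ge> (\<Sum>s\<in>Om. \<Sum>t\<in>Om. l s * l t * (N / real (totient Q) * (\<Prod>p\<in>P. dens2 m p (s p) (t p))) - \<bar>l s\<bar> * \<bar>l t\<bar> * E s t)"
  proof (intro sum_mono)
    fix s t assume st: "s \<in> Om" "t \<in> Om"
    show "l s * l t * (N / real (totient Q) * (\<Prod>p\<in>P. dens2 m p (s p) (t p))) - \<bar>l s\<bar> * \<bar>l t\<bar> * E s t \<le> l s * l t * f s t"
    \<comment> \<open>A vanishing coefficient gives no control over the modulus, so the error
      estimate is invoked only for nonzero ones.\<close>
    proof (cases "l s = 0 \<or> l t = 0")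
      case True thus ?thesis by auto
    next
      case False
      define d where "d = f s t - N / real (totient Q) * (\<Prod>p\<in>P. dens2 m p (s p) (t p))"
      have "\<bar>d\<bar> \<le> E s t" unfolding d_def using each[OF st] supp[OF st] False by blast
      hence "\<bar>l s * l t * d\<bar> \<le> \<bar>l s\<bar> * \<bar>l t\<bar> * E s t" unfolding abs_mult by (intro mult_left_mono) auto
      hence "- (\<bar>l s\<bar> * \<bar>l t\<bar> * E s t) \<le> l s * l t * d" by linarith
      thus ?thesis unfolding d_def by (simp only: right_diff_distrib)
    qed
  qed
  also have "(\<Sum>s\<in>Om. \<Sum>t\<in>Om. l s * l t * (N / real (totient Q) * (\<Prod>p\<in>P. dens2 m p (s p) (t p))) - \<bar>l s\<bar> * \<bar>l t\<bar> * E s t)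
     = N / real (totient Q) * (\<Sum>s\<in>Om. \<Sum>t\<in>Om. l s * l t * (\<Prod>p\<in>P. dens2 m p (s p) (t p))) - (\<Sum>s\<in>Om. \<Sum>t\<in>Om. \<bar>l s\<bar> * \<bar>l t\<bar> * E s t)"
    by (simp add: sum_subtractf sum_distrib_left mult_ac)
  finally show ?thesis unfolding E_def z_def .
qed

end

section \<open>Sieve weights and error terms\<close>

context sieve begin

text \<open>At an uncoloured prime the six colours contribute p/(p - 1) * 1/p each, at a coloured
  one only p/(p - 1) remains; both are at most 1 + 6/(p - 1).\<close>

lemma lam_abs_le:
  assumes eps1: "eps \<le> 1" and s: "s \<in> PiE P (\<lambda>_. insert 0 K)"
  shows "\<bar>lam P K yF s\<bar> \<le> 2 * Fm * Pi1 ^ 6"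
proof -
  let ?C = "PiE P (\<lambda>_. insert 0 K)"
  define g where "g p a b = (if a = 0 then 1 else real p / (real p - 1)) * \<bar>Tinv p a b\<bar>" for p a b :: nat
  have yF: "0 \<le> yF b" "yF b \<le> Fm" for b
    unfolding yF_def using F0 Fm ucol_PiE[of K] by auto
  have pos: "real p - 1 > 0" if "p \<in> P" for p using P_ge(1)[OF that] by simp
  have "\<bar>lam P K yF s\<bar> \<le> (\<Sum>c\<in>?C. \<bar>zcoef P yF c * (\<Prod>p\<in>P. Tinv p (c p) (s p))\<bar>)"
    unfolding lam_def by (rule sum_abs)
  also have "\<dots> \<le> (\<Sum>c\<in>?C. Fm * (\<Prod>p\<in>P. g p (c p) (s p)))"
  proof (intro sum_mono)
    fix c
    have "\<bar>zcoef P yF c * (\<Prod>p\<in>P. Tinv p (c p) (s p))\<bar> = yF c * (\<Prod>p\<in>P. g p (c p) (s p))"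
    proof -
      have "\<bar>\<Prod>p\<in>P. if c p = 0 then 1 else - (real p / (real p - 1))\<bar> = (\<Prod>p\<in>P. if c p = 0 then 1 else real p / (real p - 1))"
        unfolding abs_prod
      proof (intro prod.cong refl)
        fix p assume "p \<in> P"
        hence "0 \<le> real p / (real p - 1)" using pos[of p] by simp
        thus "\<bar>if c p = 0 then 1 else - (real p / (real p - 1))\<bar> = (if c p = 0 then 1 else real p / (real p - 1))" by auto
      qed
      thus ?thesis using yF(1)[of c] by (simp add: zcoef_def g_def abs_mult abs_prod prod.distrib)
    qed
    also have "\<dots> \<le> Fm * (\<Prod>p\<in>P. g p (c p) (s p))"
      using yF(2)[of c] pos by (intro mult_right_mono prod_nonneg) (auto simp: g_def less_imp_le)
    finally show "\<bar>zcoef P yF c * (\<Prod>p\<in>P. Tinv p (c p) (s p))\<bar> \<le> Fm * (\<Prod>p\<in>P. g p (c p) (s p))" .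
  qed
  also have "\<dots> = Fm * (\<Prod>p\<in>P. \<Sum>a\<in>insert 0 K. g p a (s p))"
    unfolding sum_distrib_left[symmetric] by (subst prod_sum_PiE) (use finite_P K in auto)
  finally have le: "\<bar>lam P K yF s\<bar> \<le> Fm * (\<Prod>p\<in>P. \<Sum>a\<in>insert 0 K. g p a (s p))" .
  have "(\<Prod>p\<in>P. \<Sum>a\<in>insert 0 K. g p a (s p)) \<le> (\<Prod>p\<in>P. 1 + 6 / (real p - 1))"
  proof (intro prod_mono conjI)
    fix p assume p: "p \<in> P"
    show "0 \<le> (\<Sum>a\<in>insert 0 K. g p a (s p))" using pos[OF p] by (intro sum_nonneg) (auto simp: g_def)
    show "(\<Sum>a\<in>insert 0 K. g p a (s p)) \<le> 1 + 6 / (real p - 1)"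
    proof (cases "s p = 0")
      case True
      have nz: "b \<noteq> 0" if "b \<in> K" for b using that K(2) by metis
      have "(\<Sum>a\<in>K. g p a (s p)) = (\<Sum>a\<in>K. 1 / (real p - 1))"
        using True nz pos[OF p] by (intro sum.cong) (auto simp: g_def Tinv_def)
      also have "\<dots> = 6 / (real p - 1)" using K by simp
      finally have "(\<Sum>a\<in>insert 0 K. g p a (s p)) = 1 + 6 / (real p - 1)"
        using True K by (simp add: g_def Tinv_def)
      thus ?thesis by simp
    next
      case False
      hence sK: "s p \<in> K" using s p by (auto simp: PiE_iff)
      have "(\<Sum>a\<in>insert 0 K. g p a (s p)) = (\<Sum>a\<in>K. g p a (s p))"
        using K False by (simp add: g_def Tinv_def)
      also have "\<dots> = g p (s p) (s p) + (\<Sum>a\<in>K-{s p}. g p a (s p))"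
        using K sK by (subst sum.remove) auto
      also have "(\<Sum>a\<in>K-{s p}. g p a (s p)) = 0" using False by (intro sum.neutral) (auto simp: g_def Tinv_def)
      also have "g p (s p) (s p) + 0 = real p / (real p - 1)" using False by (simp add: g_def Tinv_def)
      also have "\<dots> \<le> 1 + 6 / (real p - 1)" using pos[OF p] by (simp add: field_simps)
      finally show ?thesis .
    qed
  qed
  also have "(\<Prod>p\<in>P. 1 + 6 / (real p - 1)) \<le> 2 * Pi1 ^ 6"
  proof -
    have "(\<Prod>p\<in>P. 1 + 6 / (real p - 1)) - (\<Prod>p\<in>P. 1 + real 6 / real p) \<le> (\<Prod>p\<in>P. 1 + real 6 / real p) * eps"
    proof (intro prod_perturb)
      fix p assume p: "p \<in> P"
      define x where "x = real p - 1000"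
      have x: "x \<ge> 0" "real p = x + 1000" using P_ge(1)[OF p] by (auto simp: x_def)
      have "6 * (real p)\<^sup>2 \<le> (6 * real p + 1000) * (real p - 1)"
        unfolding x(2) using x(1) by (simp add: power2_eq_square algebra_simps)
      hence "6 / (real p - 1) * ((real p)\<^sup>2 * (real p - 1)) \<le> (6 * real p + 1000) / (real p)\<^sup>2 * ((real p)\<^sup>2 * (real p - 1))"
        using x by simp
      moreover have "(real p)\<^sup>2 * (real p - 1) > 0" using x by simp
      ultimately have "6 / (real p - 1) \<le> (6 * real p + 1000) / (real p)\<^sup>2" by (rule mult_right_le_imp_le)
      also have "\<dots> = real 6 / real p + 1000 / (real p)\<^sup>2" using pos[OF p] by (simp add: add_divide_distrib power2_eq_square)
      finally have "6 / (real p - 1) \<le> real 6 / real p + 1000 / (real p)\<^sup>2" .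
      moreover have "0 \<le> real 6 / real p * (1000 / (real p)\<^sup>2)" by simp
      moreover have "(1 + a) * (1 + b) = 1 + a + b + a * b" for a b :: real by (simp add: algebra_simps)
      ultimately show "1 + 6 / (real p - 1) \<le> (1 + real 6 / real p) * (1 + 1000 / (real p)\<^sup>2)"
        by (simp only:)
      show "0 \<le> 1 + 6 / (real p - 1)" using pos[OF p] by simp
    qed auto
    also have "\<dots> \<le> (\<Prod>p\<in>P. 1 + real 6 / real p) * 1" using eps1 by (intro mult_left_mono prod_nonneg) auto
    finally have "(\<Prod>p\<in>P. 1 + 6 / (real p - 1)) \<le> 2 * (\<Prod>p\<in>P. 1 + real 6 / real p)" by simp
    also have "\<dots> \<le> 2 * Pi1 ^ 6" by (intro mult_left_mono prod_one_plus_le_Pi1) auto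
    finally show ?thesis .
  qed
  finally have "(\<Prod>p\<in>P. \<Sum>a\<in>insert 0 K. g p a (s p)) \<le> 2 * Pi1 ^ 6" .
  from order_trans[OF le mult_left_mono[OF this Fm0]] show ?thesis by (simp only: mult_ac)
qed

text \<open>\<open>Tinv\<close> vanishes unless s p is 0 or equals c p, so the coloured primes of
  \<open>s\<close> are among those of some \<open>c\<close> in the support of the weight.\<close>

lemma lam_support:
  assumes s: "s \<in> PiE P (\<lambda>_. insert 0 K)" and nz: "lam P K yF s \<noteq> 0"
  shows "real (\<Prod>{p\<in>P. s p \<noteq> 0}) \<le> R"
proof -
  obtain c where c: "c \<in> PiE P (\<lambda>_. insert 0 K)" "zcoef P yF c * (\<Prod>p\<in>P. Tinv p (c p) (s p)) \<noteq> 0"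
    using nz unfolding lam_def by (rule sum.not_neutral_contains_not_neutral)
  have y: "yF c \<noteq> 0" using c(2) by (auto simp: zcoef_def)
  have T: "Tinv p (c p) (s p) \<noteq> 0" if "p \<in> P" for p using c(2) finite_P that by auto
  have sub: "{p\<in>P. s p \<noteq> 0} \<subseteq> {p\<in>P. c p \<noteq> 0}" 
  proof
    fix p assume p: "p \<in> {p\<in>P. s p \<noteq> 0}"
    hence "s p = c p" using T[of p] by (simp add: Tinv_def split: if_splits)
    thus "p \<in> {p\<in>P. c p \<noteq> 0}" using p by simp
  qed
  have "real (\<Prod>i\<in>K. ucol P K c i) \<le> R" 
  proof (rule ccontr)
    assume "\<not> ?thesis"
    hence "F (ucol P K c) = 0" using ucol_PiE[of K c] by (intro Fsupp) auto
    thus False using y by (simp add: yF_def)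
  qed
  moreover have "(\<Prod>i\<in>K. ucol P K c i) = \<Prod>{p\<in>P. c p \<noteq> 0}"
  proof -
    have "(\<Prod>i\<in>K. ucol P K c i) = (\<Prod>i\<in>K. \<Prod>p\<in>{p\<in>P. c p = i}. p)" by (intro prod.cong) (auto simp: ucol_def)
    also have "\<dots> = (\<Prod>p\<in>P. if c p = 0 then 1 else p)" by (rule prod_colours[OF finite_P K(1,2) c(1)])
    also have "\<dots> = (\<Prod>p\<in>P. if c p \<noteq> 0 then p else 1)" by (intro prod.cong) auto
    also have "\<dots> = \<Prod>{p\<in>P. c p \<noteq> 0}" by (rule prod.inter_filter[OF finite_P, symmetric])
    finally show ?thesis .
  qed
  moreover have le: "\<Prod>{p\<in>P. s p \<noteq> 0} \<le> \<Prod>{p\<in>P. c p \<noteq> 0}"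
  proof (rule dvd_imp_le)
    show "\<Prod>{p\<in>P. s p \<noteq> 0} dvd \<Prod>{p\<in>P. c p \<noteq> 0}" using finite_P sub by (intro prod_dvd_prod_subset) auto
    show "\<Prod>{p\<in>P. c p \<noteq> 0} > 0" using P_ge(2) prime_gt_0_nat by (intro prod_pos) auto
  qed
  moreover have "real (\<Prod>{p\<in>P. s p \<noteq> 0}) \<le> real (\<Prod>{p\<in>P. c p \<noteq> 0})" using le by (rule of_nat_mono)
  ultimately show ?thesis by linarith
qed

text \<open>Rankin's trick: on the support the product of the coloured primes is at most R, so each
  term may be multiplied by R over this product. The reciprocals sum to an Euler product bounded by
  Pi1^6.\<close>

lemma sum_lam_le:
  assumes eps1: "eps \<le> 1" and R1: "R \<ge> 1"
  shows "(\<Sum>s\<in>PiE P (\<lambda>_. insert 0 K). \<bar>lam P K yF s\<bar>) \<le> 2 * Fm * Pi1 ^ 12 * R"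
proof -
  let ?C = "PiE P (\<lambda>_. insert 0 K)"
  have "(\<Sum>s\<in>?C. \<bar>lam P K yF s\<bar>) \<le> (\<Sum>s\<in>?C. 2 * Fm * Pi1 ^ 6 * R * (\<Prod>p\<in>P. if s p = 0 then 1 else 1 / real p))"
  proof (intro sum_mono)
    fix s assume s: "s \<in> ?C"
    have w: "(\<Prod>p\<in>P. if s p = 0 then 1 else 1 / real p) = 1 / real (\<Prod>{p\<in>P. s p \<noteq> 0})"
    proof -
      have "(\<Prod>p\<in>P. if s p = 0 then 1 else 1 / real p) = (\<Prod>p\<in>P. if s p \<noteq> 0 then 1 / real p else 1)" by (intro prod.cong) auto
      also have "\<dots> = (\<Prod>p\<in>{p\<in>P. s p \<noteq> 0}. 1 / real p)" by (rule prod.inter_filter[OF finite_P, symmetric])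
      finally show ?thesis by (simp add: prod_dividef)
    qed
    have pos: "real (\<Prod>{p\<in>P. s p \<noteq> 0}) > 0" using P_ge(2) prime_gt_0_nat unfolding of_nat_0_less_iff by (intro prod_pos) auto
    have A: "0 \<le> 2 * Fm * Pi1 ^ 6" using Fm0 Pi1_ge1 by (intro mult_nonneg_nonneg) auto
    show "\<bar>lam P K yF s\<bar> \<le> 2 * Fm * Pi1 ^ 6 * R * (\<Prod>p\<in>P. if s p = 0 then 1 else 1 / real p)"
    proof (cases "lam P K yF s = 0")
      case True
      thus ?thesis unfolding w using A R1 pos by simp
    next
      case False
      have "1 \<le> R * (1 / real (\<Prod>{p\<in>P. s p \<noteq> 0}))" using lam_support[OF s False] pos by (simp add: field_simps del: of_nat_prod)
      hence "2 * Fm * Pi1 ^ 6 * 1 \<le> 2 * Fm * Pi1 ^ 6 * (R * (1 / real (\<Prod>{p\<in>P. s p \<noteq> 0})))" using A by (intro mult_left_mono)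
      thus ?thesis using lam_abs_le[OF eps1 s] unfolding w by (simp only: mult.assoc mult_1_right)
    qed
  qed
  also have "\<dots> = 2 * Fm * Pi1 ^ 6 * R * (\<Prod>p\<in>P. 1 + real 6 / real p)"
    unfolding sum_distrib_left[symmetric] sum_configs[OF finite_P K(1,2)] K(3) by simp
  also have "\<dots> \<le> 2 * Fm * Pi1 ^ 6 * R * Pi1 ^ 6"
    using Fm0 Pi1_ge1 R1 by (intro mult_left_mono prod_one_plus_le_Pi1 mult_nonneg_nonneg) auto
  also have "\<dots> = 2 * Fm * Pi1 ^ 12 * R"
  proof -
    have "Pi1 ^ 6 * Pi1 ^ 6 = Pi1 ^ 12" by (simp flip: power_add)
    moreover have "2 * Fm * Pi1 ^ 6 * R * Pi1 ^ 6 = 2 * Fm * (Pi1 ^ 6 * Pi1 ^ 6) * R" by (simp only: mult_ac)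
    ultimately show ?thesis by simp
  qed
  finally show ?thesis .
qed

text \<open>Each prime of B offers at most 7 * 7 = 49 pairs of colours, counting 0.\<close>

lemma card_pairs_le:
  assumes "B \<subseteq> P"
  shows "card {x\<in>PiE P (\<lambda>_. insert 0 K) \<times> PiE P (\<lambda>_. insert 0 K). {p\<in>P. fst x p \<noteq> 0 \<or> snd x p \<noteq> 0} = B} \<le> 49 ^ card B"
proof -
  let ?C = "PiE P (\<lambda>_. insert 0 K)"
  let ?S = "{x\<in>?C \<times> ?C. {p\<in>P. fst x p \<noteq> 0 \<or> snd x p \<noteq> 0} = B}"
  let ?T = "PiE B (\<lambda>_. insert 0 K \<times> insert 0 K)"
  define f where "f x = (\<lambda>p\<in>B. (fst x p, snd x p))" for x :: "(nat \<Rightarrow> nat) \<times> (nat \<Rightarrow> nat)"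
  have finB: "finite B" using assms finite_P finite_subset by blast
  have "card ?S \<le> card ?T"
  proof (rule card_inj_on_le)
    show "finite ?T" using finB K by (intro finite_PiE) auto
    show "f ` ?S \<subseteq> ?T"
    proof (rule image_subsetI)
      fix x assume x: "x \<in> ?S"
      hence x': "fst x \<in> ?C" "snd x \<in> ?C" by auto
      have "(fst x p, snd x p) \<in> insert 0 K \<times> insert 0 K" if "p \<in> B" for p
        using PiE_mem[OF x'(1), of p] PiE_mem[OF x'(2), of p] subsetD[OF assms that] by blast
      thus "f x \<in> ?T" unfolding f_def by (simp only: restrict_PiE_iff) simp
    qed
    show "inj_on f ?S"
    proof (rule inj_onI)
      fix x y assume x: "x \<in> ?S" and y: "y \<in> ?S" and e: "f x = f y"
      have "fst x p = fst y p \<and> snd x p = snd y p" if p: "p \<in> P" for p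
      proof (cases "p \<in> B")
        case True thus ?thesis using fun_cong[OF e, of p] by (simp add: f_def)
      next
        case False
        have "p \<notin> {p\<in>P. fst x p \<noteq> 0 \<or> snd x p \<noteq> 0}" "p \<notin> {p\<in>P. fst y p \<noteq> 0 \<or> snd y p \<noteq> 0}" using x y False by auto
        thus ?thesis using p by auto
      qed
      note pt = this
      have m: "fst x \<in> ?C" "snd x \<in> ?C" "fst y \<in> ?C" "snd y \<in> ?C" using x y by auto
      have "fst x = fst y" by (rule PiE_ext[OF m(1,3)]) (use pt in blast)
      moreover have "snd x = snd y" by (rule PiE_ext[OF m(2,4)]) (use pt in blast)
      ultimately
      show "x = y" by (rule prod_eqI)
    qed
  qed
  also have "card ?T = 49 ^ card B"
  proof -
    have "card (insert 0 K) = 7" using K by simp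
    hence "card (insert 0 K \<times> insert 0 K) = 49" by (simp only: card_cartesian_product)
    thus ?thesis by (simp only: card_PiE[OF finB] prod_constant)
  qed
  finally show ?thesis .
qed

text \<open>One modulus can arise from 49^(card B) pairs, whereas the distribution hypothesis
  controls only a sum without multiplicities. The parameter \<open>d\<close> balances two bounds:
  the squared multiplicities, 49^2 = 2401 for each prime, meet the trivial bound M/phi, where
  2401/(p - 1) <= 4802/p explains the power Pi1^4802; the plain sum of E is paid for by 1/d.\<close>

lemma error_sum_le:
  fixes E :: "nat \<Rightarrow> real"
  assumes eps1: "eps \<le> 1" and q: "q \<ge> 1" and X: "real q * R\<^sup>2 \<le> real X" and d: "d > 0" and R1: "R \<ge> 1"
    and E0: "\<And>n. n \<in> {1..X} \<Longrightarrow> 0 \<le> E n"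
    and EM: "\<And>B. B \<subseteq> P \<Longrightarrow> q * \<Prod>B \<le> X \<Longrightarrow> E (q * \<Prod>B) \<le> M * (\<Prod>p\<in>B. 1 / (real p - 1))" and M: "M \<ge> 0"
  shows "(\<Sum>s\<in>PiE P (\<lambda>_. insert 0 K). \<Sum>t\<in>PiE P (\<lambda>_. insert 0 K). \<bar>lam P K yF s\<bar> * \<bar>lam P K yF t\<bar> * E (q * \<Prod>{p\<in>P. s p \<noteq> 0 \<or> t p \<noteq> 0}))
    \<le> 4 * Fm\<^sup>2 * Pi1 ^ 12 * (d * M * Pi1 ^ 4802 + (\<Sum>n\<in>{1..X}. E n) / d)"
proof -
  let ?C = "PiE P (\<lambda>_. insert 0 K)"
  define Bs where "Bs s t = {p\<in>P. s p \<noteq> 0 \<or> t p \<noteq> 0}" for s t :: "nat \<Rightarrow> nat"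
  define \<B> where "\<B> = {B\<in>Pow P. q * \<Prod>B \<le> X}"
  have fin\<B>: "finite \<B>" using finite_P by (simp add: \<B>_def)
  have finC: "finite ?C" using finite_P K by (intro finite_PiE) auto
  have A: "0 \<le> 2 * Fm * Pi1 ^ 6" using Fm0 Pi1_ge1 by (intro mult_nonneg_nonneg) auto
  have prod1: "\<Prod>B \<ge> 1" if "B \<subseteq> P" for B
  proof -
    have "1 \<le> p" if "p \<in> B" for p using that \<open>B \<subseteq> P\<close> P_ge(3)[of p] D by auto
    thus ?thesis by (intro prod_ge_1) auto
  qed
  have EB0: "E (q * \<Prod>B) \<ge> 0" if "B \<in> \<B>" for B
  proof -
    have "1 * 1 \<le> q * \<Prod>B" using q prod1[of B] that by (intro mult_mono) (auto simp: \<B>_def)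
    thus ?thesis using that by (intro E0) (auto simp: \<B>_def)
  qed
  have inB: "Bs s t \<in> \<B>" if st: "s \<in> ?C" "t \<in> ?C" "lam P K yF s \<noteq> 0" "lam P K yF t \<noteq> 0" for s t
  proof -
    let ?S = "{p\<in>P. s p \<noteq> 0}" and ?T = "{p\<in>P. t p \<noteq> 0}"
    have e: "Bs s t = ?S \<union> ?T" by (auto simp: Bs_def)
    have "\<Prod>(?S \<union> ?T) * \<Prod>(?S \<inter> ?T) = \<Prod>?S * \<Prod>?T" using finite_P by (intro prod.union_inter) auto
    moreover have "\<Prod>(?S \<inter> ?T) \<ge> 1" by (rule prod1) auto
    moreover from this have "\<Prod>(?S \<union> ?T) * 1 \<le> \<Prod>(?S \<union> ?T) * \<Prod>(?S \<inter> ?T)" by (rule mult_le_mono2)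
    ultimately have "\<Prod>(Bs s t) \<le> \<Prod>?S * \<Prod>?T" unfolding e by linarith
    hence "real (\<Prod>(Bs s t)) \<le> real (\<Prod>?S * \<Prod>?T)" by (rule of_nat_mono)
    hence "real (\<Prod>(Bs s t)) \<le> real (\<Prod>?S) * real (\<Prod>?T)" by (simp only: of_nat_mult)
    also have "\<dots> \<le> R * R" using lam_support[OF st(1,3)] lam_support[OF st(2,4)] R1 by (intro mult_mono) (auto intro!: prod_nonneg)
    finally have "real q * real (\<Prod>(Bs s t)) \<le> real q * R\<^sup>2" by (intro mult_left_mono) (auto simp: power2_eq_square)
    hence "real (q * \<Prod>(Bs s t)) \<le> real X" using X by simp
    hence "q * \<Prod>(Bs s t) \<le> X" by (simp only: of_nat_le_iff)
    moreover have "Bs s t \<subseteq> P" by (auto simp: Bs_def)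
    ultimately show ?thesis by (simp add: \<B>_def)
  qed
  have "(\<Sum>s\<in>?C. \<Sum>t\<in>?C. \<bar>lam P K yF s\<bar> * \<bar>lam P K yF t\<bar> * E (q * \<Prod>(Bs s t)))
     \<le> (\<Sum>s\<in>?C. \<Sum>t\<in>?C. (2 * Fm * Pi1 ^ 6)\<^sup>2 * (if Bs s t \<in> \<B> then E (q * \<Prod>(Bs s t)) else 0))"
  proof (intro sum_mono)
    fix s t assume st: "s \<in> ?C" "t \<in> ?C"
    show "\<bar>lam P K yF s\<bar> * \<bar>lam P K yF t\<bar> * E (q * \<Prod>(Bs s t)) \<le> (2 * Fm * Pi1 ^ 6)\<^sup>2 * (if Bs s t \<in> \<B> then E (q * \<Prod>(Bs s t)) else 0)"
    proof (cases "lam P K yF s = 0 \<or> lam P K yF t = 0")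
      case True
      have "0 \<le> (2 * Fm * Pi1 ^ 6)\<^sup>2 * (if Bs s t \<in> \<B> then E (q * \<Prod>(Bs s t)) else 0)" using EB0 by (intro mult_nonneg_nonneg) auto
      thus ?thesis using True by auto
    next
      case False
      hence b: "Bs s t \<in> \<B>" using inB st by blast
      have "\<bar>lam P K yF s\<bar> * \<bar>lam P K yF t\<bar> \<le> (2 * Fm * Pi1 ^ 6) * (2 * Fm * Pi1 ^ 6)"
        using lam_abs_le[OF eps1] st A by (intro mult_mono) auto
      hence "\<bar>lam P K yF s\<bar> * \<bar>lam P K yF t\<bar> * E (q * \<Prod>(Bs s t)) \<le> (2 * Fm * Pi1 ^ 6)\<^sup>2 * E (q * \<Prod>(Bs s t))"
        using EB0[OF b] unfolding power2_eq_square by (intro mult_right_mono)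
      thus ?thesis using b by simp
    qed
  qed
  also have "\<dots> = (2 * Fm * Pi1 ^ 6)\<^sup>2 * (\<Sum>s\<in>?C. \<Sum>t\<in>?C. if Bs s t \<in> \<B> then E (q * \<Prod>(Bs s t)) else 0)"
    by (simp only: sum_distrib_left)
  also have "\<dots> \<le> (2 * Fm * Pi1 ^ 6)\<^sup>2 * (d * M * Pi1 ^ 4802 + (\<Sum>n\<in>{1..X}. E n) / d)"
  proof (intro mult_left_mono)
    define N where "N B = card {x\<in>?C \<times> ?C. Bs (fst x) (snd x) = B}" for B
    have N: "N B \<le> 49 ^ card B" if "B \<in> \<B>" for B
      unfolding N_def Bs_def by (rule card_pairs_le) (use that in \<open>auto simp: \<B>_def\<close>)
    have "(\<Sum>s\<in>?C. \<Sum>t\<in>?C. if Bs s t \<in> \<B> then E (q * \<Prod>(Bs s t)) else 0)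
      = (\<Sum>x\<in>?C \<times> ?C. if Bs (fst x) (snd x) \<in> \<B> then E (q * \<Prod>(Bs (fst x) (snd x))) else 0)"
      by (subst sum.cartesian_product) (simp add: case_prod_unfold)
    also have "\<dots> = (\<Sum>x\<in>{x\<in>?C \<times> ?C. Bs (fst x) (snd x) \<in> \<B>}. E (q * \<Prod>(Bs (fst x) (snd x))))"
      using finC by (intro sum.inter_filter[symmetric]) auto
    also have "\<dots> = (\<Sum>B\<in>\<B>. \<Sum>x\<in>{x\<in>{x\<in>?C \<times> ?C. Bs (fst x) (snd x) \<in> \<B>}. Bs (fst x) (snd x) = B}. E (q * \<Prod>(Bs (fst x) (snd x))))"
      using finC fin\<B> by (intro sum.group[symmetric]) auto
    also have "\<dots> = (\<Sum>B\<in>\<B>. real (N B) * E (q * \<Prod>B))"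
    proof (intro sum.cong refl)
      fix B assume B: "B \<in> \<B>"
      have e: "{x\<in>{x\<in>?C \<times> ?C. Bs (fst x) (snd x) \<in> \<B>}. Bs (fst x) (snd x) = B} = {x\<in>?C \<times> ?C. Bs (fst x) (snd x) = B}" using B by auto
      have "(\<Sum>x\<in>{x\<in>?C \<times> ?C. Bs (fst x) (snd x) = B}. E (q * \<Prod>(Bs (fst x) (snd x)))) = (\<Sum>x\<in>{x\<in>?C \<times> ?C. Bs (fst x) (snd x) = B}. E (q * \<Prod>B))"
        by (intro sum.cong refl) simp
      thus "(\<Sum>x\<in>{x\<in>{x\<in>?C \<times> ?C. Bs (fst x) (snd x) \<in> \<B>}. Bs (fst x) (snd x) = B}. E (q * \<Prod>(Bs (fst x) (snd x)))) = real (N B) * E (q * \<Prod>B)"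
        unfolding e N_def by simp
    qed
    also have "\<dots> \<le> (\<Sum>B\<in>\<B>. d * M * (\<Prod>p\<in>B. 2401 * (1 / (real p - 1))) + E (q * \<Prod>B) / d)"
    proof (intro sum_mono)
      fix B assume B: "B \<in> \<B>"
      define x :: real where "x = 49 ^ card B"
      have finB: "finite B" using B finite_P finite_subset by (auto simp: \<B>_def)
      \<comment> \<open>\<open>x \<le> d x\<^sup>2 + 1 / d\<close> plays the role of Cauchy--Schwarz in separating the multiplicities from \<open>E\<close>.\<close>
      have "0 \<le> (d * x - 1)\<^sup>2" by simp
      hence "2 * d * x \<le> d * d * x * x + 1" by (simp add: power2_eq_square algebra_simps)
      moreover have "d * x \<ge> 0" using d by (simp add: x_def)
      ultimately have "d * x \<le> d * (d * x\<^sup>2 + 1 / d)" using d by (simp add: algebra_simps power2_eq_square)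
      hence x: "x \<le> d * x\<^sup>2 + 1 / d" using d by simp
      have "real (N B) \<le> x" 
      proof -
        have "real (N B) \<le> real (49 ^ card B)" using N[OF B] by (rule of_nat_mono)
        thus ?thesis by (simp add: x_def)
      qed
      hence "real (N B) * E (q * \<Prod>B) \<le> (d * x\<^sup>2 + 1 / d) * E (q * \<Prod>B)"
        using x EB0[OF B] by (intro mult_right_mono) auto
      also have "\<dots> = d * x\<^sup>2 * E (q * \<Prod>B) + E (q * \<Prod>B) / d" by (simp add: algebra_simps)
      also have "d * x\<^sup>2 * E (q * \<Prod>B) \<le> d * x\<^sup>2 * (M * (\<Prod>p\<in>B. 1 / (real p - 1)))"
        using EM[of B] B d by (intro mult_left_mono) (auto simp: \<B>_def)
      also have "d * x\<^sup>2 * (M * (\<Prod>p\<in>B. 1 / (real p - 1))) = d * M * (\<Prod>p\<in>B. 2401 * (1 / (real p - 1)))"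
      proof -
        have "x\<^sup>2 = 2401 ^ card B" unfolding x_def by (simp flip: power_mult power_mult_distrib add: power2_eq_square)
        moreover have "(\<Prod>p\<in>B. 2401 * (1 / (real p - 1))) = 2401 ^ card B * (\<Prod>p\<in>B. 1 / (real p - 1))"
          by (simp only: prod.distrib prod_constant)
        ultimately show ?thesis by (simp only: mult_ac)
      qed
      finally show "real (N B) * E (q * \<Prod>B) \<le> d * M * (\<Prod>p\<in>B. 2401 * (1 / (real p - 1))) + E (q * \<Prod>B) / d" by simp
    qed
    also have "\<dots> = d * M * (\<Sum>B\<in>\<B>. \<Prod>p\<in>B. 2401 * (1 / (real p - 1))) + (\<Sum>B\<in>\<B>. E (q * \<Prod>B)) / d"
      by (simp add: sum.distrib sum_distrib_left sum_divide_distrib)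
    also have "\<dots> \<le> d * M * Pi1 ^ 4802 + (\<Sum>n\<in>{1..X}. E n) / d"
    proof (intro add_mono mult_left_mono divide_right_mono)
      have pos: "real p - 1 > 0" if "p \<in> P" for p using P_ge(1)[OF that] by simp
      have "(\<Sum>B\<in>\<B>. \<Prod>p\<in>B. 2401 * (1 / (real p - 1))) \<le> (\<Sum>B\<in>Pow P. \<Prod>p\<in>B. 2401 * (1 / (real p - 1)))"
      proof (intro sum_mono2)
        show "0 \<le> (\<Prod>p\<in>B. 2401 * (1 / (real p - 1)))" if "B \<in> Pow P - \<B>" for B
        proof (intro prod_nonneg)
          fix p assume "p \<in> B"
          hence "real p - 1 > 0" using that pos by auto
          thus "0 \<le> 2401 * (1 / (real p - 1))" by simp
        qed
      qed (use finite_P in \<open>auto simp: \<B>_def\<close>)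
      also have "\<dots> = (\<Prod>p\<in>P. 1 + 2401 * (1 / (real p - 1)))" by (rule prod_one_plus_eq_sum_subsets[OF finite_P, symmetric])
      also have "\<dots> \<le> (\<Prod>p\<in>P. 1 + real 4802 / real p)"
      proof (intro prod_mono conjI)
        fix p assume p: "p \<in> P"
        show "0 \<le> 1 + 2401 * (1 / (real p - 1))" using pos[OF p] by simp
        show "1 + 2401 * (1 / (real p - 1)) \<le> 1 + real 4802 / real p" using pos[OF p] P_ge(1)[OF p] by (simp add: field_simps)
      qed
      also have "\<dots> \<le> Pi1 ^ 4802" by (rule prod_one_plus_le_Pi1)
      finally show "(\<Sum>B\<in>\<B>. \<Prod>p\<in>B. 2401 * (1 / (real p - 1))) \<le> Pi1 ^ 4802" .
      have inj: "inj_on (\<lambda>B. q * \<Prod>B) \<B>"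
      proof (rule inj_onI)
        fix A B assume AB: "A \<in> \<B>" "B \<in> \<B>" "q * \<Prod>A = q * \<Prod>B"
        have "\<Prod>A = \<Prod>B" using AB(3) q by simp
        moreover have "A \<in> Pow {p. prime p \<and> real p \<le> R}" "B \<in> Pow {p. prime p \<and> real p \<le> R}"
          using AB by (auto simp: \<B>_def P_def)
        ultimately show "A = B" by (rule inj_onD[OF inj_on_prod_primes])
      qed
      have "(\<Sum>B\<in>\<B>. E (q * \<Prod>B)) = (\<Sum>n\<in>(\<lambda>B. q * \<Prod>B) ` \<B>. E n)" using inj by (simp add: sum.reindex)
      also have "\<dots> \<le> (\<Sum>n\<in>{1..X}. E n)"
      proof (intro sum_mono2)
        show "(\<lambda>B. q * \<Prod>B) ` \<B> \<subseteq> {1..X}"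
        proof
          fix n assume "n \<in> (\<lambda>B. q * \<Prod>B) ` \<B>"
          then obtain B where B: "n = q * \<Prod>B" "B \<in> \<B>" by auto
          have "1 * 1 \<le> q * \<Prod>B" using q prod1[of B] B(2) by (intro mult_mono) (auto simp: \<B>_def)
          thus "n \<in> {1..X}" using B by (auto simp: \<B>_def)
        qed
      qed (use E0 in auto)
      finally show "(\<Sum>B\<in>\<B>. E (q * \<Prod>B)) \<le> (\<Sum>n\<in>{1..X}. E n)" .
    qed (use d M in auto)
    finally show "(\<Sum>s\<in>?C. \<Sum>t\<in>?C. if Bs s t \<in> \<B> then E (q * \<Prod>(Bs s t)) else 0) \<le> d * M * Pi1 ^ 4802 + (\<Sum>n\<in>{1..X}. E n) / d" .
  qed auto
  also have "(2 * Fm * Pi1 ^ 6)\<^sup>2 = 4 * Fm\<^sup>2 * Pi1 ^ 12" by (simp add: power_mult_distrib flip: power_mult)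
  finally show ?thesis unfolding Bs_def .
qed

end

section \<open>Six linear forms\<close>

text \<open>In the class chosen below n + 3 is divisible by 36, so 3 is left out. Each of the other
  numbers receives one fixed prime through \<open>mult6\<close>: n is odd and divisible by 3, which
  puts 2 into n + 1 and n + 5 and 3 into n and n + 6, while n + 2 and n + 4 are free of 2 and 3 and
  are given 5 and 7.\<close>

definition shift :: "nat \<Rightarrow> nat" where
  "shift m = (if m = 1 then 0 else if m = 2 then 1 else if m = 3 then 2 else if m = 4 then 4 else if m = 5 then 5 else 6)"

definition mult6 :: "nat \<Rightarrow> nat" where
  "mult6 m = (if m = 1 then 3 else if m = 2 then 2 else if m = 3 then 5 else if m = 4 then 7 else if m = 5 then 2 else 3)"

section \<open>Choice of the residue class\<close>

lemma not_coprime_prime: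
  fixes a b :: nat
  assumes "\<And>p. prime p \<Longrightarrow> p dvd a \<Longrightarrow> p dvd b \<Longrightarrow> False"
  shows "coprime a b"
proof (rule ccontr)
  assume "\<not> coprime a b"
  hence "gcd a b \<noteq> 1" unfolding coprime_iff_gcd_eq_1 .
  then obtain p where p: "prime p" "p dvd gcd a b" using prime_factor_nat by blast
  have "p dvd a" "p dvd b" using p(2) by simp_all
  thus False using assms[OF p(1)] by blast
qed

lemma prime_less_11: "prime (p::nat) \<Longrightarrow> p < 11 \<Longrightarrow> p = 2 \<or> p = 3 \<or> p = 5 \<or> p = 7"
proof -
  assume p: "prime p" "p < 11"
  have "p = 0 \<or> p = 1 \<or> p = 2 \<or> p = 3 \<or> p = 4 \<or> p = 5 \<or> p = 6 \<or> p = 7 \<or> p = 8 \<or> p = 9 \<or> p = 10"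
    using p(2) by arith
  moreover have "p \<noteq> 0" "p \<noteq> 1" using prime_gt_1_nat[OF p(1)] by auto
  moreover have "\<not> (2 dvd p \<and> p \<noteq> 2)" using primes_dvd_imp_eq[OF two_is_prime_nat p(1)] by blast
  moreover have "\<not> (3 dvd p \<and> p \<noteq> 3)"
  proof -
    have "prime (3::nat)" by simp
    thus ?thesis using primes_dvd_imp_eq[of 3 p] p(1) by blast
  qed
  moreover have "2 dvd (4::nat)" "2 dvd (6::nat)" "2 dvd (8::nat)" "3 dvd (9::nat)" "2 dvd (10::nat)" by simp_all
  ultimately show ?thesis by auto
qed

lemma residue_neq:
  fixes v h q y :: nat
  assumes "(v mod q + h) mod q \<noteq> 0" "q dvd y"
  shows "v + h \<noteq> y"
proof
  assume "v + h = y"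
  hence "(v + h) mod q = 0" using assms(2) by simp
  thus False using assms(1) mod_add_left_eq[of v q h] by simp
qed

lemma residue_dvd:
  fixes v h q :: nat
  assumes "(v mod q + h) mod q = 0"
  shows "q dvd v + h"
  unfolding dvd_eq_mod_eq_0 mod_add_left_eq[of v q h, symmetric] by (rule assms)

text \<open>Residues modulo p show which shifts p divides at all. Only for p =
  \<open>mult6 m\<close> is the residue modulo p^2 needed, to see that this factor occurs exactly
  once.\<close>

lemma shift_residues:
  fixes v k p :: nat
  assumes v: "v mod 4 = 1" "v mod 9 = 6" "v mod 25 = 3" "v mod 49 = 3" and m: "m \<in> {1..6}"
  shows "mult6 m dvd v + shift m" and "p = 2 \<or> p = 3 \<or> p = 5 \<or> p = 7 \<Longrightarrow> v + shift m \<noteq> mult6 m * (p * k)"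
proof -
  have mm: "m = 1 \<or> m = 2 \<or> m = 3 \<or> m = 4 \<or> m = 5 \<or> m = 6" using m by auto
  have r: "v mod 2 = 1" "v mod 3 = 0" "v mod 5 = 3" "v mod 7 = 3"
    using v mod_mod_cancel[of 2 4 v] mod_mod_cancel[of 3 9 v] mod_mod_cancel[of 5 25 v] mod_mod_cancel[of 7 49 v] by simp_all
  have d: "3 dvd v" "2 dvd v + 1" "5 dvd v + 2" "7 dvd v + 4" "2 dvd v + 5" "3 dvd v + 6"
  proof -
    show "3 dvd v" using r(2) by (simp only: dvd_eq_mod_eq_0)
    show "2 dvd v + 1" "5 dvd v + 2" "7 dvd v + 4" "2 dvd v + 5" "3 dvd v + 6"
      by (rule residue_dvd, simp add: r)+
  qed
  show "mult6 m dvd v + shift m" using mm d by (elim disjE) (simp_all add: mult6_def shift_def)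
  have e1: "v + 0 \<noteq> 3 * (2 * k)" "v + 0 \<noteq> 3 * (3 * k)" "v + 0 \<noteq> 3 * (5 * k)" "v + 0 \<noteq> 3 * (7 * k)"
  proof -
    show "v + 0 \<noteq> 3 * (2 * k)" by (rule residue_neq[of v 2], simp add: r, rule dvd_mult, rule dvd_triv_left)
    show "v + 0 \<noteq> 3 * (3 * k)" by (rule residue_neq[of v 9]) (simp_all add: v)
    show "v + 0 \<noteq> 3 * (5 * k)" by (rule residue_neq[of v 5], simp add: r, rule dvd_mult, rule dvd_triv_left)
    show "v + 0 \<noteq> 3 * (7 * k)" by (rule residue_neq[of v 7], simp add: r, rule dvd_mult, rule dvd_triv_left)
  qed
  have e2: "v + 1 \<noteq> 2 * (2 * k)" "v + 1 \<noteq> 2 * (3 * k)" "v + 1 \<noteq> 2 * (5 * k)" "v + 1 \<noteq> 2 * (7 * k)"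
  proof -
    show "v + 1 \<noteq> 2 * (2 * k)" by (rule residue_neq[of v 4]) (simp_all add: v)
    show "v + 1 \<noteq> 2 * (3 * k)" by (rule residue_neq[of v 3], simp add: r, rule dvd_mult, rule dvd_triv_left)
    show "v + 1 \<noteq> 2 * (5 * k)" by (rule residue_neq[of v 5], simp add: r, rule dvd_mult, rule dvd_triv_left)
    show "v + 1 \<noteq> 2 * (7 * k)" by (rule residue_neq[of v 7], simp add: r, rule dvd_mult, rule dvd_triv_left)
  qed
  have e3: "v + 2 \<noteq> 5 * (2 * k)" "v + 2 \<noteq> 5 * (3 * k)" "v + 2 \<noteq> 5 * (5 * k)" "v + 2 \<noteq> 5 * (7 * k)"
  proof -
    show "v + 2 \<noteq> 5 * (2 * k)" by (rule residue_neq[of v 2], simp add: r, rule dvd_mult, rule dvd_triv_left)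
    show "v + 2 \<noteq> 5 * (3 * k)" by (rule residue_neq[of v 3], simp add: r, rule dvd_mult, rule dvd_triv_left)
    show "v + 2 \<noteq> 5 * (5 * k)" by (rule residue_neq[of v 25]) (simp_all add: v)
    show "v + 2 \<noteq> 5 * (7 * k)" by (rule residue_neq[of v 7], simp add: r, rule dvd_mult, rule dvd_triv_left)
  qed
  have e4: "v + 4 \<noteq> 7 * (2 * k)" "v + 4 \<noteq> 7 * (3 * k)" "v + 4 \<noteq> 7 * (5 * k)" "v + 4 \<noteq> 7 * (7 * k)"
  proof -
    show "v + 4 \<noteq> 7 * (2 * k)" by (rule residue_neq[of v 2], simp add: r, rule dvd_mult, rule dvd_triv_left)
    show "v + 4 \<noteq> 7 * (3 * k)" by (rule residue_neq[of v 3], simp add: r, rule dvd_mult, rule dvd_triv_left)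
    show "v + 4 \<noteq> 7 * (5 * k)" by (rule residue_neq[of v 5], simp add: r, rule dvd_mult, rule dvd_triv_left)
    show "v + 4 \<noteq> 7 * (7 * k)" by (rule residue_neq[of v 49]) (simp_all add: v)
  qed
  have e5: "v + 5 \<noteq> 2 * (2 * k)" "v + 5 \<noteq> 2 * (3 * k)" "v + 5 \<noteq> 2 * (5 * k)" "v + 5 \<noteq> 2 * (7 * k)"
  proof -
    show "v + 5 \<noteq> 2 * (2 * k)" by (rule residue_neq[of v 4]) (simp_all add: v)
    show "v + 5 \<noteq> 2 * (3 * k)" by (rule residue_neq[of v 3], simp add: r, rule dvd_mult, rule dvd_triv_left)
    show "v + 5 \<noteq> 2 * (5 * k)" by (rule residue_neq[of v 5], simp add: r, rule dvd_mult, rule dvd_triv_left)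
    show "v + 5 \<noteq> 2 * (7 * k)" by (rule residue_neq[of v 7], simp add: r, rule dvd_mult, rule dvd_triv_left)
  qed
  have e6: "v + 6 \<noteq> 3 * (2 * k)" "v + 6 \<noteq> 3 * (3 * k)" "v + 6 \<noteq> 3 * (5 * k)" "v + 6 \<noteq> 3 * (7 * k)"
  proof -
    show "v + 6 \<noteq> 3 * (2 * k)" by (rule residue_neq[of v 2], simp add: r, rule dvd_mult, rule dvd_triv_left)
    show "v + 6 \<noteq> 3 * (3 * k)" by (rule residue_neq[of v 9]) (simp_all add: v)
    show "v + 6 \<noteq> 3 * (5 * k)" by (rule residue_neq[of v 5], simp add: r, rule dvd_mult, rule dvd_triv_left)
    show "v + 6 \<noteq> 3 * (7 * k)" by (rule residue_neq[of v 7], simp add: r, rule dvd_mult, rule dvd_triv_left)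
  qed
  show "v + shift m \<noteq> mult6 m * (p * k)" if p: "p = 2 \<or> p = 3 \<or> p = 5 \<or> p = 7"
  proof -
    have "v + shift 1 \<noteq> mult6 1 * (p * k)" using p e1 by (elim disjE) (simp_all add: shift_def mult6_def)
    moreover have "v + shift 2 \<noteq> mult6 2 * (p * k)" using p e2 by (elim disjE) (simp_all add: shift_def mult6_def)
    moreover have "v + shift 3 \<noteq> mult6 3 * (p * k)" using p e3 by (elim disjE) (simp_all add: shift_def mult6_def)
    moreover have "v + shift 4 \<noteq> mult6 4 * (p * k)" using p e4 by (elim disjE) (simp_all add: shift_def mult6_def)
    moreover have "v + shift 5 \<noteq> mult6 5 * (p * k)" using p e5 by (elim disjE) (simp_all add: shift_def mult6_def)
    moreover have "v + shift 6 \<noteq> mult6 6 * (p * k)" using p e6 by (elim disjE) (simp_all add: shift_def mult6_def)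
    ultimately show ?thesis using mm by blast
  qed
qed

lemma modulus_exists:
  assumes D: "D \<ge> 11"
  shows "\<exists>Q v. Q \<ge> 1 \<and> (\<forall>p. prime p \<longrightarrow> (p dvd Q \<longleftrightarrow> p \<le> D)) \<and>
    (\<forall>m\<in>{1..6}. (mult6 m)\<^sup>2 dvd Q \<and> mult6 m dvd v + shift m \<and> coprime ((v + shift m) div mult6 m) Q)"
proof -
  define P where "P = {p. prime p \<and> 11 \<le> p \<and> p \<le> D}"
  define B where "B = 1225 * \<Prod>P"
  define Q where "Q = 36 * B"
  have finP: "finite P" unfolding P_def by simp
  have dP: "p dvd \<Prod>P \<longleftrightarrow> p \<in> P" if "prime p" for p
  proof -
    have "p dvd \<Prod>P \<longleftrightarrow> (\<exists>x\<in>P. p dvd x)" using prime_dvd_prod_iff[of P p "\<lambda>x. x"] finP that by simp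
    also have "\<dots> \<longleftrightarrow> p \<in> P"
    proof
      assume "\<exists>x\<in>P. p dvd x"
      then obtain x where "x \<in> P" "p dvd x" by blast
      thus "p \<in> P" using primes_dvd_imp_eq[of p x] that by (simp add: P_def)
    next
      assume "p \<in> P" thus "\<exists>x\<in>P. p dvd x" by (intro bexI[where x = p]) simp_all
    qed
    finally show ?thesis .
  qed
  have d36: "p dvd 36 \<longleftrightarrow> p = 2 \<or> p = 3" if "prime p" for p :: nat
  proof
    assume "p dvd 36"
    moreover have "(36::nat) = 2 * 2 * (3 * 3)" by simp
    ultimately have "p dvd 2 \<or> p dvd 3" using that by (simp only: prime_dvd_mult_iff) blast
    thus "p = 2 \<or> p = 3" using primes_dvd_imp_eq[OF that two_is_prime_nat] primes_dvd_imp_eq[OF that, of 3] by auto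
  qed auto
  have d1225: "p dvd 1225 \<longleftrightarrow> p = 5 \<or> p = 7" if "prime p" for p :: nat
  proof
    assume "p dvd 1225"
    moreover have "(1225::nat) = 5 * 5 * (7 * 7)" by simp
    ultimately have "p dvd 5 \<or> p dvd 7" using that by (simp only: prime_dvd_mult_iff) blast
    thus "p = 5 \<or> p = 7" using primes_dvd_imp_eq[OF that, of 5] primes_dvd_imp_eq[OF that, of 7] by auto
  qed auto
  have dQ: "p dvd Q \<longleftrightarrow> p \<le> D" if p: "prime p" for p
  proof -
    have "p dvd Q \<longleftrightarrow> (p = 2 \<or> p = 3) \<or> (p = 5 \<or> p = 7) \<or> p \<in> P"
      unfolding Q_def B_def using p by (simp only: prime_dvd_mult_iff d36 d1225 dP)
    also have "\<dots> \<longleftrightarrow> p \<le> D" using prime_less_11[OF p] D p by (cases "p < 11") (auto simp: P_def)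
    finally show ?thesis .
  qed
  have B0: "\<Prod>P > 0" by (intro prod_pos) (simp add: P_def prime_gt_0_nat)
  have Q1: "Q \<ge> 1" using B0 by (simp add: Q_def B_def)
  have cop: "coprime 36 B"
  proof (rule not_coprime_prime)
    fix p :: nat assume p: "prime p" "p dvd 36" "p dvd B"
    have "p dvd 1225 \<or> p dvd \<Prod>P" using p(1,3) unfolding B_def by (simp only: prime_dvd_mult_iff)
    thus False using p d36[OF p(1)] d1225[OF p(1)] dP[OF p(1)] by (auto simp: P_def)
  qed
  \<comment> \<open>33 is 1 modulo 4 and 6 modulo 9. Modulo everything else the residue is 3: then v
    + 2 is 5 modulo 25, v + 4 is 7 modulo 49, and for p >= 11 every v + shift m is congruent to one
    of 3, ..., 9, hence not to 0.\<close>
  obtain v where v: "[v = 33] (mod 36)" "[v = 3] (mod B)"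
    using binary_chinese_remainder_nat[OF cop, of 33 3] by blast
  have v1: "v mod 36 = 33" using v(1) by (simp add: cong_def)
  have v2: "[v = 3] (mod 1225)" using v(2) unfolding B_def by (rule cong_modulus_mult_nat)
  hence v2': "v mod 1225 = 3" by (simp add: cong_def)
  have vm: "v mod 4 = 1" "v mod 9 = 6" "v mod 25 = 3" "v mod 49 = 3"
    using v1 v2' mod_mod_cancel[of 4 36 v] mod_mod_cancel[of 9 36 v] mod_mod_cancel[of 25 1225 v] mod_mod_cancel[of 49 1225 v]
    by simp_all
  have main: "(mult6 m)\<^sup>2 dvd Q \<and> mult6 m dvd v + shift m \<and> coprime ((v + shift m) div mult6 m) Q" if m: "m \<in> {1..6}" for m
  proof (intro conjI)
    have "(mult6 m)\<^sup>2 = 9 \<or> (mult6 m)\<^sup>2 = 4 \<or> (mult6 m)\<^sup>2 = 25 \<or> (mult6 m)\<^sup>2 = 49"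
      by (simp add: mult6_def)
    hence "(mult6 m)\<^sup>2 dvd 36 * 1225" by (elim disjE) simp_all
    moreover have "Q = (36 * 1225) * \<Prod>P" by (simp only: Q_def B_def mult.assoc)
    ultimately show "(mult6 m)\<^sup>2 dvd Q" by (simp only: dvd_mult2)
    show dv: "mult6 m dvd v + shift m" by (rule shift_residues(1)[OF vm m])
    define x where "x = (v + shift m) div mult6 m"
    have x: "v + shift m = mult6 m * x" using dv by (simp add: x_def)
    show "coprime ((v + shift m) div mult6 m) Q"
      unfolding x_def[symmetric]
    proof (rule not_coprime_prime)
      fix p :: nat assume p: "prime p" "p dvd x" "p dvd Q"
      obtain k where k: "x = p * k" using p(2) by (elim dvdE)
      have ne: "\<not> (p = 2 \<or> p = 3 \<or> p = 5 \<or> p = 7)"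
      proof
        assume "p = 2 \<or> p = 3 \<or> p = 5 \<or> p = 7"
        from shift_residues(2)[OF vm m this, of k] show False using x k by simp
      qed
      hence p11: "p \<ge> 11" using prime_less_11[OF p(1)] by linarith
      have "p \<le> D" using p(3) dQ[OF p(1)] by simp
      hence "p \<in> P" using p11 p(1) by (simp add: P_def)
      hence "p dvd B" using dP[OF p(1)] unfolding B_def by simp
      then obtain j where j: "B = p * j" by (elim dvdE)
      have "[v = 3] (mod p)" using v(2) unfolding j by (rule cong_modulus_mult_nat)
      hence c: "[v + shift m = 3 + shift m] (mod p)" by (simp only: cong_add_rcancel_nat)
      have "p dvd v + shift m" unfolding x k by simp
      hence "p dvd 3 + shift m" using cong_dvd_iff[OF c] by simp
      hence "p \<le> 3 + shift m" by (rule dvd_imp_le) simp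
      moreover have "shift m \<le> 6" by (simp add: shift_def)
      ultimately show False using p11 by linarith
    qed
  qed
  show ?thesis using Q1 dQ main by blast
qed

lemma totient_ratio:
  assumes "Q \<ge> 1" "\<And>p. prime p \<Longrightarrow> p dvd Q \<longleftrightarrow> p \<le> D"
  shows "real (totient Q) / real Q = (\<Prod>p | prime p \<and> p \<le> D. 1 - 1 / real p)"
proof -
  have "prime_factors Q = {p. prime p \<and> p \<le> D}" using assms by (auto simp: in_prime_factors_iff)
  thus ?thesis using totient_formula2[of Q] assms(1) by simp
qed

text \<open>The remainders contain D but not R: D stays fixed while R tends to infinity. The factor
  36 is the square of the bound 6 for the weight, and X = 200 k ln R bounds both \<open>Pi1\<close>
  and \<open>A0\<close>.\<close>

lemma forms_eventually:
  assumes K: "finite K" "0 \<notin> K" "card K = 6" and D: "D \<ge> 2000" and Q: "Q \<ge> 1"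
    and dvd_Q: "\<And>p. prime p \<Longrightarrow> p dvd Q \<longleftrightarrow> p \<le> D" and eta: "\<eta> > 0"
  defines "k \<equiv> real (totient Q) / real Q"
  shows "\<forall>\<^sub>F R in at_top. sieve Q D R K (FR K R) 6 \<and> sieve.Pi1 D R \<le> 200 * k * ln R \<and>
     (\<Sum>s\<in>PiE (sieve.P D R) (\<lambda>_. insert 0 K). \<Sum>t\<in>PiE (sieve.P D R) (\<lambda>_. insert 0 K).
        lam (sieve.P D R) K (sieve.yF D R K (FR K R)) s * lam (sieve.P D R) K (sieve.yF D R K (FR K R)) t * (\<Prod>p\<in>sieve.P D R. dens1 p (s p) (t p)))
        \<le> k ^ 6 * ln R ^ 6 * (29 / 60480 + \<eta> + 36 * 200 ^ 6 * (2000 / real D)) \<and>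
     (\<forall>m\<in>K. (\<Sum>s\<in>PiE (sieve.P D R) (\<lambda>_. insert 0 K). \<Sum>t\<in>PiE (sieve.P D R) (\<lambda>_. insert 0 K).
        lam (sieve.P D R) K (sieve.yF D R K (FR K R)) s * lam (sieve.P D R) K (sieve.yF D R K (FR K R)) t * (\<Prod>p\<in>sieve.P D R. dens2 m p (s p) (t p)))
        \<ge> k ^ 7 * ln R ^ 7 * (1 / 5940 - \<eta> - 25 * 36 * 200 ^ 7 * (2000 / real D)))"
proof -
  have k: "k > 0" "k \<le> 1" using Q totient_le[of Q] by (auto simp: k_def field_simps)
  have ev1: "\<forall>\<^sub>F R in at_top. (\<Sum>u\<in>tuples Q K R. w1 K u * (FR K R u)\<^sup>2) / ln R ^ 6 < k ^ 6 * (29 / 60480 + \<eta>)"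
    using T1_asym[OF K(1,3) Q] unfolding k_def[symmetric] by (rule order_tendstoD(2)) (use k eta in simp)
  have ev2: "\<forall>\<^sub>F R in at_top. \<forall>m\<in>K. (\<Sum>u\<in>tuples Q (K - {m}) R. w1 (K - {m}) u * (\<Sum>a\<in>Cop_le Q R. 1 / real a * FR K R (u(m := a)))\<^sup>2)
     \<ge> k ^ 7 * ln R ^ 7 * (1 / 5940 - \<eta>)"
    using T2_lower[OF K(1,3) _ Q eta] unfolding k_def[symmetric] by (intro eventually_ball_finite K(1) ballI)
  have "((\<lambda>R. (\<Sum>a\<in>Cop_le Q R. 1 / real a) / ln R) \<longlongrightarrow> k) at_top"
    using ln_asym_tendsto[OF sum_Cop_ln_power[OF Q, of 0]] by (simp add: k_def)
  hence ev3: "\<forall>\<^sub>F R in at_top. (\<Sum>a\<in>Cop_le Q R. 1 / real a) / ln R < 200 * k" by (rule order_tendstoD(2)) (use k in simp)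
  show ?thesis
    using ev1 ev2 ev3 eventually_ge_at_top[of "real D"]
  proof eventually_elim
    case (elim R)
    have R: "R \<ge> 2000" "R > 1" using elim(4) D by simp_all
    have l: "ln R > 0" using R by simp
    interpret S: sieve Q D R K "FR K R" 6
    proof
      show "FR K R u = 0" if "R < real (\<Prod>i\<in>K. u i)" for u using that by (simp add: FR_def)
    qed (use Q dvd_Q D K R FR_bounds[OF K(1)] in simp_all)
    define X where "X = 200 * k * ln R"
    have Pi: "S.Pi1 \<le> X"
      using prod_primes_between_le[of R D] R elim(4) totient_ratio[OF Q dvd_Q] unfolding S.Pi1_def S.P_def X_def k_def by simp
    have A0: "S.A0 \<le> X" using elim(3) l unfolding S.A0_def X_def by (simp add: pos_divide_less_eq less_imp_le)
    have eps: "S.eps = 2000 / real D" by (rule S.eps_def)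
    have eps1: "S.eps \<le> 1" using D unfolding eps by simp
    have X0: "X \<ge> 0" using k l by (simp add: X_def)
    have form1: "(\<Sum>s\<in>PiE S.P (\<lambda>_. insert 0 K). \<Sum>t\<in>PiE S.P (\<lambda>_. insert 0 K). lam S.P K S.yF s * lam S.P K S.yF t * (\<Prod>p\<in>S.P. dens1 p (s p) (t p)))
       \<le> k ^ 6 * ln R ^ 6 * (29 / 60480 + \<eta> + 36 * 200 ^ 6 * (2000 / real D))"
    proof -
      have "(\<Sum>u\<in>tuples Q K R. w1 K u * (FR K R u)\<^sup>2) \<le> k ^ 6 * (29 / 60480 + \<eta>) * ln R ^ 6"
        using elim(1) l by (simp add: pos_divide_less_eq less_imp_le)
      moreover have "6\<^sup>2 * (S.Pi1 ^ 6 * S.eps) \<le> 36 * (X ^ 6 * S.eps)"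
        using Pi S.Pi1_ge1 S.eps_pos by (intro mult_mono power_mono) auto
      moreover have "36 * (X ^ 6 * S.eps) = k ^ 6 * ln R ^ 6 * (36 * 200 ^ 6 * (2000 / real D))"
        unfolding X_def eps power_mult_distrib by (simp only: mult_ac)
      moreover have "k ^ 6 * ln R ^ 6 * (29 / 60480 + \<eta> + 36 * 200 ^ 6 * (2000 / real D))
         = k ^ 6 * (29 / 60480 + \<eta>) * ln R ^ 6 + k ^ 6 * ln R ^ 6 * (36 * 200 ^ 6 * (2000 / real D))"
        by (simp only: distrib_left distrib_right mult_ac)
      ultimately show ?thesis using S.form1_upper unfolding w1_def by linarith
    qed
    have form2: "(\<Sum>s\<in>PiE S.P (\<lambda>_. insert 0 K). \<Sum>t\<in>PiE S.P (\<lambda>_. insert 0 K). lam S.P K S.yF s * lam S.P K S.yF t * (\<Prod>p\<in>S.P. dens2 m p (s p) (t p)))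
       \<ge> k ^ 7 * ln R ^ 7 * (1 / 5940 - \<eta> - 25 * 36 * 200 ^ 7 * (2000 / real D))" if m: "m \<in> K" for m
    proof -
      have "(\<Sum>u\<in>tuples Q (K - {m}) R. (\<Prod>i\<in>K - {m}. 1 / real (u i)) * (S.Yo m u)\<^sup>2) \<ge> k ^ 7 * ln R ^ 7 * (1 / 5940 - \<eta>)"
        using elim(2) m unfolding w1_def S.Yo_def by blast
      moreover have "25 * 6\<^sup>2 * X ^ 7 * S.eps = k ^ 7 * ln R ^ 7 * (25 * 36 * 200 ^ 7 * (2000 / real D))"
      proof -
        have "(6::real)\<^sup>2 = 36" by simp
        thus ?thesis unfolding X_def eps power_mult_distrib by (simp only: mult_ac)
      qed
      moreover have "k ^ 7 * ln R ^ 7 * (1 / 5940 - \<eta> - 25 * 36 * 200 ^ 7 * (2000 / real D))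
         = k ^ 7 * ln R ^ 7 * (1 / 5940 - \<eta>) - k ^ 7 * ln R ^ 7 * (25 * 36 * 200 ^ 7 * (2000 / real D))"
        by (rule right_diff_distrib)
      ultimately show ?thesis using S.form2_lower[OF m eps1 Pi A0] by linarith
    qed
    show ?case using S.sieve_axioms Pi form1 form2 unfolding X_def by blast
  qed
qed

section \<open>Conclusion\<close>

lemma (in sieve) prod_union_support_le:
  assumes "s \<in> PiE P (\<lambda>_. insert 0 K)" "t \<in> PiE P (\<lambda>_. insert 0 K)"
    and "lam P K yF s \<noteq> 0" "lam P K yF t \<noteq> 0" and R1: "R \<ge> 1"
  shows "real (\<Prod>{p\<in>P. s p \<noteq> 0 \<or> t p \<noteq> 0}) \<le> R\<^sup>2"
proof -
  let ?S = "{p\<in>P. s p \<noteq> 0}" and ?T = "{p\<in>P. t p \<noteq> 0}"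
  have e: "{p\<in>P. s p \<noteq> 0 \<or> t p \<noteq> 0} = ?S \<union> ?T" by auto
  have "1 \<le> p" if "p \<in> ?S \<inter> ?T" for p using that P_ge(3)[of p] D by auto
  hence i1: "\<Prod>(?S \<inter> ?T) \<ge> 1" by (intro prod_ge_1) auto
  have u: "\<Prod>(?S \<union> ?T) * \<Prod>(?S \<inter> ?T) = \<Prod>?S * \<Prod>?T" using finite_P by (intro prod.union_inter) auto
  have "\<Prod>(?S \<union> ?T) * 1 \<le> \<Prod>(?S \<union> ?T) * \<Prod>(?S \<inter> ?T)" using i1 by (rule mult_le_mono2)
  hence "\<Prod>{p\<in>P. s p \<noteq> 0 \<or> t p \<noteq> 0} \<le> \<Prod>?S * \<Prod>?T" unfolding e using u by linarith
  hence "real (\<Prod>{p\<in>P. s p \<noteq> 0 \<or> t p \<noteq> 0}) \<le> real (\<Prod>?S * \<Prod>?T)" by (rule of_nat_mono)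
  also have "\<dots> = real (\<Prod>?S) * real (\<Prod>?T)" by (rule of_nat_mult)
  also have "\<dots> \<le> R * R" using lam_support[OF assms(1,3)] lam_support[OF assms(2,4)] R1
    by (intro mult_mono) (auto intro!: prod_nonneg)
  finally show ?thesis by (simp add: power2_eq_square)
qed

text \<open>The range is imposed on n + h m rather than on n, so that it corresponds exactly to the
  range of x = (n + h m) / c m in the prime sums.\<close>

definition (in sieve_count) prime_weight :: "real \<Rightarrow> nat \<Rightarrow> nat \<Rightarrow> real" where
  "prime_weight N m n = (if c m dvd n + h m \<and> N < real (n + h m) \<and> real (n + h m) \<le> 2 * N then vpi ((n + h m) div c m) else 0)"

lemma (in sieve_count) S2_le_sum:
  assumes m: "m \<in> K" and N: "N \<ge> 7"
  shows "(\<Sum>x | N / real (c m) < real x \<and> real x \<le> 2 * (N / real (c m)) \<and> [c m * x - h m = v] (mod Q). vpi x * wt (c m * x - h m))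
    \<le> (\<Sum>n | N - 6 < real n \<and> real n \<le> 2 * N \<and> [n = v] (mod Q). prime_weight N m n * wt n)"
proof -
  let ?A = "{x. N / real (c m) < real x \<and> real x \<le> 2 * (N / real (c m)) \<and> [c m * x - h m = v] (mod Q)}"
  let ?B = "{n. N - 6 < real n \<and> real n \<le> 2 * N \<and> [n = v] (mod Q)}"
  define f where "f x = c m * x - h m" for x
  have c0: "c m > 0" using c(1)[OF m] by (rule prime_gt_0_nat)
  have A: "h m \<le> c m * x" "N < real (c m * x)" "real (c m * x) \<le> 2 * N" if "x \<in> ?A" for x
  proof -
    have "N / real (c m) < real x" "real x \<le> 2 * (N / real (c m))" using that by simp_all
    thus 1: "N < real (c m * x)" "real (c m * x) \<le> 2 * N" using c0 by (simp_all add: field_simps)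
    show "h m \<le> c m * x" using 1 h(1)[OF m] N by linarith
  qed
  have fh: "f x + h m = c m * x" if "x \<in> ?A" for x using A(1)[OF that] by (simp add: f_def)
  have finB: "finite ?B" using Q N by (intro card_residue_interval) auto
  have inj: "inj_on f ?A"
  proof (rule inj_onI)
    fix x y assume "x \<in> ?A" "y \<in> ?A" "f x = f y"
    hence "c m * x = c m * y" using fh[of x] fh[of y] by linarith
    thus "x = y" using c0 by simp
  qed
  have pw0: "prime_weight N m n \<ge> 0" for n
    unfolding prime_weight_def vpi_def using prime_ge_1_nat by simp
  have "(\<Sum>x\<in>?A. vpi x * wt (c m * x - h m)) = (\<Sum>x\<in>?A. prime_weight N m (f x) * wt (f x))"
  proof (intro sum.cong refl)
    fix x assume x: "x \<in> ?A"
    have "prime_weight N m (f x) = vpi x" using fh[OF x] A[OF x] c0 by (simp add: prime_weight_def)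
    thus "vpi x * wt (c m * x - h m) = prime_weight N m (f x) * wt (f x)" by (simp add: f_def)
  qed
  also have "\<dots> = (\<Sum>n\<in>f ` ?A. prime_weight N m n * wt n)" using inj by (simp add: sum.reindex)
  also have "\<dots> \<le> (\<Sum>n\<in>?B. prime_weight N m n * wt n)"
  proof (rule sum_mono2[OF finB])
    show "f ` ?A \<subseteq> ?B"
    proof (rule image_subsetI)
      fix x assume x: "x \<in> ?A"
      have "real (f x) + real (h m) = real (c m * x)" using fh[OF x] by (simp only: of_nat_add[symmetric])
      moreover have "real (h m) \<le> 6" using h(1)[OF m] by simp
      ultimately have "N - 6 < real (f x)" "real (f x) \<le> 2 * N" using A(2,3)[OF x] by linarith+
      moreover have "[f x = v] (mod Q)" using x by (simp add: f_def)
      ultimately show "f x \<in> ?B" by simp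
    qed
  qed (use pw0 wt_nonneg in \<open>auto intro!: mult_nonneg_nonneg\<close>)
  finally show ?thesis .
qed

text \<open>The pigeonhole step: if no n has two prime forms, the prime weights of all forms at n
  add up to a single logarithm, at most ln(2N). A violation of this inequality therefore yields the
  required pair.\<close>

lemma (in sieve_count) sum_S2_le:
  assumes N: "N \<ge> 7"
    and none: "\<And>n m m'. real n > N - 6 \<Longrightarrow> m \<in> K \<Longrightarrow> m' \<in> K \<Longrightarrow> m \<noteq> m' \<Longrightarrow> prime_weight N m n = 0 \<or> prime_weight N m' n = 0"
  shows "(\<Sum>m\<in>K. \<Sum>x | N / real (c m) < real x \<and> real x \<le> 2 * (N / real (c m)) \<and> [c m * x - h m = v] (mod Q). vpi x * wt (c m * x - h m))
    \<le> ln (2 * N) * (\<Sum>n | N - 6 < real n \<and> real n \<le> 2 * N \<and> [n = v] (mod Q). wt n)"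
proof -
  let ?B = "{n. N - 6 < real n \<and> real n \<le> 2 * N \<and> [n = v] (mod Q)}"
  have l0: "ln (2 * N) \<ge> 0" using N by simp
  have pw: "prime_weight N m n \<le> ln (2 * N)" if m: "m \<in> K" for m n
  proof (cases "c m dvd n + h m \<and> N < real (n + h m) \<and> real (n + h m) \<le> 2 * N \<and> prime ((n + h m) div c m)")
    case False
    thus ?thesis using l0 by (auto simp: prime_weight_def vpi_def)
  next
    case True
    have "(n + h m) div c m \<le> n + h m" by simp
    hence "real ((n + h m) div c m) \<le> real (n + h m)" by (rule of_nat_mono)
    hence le: "real ((n + h m) div c m) \<le> 2 * N" using True by linarith
    have "real ((n + h m) div c m) > 0" using True prime_gt_0_nat by simp
    hence "ln (real ((n + h m) div c m)) \<le> ln (2 * N)" using le by simp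
    thus ?thesis using True by (simp add: prime_weight_def vpi_def)
  qed
  have total: "(\<Sum>m\<in>K. prime_weight N m n) \<le> ln (2 * N)" if n: "real n > N - 6" for n
  proof (cases "\<exists>m\<in>K. prime_weight N m n \<noteq> 0")
    case True
    then obtain m where m: "m \<in> K" "prime_weight N m n \<noteq> 0" by blast
    have "(\<Sum>m\<in>K. prime_weight N m n) = prime_weight N m n + (\<Sum>m'\<in>K-{m}. prime_weight N m' n)"
      using K(1) m(1) by (rule sum.remove)
    also have "(\<Sum>m'\<in>K-{m}. prime_weight N m' n) = 0"
    proof (intro sum.neutral ballI)
      fix m' assume "m' \<in> K - {m}"
      thus "prime_weight N m' n = 0" using none[OF n m(1), of m'] m(2) by auto
    qed
    finally show ?thesis using pw[OF m(1), of n] by simp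
  next
    case False
    hence "(\<Sum>m\<in>K. prime_weight N m n) = 0" by (intro sum.neutral) simp
    thus ?thesis using l0 by simp
  qed
  have "(\<Sum>m\<in>K. \<Sum>x | N / real (c m) < real x \<and> real x \<le> 2 * (N / real (c m)) \<and> [c m * x - h m = v] (mod Q). vpi x * wt (c m * x - h m))
     \<le> (\<Sum>m\<in>K. \<Sum>n\<in>?B. prime_weight N m n * wt n)"
    by (intro sum_mono S2_le_sum N)
  also have "\<dots> = (\<Sum>n\<in>?B. (\<Sum>m\<in>K. prime_weight N m n) * wt n)"
    by (subst sum.swap) (simp only: sum_distrib_right)
  also have "\<dots> \<le> (\<Sum>n\<in>?B. ln (2 * N) * wt n)"
    using total wt_nonneg by (intro sum_mono mult_right_mono) auto
  also have "\<dots> = ln (2 * N) * (\<Sum>n\<in>?B. wt n)" by (simp only: sum_distrib_left)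
  finally show ?thesis .
qed

text \<open>The two primes could coincide only if n + h m were the square of a multiplier, at most 7
  * 7 = 49; this is excluded by N >= 50.\<close>

lemma (in sieve_count) two_prime_prod_if_weight:
  assumes m: "m \<in> K" and N: "N \<ge> 50" and pw: "prime_weight N m n \<noteq> 0"
  shows "two_prime_prod (n + h m)" "real (n + h m) > N"
proof -
  have d: "c m dvd n + h m" and g: "N < real (n + h m)" and v0: "vpi ((n + h m) div c m) \<noteq> 0"
    using pw by (auto simp: prime_weight_def split: if_splits)
  show "real (n + h m) > N" by (rule g)
  define x where "x = (n + h m) div c m"
  have x: "n + h m = c m * x" using d by (simp add: x_def)
  have px: "prime x" using v0 unfolding x_def[symmetric] vpi_def by (auto split: if_splits)
  have "x \<noteq> c m"
  proof
    assume "x = c m"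
    hence "n + h m \<le> 7 * 7" unfolding x using c(2)[OF m] by (intro mult_mono) auto
    hence "real (n + h m) \<le> real (7 * 7)" by (rule of_nat_mono)
    thus False using g N by simp
  qed
  thus "two_prime_prod (n + h m)" unfolding two_prime_prod_def x using c(1)[OF m] px by blast
qed

section \<open>Numerical comparison and choice of parameters\<close>

lemma eventually_error_small:
  fixes c1 c2 :: real
  assumes "c1 > 0" "c2 > 0"
  shows "\<forall>\<^sub>F N in at_top. 36 * (c1 * N / ln N) + ln (2 * N) * (c2 * ln N ^ 24 * N powr (19/20)) \<le> N"
proof -
  have "((\<lambda>N::real. 36 * (c1 / ln N) + ln (2 * N) * (c2 * ln N ^ 24 * N powr (-1/20))) \<longlongrightarrow> 0) at_top"
    by real_asymp
  hence "\<forall>\<^sub>F N in at_top. 36 * (c1 / ln N) + ln (2 * N) * (c2 * ln N ^ 24 * N powr (-1/20)) < 1"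
    by (rule order_tendstoD(2)) simp
  thus ?thesis using eventually_gt_at_top[of 1]
  proof eventually_elim
    case (elim N)
    have p: "N powr (19/20) = N * N powr (-1/20)"
      using elim powr_add[of N 1 "-1/20"] by simp
    have "36 * (c1 * N / ln N) + ln (2 * N) * (c2 * ln N ^ 24 * N powr (19/20))
       = N * (36 * (c1 / ln N) + ln (2 * N) * (c2 * ln N ^ 24 * N powr (-1/20)))"
      unfolding p by (simp add: algebra_simps)
    also have "\<dots> \<le> N * 1" using elim by (intro mult_left_mono) auto
    finally show ?case by simp
  qed
qed

text \<open>6 * (19/40) / 5940 exceeds 29/60480 by about 3.0 * 10^-7. The slacks 1/10^8 on both
  sides and the factor 10001/10000, which covers ln(2N) against ln N, together cost about 0.9 *
  10^-7, so more than 10^-7 is left.\<close>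

lemma numeric_gap:
  fixes W Lam l2 E1 E2 N :: real
  assumes W: "W > 0" and Lam: "Lam > 0" and l2: "l2 \<le> 10001 / 10000 * Lam"
    and main: "6 * (W * (19/40 * Lam) * (1 / 5940 - 1 / 10^8) - E2) \<le> l2 * (W * (29 / 60480 + 1 / 10^8) + E1)"
  shows "W * Lam / 10^7 \<le> 6 * E2 + l2 * E1"
proof -
  have "l2 * (W * (29 / 60480 + 1 / 10^8)) \<le> 10001 / 10000 * Lam * (W * (29 / 60480 + 1 / 10^8))"
    using l2 W by (intro mult_right_mono) auto
  moreover have "10001 / 10000 * Lam * (W * (29 / 60480 + 1 / 10^8)) = W * Lam * (10001 / 10000 * (29 / 60480 + 1 / 10^8))"
    by (simp only: mult_ac)
  moreover have "6 * (W * (19/40 * Lam) * (1 / 5940 - 1 / 10^8)) = W * Lam * (6 * (19/40) * (1 / 5940 - 1 / 10^8))"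
    by (simp only: mult_ac)
  moreover have "W * Lam * (10001 / 10000 * (29 / 60480 + 1 / 10^8)) + W * Lam / 10^7 \<le> W * Lam * (6 * (19/40) * (1 / 5940 - 1 / 10^8))"
  proof -
    have "W * Lam * (10001 / 10000 * (29 / 60480 + 1 / 10^8) + 1 / 10^7) \<le> W * Lam * (6 * (19/40) * (1 / 5940 - 1 / 10^8))"
      using W Lam by (intro mult_left_mono) (simp_all add: field_simps)
    thus ?thesis by (simp only: distrib_left times_divide_eq_right mult_1_right)
  qed
  ultimately show ?thesis using main by (simp only: right_diff_distrib distrib_left)
qed

lemma close_two_prime_prods:
  fixes \<theta> :: real
  assumes theta: "\<theta> > 1901/2000" and BV: "BV \<theta>"
  shows "\<forall>\<^sub>F N in at_top. \<exists>a b. N < real a \<and> a < b \<and> b \<le> a + 6 \<and> two_prime_prod a \<and> two_prime_prod b"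
proof -
  \<comment> \<open>The larger remainder, 25 * 36 * 200^7 * 2000 / D, is then about 2.3 * 10^-9 and
    fits into the slack 1/(2 * 10^8).\<close>
  define D :: nat where "D = 10 ^ 31"
  define K :: "nat set" where "K = {1..6}"
  define c0 :: real where "c0 = 200"
  have K: "finite K" "0 \<notin> K" "card K = 6" by (auto simp: K_def)
  have D: "D \<ge> 2000" by (simp add: D_def)
  obtain Q v where Q: "Q \<ge> 1" and dQ: "\<And>p. prime p \<Longrightarrow> p dvd Q \<longleftrightarrow> p \<le> D"
    and Qv: "\<And>m. m \<in> K \<Longrightarrow> (mult6 m)\<^sup>2 dvd Q \<and> mult6 m dvd v + shift m \<and> coprime ((v + shift m) div mult6 m) Q"
  proof -
    have "D \<ge> 11" using D by simp
    from modulus_exists[OF this] show thesis using that unfolding K_def by blast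
  qed
  define k where "k = real (totient Q) / real Q"
  have k: "k > 0" "k \<le> 1" using Q totient_le[of Q] by (auto simp: k_def field_simps)
  \<comment> \<open>Twice 19/40 is 0.95, just above the value of about 0.9494 at which the sieve
    begins to succeed.\<close>
  define R where "R N = N powr (19/40)" for N :: real
  have limR: "filterlim R at_top at_top" unfolding R_def by real_asymp
  define Form1 where "Form1 R = (\<Sum>s\<in>PiE (sieve.P D R) (\<lambda>_. insert 0 K). \<Sum>t\<in>PiE (sieve.P D R) (\<lambda>_. insert 0 K).
        lam (sieve.P D R) K (sieve.yF D R K (FR K R)) s * lam (sieve.P D R) K (sieve.yF D R K (FR K R)) t * (\<Prod>p\<in>sieve.P D R. dens1 p (s p) (t p)))" for R
  define Form2 where "Form2 m R = (\<Sum>s\<in>PiE (sieve.P D R) (\<lambda>_. insert 0 K). \<Sum>t\<in>PiE (sieve.P D R) (\<lambda>_. insert 0 K).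
        lam (sieve.P D R) K (sieve.yF D R K (FR K R)) s * lam (sieve.P D R) K (sieve.yF D R K (FR K R)) t * (\<Prod>p\<in>sieve.P D R. dens2 m p (s p) (t p)))" for m R
  have ev1: "\<forall>\<^sub>F R in at_top. sieve Q D R K (FR K R) 6 \<and> sieve.Pi1 D R \<le> 200 * k * ln R \<and>
     Form1 R \<le> k ^ 6 * ln R ^ 6 * (29 / 60480 + 1 / (2 * 10^8) + 36 * 200 ^ 6 * (2000 / real D)) \<and>
     (\<forall>m\<in>K. Form2 m R \<ge> k ^ 7 * ln R ^ 7 * (1 / 5940 - 1 / (2 * 10^8) - 25 * 36 * 200 ^ 7 * (2000 / real D)))"
    unfolding Form1_def Form2_def k_def by (rule forms_eventually[OF K D Q dQ]) auto
  have ev1': "\<forall>\<^sub>F N in at_top. sieve Q D (R N) K (FR K (R N)) 6 \<and> sieve.Pi1 D (R N) \<le> 200 * k * ln (R N) \<and>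
     Form1 (R N) \<le> k ^ 6 * ln (R N) ^ 6 * (29 / 60480 + 1 / (2 * 10^8) + 36 * 200 ^ 6 * (2000 / real D)) \<and>
     (\<forall>m\<in>K. Form2 m (R N) \<ge> k ^ 7 * ln (R N) ^ 7 * (1 / 5940 - 1 / (2 * 10^8) - 25 * 36 * 200 ^ 7 * (2000 / real D)))"
    by (rule eventually_compose_filterlim[OF ev1 limR])
  define err where "err N = (\<Sum>q\<in>{1..nat \<lfloor>N powr (1901/2000)\<rfloor>}. ErrStar N q)" for N
  \<comment> \<open>1901/2000 lies strictly between 19/20 and theta: the first gap absorbs the
    factor Q in the moduli, the second is the epsilon of the hypothesis. The saving (ln N)^6000 has
    to beat the loss 1/d = (ln N)^5000 incurred below.\<close>
  have "err \<in> O[at_top](\<lambda>N. N * ln N powr (-6000))"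
  proof -
    have "\<theta> - (\<theta> - 1901/2000) = 1901/2000" by simp
    moreover have "(\<lambda>N::real. \<Sum>q\<in>{1..nat \<lfloor>N powr (\<theta> - (\<theta> - 1901/2000))\<rfloor>}. ErrStar N q) \<in> O[at_top](\<lambda>N. N * ln N powr (-6000))"
      using BV[unfolded BV_def, rule_format, of 6000 "\<theta> - 1901/2000"] theta by simp
    ultimately show ?thesis unfolding err_def by simp
  qed
  then obtain C where C: "C > 0" and evC: "\<forall>\<^sub>F N in at_top. norm (err N) \<le> C * norm (N * ln N powr (-6000))"
    by (elim landau_o.bigE)
  \<comment> \<open>With the bound Fm = 6 on the weight, 144 = 4 Fm^2, and 1008 in \<open>c2\<close>
    is 7 * (2 Fm)^2.\<close>
  define c1 where "c1 = 144 * c0 ^ 12 * (6 * c0 ^ 4802 + C)"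
  define c2 where "c2 = 1008 * c0 ^ 24"
  have c00: "c0 > 0" by (simp add: c0_def)
  have c12: "c1 > 0" "c2 > 0" using c00 C by (auto simp: c1_def c2_def intro!: mult_pos_pos add_pos_pos)
  \<comment> \<open>N * c3 * (ln N)^7 is the surplus guaranteed by \<open>numeric_gap\<close>; it
    outgrows the errors, whose total is at most N.\<close>
  define c3 where "c3 = k ^ 6 * (19/40) ^ 6 / real Q / 10 ^ 7"
  have c3: "c3 > 0" using k Q by (simp add: c3_def)
  have Q0: "real Q > 0" using Q by simp
  have evQ: "\<forall>\<^sub>F N in at_top. real Q * N powr (19/20) \<le> N powr (1901/2000) - 1" using Q0 by real_asymp
  have evR: "\<forall>\<^sub>F N::real in at_top. N powr (19/40) \<le> N / 7" by real_asymp
  have evl: "\<forall>\<^sub>F N::real in at_top. ln (2 * N) \<le> 10001 / 10000 * ln N" by real_asymp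
  have ev3: "\<forall>\<^sub>F N in at_top. c3 * ln N ^ 7 > 1" using c3 by real_asymp
  have evl1: "\<forall>\<^sub>F N::real in at_top. ln N \<ge> 1" by real_asymp
  show ?thesis
    using ev1' evC evQ evR evl ev3 evl1 eventually_error_small[OF c12] eventually_ge_at_top[of 100]
  proof eventually_elim
    case (elim N)
    define Lam where "Lam = ln N"
    have N: "N \<ge> 100" using elim by simp
    have Lam1: "Lam \<ge> 1" using elim by (simp add: Lam_def)
    have L: "ln (R N) = 19/40 * Lam" using N by (simp add: R_def Lam_def ln_powr)
    have R1: "R N \<ge> 1" using N by (simp add: R_def ge_one_powr_ge_zero)
    have R2: "(R N)\<^sup>2 = N powr (19/20)" using N by (simp add: R_def power2_eq_square flip: powr_add)
    interpret S: sieve Q D "R N" K "FR K (R N)" 6 using elim(1) by blast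
    define l where "l = lam S.P K S.yF"
    interpret C: sieve_count S.P K Q v shift mult6 l
    proof
      show "inj_on shift K"
      proof (rule inj_onI)
        fix x y assume "x \<in> K" "y \<in> K" and e: "shift x = shift y"
        hence "x = 1 \<or> x = 2 \<or> x = 3 \<or> x = 4 \<or> x = 5 \<or> x = 6" "y = 1 \<or> y = 2 \<or> y = 3 \<or> y = 4 \<or> y = 5 \<or> y = 6"
          unfolding K_def by auto
        thus "x = y" using e by (elim disjE) (simp_all add: shift_def)
      qed
      show "prime (mult6 m)" for m by (simp add: mult6_def)
      show "\<not> p dvd Q" if "p \<in> S.P" for p using dQ[OF S.P_ge(2)[OF that]] S.P_ge(3)[OF that] by simp
      show "p > 1000" if "p \<in> S.P" for p using S.P_ge(3)[OF that] D by simp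
    qed (use S.finite_P S.P_ge(2) K Qv Q in \<open>auto simp: shift_def mult6_def\<close>)
    have Om: "C.Om = PiE S.P (\<lambda>_. insert 0 K)" by (rule C.Om_def)
    have eps1: "S.eps \<le> 1" unfolding S.eps_def using D by simp
    have Pi: "S.Pi1 \<le> c0 * Lam"
    proof -
      have "S.Pi1 \<le> 200 * k * (19/40 * Lam)" using elim(1) unfolding L by blast
      also have "\<dots> \<le> 200 * 1 * (1 * Lam)" using k Lam1 by (intro mult_mono) auto
      finally show ?thesis by (simp add: c0_def)
    qed
    have Pin: "S.Pi1 ^ n \<le> c0 ^ n * Lam ^ n" for n
      using power_mono[OF Pi, of n] S.Pi1_ge1 by (simp add: power_mult_distrib)
    have f1: "Form1 (R N) \<le> k ^ 6 * (19/40 * Lam) ^ 6 * (29 / 60480 + 1 / 10^8)"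
    proof -
      have a: "Form1 (R N) \<le> k ^ 6 * (19/40 * Lam) ^ 6 * (29 / 60480 + 1 / (2 * 10^8) + 36 * 200 ^ 6 * (2000 / real D))" using elim(1) unfolding L by blast
      have b: "29 / 60480 + 1 / (2 * 10^8) + 36 * 200 ^ 6 * (2000 / real D) \<le> 29 / 60480 + 1 / 10^8" by (simp add: D_def)
      have c: "0 \<le> k ^ 6 * (19/40 * Lam) ^ 6" using k Lam1 by simp
      from order_trans[OF a mult_left_mono[OF b c]] show ?thesis .
    qed
    have f2: "Form2 m (R N) \<ge> k ^ 7 * (19/40 * Lam) ^ 7 * (1 / 5940 - 1 / 10^8)" if m: "m \<in> K" for m
    proof -
      have a: "Form2 m (R N) \<ge> k ^ 7 * (19/40 * Lam) ^ 7 * (1 / 5940 - 1 / (2 * 10^8) - 25 * 36 * 200 ^ 7 * (2000 / real D))" using elim(1) m unfolding L by blast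
      have b: "1 / 5940 - 1 / 10^8 \<le> 1 / 5940 - 1 / (2 * 10^8) - 25 * 36 * 200 ^ 7 * (2000 / real D)" by (simp add: D_def)
      have c: "0 \<le> k ^ 7 * (19/40 * Lam) ^ 7" using k Lam1 by simp
      from order_trans[OF mult_left_mono[OF b c] a] show ?thesis .
    qed
    define S1 where "S1 = (\<Sum>n | N - 6 < real n \<and> real n \<le> 2 * N \<and> [n = v] (mod Q). C.wt n)"
    define S2 where "S2 m = (\<Sum>x | N / real (mult6 m) < real x \<and> real x \<le> 2 * (N / real (mult6 m)) \<and> [mult6 m * x - shift m = v] (mod Q). vpi x * C.wt (mult6 m * x - shift m))" for m
    define E1 where "E1 = c2 * Lam ^ 24 * N powr (19/20)"
    define E2 where "E2 = c1 * N / Lam"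
    have s1: "S1 \<le> N / real Q * Form1 (R N) + E1"
    proof -
      have "S1 \<le> N / real Q * Form1 (R N) + 7 * (\<Sum>s\<in>C.Om. \<bar>l s\<bar>)\<^sup>2"
        unfolding S1_def Form1_def l_def[symmetric] Om[symmetric] by (rule C.S1_le) (use N in simp)
      moreover have "7 * (\<Sum>s\<in>C.Om. \<bar>l s\<bar>)\<^sup>2 \<le> E1"
      proof -
        have "(\<Sum>s\<in>C.Om. \<bar>l s\<bar>) \<le> 2 * 6 * S.Pi1 ^ 12 * R N" unfolding Om l_def by (rule S.sum_lam_le[OF eps1 R1])
        also have "\<dots> \<le> 2 * 6 * (c0 ^ 12 * Lam ^ 12) * R N" using Pin[of 12] R1 by (intro mult_right_mono mult_left_mono) auto
        finally have "(\<Sum>s\<in>C.Om. \<bar>l s\<bar>)\<^sup>2 \<le> (2 * 6 * (c0 ^ 12 * Lam ^ 12) * R N)\<^sup>2" by (intro power_mono sum_nonneg) auto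
        also have "\<dots> = 144 * (c0 ^ 24 * Lam ^ 24) * (R N)\<^sup>2" by (simp add: power_mult_distrib flip: power_mult)
        finally show ?thesis unfolding E1_def c2_def R2 by (simp add: mult_ac)
      qed
      ultimately show ?thesis by linarith
    qed
    define X where "X = nat \<lfloor>N powr (1901/2000)\<rfloor>"
    have X1: "N powr (1901/2000) - 1 \<le> real X" "real X \<le> N powr (1901/2000)"
    proof -
      have "N powr (1901/2000) \<ge> 0" by simp
      thus "N powr (1901/2000) - 1 \<le> real X" "real X \<le> N powr (1901/2000)" unfolding X_def by linarith+
    qed
    have XN: "real X \<le> N"
    proof -
      have "N powr (1901/2000) \<le> N powr 1" using N by (intro powr_mono) auto
      thus ?thesis using X1 N by simp
    qed
    have QX: "real Q * (R N)\<^sup>2 \<le> real X" using elim(3) X1 unfolding R2 by linarith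
    have s2: "S2 m \<ge> N / real (totient Q) * Form2 m (R N) - E2" if m: "m \<in> K" for m
    proof -
      define q where "q = Q div mult6 m"
      have c0': "mult6 m > 0" by (simp add: mult6_def)
      have "mult6 m dvd Q" using Qv[OF m] by (metis dvd_trans dvd_triv_left power2_eq_square)
      hence Qq: "Q = mult6 m * q" by (simp add: q_def)
      have q1: "q \<ge> 1" using Q Qq by (cases q) auto
      have qQ: "q \<le> Q" unfolding q_def by simp
      have "S2 m \<ge> N / real (totient Q) * Form2 m (R N) - (\<Sum>s\<in>C.Om. \<Sum>t\<in>C.Om. \<bar>l s\<bar> * \<bar>l t\<bar> * ErrStar N (q * \<Prod>(C.Bset s t)))"
        unfolding S2_def Form2_def l_def[symmetric] Om[symmetric] q_def
      proof (rule C.S2_ge[OF m])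
        show "real p \<le> N / 7" if "p \<in> S.P" for p
        proof -
          have "real p \<le> R N" using that by (simp add: S.P_def)
          thus ?thesis using elim(4) unfolding R_def by linarith
        qed
        fix s t assume "s \<in> C.Om" "t \<in> C.Om" "l s \<noteq> 0" "l t \<noteq> 0"
        hence "real (\<Prod>(C.Bset s t)) \<le> (R N)\<^sup>2"
          unfolding Om l_def C.Bset_def by (intro S.prod_union_support_le R1)
        hence "real Q * real (\<Prod>(C.Bset s t)) \<le> real Q * (R N)\<^sup>2" by (intro mult_left_mono) auto
        hence "real Q * real (\<Prod>(C.Bset s t)) \<le> N" using QX XN by linarith
        thus "real (Q * \<Prod>(C.Bset s t)) \<le> N" by (simp only: of_nat_mult)
      qed (use N in simp)
      moreover have "(\<Sum>s\<in>C.Om. \<Sum>t\<in>C.Om. \<bar>l s\<bar> * \<bar>l t\<bar> * ErrStar N (q * \<Prod>(C.Bset s t))) \<le> E2"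
      proof -
        \<comment> \<open>Small enough to defeat the (ln N)^4803 of the trivial bound, while 1/d is
          still covered by the saving (ln N)^6000.\<close>
        define d where "d = 1 / Lam ^ 5000"
        define M where "M = 3 * N * ln (2 * N)"
        have d0: "d > 0" using Lam1 by (simp add: d_def)
        have M0: "M \<ge> 0" using N by (simp add: M_def)
        have qX: "real q * (R N)\<^sup>2 \<le> real X"
        proof -
          have "real q * (R N)\<^sup>2 \<le> real Q * (R N)\<^sup>2" using qQ by (intro mult_right_mono) auto
          thus ?thesis using QX by linarith
        qed
        have "(\<Sum>s\<in>C.Om. \<Sum>t\<in>C.Om. \<bar>l s\<bar> * \<bar>l t\<bar> * ErrStar N (q * \<Prod>(C.Bset s t)))
           \<le> 4 * 6\<^sup>2 * S.Pi1 ^ 12 * (d * M * S.Pi1 ^ 4802 + (\<Sum>n\<in>{1..X}. ErrStar N n) / d)"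
          unfolding Om l_def C.Bset_def
        proof (rule S.error_sum_le[OF eps1 q1 qX d0 R1 _ _ M0])
          fix n assume n: "n \<in> {1..X}"
          have "real n \<le> real X" using n by simp
          hence "real n \<le> N" using XN by linarith
          thus "0 \<le> ErrStar N n" using n N by (intro ErrStar_bounds(1)) auto
        next
          fix B assume B: "B \<subseteq> S.P" "q * \<Prod>B \<le> X"
          have Bp: "finite B" "\<And>p. p \<in> B \<Longrightarrow> prime p" "\<And>p. p \<in> B \<Longrightarrow> \<not> p dvd q"
          proof -
            show "finite B" using B(1) S.finite_P by (rule finite_subset)
            show "prime p" if "p \<in> B" for p using S.P_ge(2) B(1) that by blast
            show "\<not> p dvd q" if p: "p \<in> B" for p
            proof
              assume "p dvd q"
              hence "p dvd Q" unfolding Qq by simp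
              thus False using C.P(4)[of p] B(1) p by blast
            qed
          qed
          have B1: "\<Prod>B > 0" using Bp(2) prime_gt_0_nat by (intro prod_pos) blast
          have r1: "q * \<Prod>B \<ge> 1" using q1 B1 by simp
          have "real (q * \<Prod>B) \<le> real X" using B(2) by (rule of_nat_mono)
          hence rN: "real (q * \<Prod>B) \<le> N" using XN by linarith
          have pp: "(\<Prod>p\<in>B. real p - 1) > 0"
          proof (intro prod_pos)
            fix p assume "p \<in> B"
            hence "p > 1" using Bp(2) prime_gt_1_nat by blast
            thus "real p - 1 > 0" by simp
          qed
          have t1: "real (totient q) \<ge> 1"
          proof -
            have "totient q > 0" using q1 by simp
            thus ?thesis by linarith
          qed
          have "ErrStar N (q * \<Prod>B) \<le> M / real (totient (q * \<Prod>B))"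
            unfolding M_def by (rule ErrStar_bounds(2)[OF r1 rN]) (use N in simp)
          also have "real (totient (q * \<Prod>B)) = real (totient q) * (\<Prod>p\<in>B. real p - 1)" by (rule C.totient_prod_primes[OF Bp])
          also have "M / (real (totient q) * (\<Prod>p\<in>B. real p - 1)) \<le> M / (1 * (\<Prod>p\<in>B. real p - 1))"
            using t1 pp M0 q1 by (intro divide_left_mono mult_right_mono mult_pos_pos) auto
          also have "\<dots> = M * (\<Prod>p\<in>B. 1 / (real p - 1))" by (simp add: prod_dividef)
          finally show "ErrStar N (q * \<Prod>B) \<le> M * (\<Prod>p\<in>B. 1 / (real p - 1))" .
        qed
        also have "\<dots> \<le> 4 * 6\<^sup>2 * (c0 ^ 12 * Lam ^ 12) * (6 * c0 ^ 4802 * N / Lam ^ 100 + C * N / Lam ^ 100)"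
        proof (intro mult_mono add_mono mult_left_mono Pin)
          have l2: "ln (2 * N) \<le> 2 * Lam" using elim(5) Lam1 unfolding Lam_def[symmetric] by linarith
          have "d * M * S.Pi1 ^ 4802 \<le> d * (3 * N * (2 * Lam)) * (c0 ^ 4802 * Lam ^ 4802)"
            unfolding M_def using Pin[of 4802] l2 d0 N Lam1 S.Pi1_ge1 by (intro mult_mono) auto
          also have "\<dots> = 6 * c0 ^ 4802 * N * (Lam * Lam ^ 4802 / Lam ^ 5000)" by (simp add: d_def)
          also have "\<dots> \<le> 6 * c0 ^ 4802 * N * (1 / Lam ^ 100)"
          proof (intro mult_left_mono)
            have "Lam * Lam ^ 4802 * Lam ^ 100 = Lam ^ 4903" by (simp flip: power_Suc power_add)
            also have "\<dots> \<le> Lam ^ 5000" using Lam1 by (intro power_increasing) auto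
            finally show "Lam * Lam ^ 4802 / Lam ^ 5000 \<le> 1 / Lam ^ 100" using Lam1 by (simp add: divide_simps)
          qed (use c00 N in auto)
          finally show "d * M * S.Pi1 ^ 4802 \<le> 6 * c0 ^ 4802 * N / Lam ^ 100" by simp
          have "(\<Sum>n\<in>{1..X}. ErrStar N n) \<le> C * (N * Lam powr (-6000))"
            using elim(2) N unfolding err_def X_def[symmetric] Lam_def[symmetric] by simp
          also have "Lam powr (-6000) = 1 / Lam ^ 6000"
            using Lam1 powr_realpow[of Lam 6000] by (simp add: powr_minus_divide)
          finally have "(\<Sum>n\<in>{1..X}. ErrStar N n) / d \<le> C * (N * (1 / Lam ^ 6000)) / d" using d0 by (intro divide_right_mono) auto
          also have "\<dots> = C * N * (Lam ^ 5000 / Lam ^ 6000)" by (simp add: d_def)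
          also have "\<dots> \<le> C * N * (1 / Lam ^ 100)"
          proof (intro mult_left_mono)
            have "Lam ^ 5000 * Lam ^ 100 = Lam ^ 5100" by (simp flip: power_add)
            also have "\<dots> \<le> Lam ^ 6000" using Lam1 by (intro power_increasing) auto
            finally show "Lam ^ 5000 / Lam ^ 6000 \<le> 1 / Lam ^ 100" using Lam1 by (simp add: divide_simps)
          qed (use C N in auto)
          finally show "(\<Sum>n\<in>{1..X}. ErrStar N n) / d \<le> C * N / Lam ^ 100" by simp
          show "0 \<le> d * M * S.Pi1 ^ 4802 + (\<Sum>n\<in>{1..X}. ErrStar N n) / d"
          proof (intro add_nonneg_nonneg divide_nonneg_nonneg sum_nonneg)
            fix n assume n: "n \<in> {1..X}"
            have "real n \<le> real X" using n by simp
            hence "real n \<le> N" using XN by linarith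
            thus "0 \<le> ErrStar N n" using n N by (intro ErrStar_bounds(1)) auto
          qed (use d0 M0 S.Pi1_ge1 in auto)
        qed (use c00 Lam1 in auto)
        also have "\<dots> = c1 * N * (Lam ^ 12 / Lam ^ 100)"
        proof -
          have "4 * 6\<^sup>2 = (144::real)" by simp
          thus ?thesis unfolding c1_def by (simp only: distrib_left distrib_right add_divide_distrib times_divide_eq_left times_divide_eq_right mult_ac)
        qed
        also have "\<dots> \<le> c1 * N * (1 / Lam)"
        proof (intro mult_left_mono)
          have "Lam ^ 12 * Lam = Lam ^ 13" by (simp flip: power_Suc2)
          also have "\<dots> \<le> Lam ^ 100" using Lam1 by (intro power_increasing) auto
          finally show "Lam ^ 12 / Lam ^ 100 \<le> 1 / Lam" using Lam1 by (simp add: divide_simps)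
        qed (use c12 N in auto)
        finally show ?thesis by (simp add: E2_def)
      qed
      ultimately show ?thesis by linarith
    qed
    have "\<exists>n m m'. real n > N - 6 \<and> m \<in> K \<and> m' \<in> K \<and> m \<noteq> m' \<and> C.prime_weight N m n \<noteq> 0 \<and> C.prime_weight N m' n \<noteq> 0"
    \<comment> \<open>Without such an n the sums over primes are bounded by ln(2N) S1, and the
      numerical surplus of the six forms over this bound contradicts the size of the errors.\<close>
    proof (rule ccontr)
      assume no: "\<not> ?thesis"
      have "(\<Sum>m\<in>K. S2 m) \<le> ln (2 * N) * S1"
        unfolding S1_def S2_def by (rule C.sum_S2_le) (use N no in auto)
      define W where "W = N / real Q * (k ^ 6 * (19/40 * Lam) ^ 6)"
      have W0: "W > 0" unfolding W_def using N Q0 k Lam1 by (intro mult_pos_pos divide_pos_pos zero_less_power) auto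
      have S2W: "W * (19/40 * Lam) * (1 / 5940 - 1 / 10^8) - E2 \<le> S2 m" if m: "m \<in> K" for m
      proof -
        have t0: "real (totient Q) > 0" using Q by simp
        have "N / real (totient Q) * (k ^ 7 * (19/40 * Lam) ^ 7 * (1 / 5940 - 1 / 10^8)) \<le> N / real (totient Q) * Form2 m (R N)"
          using f2[OF m] N by (intro mult_left_mono) auto
        moreover have "N / real (totient Q) * (k ^ 7 * (19/40 * Lam) ^ 7 * (1 / 5940 - 1 / 10^8)) = W * (19/40 * Lam) * (1 / 5940 - 1 / 10^8)"
        proof -
          have e1: "N / real (totient Q) * k = N / real Q" using t0 Q0 by (simp add: k_def)
          have e2: "N / t * (k ^ 7 * y ^ 7 * z) = (N / t * k) * (k ^ 6 * y ^ 6) * y * z" for t y z :: real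
          proof -
            have "k ^ 7 = k * k ^ 6" "y ^ 7 = y * y ^ 6" by (simp_all flip: power_Suc)
            thus ?thesis by (simp only: mult_ac)
          qed
          show ?thesis unfolding e2 e1 W_def by (simp only: mult_ac)
        qed
        ultimately show ?thesis using s2[OF m] by linarith
      qed
      have "6 * (W * (19/40 * Lam) * (1 / 5940 - 1 / 10^8) - E2) \<le> (\<Sum>m\<in>K. S2 m)"
        using sum_mono[of K "\<lambda>_. W * (19/40 * Lam) * (1 / 5940 - 1 / 10^8) - E2" S2] S2W K by simp
      also have "\<dots> \<le> ln (2 * N) * S1" by fact
      also have "\<dots> \<le> ln (2 * N) * (W * (29 / 60480 + 1 / 10^8) + E1)"
      proof (intro mult_left_mono)
        have "N / real Q * Form1 (R N) \<le> N / real Q * (k ^ 6 * (19/40 * Lam) ^ 6 * (29 / 60480 + 1 / 10^8))"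
          using f1 N by (intro mult_left_mono) auto
        also have "\<dots> = W * (29 / 60480 + 1 / 10^8)" unfolding W_def by (simp only: mult.assoc)
        finally show "S1 \<le> W * (29 / 60480 + 1 / 10^8) + E1" using s1 by linarith
      qed (use N in simp)
      finally have main: "6 * (W * (19/40 * Lam) * (1 / 5940 - 1 / 10^8) - E2) \<le> ln (2 * N) * (W * (29 / 60480 + 1 / 10^8) + E1)" .
      have "W * Lam / 10^7 \<le> 6 * E2 + ln (2 * N) * E1"
        by (rule numeric_gap[OF W0 _ _ main]) (use Lam1 elim(5) in \<open>simp_all add: Lam_def\<close>)
      also have "\<dots> \<le> 36 * E2 + ln (2 * N) * E1"
      proof -
        have "0 \<le> E2" unfolding E2_def using c12 N Lam1 by (intro divide_nonneg_nonneg mult_nonneg_nonneg) auto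
        thus ?thesis by simp
      qed
      also have "\<dots> \<le> N" using elim(8) unfolding E1_def E2_def Lam_def by simp
      finally have "W * Lam / 10^7 \<le> N" .
      moreover have "W * Lam / 10^7 = N * (c3 * Lam ^ 7)"
      proof -
        have L7: "Lam ^ 7 = Lam ^ 6 * Lam" by (simp flip: power_Suc2)
        have "n / q * (k' * (a * l6)) * l1 / t = n * (k' * a / q / t * (l6 * l1))" for n q k' a l6 l1 t :: real by simp
        thus ?thesis unfolding W_def c3_def L7 power_mult_distrib by (rule trans) (rule refl)
      qed
      ultimately have "N * (c3 * Lam ^ 7) \<le> N * 1" by simp
      hence "c3 * Lam ^ 7 \<le> 1" using N by simp
      thus False using elim(6) unfolding Lam_def by simp
    qed
    then obtain n m m' where nm: "real n > N - 6" "m \<in> K" "m' \<in> K" "m \<noteq> m'" "C.prime_weight N m n \<noteq> 0" "C.prime_weight N m' n \<noteq> 0" by blast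
    have N50: "N \<ge> 50" using N by simp
    note t1 = C.two_prime_prod_if_weight[OF nm(2) N50 nm(5)]
    note t2 = C.two_prime_prod_if_weight[OF nm(3) N50 nm(6)]
    have ne: "shift m \<noteq> shift m'" using C.h(2) nm(2,3,4) by (auto simp: inj_on_def)
    have s6: "shift m \<le> 6" "shift m' \<le> 6" by (simp_all add: shift_def)
    show ?case
    proof (cases "shift m < shift m'")
      case True
      have "n + shift m < n + shift m'" "n + shift m' \<le> n + shift m + 6" using True s6 by linarith+
      thus ?thesis using t1 t2 by blast
    next
      case False
      have "n + shift m' < n + shift m" "n + shift m \<le> n + shift m' + 6" using False ne s6 by linarith+
      thus ?thesis using t1 t2 by blast
    qed
  qed
qed

lemma liminf_enumerate_le:
  assumes ev: "\<forall>\<^sub>F N in at_top. \<exists>a b. N < real a \<and> a < b \<and> b \<le> a + 6 \<and> P a \<and> P b"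
  shows "liminf (\<lambda>n. ereal (real (enumerate {n. P n} (Suc n)) - real (enumerate {n. P n} n))) \<le> 6"
proof (rule ccontr)
  let ?S = "{n. P n}"
  assume "\<not> ?thesis"
  hence "6 < liminf (\<lambda>n. ereal (real (enumerate ?S (Suc n)) - real (enumerate ?S n)))" by simp
  hence "\<forall>\<^sub>F n in sequentially. 6 < ereal (real (enumerate ?S (Suc n)) - real (enumerate ?S n))" by (rule less_LiminfD)
  then obtain n0 where n0: "\<And>n. n \<ge> n0 \<Longrightarrow> 6 < ereal (real (enumerate ?S (Suc n)) - real (enumerate ?S n))"
    by (auto simp: eventually_sequentially)
  obtain N0 where N0: "\<And>N. N \<ge> N0 \<Longrightarrow> \<exists>a b. N < real a \<and> a < b \<and> b \<le> a + 6 \<and> P a \<and> P b"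
    using ev by (auto simp: eventually_at_top_linorder)
  have inf: "infinite ?S"
    unfolding infinite_nat_iff_unbounded
  proof
    fix m
    obtain a b where ab: "max N0 (real m) < real a" "P a" using N0[of "max N0 (real m)"] by auto
    have "m < a" using ab(1) by simp
    thus "\<exists>n>m. n \<in> ?S" using ab(2) by auto
  qed
  \<comment> \<open>Going beyond the element with index n0 ensures that \<open>a\<close> has an
    index above n0, where gaps are assumed to exceed 6; yet the successor of \<open>a\<close> is at
    most \<open>b\<close>.\<close>
  obtain a b where ab: "max N0 (real (enumerate ?S n0)) < real a" "a < b" "b \<le> a + 6" "P a" "P b"
    using N0[of "max N0 (real (enumerate ?S n0))"] by auto
  obtain i where i: "enumerate ?S i = a" using enumerate_Ex[OF inf, of a] ab(4) by auto
  have "enumerate ?S n0 < enumerate ?S i" using ab(1) i by simp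
  hence "n0 < i" using strict_mono_less[OF strict_mono_enumerate[OF inf]] by blast
  hence "6 < ereal (real (enumerate ?S (Suc i)) - real (enumerate ?S i))" by (intro n0) simp
  hence gap: "real (enumerate ?S (Suc i)) - real (enumerate ?S i) > 6" by simp
  have "enumerate ?S (Suc i) = (LEAST s. s \<in> ?S \<and> enumerate ?S i < s)" by (rule enumerate_Suc''[OF inf])
  also have "\<dots> \<le> b" using ab(2,5) i by (intro Least_le) simp
  finally have "enumerate ?S (Suc i) \<le> enumerate ?S i + 6" using ab(3) i by linarith
  hence "real (enumerate ?S (Suc i)) \<le> real (enumerate ?S i + 6)" by (rule of_nat_mono)
  thus False using gap by simp
qed

theorem theorem4:
  fixes \<theta> :: real
  assumes "(75 - sqrt 473) / 56 < \<theta>" and "\<theta> \<le> 1"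
    and "BV \<theta>" and "BV2 \<theta>"
  shows "liminf (\<lambda>n. ereal (real (q_seq (Suc n)) - real (q_seq n))) \<le> 6"
proof -
  \<comment> \<open>(87/4)^2 = 473.0625, and (75 - 87/4)/56 is about 0.95089, still above 1901/2000
    = 0.9505.\<close>
  have "sqrt 473 \<le> 87/4" by (rule real_le_lsqrt) (auto simp: power2_eq_square)
  hence "\<theta> > 1901/2000" using assms(1) by simp
  from close_two_prime_prods[OF this assms(3)] show ?thesis
    unfolding q_seq_def by (rule liminf_enumerate_le)
qed

end
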